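(* Let $n\geqslant 1$ be an integer. The following statements are equivalent: (1) $\theta_n(t)<\infty$ for every $t\geqslant 1$; (2) Kaplansky's second test problem is true for $\mathbb{M}_n\otimes\ell^\infty=\mathbb{M}_n(\ell^\infty)$; (3) Kaplansky's second test problem is true for every type $\mathrm{I}_n$ von Neumann algebra.
   Context: $\mathbb{M}_n$ denotes the $n\times n$ complex matrices with the operator norm, and $\ell^\infty$ is the von Neumann algebra of bounded complex sequences. For elements $A,B$ of a unital algebra $\mathcal{N}$, $A\sim B$ in $\mathcal{N}$ means $A=XBX^{-1}$ for some invertible $X\in\mathcal{N}$; $A\oplus A$ denotes the diagonal matrix $\mathrm{diag}(A,A)\in\mathbb{M}_2(\mathcal{N})$. "Kaplansky's second test problem is true for $\mathcal{M}$" means: for all $A,B\in\mathcal{M}$, if $A\oplus A\sim B\oplus B$ in $\mathbb{M}_2(\mathcal{M})$, then $A\sim B$ in $\mathcal{M}$. For $k\geqslant 1$ and $A,B\in\mathbb{M}_k$ with $A\sim B$, the similarity number is $s(A,B)=\min\{\|X\|\,\|X^{-1}\|\colon X \text{ invertible in } \mathbb{M}_k,\ A=XBX^{-1}\}$ (the minimum is attained); put $s(A,B)=\infty$ if $A\nsim B$. The similarity function $\theta_n\colon[1,\infty)\to[1,\infty]$ is $\theta_n(t)=\sup\{s(A,B)\colon A,B\in\mathbb{M}_n,\ s(A\oplus A,B\oplus B)\leqslant t\}$. A type $\mathrm{I}_n$ von Neumann algebra is one isomorphic to $\mathbb{M}_n(\mathcal{A})$ with $\mathcal{A}$ an abelian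 von Neumann algebra (not assumed to act on a separable space). *)

theory Defs
  imports
    Complex_Main
    "HOL-Library.Extended_Real"
    "HOL-Library.Equipollence"
    "HOL-Library.FuncSet"
    "HOL-Algebra.QuotRing"
    "Jordan_Normal_Form.VS_Connect"
begin

section \<open>The similarity function of complex matrices\<close>

definition l2norm :: "complex vec \<Rightarrow> real" where
  "l2norm v = sqrt (Re (v \<bullet>c v))"

definition opnorm :: "complex mat \<Rightarrow> real" where
  "opnorm A = Sup {l2norm (A *\<^sub>v v) | v. v \<in> carrier_vec (dim_col A) \<and> l2norm v \<le> 1}"

text \<open>The infimum is attained as soon as the matrices are similar, so it is the usual minimum;
  it is \<open>\<infinity>\<close> if they are not similar.  In \<^const>\<open>similar_mat_wit\<close> the last argument is
  the inverse of the third one.\<close>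

definition similarity_number :: "complex mat \<Rightarrow> complex mat \<Rightarrow> ereal" where
  "similarity_number A B =
     (INF (X, Y) \<in> {(X, Y). similar_mat_wit A B X Y}. ereal (opnorm X * opnorm Y))"

definition double_mat :: "complex mat \<Rightarrow> complex mat" where
  "double_mat A =
     four_block_mat A (0\<^sub>m (dim_row A) (dim_col A)) (0\<^sub>m (dim_row A) (dim_col A)) A"

definition similarity_function :: "nat \<Rightarrow> real \<Rightarrow> ereal" where
  "similarity_function n t =
     (SUP (A, B) \<in> {(A, B). A \<in> carrier_mat n n \<and> B \<in> carrier_mat n n \<and>
                       similarity_number (double_mat A) (double_mat B) \<le> ereal t}.
        similarity_number A B)"

section \<open>Star algebras and matrices over them\<close>

record 'a star_algebra = "(complex, 'a) module" +
  star :: "'a \<Rightarrow> 'a"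

definition mat_alg :: "nat \<Rightarrow> 'a star_algebra \<Rightarrow> 'a mat star_algebra" where
  "mat_alg n R =
    \<lparr>carrier = {A \<in> carrier_mat n n. \<forall>i<n. \<forall>j<n. A $$ (i, j) \<in> carrier R},
     mult = (\<lambda>A B. mat n n (\<lambda>(i, j). \<Oplus>\<^bsub>R\<^esub>k\<in>{..<n}. A $$ (i, k) \<otimes>\<^bsub>R\<^esub> B $$ (k, j))),
     one = mat n n (\<lambda>(i, j). if i = j then \<one>\<^bsub>R\<^esub> else \<zero>\<^bsub>R\<^esub>),
     zero = mat n n (\<lambda>_. \<zero>\<^bsub>R\<^esub>),
     add = (\<lambda>A B. mat n n (\<lambda>(i, j). A $$ (i, j) \<oplus>\<^bsub>R\<^esub> B $$ (i, j))),
     smult = (\<lambda>c A. mat n n (\<lambda>(i, j). c \<odot>\<^bsub>R\<^esub> A $$ (i, j))),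
     star = (\<lambda>A. mat n n (\<lambda>(i, j). star R (A $$ (j, i))))\<rparr>"

definition linf :: "(nat \<Rightarrow> complex) star_algebra" where
  "linf =
    \<lparr>carrier = {f. Bseq f},
     mult = (\<lambda>f g k. f k * g k),
     one = (\<lambda>_. 1),
     zero = (\<lambda>_. 0),
     add = (\<lambda>f g k. f k + g k),
     smult = (\<lambda>c f k. c * f k),
     star = (\<lambda>f k. cnj (f k))\<rparr>"

definition star_iso :: "'a star_algebra \<Rightarrow> 'b star_algebra \<Rightarrow> ('a \<Rightarrow> 'b) set" where
  "star_iso R S = {h \<in> ring_iso R S. \<forall>x\<in>carrier R.
     (\<forall>c. h (c \<odot>\<^bsub>R\<^esub> x) = c \<odot>\<^bsub>S\<^esub> h x) \<and> h (star R x) = star S (h x)}"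

section \<open>Kaplansky's second test problem\<close>

definition similar_in :: "'a star_algebra \<Rightarrow> 'a \<Rightarrow> 'a \<Rightarrow> bool" where
  "similar_in R A B \<longleftrightarrow> (\<exists>X\<in>Units R. A = X \<otimes>\<^bsub>R\<^esub> B \<otimes>\<^bsub>R\<^esub> inv\<^bsub>R\<^esub> X)"

definition oplus_self :: "'a star_algebra \<Rightarrow> 'a \<Rightarrow> 'a mat" where
  "oplus_self R A = mat 2 2 (\<lambda>(i, j). if i = j then A else \<zero>\<^bsub>R\<^esub>)"

definition kaplansky2 :: "'a star_algebra \<Rightarrow> bool" where
  "kaplansky2 R \<longleftrightarrow> (\<forall>A\<in>carrier R. \<forall>B\<in>carrier R.
     similar_in (mat_alg 2 R) (oplus_self R A) (oplus_self R B) \<longrightarrow> similar_in R A B)"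

section \<open>Von Neumann algebras\<close>

text \<open>Hilbert spaces are carried by sets, so that one can quantify over all Hilbert spaces whose
  points lie in a given type.  As usual for modules in HOL-Algebra, the multiplicative fields
  of the record are irrelevant.  The inner product is linear in its first argument.\<close>

record 'h hilbert = "(complex, 'h) module" +
  ip :: "'h \<Rightarrow> 'h \<Rightarrow> complex"

definition hnorm :: "'h hilbert \<Rightarrow> 'h \<Rightarrow> real" where
  "hnorm H x = sqrt (Re (ip H x x))"

locale hilbert_space = vectorspace "class_ring :: complex ring" H for H :: "'h hilbert" +
  assumes ip_add: "\<lbrakk>x \<in> carrier H; y \<in> carrier H; z \<in> carrier H\<rbrakk> \<Longrightarrow>
      ip H (x \<oplus>\<^bsub>H\<^esub> y) z = ip H x z + ip H y z"
    and ip_smult: "\<lbrakk>x \<in> carrier H; y \<in> carrier H\<rbrakk> \<Longrightarrow> ip H (c \<odot>\<^bsub>H\<^esub> x) y = c * ip H x y"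
    and ip_cnj: "\<lbrakk>x \<in> carrier H; y \<in> carrier H\<rbrakk> \<Longrightarrow> ip H y x = cnj (ip H x y)"
    and ip_pos: "\<lbrakk>x \<in> carrier H; x \<noteq> \<zero>\<^bsub>H\<^esub>\<rbrakk> \<Longrightarrow> 0 < Re (ip H x x)"
    and complete: "\<lbrakk>range s \<subseteq> carrier H;
       \<forall>e>0. \<exists>N. \<forall>i\<ge>N. \<forall>j\<ge>N. hnorm H (s i \<ominus>\<^bsub>H\<^esub> s j) < e\<rbrakk> \<Longrightarrow>
      \<exists>x\<in>carrier H. (\<lambda>i. hnorm H (s (i::nat) \<ominus>\<^bsub>H\<^esub> x)) \<longlonglongrightarrow> 0"

text \<open>Operators are extensional (\<^const>\<open>undefined\<close> off the carrier), so that equality of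
  HOL functions is equality of operators.\<close>

definition bounded_ops :: "'h hilbert \<Rightarrow> ('h \<Rightarrow> 'h) set" where
  "bounded_ops H = {T \<in> module_hom class_ring H H \<inter> extensional (carrier H).
     \<exists>c. \<forall>x\<in>carrier H. hnorm H (T x) \<le> c * hnorm H x}"

definition adjoint :: "'h hilbert \<Rightarrow> ('h \<Rightarrow> 'h) \<Rightarrow> ('h \<Rightarrow> 'h)" where
  "adjoint H T = (THE S. S \<in> bounded_ops H \<and>
     (\<forall>x\<in>carrier H. \<forall>y\<in>carrier H. ip H (T x) y = ip H x (S y)))"

definition op_alg :: "'h hilbert \<Rightarrow> ('h \<Rightarrow> 'h) set \<Rightarrow> ('h \<Rightarrow> 'h) star_algebra" where
  "op_alg H M =
    \<lparr>carrier = M,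
     mult = compose (carrier H),
     one = (\<lambda>x\<in>carrier H. x),
     zero = (\<lambda>x\<in>carrier H. \<zero>\<^bsub>H\<^esub>),
     add = (\<lambda>S T. \<lambda>x\<in>carrier H. S x \<oplus>\<^bsub>H\<^esub> T x),
     smult = (\<lambda>c T. \<lambda>x\<in>carrier H. c \<odot>\<^bsub>H\<^esub> T x),
     star = adjoint H\<rparr>"

definition commutant :: "'h hilbert \<Rightarrow> ('h \<Rightarrow> 'h) set \<Rightarrow> ('h \<Rightarrow> 'h) set" where
  "commutant H M =
     {T \<in> bounded_ops H. \<forall>S\<in>M. compose (carrier H) S T = compose (carrier H) T S}"

text \<open>Dixmier's definition: a self-adjoint set of bounded operators that equals its bicommutant.
  Being a commutant, it is automatically a unital subalgebra.\<close>

definition von_neumann_algebra :: "'h hilbert \<Rightarrow> ('h \<Rightarrow> 'h) set \<Rightarrow> bool" where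
  "von_neumann_algebra H M \<longleftrightarrow> hilbert_space H \<and> M \<subseteq> bounded_ops H \<and>
     (\<forall>T\<in>M. adjoint H T \<in> M) \<and> commutant H (commutant H M) = M"

definition abelian_von_neumann_algebra :: "'h hilbert \<Rightarrow> ('h \<Rightarrow> 'h) set \<Rightarrow> bool" where
  "abelian_von_neumann_algebra H A \<longleftrightarrow> von_neumann_algebra H A \<and>
     (\<forall>S\<in>A. \<forall>T\<in>A. compose (carrier H) S T = compose (carrier H) T S)"

text \<open>Taking the Hilbert space \<open>K\<close> of the abelian algebra in the same type as \<open>H\<close> is no
  restriction: for \<open>n \<ge> 1\<close> that algebra is isomorphic to the centre of \<open>M\<close>, which acts on \<open>H\<close>.\<close>

definition type_I :: "nat \<Rightarrow> 'h hilbert \<Rightarrow> ('h \<Rightarrow> 'h) set \<Rightarrow> bool" where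
  "type_I n H M \<longleftrightarrow> von_neumann_algebra H M \<and>
     (\<exists>(K :: 'h hilbert) A. abelian_von_neumann_algebra K A \<and>
        star_iso (op_alg H M) (mat_alg n (op_alg K A)) \<noteq> {})"

text \<open>HOL cannot quantify over all types inside a formula, so ``every type \<open>I\<^sub>n\<close> von Neumann
  algebra'' ranges over the Hilbert spaces whose points lie in a type \<open>'h\<close>, which may be any type
  of at least the cardinality of the continuum.  As every nonzero Hilbert space has at least that
  many points, exactly the types containing only the zero space are left out; and
  since \<open>'h\<close> is otherwise arbitrary, no Hilbert space (separable or not) is left out.\<close>

definition kaplansky2_type_I :: "'h itself \<Rightarrow> nat \<Rightarrow> bool" where
  "kaplansky2_type_I (_ :: 'h itself) n \<longleftrightarrow>
     (\<forall>(H :: 'h hilbert) M. type_I n H M \<longrightarrow> kaplansky2 (op_alg H M))"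

end

theory Submission
  imports Defs "HOL-Analysis.L2_Norm" "HOL-Analysis.Abstract_Topology_2"
begin

text \<open>
  The three statements are proved equivalent in a cycle: truth of the test problem for matrices of
  bounded sequences makes the similarity function finite; finiteness of the similarity function
  gives the test problem for all type \<open>I\<^sub>n\<close> algebras; and one particular type \<open>I\<^sub>n\<close> algebra is
  isomorphic to the matrices of bounded sequences. Throughout, a similarity of \<open>A \<oplus> A\<close> and
  \<open>B \<oplus> B\<close> is replaced by four blocks of a witness and four blocks of its inverse subject to
  polynomial identities (\<open>block_similar_iff\<close>).

  Sequences to similarity function. If the similarity function is infinite at \<open>t\<close>, there are pairs
  of matrices whose doubles are similar with condition number about \<open>t\<close>, while every similarity
  of the \<open>m\<close>-th pair itself has condition number larger than \<open>m\<close>. After rescaling, these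
  pairs and the witnesses for their doubles form bounded sequences, so they are elements of
  the matrix algebra over bounded sequences. A similarity there would bound all the condition
  numbers at once.

  Similarity function to type \<open>I\<^sub>n\<close>. Let \<open>A\<close>, \<open>B\<close> be matrices over an abelian von Neumann
  algebra whose doubles are similar. At each point of the spectrum one gets complex matrices with
  boundedly similar doubles, hence a similarity whose entries lie in a fixed bounded set
  \<open>K\<close>. The issue is to choose these pointwise similarities as elements of the algebra.
  Instead of characters the proof uses sequences of unit vectors that are asymptotic joint
  eigenvectors (\<open>asymp_eigen_exists\<close>), and instead of a measurable selection it uses the complete
  Boolean algebra of projections: \<open>K\<close> is cut into finitely many small pieces, and the identity is
  cut into orthogonal projections, on each of which the system is approximately solvable inside
  one piece (\<open>good_split\<close>). Constants chosen in the pieces give an approximate solution that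
  satisfies the quadratic equations \<open>X Y = 1 = Y X\<close> exactly, and refining the pieces
  gives a norm convergent sequence of such solutions (\<open>adapted_refine\<close>). Its limit solves the linear
  equation \<open>A X = X B\<close> as well (\<open>linear_system_solution\<close>).

  Type \<open>I\<^sub>n\<close> to sequences. On the space of square summable sequences, the operators that commute
  with the projections onto consecutive blocks of \<open>n\<close> coordinates form a von Neumann algebra. Its
  elements are exactly the bounded sequences of \<open>n \<times> n\<close> matrices, acting blockwise; for
  \<open>n = 1\<close> they are the diagonal operators (\<open>ent_star_iso\<close>). The set of all complex sequences has
  the cardinality of the continuum, so this Hilbert space can be placed inside the given type.
\<close>

section \<open>Hilbert spaces on carrier sets\<close>

lemma null_sequence_comparison:
  fixes f :: "nat \<Rightarrow> 'a::real_normed_vector"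
  assumes "\<And>i. norm (f i) \<le> g i" and "g \<longlonglongrightarrow> 0"
  shows "f \<longlonglongrightarrow> 0"
proof (rule tendsto_norm_zero_cancel, rule tendsto_sandwich)
  show "(\<lambda>_. 0) \<longlonglongrightarrow> (0::real)" by simp
  show "g \<longlonglongrightarrow> 0" by fact
qed (use assms(1) in auto)

context hilbert_space
begin

lemma vadd [simp, intro]: "x \<in> carrier H \<Longrightarrow> y \<in> carrier H \<Longrightarrow> x \<oplus>\<^bsub>H\<^esub> y \<in> carrier H"
  by (rule M.a_closed)

lemma vzero [simp, intro]: "\<zero>\<^bsub>H\<^esub> \<in> carrier H"
  by (rule M.zero_closed)

lemma vsmult [simp, intro]: "x \<in> carrier H \<Longrightarrow> c \<odot>\<^bsub>H\<^esub> x \<in> carrier H"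
  by (rule smult_closed) auto

lemma vminus [simp, intro]: "x \<in> carrier H \<Longrightarrow> y \<in> carrier H \<Longrightarrow> x \<ominus>\<^bsub>H\<^esub> y \<in> carrier H"
  by (rule M.minus_closed)

lemma ip_zero_left [simp]: "y \<in> carrier H \<Longrightarrow> ip H \<zero>\<^bsub>H\<^esub> y = 0"
  using ip_add[of "\<zero>\<^bsub>H\<^esub>" "\<zero>\<^bsub>H\<^esub>" y] by simp

lemma ip_diff: assumes "x \<in> carrier H" "y \<in> carrier H" "z \<in> carrier H"
  shows "ip H (x \<ominus>\<^bsub>H\<^esub> y) z = ip H x z - ip H y z"
proof -
  have "ip H ((x \<ominus>\<^bsub>H\<^esub> y) \<oplus>\<^bsub>H\<^esub> y) z = ip H (x \<ominus>\<^bsub>H\<^esub> y) z + ip H y z"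
    using assms by (simp only: ip_add vminus)
  moreover have "(x \<ominus>\<^bsub>H\<^esub> y) \<oplus>\<^bsub>H\<^esub> y = x"
    using assms by (simp add: M.minus_eq M.add.m_assoc M.l_neg)
  ultimately show ?thesis by simp
qed

lemma ip_add_right: "x \<in> carrier H \<Longrightarrow> y \<in> carrier H \<Longrightarrow> z \<in> carrier H \<Longrightarrow>
    ip H z (x \<oplus>\<^bsub>H\<^esub> y) = ip H z x + ip H z y"
  by (metis ip_cnj ip_add complex_cnj_add vadd)

lemma ip_diff_right: "x \<in> carrier H \<Longrightarrow> y \<in> carrier H \<Longrightarrow> z \<in> carrier H \<Longrightarrow>
    ip H z (x \<ominus>\<^bsub>H\<^esub> y) = ip H z x - ip H z y"
  by (metis ip_cnj ip_diff complex_cnj_diff vminus)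

lemma ip_smult_right: "x \<in> carrier H \<Longrightarrow> z \<in> carrier H \<Longrightarrow>
    ip H z (c \<odot>\<^bsub>H\<^esub> x) = cnj c * ip H z x"
  by (metis ip_cnj ip_smult complex_cnj_mult vsmult)

lemma ip_zero_right [simp]: "y \<in> carrier H \<Longrightarrow> ip H y \<zero>\<^bsub>H\<^esub> = 0"
  by (metis ip_cnj ip_zero_left complex_cnj_zero vzero)

lemmas ip_simps = ip_add ip_diff ip_smult ip_add_right ip_diff_right ip_smult_right

lemma ip_self: "x \<in> carrier H \<Longrightarrow> ip H x x = complex_of_real (Re (ip H x x))"
  using ip_cnj[of x x] by (metis Reals_cnj_iff of_real_Re)

lemma ip_self_nonneg: "x \<in> carrier H \<Longrightarrow> 0 \<le> Re (ip H x x)"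
  by (cases "x = \<zero>\<^bsub>H\<^esub>") (auto simp: less_imp_le[OF ip_pos])

lemma hnorm_sq: "x \<in> carrier H \<Longrightarrow> (hnorm H x)\<^sup>2 = Re (ip H x x)"
  by (simp add: hnorm_def ip_self_nonneg)

lemma ip_self_hnorm: "x \<in> carrier H \<Longrightarrow> ip H x x = complex_of_real ((hnorm H x)\<^sup>2)"
  by (metis hnorm_sq ip_self)

lemma hnorm_nonneg [simp]: "x \<in> carrier H \<Longrightarrow> 0 \<le> hnorm H x"
  by (simp add: hnorm_def ip_self_nonneg)

lemma hnorm_zero [simp]: "hnorm H \<zero>\<^bsub>H\<^esub> = 0"
  by (simp add: hnorm_def)

lemma hnorm_eq_0 [simp]: "x \<in> carrier H \<Longrightarrow> hnorm H x = 0 \<longleftrightarrow> x = \<zero>\<^bsub>H\<^esub>"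
  using ip_pos[of x] by (cases "x = \<zero>\<^bsub>H\<^esub>") (auto simp: hnorm_def)

lemma hnorm_pos: "x \<in> carrier H \<Longrightarrow> x \<noteq> \<zero>\<^bsub>H\<^esub> \<Longrightarrow> 0 < hnorm H x"
  using hnorm_eq_0[of x] hnorm_nonneg[of x] by linarith

lemma diff_zero_iff: "x \<in> carrier H \<Longrightarrow> y \<in> carrier H \<Longrightarrow> x \<ominus>\<^bsub>H\<^esub> y = \<zero>\<^bsub>H\<^esub> \<longleftrightarrow> x = y"
proof
  assume x: "x \<in> carrier H" and y: "y \<in> carrier H" and "x \<ominus>\<^bsub>H\<^esub> y = \<zero>\<^bsub>H\<^esub>"
  moreover have "(x \<ominus>\<^bsub>H\<^esub> y) \<oplus>\<^bsub>H\<^esub> y = x"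
    using x y by (simp add: M.minus_eq M.add.m_assoc M.l_neg)
  ultimately show "x = y" by simp
qed (simp add: M.minus_eq M.r_neg)

text \<open>The inner product separates points, so identities between vectors can be checked on
  complex numbers.\<close>

lemma vec_eqI:
  assumes "x \<in> carrier H" "y \<in> carrier H" "\<And>z. z \<in> carrier H \<Longrightarrow> ip H x z = ip H y z"
  shows "x = y"
proof -
  have "ip H (x \<ominus>\<^bsub>H\<^esub> y) (x \<ominus>\<^bsub>H\<^esub> y) = 0"
    using assms by (simp add: ip_diff)
  then show ?thesis
    using assms ip_pos[of "x \<ominus>\<^bsub>H\<^esub> y"] diff_zero_iff[of x y] by fastforce
qed

lemma hnorm_smult: "x \<in> carrier H \<Longrightarrow> hnorm H (c \<odot>\<^bsub>H\<^esub> x) = cmod c * hnorm H x"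
proof -
  assume x: "x \<in> carrier H"
  have "ip H (c \<odot>\<^bsub>H\<^esub> x) (c \<odot>\<^bsub>H\<^esub> x) = complex_of_real ((cmod c)\<^sup>2 * (hnorm H x)\<^sup>2)"
    unfolding of_real_mult complex_norm_square using x
    by (simp add: ip_smult ip_smult_right ip_self_hnorm[of x])
  then show ?thesis
    unfolding hnorm_def[of H "c \<odot>\<^bsub>H\<^esub> x"] using x by (simp add: real_sqrt_mult)
qed

lemma hnorm_diff_sq: "x \<in> carrier H \<Longrightarrow> y \<in> carrier H \<Longrightarrow>
   (hnorm H (x \<ominus>\<^bsub>H\<^esub> y))\<^sup>2 = (hnorm H x)\<^sup>2 - 2 * Re (ip H x y) + (hnorm H y)\<^sup>2"
  using ip_cnj[of x y] by (simp add: hnorm_sq ip_simps)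

lemma hnorm_add_sq: "x \<in> carrier H \<Longrightarrow> y \<in> carrier H \<Longrightarrow>
   (hnorm H (x \<oplus>\<^bsub>H\<^esub> y))\<^sup>2 = (hnorm H x)\<^sup>2 + 2 * Re (ip H x y) + (hnorm H y)\<^sup>2"
  using ip_cnj[of x y] by (simp add: hnorm_sq ip_simps)

lemma cauchy_schwarz:
  assumes x: "x \<in> carrier H" and y: "y \<in> carrier H"
  shows "cmod (ip H x y) \<le> hnorm H x * hnorm H y"
proof (cases "y = \<zero>\<^bsub>H\<^esub>")
  case True then show ?thesis using x by simp
next
  case False
  define n where "n = (hnorm H y)\<^sup>2"
  have n: "n > 0" using False y by (simp add: n_def hnorm_pos)
  define c where "c = ip H x y"
  define t where "t = c / complex_of_real n"
  have yy: "ip H y y = complex_of_real n" using y by (simp add: ip_self_hnorm n_def)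
  have cc: "c * cnj c = complex_of_real ((cmod c)\<^sup>2)" by (metis complex_norm_square)
  have "0 \<le> Re (ip H (x \<ominus>\<^bsub>H\<^esub> t \<odot>\<^bsub>H\<^esub> y) (x \<ominus>\<^bsub>H\<^esub> t \<odot>\<^bsub>H\<^esub> y))"
    using x y by (simp add: ip_self_nonneg)
  also have "ip H (x \<ominus>\<^bsub>H\<^esub> t \<odot>\<^bsub>H\<^esub> y) (x \<ominus>\<^bsub>H\<^esub> t \<odot>\<^bsub>H\<^esub> y) = ip H x x - c * cnj c / complex_of_real n"
    using x y ip_cnj[OF x y] n by (simp add: ip_simps yy c_def[symmetric] t_def field_simps)
  also have "\<dots> = complex_of_real ((hnorm H x)\<^sup>2 - (cmod c)\<^sup>2 / n)"
    unfolding cc using x by (simp add: ip_self_hnorm)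
  finally have "(cmod c)\<^sup>2 \<le> (hnorm H x)\<^sup>2 * n" using n by (simp add: field_simps)
  then have "(cmod c)\<^sup>2 \<le> (hnorm H x * hnorm H y)\<^sup>2" by (simp only: n_def power_mult_distrib)
  then have "cmod c \<le> hnorm H x * hnorm H y"
    by (rule power2_le_imp_le) (intro mult_nonneg_nonneg hnorm_nonneg x y)
  then show ?thesis by (simp only: c_def)
qed

lemma hnorm_triangle:
  assumes x: "x \<in> carrier H" and y: "y \<in> carrier H"
  shows "hnorm H (x \<oplus>\<^bsub>H\<^esub> y) \<le> hnorm H x + hnorm H y"
proof (rule power2_le_imp_le)
  have "Re (ip H x y) \<le> hnorm H x * hnorm H y"
    using cauchy_schwarz[OF x y] complex_Re_le_cmod order_trans by blast
  then show "(hnorm H (x \<oplus>\<^bsub>H\<^esub> y))\<^sup>2 \<le> (hnorm H x + hnorm H y)\<^sup>2"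
    by (simp add: hnorm_add_sq x y power2_sum)
qed (use x y in simp)

lemma hnorm_minus_commute: "x \<in> carrier H \<Longrightarrow> y \<in> carrier H \<Longrightarrow>
    hnorm H (x \<ominus>\<^bsub>H\<^esub> y) = hnorm H (y \<ominus>\<^bsub>H\<^esub> x)"
  by (rule power2_eq_imp_eq) (simp_all add: hnorm_diff_sq ip_cnj[of x y])

lemma hnorm_triangle_via:
  assumes "x \<in> carrier H" "y \<in> carrier H" "z \<in> carrier H"
  shows "hnorm H (x \<ominus>\<^bsub>H\<^esub> z) \<le> hnorm H (x \<ominus>\<^bsub>H\<^esub> y) + hnorm H (y \<ominus>\<^bsub>H\<^esub> z)"
proof -
  have "x \<ominus>\<^bsub>H\<^esub> z = (x \<ominus>\<^bsub>H\<^esub> y) \<oplus>\<^bsub>H\<^esub> (y \<ominus>\<^bsub>H\<^esub> z)"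
    by (rule vec_eqI) (use assms in \<open>simp_all add: ip_simps\<close>)
  then show ?thesis using assms hnorm_triangle by simp
qed

lemma hnorm_triangle_diff:
  assumes "x \<in> carrier H" "y \<in> carrier H"
  shows "hnorm H x \<le> hnorm H (x \<ominus>\<^bsub>H\<^esub> y) + hnorm H y"
proof -
  have "x = (x \<ominus>\<^bsub>H\<^esub> y) \<oplus>\<^bsub>H\<^esub> y"
    by (rule vec_eqI) (use assms in \<open>simp_all add: ip_simps\<close>)
  then show ?thesis using assms hnorm_triangle[of "x \<ominus>\<^bsub>H\<^esub> y" y] by simp
qed

definition vlim :: "(nat \<Rightarrow> 'h) \<Rightarrow> 'h \<Rightarrow> bool" where
  "vlim s x \<longleftrightarrow> (\<lambda>i. hnorm H (s i \<ominus>\<^bsub>H\<^esub> x)) \<longlonglongrightarrow> 0"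

lemma vlim_ip:
  assumes "range s \<subseteq> carrier H" "x \<in> carrier H" "y \<in> carrier H" "vlim s x"
  shows "(\<lambda>i. ip H (s i) y) \<longlonglongrightarrow> ip H x y"
proof -
  have "cmod (ip H (s i) y - ip H x y) \<le> hnorm H (s i \<ominus>\<^bsub>H\<^esub> x) * hnorm H y" for i
    using cauchy_schwarz[of "s i \<ominus>\<^bsub>H\<^esub> x" y] assms by (auto simp: ip_simps image_subset_iff)
  moreover have "(\<lambda>i. hnorm H (s i \<ominus>\<^bsub>H\<^esub> x) * hnorm H y) \<longlonglongrightarrow> 0"
    using assms(4) by (simp add: vlim_def tendsto_mult_left_zero)
  ultimately have "(\<lambda>i. ip H (s i) y - ip H x y) \<longlonglongrightarrow> 0"
    by (rule null_sequence_comparison)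
  then show ?thesis by (simp add: LIM_zero_iff)
qed

lemma vlim_hnorm:
  assumes "range s \<subseteq> carrier H" "x \<in> carrier H" "vlim s x"
  shows "(\<lambda>i. hnorm H (s i)) \<longlonglongrightarrow> hnorm H x"
proof -
  have "\<bar>hnorm H (s i) - hnorm H x\<bar> \<le> hnorm H (s i \<ominus>\<^bsub>H\<^esub> x)" for i
    using hnorm_triangle_diff[of "s i" x] hnorm_triangle_diff[of x "s i"]
      hnorm_minus_commute[of x "s i"] assms by (auto simp: image_subset_iff abs_le_iff)
  then have "(\<lambda>i. hnorm H (s i) - hnorm H x) \<longlonglongrightarrow> 0"
    using assms(3) unfolding vlim_def real_norm_def[symmetric] by (rule null_sequence_comparison)
  then show ?thesis by (simp add: LIM_zero_iff)
qed

definition closed_subspace :: "'h set \<Rightarrow> bool" where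
  "closed_subspace N \<longleftrightarrow> N \<subseteq> carrier H \<and> \<zero>\<^bsub>H\<^esub> \<in> N \<and> (\<forall>x\<in>N. \<forall>y\<in>N. x \<oplus>\<^bsub>H\<^esub> y \<in> N) \<and>
     (\<forall>c. \<forall>x\<in>N. c \<odot>\<^bsub>H\<^esub> x \<in> N) \<and>
     (\<forall>s x. range s \<subseteq> N \<longrightarrow> x \<in> carrier H \<longrightarrow> vlim s x \<longrightarrow> x \<in> N)"

lemma Cauchy_vlim:
  assumes "range s \<subseteq> carrier H"
    and "\<And>i j. (hnorm H (s i \<ominus>\<^bsub>H\<^esub> s j))\<^sup>2 \<le> f i + f j" and "f \<longlonglongrightarrow> (0::real)"
  shows "\<exists>x\<in>carrier H. vlim s x"
  unfolding vlim_def
proof (rule complete[OF assms(1)], intro allI impI)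
  fix e :: real assume e: "e > 0"
  then have "e\<^sup>2 / 2 > 0" by simp
  then obtain N where N: "\<And>i. i \<ge> N \<Longrightarrow> \<bar>f i\<bar> < e\<^sup>2 / 2"
    using LIMSEQ_D[OF assms(3)] by fastforce
  have "hnorm H (s i \<ominus>\<^bsub>H\<^esub> s j) < e" if "i \<ge> N" "j \<ge> N" for i j
  proof (rule power_less_imp_less_base)
    show "(hnorm H (s i \<ominus>\<^bsub>H\<^esub> s j))\<^sup>2 < e\<^sup>2"
      using assms(2)[of i j] N[OF that(1)] N[OF that(2)] by linarith
  qed (use e in simp)
  then show "\<exists>N. \<forall>i\<ge>N. \<forall>j\<ge>N. hnorm H (s i \<ominus>\<^bsub>H\<^esub> s j) < e" by blast
qed

text \<open>The nearest point exists because the parallelogram law makes a minimizing sequence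
  Cauchy; orthogonality is the first-order condition at the minimum.\<close>

lemma projection_exists:
  assumes N: "closed_subspace N" and x: "x \<in> carrier H"
  shows "\<exists>y\<in>N. \<forall>z\<in>N. ip H (x \<ominus>\<^bsub>H\<^esub> y) z = 0"
proof -
  have NV: "\<And>z. z \<in> N \<Longrightarrow> z \<in> carrier H" and N0: "\<zero>\<^bsub>H\<^esub> \<in> N"
    and Nadd: "\<And>x y. x \<in> N \<Longrightarrow> y \<in> N \<Longrightarrow> x \<oplus>\<^bsub>H\<^esub> y \<in> N"
    and Nsm: "\<And>c x. x \<in> N \<Longrightarrow> c \<odot>\<^bsub>H\<^esub> x \<in> N"
    and Ncl: "\<And>s x. range s \<subseteq> N \<Longrightarrow> x \<in> carrier H \<Longrightarrow> vlim s x \<Longrightarrow> x \<in> N"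
    using N by (auto simp: closed_subspace_def)
  define D where "D = (\<lambda>z. (hnorm H (x \<ominus>\<^bsub>H\<^esub> z))\<^sup>2)"
  define d where "d = Inf (D ` N)"
  have bdd: "bdd_below (D ` N)" by (rule bdd_belowI[of _ 0]) (auto simp: D_def)
  have dle: "d \<le> D z" if "z \<in> N" for z unfolding d_def using bdd that by (simp add: cInf_lower)
  have "\<exists>z\<in>N. D z < d + 1 / real (Suc i)" for i
  proof -
    have "Inf (D ` N) < d + 1 / real (Suc i)" unfolding d_def by simp
    then show ?thesis using cInf_less_iff[of "D ` N"] N0 bdd by auto
  qed
  then obtain s where sN: "\<And>i. s i \<in> N" and sD: "\<And>i. D (s i) < d + 1 / real (Suc i)" by metis
  have par: "(hnorm H (s i \<ominus>\<^bsub>H\<^esub> s j))\<^sup>2 \<le> 2 / real (Suc i) + 2 / real (Suc j)" for i j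
  proof -
    let ?m = "(1/2) \<odot>\<^bsub>H\<^esub> (s i \<oplus>\<^bsub>H\<^esub> s j)"
    have "d \<le> D ?m" using dle Nadd Nsm sN by simp
    moreover have "(hnorm H (s i \<ominus>\<^bsub>H\<^esub> s j))\<^sup>2 = 2 * D (s i) + 2 * D (s j) - 4 * D ?m"
      using x NV[OF sN] by (simp add: D_def hnorm_sq ip_simps algebra_simps)
    ultimately show ?thesis using sD[of i] sD[of j] by simp
  qed
  have "(\<lambda>i. 2 / real (Suc i)) \<longlonglongrightarrow> 0"
    using tendsto_mult_right_zero[OF LIMSEQ_inverse_real_of_nat, of 2] by (simp add: divide_inverse)
  then obtain y where y: "y \<in> carrier H" "vlim s y"
    using Cauchy_vlim[of s, OF _ par] sN NV by auto
  have yN: "y \<in> N" using Ncl y sN by auto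
  have "vlim (\<lambda>i. x \<ominus>\<^bsub>H\<^esub> s i) (x \<ominus>\<^bsub>H\<^esub> y)"
  proof -
    have "hnorm H ((x \<ominus>\<^bsub>H\<^esub> s i) \<ominus>\<^bsub>H\<^esub> (x \<ominus>\<^bsub>H\<^esub> y)) = hnorm H (s i \<ominus>\<^bsub>H\<^esub> y)" for i
      by (rule power2_eq_imp_eq) (use x y(1) NV[OF sN] in \<open>simp_all add: hnorm_sq ip_simps algebra_simps\<close>)
    then show ?thesis using y(2) by (simp add: vlim_def)
  qed
  then have "(\<lambda>i. hnorm H (x \<ominus>\<^bsub>H\<^esub> s i)) \<longlonglongrightarrow> hnorm H (x \<ominus>\<^bsub>H\<^esub> y)"
    using vlim_hnorm[of "\<lambda>i. x \<ominus>\<^bsub>H\<^esub> s i"] x y(1) NV[OF sN] by auto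
  then have "(\<lambda>i. D (s i)) \<longlonglongrightarrow> D y" unfolding D_def by (intro tendsto_intros)
  moreover have "(\<lambda>i. d + 1 / real (Suc i)) \<longlonglongrightarrow> d"
    using LIMSEQ_inverse_real_of_nat_add[of d] by (simp add: divide_inverse)
  ultimately have "D y \<le> d" using sD by (intro LIMSEQ_le) (auto intro: less_imp_le)
  have "ip H (x \<ominus>\<^bsub>H\<^esub> y) z = 0" if z: "z \<in> N" for z
  proof (cases "z = \<zero>\<^bsub>H\<^esub>")
    case True then show ?thesis using x y by simp
  next
    case False
    have zV: "z \<in> carrier H" using z NV by auto
    define w where "w = x \<ominus>\<^bsub>H\<^esub> y"
    have w: "w \<in> carrier H" using x y by (simp add: w_def)
    define n where "n = (hnorm H z)\<^sup>2"
    have n: "n > 0" using False zV by (simp add: n_def hnorm_pos)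
    define c where "c = ip H w z"
    define t where "t = c / complex_of_real n"
    have cc: "c * cnj c = complex_of_real ((cmod c)\<^sup>2)" by (metis complex_norm_square)
    have zz: "ip H z z = complex_of_real n" using zV by (simp add: ip_self_hnorm n_def)
    have eq: "x \<ominus>\<^bsub>H\<^esub> (y \<oplus>\<^bsub>H\<^esub> t \<odot>\<^bsub>H\<^esub> z) = w \<ominus>\<^bsub>H\<^esub> t \<odot>\<^bsub>H\<^esub> z"
      unfolding w_def by (rule vec_eqI) (use x y(1) zV in \<open>simp_all add: ip_simps\<close>)
    have "ip H (w \<ominus>\<^bsub>H\<^esub> t \<odot>\<^bsub>H\<^esub> z) (w \<ominus>\<^bsub>H\<^esub> t \<odot>\<^bsub>H\<^esub> z) = ip H w w - c * cnj c / complex_of_real n"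
      using w zV ip_cnj[OF w zV] n by (simp add: ip_simps zz c_def[symmetric] t_def field_simps)
    also have "\<dots> = complex_of_real ((hnorm H w)\<^sup>2 - (cmod c)\<^sup>2 / n)"
      unfolding cc using w by (simp add: ip_self_hnorm)
    finally have "D (y \<oplus>\<^bsub>H\<^esub> t \<odot>\<^bsub>H\<^esub> z) = (hnorm H w)\<^sup>2 - (cmod c)\<^sup>2 / n"
      unfolding D_def eq using w zV by (simp add: hnorm_sq)
    moreover have "d \<le> D (y \<oplus>\<^bsub>H\<^esub> t \<odot>\<^bsub>H\<^esub> z)" using yN z Nadd Nsm dle by simp
    moreover have "D y = (hnorm H w)\<^sup>2" by (simp add: D_def w_def)
    ultimately have "(cmod c)\<^sup>2 / n \<le> 0" using \<open>D y \<le> d\<close> by linarith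
    then have "c = 0" using n by (auto simp: divide_le_0_iff)
    then show ?thesis by (simp add: c_def w_def)
  qed
  then show ?thesis using yN by blast
qed

lemma op_closed [simp, intro]: "T \<in> bounded_ops H \<Longrightarrow> x \<in> carrier H \<Longrightarrow> T x \<in> carrier H"
  unfolding bounded_ops_def module_hom_def by (simp add: Pi_iff)

lemma op_add: "T \<in> bounded_ops H \<Longrightarrow> x \<in> carrier H \<Longrightarrow> y \<in> carrier H \<Longrightarrow>
    T (x \<oplus>\<^bsub>H\<^esub> y) = T x \<oplus>\<^bsub>H\<^esub> T y"
  unfolding bounded_ops_def module_hom_def by (simp add: Pi_iff)

lemma op_smult: "T \<in> bounded_ops H \<Longrightarrow> x \<in> carrier H \<Longrightarrow> T (c \<odot>\<^bsub>H\<^esub> x) = c \<odot>\<^bsub>H\<^esub> T x"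
  unfolding bounded_ops_def module_hom_def by (simp add: Pi_iff)

lemma diff_eq_add: "x \<in> carrier H \<Longrightarrow> y \<in> carrier H \<Longrightarrow> x \<ominus>\<^bsub>H\<^esub> y = x \<oplus>\<^bsub>H\<^esub> (-1) \<odot>\<^bsub>H\<^esub> y"
  by (rule vec_eqI) (simp_all add: ip_simps)

lemma zero_smult [simp]: "x \<in> carrier H \<Longrightarrow> 0 \<odot>\<^bsub>H\<^esub> x = \<zero>\<^bsub>H\<^esub>"
  by (rule vec_eqI) (simp_all add: ip_simps)

lemma one_smult [simp]: "x \<in> carrier H \<Longrightarrow> 1 \<odot>\<^bsub>H\<^esub> x = x"
  by (rule vec_eqI) (simp_all add: ip_simps)

lemma smult_zero [simp]: "c \<odot>\<^bsub>H\<^esub> \<zero>\<^bsub>H\<^esub> = \<zero>\<^bsub>H\<^esub>"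
  by (rule vec_eqI) (simp_all add: ip_simps)

lemma smult_smult: "x \<in> carrier H \<Longrightarrow> c \<odot>\<^bsub>H\<^esub> (d \<odot>\<^bsub>H\<^esub> x) = (c * d) \<odot>\<^bsub>H\<^esub> x"
  by (rule vec_eqI) (simp_all add: ip_simps)

lemma diff_self [simp]: "x \<in> carrier H \<Longrightarrow> x \<ominus>\<^bsub>H\<^esub> x = \<zero>\<^bsub>H\<^esub>"
  by (simp add: diff_zero_iff)

lemma diff_zero [simp]: "x \<in> carrier H \<Longrightarrow> x \<ominus>\<^bsub>H\<^esub> \<zero>\<^bsub>H\<^esub> = x"
  by (rule vec_eqI) (simp_all add: ip_simps)

lemma op_diff: "T \<in> bounded_ops H \<Longrightarrow> x \<in> carrier H \<Longrightarrow> y \<in> carrier H \<Longrightarrow>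
    T (x \<ominus>\<^bsub>H\<^esub> y) = T x \<ominus>\<^bsub>H\<^esub> T y"
  by (simp add: diff_eq_add op_add op_smult)

lemma op_zero [simp]: "T \<in> bounded_ops H \<Longrightarrow> T \<zero>\<^bsub>H\<^esub> = \<zero>\<^bsub>H\<^esub>"
  using op_smult[of T "\<zero>\<^bsub>H\<^esub>" 0] by simp

lemma op_bound: "T \<in> bounded_ops H \<Longrightarrow> \<exists>c>0. \<forall>x\<in>carrier H. hnorm H (T x) \<le> c * hnorm H x"
proof -
  assume "T \<in> bounded_ops H"
  then obtain c where c: "\<forall>x\<in>carrier H. hnorm H (T x) \<le> c * hnorm H x"
    unfolding bounded_ops_def by blast
  have "hnorm H (T x) \<le> (\<bar>c\<bar> + 1) * hnorm H x" if x: "x \<in> carrier H" for x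
  proof -
    have "c * hnorm H x \<le> (\<bar>c\<bar> + 1) * hnorm H x" 
      using hnorm_nonneg[OF x] by (intro mult_right_mono) simp_all
    moreover have "hnorm H (T x) \<le> c * hnorm H x" using c x by blast
    ultimately show ?thesis by linarith
  qed
  moreover have "0 < \<bar>c\<bar> + 1" by simp
  ultimately show ?thesis by blast
qed

lemma bounded_opsI:
  assumes "\<And>x. x \<in> carrier H \<Longrightarrow> T x \<in> carrier H"
    and "\<And>x y. x \<in> carrier H \<Longrightarrow> y \<in> carrier H \<Longrightarrow> T (x \<oplus>\<^bsub>H\<^esub> y) = T x \<oplus>\<^bsub>H\<^esub> T y"
    and "\<And>c x. x \<in> carrier H \<Longrightarrow> T (c \<odot>\<^bsub>H\<^esub> x) = c \<odot>\<^bsub>H\<^esub> T x"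
    and "\<And>x. x \<in> carrier H \<Longrightarrow> hnorm H (T x) \<le> c * hnorm H x"
    and "\<And>x. x \<notin> carrier H \<Longrightarrow> T x = undefined"
  shows "T \<in> bounded_ops H"
  unfolding bounded_ops_def module_hom_def extensional_def using assms by blast

lemma op_eqI:
  assumes "S \<in> bounded_ops H" "T \<in> bounded_ops H"
    and "\<And>x y. x \<in> carrier H \<Longrightarrow> y \<in> carrier H \<Longrightarrow> ip H (S x) y = ip H (T x) y"
  shows "S = T"
proof (rule extensionalityI)
  show "S \<in> extensional (carrier H)" "T \<in> extensional (carrier H)"
    using assms by (auto simp: bounded_ops_def)
  show "S x = T x" if "x \<in> carrier H" for x
    using assms that by (intro vec_eqI) auto
qed

lemma op_eqI':
  assumes "S \<in> bounded_ops H" "T \<in> bounded_ops H"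
    and "\<And>x. x \<in> carrier H \<Longrightarrow> S x = T x"
  shows "S = T"
  using op_eqI assms by auto

text \<open>The nearest-point map is linear and contractive because the orthogonal decomposition of
  a vector is unique.\<close>

lemma orth_proj_exists:
  assumes N: "closed_subspace N"
  shows "\<exists>p\<in>bounded_ops H. (\<forall>x\<in>carrier H. p x \<in> N) \<and> (\<forall>x\<in>N. p x = x) \<and>
           (\<forall>x\<in>carrier H. \<forall>z\<in>N. ip H (x \<ominus>\<^bsub>H\<^esub> p x) z = 0)"
proof -
  have NV: "\<And>z. z \<in> N \<Longrightarrow> z \<in> carrier H"
    and Nadd: "\<And>x y. x \<in> N \<Longrightarrow> y \<in> N \<Longrightarrow> x \<oplus>\<^bsub>H\<^esub> y \<in> N"
    and Nsm: "\<And>c x. x \<in> N \<Longrightarrow> c \<odot>\<^bsub>H\<^esub> x \<in> N"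
    using N by (auto simp: closed_subspace_def)
  obtain q where q: "\<And>x. x \<in> carrier H \<Longrightarrow> q x \<in> N"
    and qo: "\<And>x z. x \<in> carrier H \<Longrightarrow> z \<in> N \<Longrightarrow> ip H (x \<ominus>\<^bsub>H\<^esub> q x) z = 0"
    using projection_exists[OF N] by metis
  have uniq: "y = q x" if x: "x \<in> carrier H" and y: "y \<in> N" "\<And>z. z \<in> N \<Longrightarrow> ip H (x \<ominus>\<^bsub>H\<^esub> y) z = 0" for x y
  proof -
    have yx: "y \<in> carrier H" "q x \<in> carrier H" using y q x NV by auto
    have d: "q x \<ominus>\<^bsub>H\<^esub> y \<in> N" using y(1) q[OF x] Nadd Nsm yx by (simp add: diff_eq_add)
    have "ip H (q x \<ominus>\<^bsub>H\<^esub> y) (q x \<ominus>\<^bsub>H\<^esub> y) = ip H (x \<ominus>\<^bsub>H\<^esub> y) (q x \<ominus>\<^bsub>H\<^esub> y) - ip H (x \<ominus>\<^bsub>H\<^esub> q x) (q x \<ominus>\<^bsub>H\<^esub> y)"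
      using yx x by (simp add: ip_simps)
    also have "\<dots> = 0" using y(2)[OF d] qo[OF x d] by simp
    finally show ?thesis using ip_pos[of "q x \<ominus>\<^bsub>H\<^esub> y"] diff_zero_iff[of "q x" y] yx by fastforce
  qed
  define p where "p = (\<lambda>x\<in>carrier H. q x)"
  have pv: "p x = q x" if "x \<in> carrier H" for x using that by (simp add: p_def)
  have "p \<in> bounded_ops H"
  proof (rule bounded_opsI[where c=1])
    fix x y assume x: "x \<in> carrier H" and y: "y \<in> carrier H"
    have "q x \<oplus>\<^bsub>H\<^esub> q y = q (x \<oplus>\<^bsub>H\<^esub> y)"
    proof (rule uniq)
      fix z assume z: "z \<in> N"
      have "ip H ((x \<oplus>\<^bsub>H\<^esub> y) \<ominus>\<^bsub>H\<^esub> (q x \<oplus>\<^bsub>H\<^esub> q y)) z = ip H (x \<ominus>\<^bsub>H\<^esub> q x) z + ip H (y \<ominus>\<^bsub>H\<^esub> q y) z"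
        using x y z q NV by (simp add: ip_simps)
      then show "ip H ((x \<oplus>\<^bsub>H\<^esub> y) \<ominus>\<^bsub>H\<^esub> (q x \<oplus>\<^bsub>H\<^esub> q y)) z = 0" using qo x y z by simp
    qed (use x y q Nadd in auto)
    then show "p (x \<oplus>\<^bsub>H\<^esub> y) = p x \<oplus>\<^bsub>H\<^esub> p y" using x y by (simp add: pv)
  next
    fix c x assume x: "x \<in> carrier H"
    have "c \<odot>\<^bsub>H\<^esub> q x = q (c \<odot>\<^bsub>H\<^esub> x)"
    proof (rule uniq)
      fix z assume z: "z \<in> N"
      have "ip H ((c \<odot>\<^bsub>H\<^esub> x) \<ominus>\<^bsub>H\<^esub> (c \<odot>\<^bsub>H\<^esub> q x)) z = c * ip H (x \<ominus>\<^bsub>H\<^esub> q x) z"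
        using x z q NV by (simp add: ip_simps algebra_simps)
      then show "ip H ((c \<odot>\<^bsub>H\<^esub> x) \<ominus>\<^bsub>H\<^esub> (c \<odot>\<^bsub>H\<^esub> q x)) z = 0" using qo x z by simp
    qed (use x q Nsm in auto)
    then show "p (c \<odot>\<^bsub>H\<^esub> x) = c \<odot>\<^bsub>H\<^esub> p x" using x by (simp add: pv)
  next
    fix x assume x: "x \<in> carrier H"
    have qx: "q x \<in> carrier H" using q x NV by auto
    have "ip H x (q x) = ip H (q x) (q x)" using qo[OF x q[OF x]] x qx by (simp add: ip_simps)
    then have "(hnorm H (q x))\<^sup>2 = Re (ip H x (q x))" using qx by (simp add: hnorm_sq)
    also have "\<dots> \<le> hnorm H x * hnorm H (q x)"
      using cauchy_schwarz[OF x qx] complex_Re_le_cmod order_trans by blast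
    finally have "hnorm H (q x) \<le> hnorm H x"
      using qx x by (cases "hnorm H (q x) = 0") (simp_all add: power2_eq_square less_le)
    then show "hnorm H (p x) \<le> 1 * hnorm H x" using x by (simp add: pv)
  qed (use q NV in \<open>auto simp: p_def\<close>)
  moreover have "p x = x" if x: "x \<in> N" for x
  proof -
    have "x = q x" by (rule uniq) (use x NV in auto)
    then show ?thesis using pv[of x] NV x by auto
  qed
  ultimately show ?thesis using q qo pv by (intro bexI[of _ p]) auto
qed

text \<open>Riesz: on the orthogonal complement of the kernel a functional is one-dimensional.\<close>

lemma riesz_representation:
  assumes add: "\<And>x y. x \<in> carrier H \<Longrightarrow> y \<in> carrier H \<Longrightarrow> f (x \<oplus>\<^bsub>H\<^esub> y) = f x + f y"
    and sm: "\<And>c x. x \<in> carrier H \<Longrightarrow> f (c \<odot>\<^bsub>H\<^esub> x) = c * f x"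
    and bd: "\<And>x. x \<in> carrier H \<Longrightarrow> cmod (f x) \<le> B * hnorm H x"
  shows "\<exists>y\<in>carrier H. \<forall>x\<in>carrier H. f x = ip H x y"
proof -
  define N where "N = {x \<in> carrier H. f x = 0}"
  have diff: "f (x \<ominus>\<^bsub>H\<^esub> y) = f x - f y" if "x \<in> carrier H" "y \<in> carrier H" for x y
    using that by (simp add: diff_eq_add add sm)
  have N: "closed_subspace N"
    unfolding closed_subspace_def
  proof (intro conjI allI impI ballI)
    show "\<zero>\<^bsub>H\<^esub> \<in> N" using sm[of "\<zero>\<^bsub>H\<^esub>" 0] by (simp add: N_def)
    fix s x assume s: "range s \<subseteq> N" and x: "x \<in> carrier H" and l: "vlim s x"
    have sV: "\<And>i. s i \<in> carrier H" and s0: "\<And>i. f (s i) = 0" using s by (auto simp: N_def)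
    have "cmod (f x) \<le> B * hnorm H (s i \<ominus>\<^bsub>H\<^esub> x)" for i
      using bd[of "s i \<ominus>\<^bsub>H\<^esub> x"] sV[of i] x s0[of i] by (simp add: diff)
    moreover have "(\<lambda>i. B * hnorm H (s i \<ominus>\<^bsub>H\<^esub> x)) \<longlonglongrightarrow> 0"
      using l by (simp add: vlim_def tendsto_mult_right_zero)
    ultimately have "cmod (f x) \<le> 0" by (intro LIMSEQ_le_const) auto
    then show "x \<in> N" using x by (simp add: N_def)
  qed (auto simp: N_def add sm)
  show ?thesis
  proof (cases "\<forall>x\<in>carrier H. f x = 0")
    case True then show ?thesis by (intro bexI[of _ "\<zero>\<^bsub>H\<^esub>"]) auto
  next
    case False
    then obtain v where v: "v \<in> carrier H" "f v \<noteq> 0" by auto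
    obtain u where u: "u \<in> N" and uo: "\<And>z. z \<in> N \<Longrightarrow> ip H (v \<ominus>\<^bsub>H\<^esub> u) z = 0"
      using projection_exists[OF N v(1)] by auto
    define w where "w = v \<ominus>\<^bsub>H\<^esub> u"
    have uV: "u \<in> carrier H" "f u = 0" using u by (auto simp: N_def)
    have w: "w \<in> carrier H" "f w \<noteq> 0" using v uV by (auto simp: w_def diff)
    define n where "n = (hnorm H w)\<^sup>2"
    have "w \<noteq> \<zero>\<^bsub>H\<^esub>" using w(2) sm[of "\<zero>\<^bsub>H\<^esub>" 0] by auto
    then have n: "n > 0" using w by (simp add: n_def hnorm_pos)
    have ww: "ip H w w = complex_of_real n" using w by (simp add: ip_self_hnorm n_def)
    show ?thesis
    proof (intro bexI ballI)
      show "(cnj (f w) / complex_of_real n) \<odot>\<^bsub>H\<^esub> w \<in> carrier H" using w by simp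
      fix x assume x: "x \<in> carrier H"
      have "x \<ominus>\<^bsub>H\<^esub> (f x / f w) \<odot>\<^bsub>H\<^esub> w \<in> N"
        using x w by (simp add: N_def diff sm)
      then have "ip H w (x \<ominus>\<^bsub>H\<^esub> (f x / f w) \<odot>\<^bsub>H\<^esub> w) = 0" using uo w_def by simp
      then have "ip H (x \<ominus>\<^bsub>H\<^esub> (f x / f w) \<odot>\<^bsub>H\<^esub> w) w = 0"
        by (metis ip_cnj complex_cnj_zero w(1) x vsmult vminus)
      then have "ip H x w = (f x / f w) * complex_of_real n" using x w ww by (simp add: ip_simps)
      then show "f x = ip H x ((cnj (f w) / complex_of_real n) \<odot>\<^bsub>H\<^esub> w)"
        using x w n by (simp add: ip_simps)
    qed
  qed
qed

lemma adjoint_unique: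
  assumes "S \<in> bounded_ops H" "S' \<in> bounded_ops H"
    "\<And>x y. x \<in> carrier H \<Longrightarrow> y \<in> carrier H \<Longrightarrow> ip H x (S y) = ip H x (S' y)"
  shows "S = S'"
  by (rule op_eqI) (use assms in \<open>metis ip_cnj op_closed\<close>)+

text \<open>The Riesz vector of the functional sending \<open>x\<close> to the inner product of
  \<open>T x\<close> with \<open>y\<close> depends linearly and boundedly on
  \<open>y\<close>.\<close>

lemma adjoint_exists:
  assumes T: "T \<in> bounded_ops H"
  shows "\<exists>S\<in>bounded_ops H. \<forall>x\<in>carrier H. \<forall>y\<in>carrier H. ip H (T x) y = ip H x (S y)"
proof -
  obtain c where c: "c > 0" "\<And>x. x \<in> carrier H \<Longrightarrow> hnorm H (T x) \<le> c * hnorm H x"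
    using op_bound[OF T] by auto
  have "\<exists>w\<in>carrier H. \<forall>x\<in>carrier H. ip H (T x) y = ip H x w" if y: "y \<in> carrier H" for y
  proof (rule riesz_representation)
    fix x assume x: "x \<in> carrier H"
    have "cmod (ip H (T x) y) \<le> hnorm H (T x) * hnorm H y" using x y T by (intro cauchy_schwarz) auto
    also have "\<dots> \<le> c * hnorm H x * hnorm H y" using c(2)[OF x] y by (intro mult_right_mono) auto
    finally show "cmod (ip H (T x) y) \<le> (c * hnorm H y) * hnorm H x" by (simp add: mult_ac)
  qed (use T y in \<open>auto simp: op_add op_smult ip_simps\<close>)
  then obtain S0 where S0: "\<And>y. y \<in> carrier H \<Longrightarrow> S0 y \<in> carrier H"
    and S0e: "\<And>x y. x \<in> carrier H \<Longrightarrow> y \<in> carrier H \<Longrightarrow> ip H (T x) y = ip H x (S0 y)" by metis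
  have S0e': "ip H (S0 y) x = ip H y (T x)" if "x \<in> carrier H" "y \<in> carrier H" for x y
    using that S0e S0 T by (metis ip_cnj op_closed)
  define S where "S = (\<lambda>y\<in>carrier H. S0 y)"
  have Sv: "S y = S0 y" if "y \<in> carrier H" for y using that by (simp add: S_def)
  have "S \<in> bounded_ops H"
  proof (rule bounded_opsI[where c=c])
    fix x y assume x: "x \<in> carrier H" and y: "y \<in> carrier H"
    show "S (x \<oplus>\<^bsub>H\<^esub> y) = S x \<oplus>\<^bsub>H\<^esub> S y"
      by (rule vec_eqI) (use x y S0 T in \<open>simp_all add: Sv ip_simps S0e'\<close>)
  next
    fix d x assume x: "x \<in> carrier H"
    show "S (d \<odot>\<^bsub>H\<^esub> x) = d \<odot>\<^bsub>H\<^esub> S x"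
      by (rule vec_eqI) (use x S0 T in \<open>simp_all add: Sv ip_simps S0e'\<close>)
  next
    fix x assume x: "x \<in> carrier H"
    have s: "S0 x \<in> carrier H" using S0 x by auto
    have "(hnorm H (S0 x))\<^sup>2 = Re (ip H x (T (S0 x)))"
      using s x by (simp add: hnorm_sq S0e')
    also have "\<dots> \<le> hnorm H x * hnorm H (T (S0 x))"
      using cauchy_schwarz[of x "T (S0 x)"] x s T complex_Re_le_cmod order_trans by blast
    also have "\<dots> \<le> hnorm H x * (c * hnorm H (S0 x))" using c(2)[OF s] x by (intro mult_left_mono) auto
    finally have "hnorm H (S0 x) * hnorm H (S0 x) \<le> (c * hnorm H x) * hnorm H (S0 x)"
      by (simp add: power2_eq_square mult_ac)
    then have "hnorm H (S0 x) \<le> c * hnorm H x"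
      using s x c(1) by (cases "hnorm H (S0 x) = 0") (auto simp: less_le)
    then show "hnorm H (S x) \<le> c * hnorm H x" using x by (simp add: Sv)
  qed (auto simp: S_def S0)
  then show ?thesis using S0e Sv by (intro bexI[of _ S]) auto
qed

lemma
  assumes T: "T \<in> bounded_ops H"
  shows adjoint_bounded [simp, intro]: "adjoint H T \<in> bounded_ops H"
    and ip_adjoint: "x \<in> carrier H \<Longrightarrow> y \<in> carrier H \<Longrightarrow> ip H x (adjoint H T y) = ip H (T x) y"
proof -
  let ?P = "\<lambda>S. S \<in> bounded_ops H \<and> (\<forall>x\<in>carrier H. \<forall>y\<in>carrier H. ip H (T x) y = ip H x (S y))"
  have "\<exists>!S. ?P S" using adjoint_exists[OF T] adjoint_unique by (metis (no_types, lifting))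
  then have "?P (adjoint H T)" unfolding adjoint_def by (rule theI')
  then show "adjoint H T \<in> bounded_ops H"
    "x \<in> carrier H \<Longrightarrow> y \<in> carrier H \<Longrightarrow> ip H x (adjoint H T y) = ip H (T x) y" by auto
qed

lemma ip_adjoint': 
  assumes "T \<in> bounded_ops H" "x \<in> carrier H" "y \<in> carrier H"
  shows "ip H (adjoint H T x) y = ip H x (T y)"
  by (metis assms adjoint_bounded ip_adjoint ip_cnj op_closed)

lemma adjoint_eqI:
  assumes "T \<in> bounded_ops H" "S \<in> bounded_ops H"
    "\<And>x y. x \<in> carrier H \<Longrightarrow> y \<in> carrier H \<Longrightarrow> ip H (T x) y = ip H x (S y)"
  shows "adjoint H T = S"
  by (rule adjoint_unique) (use assms in \<open>simp_all add: ip_adjoint\<close>)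

end

section \<open>Commutants and von Neumann algebras\<close>

context hilbert_space
begin

lemma one_bounded [simp, intro]: "(\<lambda>x\<in>carrier H. x) \<in> bounded_ops H"
  by (rule bounded_opsI[where c=1]) simp_all

lemma zero_bounded [simp, intro]: "(\<lambda>x\<in>carrier H. \<zero>\<^bsub>H\<^esub>) \<in> bounded_ops H"
  by (rule bounded_opsI[where c=0]) simp_all

lemma add_bounded [simp, intro]:
  assumes S: "S \<in> bounded_ops H" and T: "T \<in> bounded_ops H"
  shows "(\<lambda>x\<in>carrier H. S x \<oplus>\<^bsub>H\<^esub> T x) \<in> bounded_ops H"
proof -
  obtain c where c: "\<And>x. x \<in> carrier H \<Longrightarrow> hnorm H (S x) \<le> c * hnorm H x" using op_bound[OF S] by blast
  obtain d where d: "\<And>x. x \<in> carrier H \<Longrightarrow> hnorm H (T x) \<le> d * hnorm H x" using op_bound[OF T] by blast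
  show ?thesis
  proof (rule bounded_opsI[where c="c + d"])
    fix x assume x: "x \<in> carrier H"
    have "hnorm H (S x \<oplus>\<^bsub>H\<^esub> T x) \<le> hnorm H (S x) + hnorm H (T x)"
      using S T x by (intro hnorm_triangle) simp_all
    then show "hnorm H ((\<lambda>x\<in>carrier H. S x \<oplus>\<^bsub>H\<^esub> T x) x) \<le> (c + d) * hnorm H x"
      using c[OF x] d[OF x] x by (simp add: algebra_simps)
  next
    fix x y assume "x \<in> carrier H" "y \<in> carrier H"
    then show "(\<lambda>x\<in>carrier H. S x \<oplus>\<^bsub>H\<^esub> T x) (x \<oplus>\<^bsub>H\<^esub> y) =
        (\<lambda>x\<in>carrier H. S x \<oplus>\<^bsub>H\<^esub> T x) x \<oplus>\<^bsub>H\<^esub> (\<lambda>x\<in>carrier H. S x \<oplus>\<^bsub>H\<^esub> T x) y"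
      using S T by (intro vec_eqI) (simp_all add: op_add ip_simps)
  next
    fix a x assume "x \<in> carrier H"
    then show "(\<lambda>x\<in>carrier H. S x \<oplus>\<^bsub>H\<^esub> T x) (a \<odot>\<^bsub>H\<^esub> x) = a \<odot>\<^bsub>H\<^esub> (\<lambda>x\<in>carrier H. S x \<oplus>\<^bsub>H\<^esub> T x) x"
      using S T by (intro vec_eqI) (simp_all add: op_smult ip_simps algebra_simps)
  qed (use S T in simp_all)
qed

lemma smult_bounded [simp, intro]:
  assumes T: "T \<in> bounded_ops H"
  shows "(\<lambda>x\<in>carrier H. a \<odot>\<^bsub>H\<^esub> T x) \<in> bounded_ops H"
proof -
  obtain c where c: "\<And>x. x \<in> carrier H \<Longrightarrow> hnorm H (T x) \<le> c * hnorm H x" using op_bound[OF T] by blast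
  show ?thesis
  proof (rule bounded_opsI[where c="cmod a * c"])
    fix x assume x: "x \<in> carrier H"
    then show "hnorm H ((\<lambda>x\<in>carrier H. a \<odot>\<^bsub>H\<^esub> T x) x) \<le> cmod a * c * hnorm H x"
      using c[OF x] T by (simp add: hnorm_smult mult.assoc mult_left_mono)
  next
    fix x y assume "x \<in> carrier H" "y \<in> carrier H"
    then show "(\<lambda>x\<in>carrier H. a \<odot>\<^bsub>H\<^esub> T x) (x \<oplus>\<^bsub>H\<^esub> y) =
        (\<lambda>x\<in>carrier H. a \<odot>\<^bsub>H\<^esub> T x) x \<oplus>\<^bsub>H\<^esub> (\<lambda>x\<in>carrier H. a \<odot>\<^bsub>H\<^esub> T x) y"
      using T by (intro vec_eqI) (simp_all add: op_add ip_simps algebra_simps)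
  next
    fix b x assume "x \<in> carrier H"
    then show "(\<lambda>x\<in>carrier H. a \<odot>\<^bsub>H\<^esub> T x) (b \<odot>\<^bsub>H\<^esub> x) = b \<odot>\<^bsub>H\<^esub> (\<lambda>x\<in>carrier H. a \<odot>\<^bsub>H\<^esub> T x) x"
      using T by (intro vec_eqI) (simp_all add: op_smult ip_simps algebra_simps)
  qed (use T in simp_all)
qed

lemma compose_bounded [simp, intro]:
  assumes S: "S \<in> bounded_ops H" and T: "T \<in> bounded_ops H"
  shows "compose (carrier H) S T \<in> bounded_ops H"
proof -
  obtain c where c0: "c > 0" and c: "\<And>x. x \<in> carrier H \<Longrightarrow> hnorm H (S x) \<le> c * hnorm H x" using op_bound[OF S] by blast
  obtain d where d: "\<And>x. x \<in> carrier H \<Longrightarrow> hnorm H (T x) \<le> d * hnorm H x" using op_bound[OF T] by blast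
  show ?thesis
  proof (rule bounded_opsI[where c="c * d"])
    fix x assume x: "x \<in> carrier H"
    have "hnorm H (S (T x)) \<le> c * hnorm H (T x)" using c x T by simp
    also have "\<dots> \<le> c * (d * hnorm H x)" using d[OF x] c0 by (intro mult_left_mono) simp_all
    finally show "hnorm H (compose (carrier H) S T x) \<le> c * d * hnorm H x"
      using x by (simp add: compose_eq mult.assoc)
  qed (use S T in \<open>simp_all add: compose_eq op_add op_smult compose_def\<close>)
qed

lemma commutant_iff:
  "T \<in> commutant H M \<longleftrightarrow> T \<in> bounded_ops H \<and> (\<forall>S\<in>M. \<forall>x\<in>carrier H. S (T x) = T (S x))"
proof -
  have "compose (carrier H) S T = compose (carrier H) T S \<longleftrightarrow> (\<forall>x\<in>carrier H. S (T x) = T (S x))" for S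
    unfolding compose_def restrict_def fun_eq_iff by (simp add: Ball_def)
  then show ?thesis unfolding commutant_def by simp
qed

lemma commutant_bounded: "commutant H M \<subseteq> bounded_ops H"
  by (auto simp: commutant_def)

lemma commutant_add: "M \<subseteq> bounded_ops H \<Longrightarrow> S \<in> commutant H M \<Longrightarrow> T \<in> commutant H M \<Longrightarrow>
    (\<lambda>x\<in>carrier H. S x \<oplus>\<^bsub>H\<^esub> T x) \<in> commutant H M"
  unfolding commutant_iff using op_add op_closed by (simp add: subset_iff)

lemma commutant_smult: "M \<subseteq> bounded_ops H \<Longrightarrow> T \<in> commutant H M \<Longrightarrow>
    (\<lambda>x\<in>carrier H. c \<odot>\<^bsub>H\<^esub> T x) \<in> commutant H M"
  unfolding commutant_iff using op_smult op_closed by (simp add: subset_iff)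

lemma commutant_compose: "M \<subseteq> bounded_ops H \<Longrightarrow> S \<in> commutant H M \<Longrightarrow> T \<in> commutant H M \<Longrightarrow>
    compose (carrier H) S T \<in> commutant H M"
  unfolding commutant_iff by (simp add: subset_iff compose_eq)

lemma commutant_one: "M \<subseteq> bounded_ops H \<Longrightarrow> (\<lambda>x\<in>carrier H. x) \<in> commutant H M"
  unfolding commutant_iff by (simp add: subset_iff)

lemma commutant_zero: "M \<subseteq> bounded_ops H \<Longrightarrow> (\<lambda>x\<in>carrier H. \<zero>\<^bsub>H\<^esub>) \<in> commutant H M"
  unfolding commutant_iff by (simp add: subset_iff)

lemma commutant_adjoint:
  assumes M: "M \<subseteq> bounded_ops H" and adj: "\<And>T. T \<in> M \<Longrightarrow> adjoint H T \<in> M" and T: "T \<in> commutant H M"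
  shows "adjoint H T \<in> commutant H M"
proof -
  have Tb: "T \<in> bounded_ops H" and Tc: "\<And>S x. S \<in> M \<Longrightarrow> x \<in> carrier H \<Longrightarrow> S (T x) = T (S x)"
    using T unfolding commutant_iff by blast+
  have "S (adjoint H T x) = adjoint H T (S x)" if S: "S \<in> M" and x: "x \<in> carrier H" for S x
  proof (rule vec_eqI)
    have Sb: "S \<in> bounded_ops H" "adjoint H S \<in> bounded_ops H" using S M adj by blast+
    show "S (adjoint H T x) \<in> carrier H" "adjoint H T (S x) \<in> carrier H"
      using Sb Tb x by simp_all
    fix z assume z: "z \<in> carrier H"
    have "ip H (S (adjoint H T x)) z = ip H (adjoint H T x) (adjoint H S z)"
      using Sb Tb x z by (simp add: ip_adjoint)
    also have "\<dots> = ip H x (adjoint H S (T z))"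
      using Sb Tb x z Tc[OF adj[OF S] z] by (simp add: ip_adjoint')
    also have "\<dots> = ip H (adjoint H T (S x)) z"
      using Sb Tb x z by (simp add: ip_adjoint ip_adjoint')
    finally show "ip H (S (adjoint H T x)) z = ip H (adjoint H T (S x)) z" .
  qed
  then show ?thesis using Tb by (simp add: commutant_iff)
qed

text \<open>Taking commutants reverses inclusions and a set lies in its bicommutant, so the third
  commutant is the first.\<close>

lemma commutant_vn:
  assumes M: "M \<subseteq> bounded_ops H" and adj: "\<And>T. T \<in> M \<Longrightarrow> adjoint H T \<in> M"
  shows "von_neumann_algebra H (commutant H M)"
proof -
  have double: "N \<subseteq> commutant H (commutant H N)" if "N \<subseteq> bounded_ops H" for N
    using that unfolding subset_iff commutant_iff[of _ "commutant H N"]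
    by (simp add: commutant_iff[of _ N])
  have "commutant H (commutant H (commutant H M)) \<subseteq> commutant H M"
    using double[OF M] unfolding commutant_def by blast
  moreover have "commutant H M \<subseteq> commutant H (commutant H (commutant H M))"
    by (rule double[OF commutant_bounded])
  ultimately show ?thesis
    using commutant_bounded commutant_adjoint[OF M adj] hilbert_space_axioms
    by (simp add: von_neumann_algebra_def)
qed

end

lemma op_alg_simps [simp]:
  "carrier (op_alg H M) = M" "mult (op_alg H M) = compose (carrier H)"
  "one (op_alg H M) = (\<lambda>x\<in>carrier H. x)" "zero (op_alg H M) = (\<lambda>x\<in>carrier H. \<zero>\<^bsub>H\<^esub>)"
  "add (op_alg H M) = (\<lambda>S T. \<lambda>x\<in>carrier H. S x \<oplus>\<^bsub>H\<^esub> T x)"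
  "module.smult (op_alg H M) = (\<lambda>c T. \<lambda>x\<in>carrier H. c \<odot>\<^bsub>H\<^esub> T x)"
  "star (op_alg H M) = adjoint H"
  by (simp_all add: op_alg_def)

locale vn_algebra = hilbert_space H for H :: "'h hilbert" +
  fixes M :: "('h \<Rightarrow> 'h) set"
  assumes vn: "von_neumann_algebra H M"
begin

lemma bounded [simp, intro]: "T \<in> M \<Longrightarrow> T \<in> bounded_ops H"
  using vn unfolding von_neumann_algebra_def by blast

lemma adjoint_mem [simp, intro]: "T \<in> M \<Longrightarrow> adjoint H T \<in> M"
  using vn unfolding von_neumann_algebra_def by blast

lemma bicommutant: "M = commutant H (commutant H M)"
  using vn unfolding von_neumann_algebra_def by blast

lemma memI: "T \<in> bounded_ops H \<Longrightarrow> (\<And>S x. S \<in> commutant H M \<Longrightarrow> x \<in> carrier H \<Longrightarrow> S (T x) = T (S x)) \<Longrightarrow> T \<in> M"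
  by (subst bicommutant) (simp add: commutant_iff[of _ "commutant H M"])

lemma commutantD: "S \<in> commutant H M \<Longrightarrow> T \<in> M \<Longrightarrow> x \<in> carrier H \<Longrightarrow> T (S x) = S (T x)"
  by (simp add: commutant_iff)

lemma
  assumes "S \<in> M" "T \<in> M"
  shows add_mem [simp, intro]: "(\<lambda>x\<in>carrier H. S x \<oplus>\<^bsub>H\<^esub> T x) \<in> M"
    and compose_mem [simp, intro]: "compose (carrier H) S T \<in> M"
  using assms commutant_add[OF commutant_bounded, of S M T] commutant_compose[OF commutant_bounded, of S M T]
  by (simp_all add: bicommutant[symmetric])

lemma
  shows one_mem [simp, intro]: "(\<lambda>x\<in>carrier H. x) \<in> M"
    and zero_mem [simp, intro]: "(\<lambda>x\<in>carrier H. \<zero>\<^bsub>H\<^esub>) \<in> M"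
    and smult_mem [simp, intro]: "T \<in> M \<Longrightarrow> (\<lambda>x\<in>carrier H. c \<odot>\<^bsub>H\<^esub> T x) \<in> M"
  using commutant_one[OF commutant_bounded, of M] commutant_zero[OF commutant_bounded, of M]
    commutant_smult[OF commutant_bounded, of T M c]
  by (simp_all add: bicommutant[symmetric])

lemma ring_op_alg: "ring (op_alg H M)"
proof (rule ringI)
  show "abelian_group (op_alg H M)"
  proof (rule abelian_groupI)
    fix S T U assume a: "S \<in> carrier (op_alg H M)" "T \<in> carrier (op_alg H M)" "U \<in> carrier (op_alg H M)"
    then show "S \<oplus>\<^bsub>op_alg H M\<^esub> T \<oplus>\<^bsub>op_alg H M\<^esub> U = S \<oplus>\<^bsub>op_alg H M\<^esub> (T \<oplus>\<^bsub>op_alg H M\<^esub> U)"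
      unfolding op_alg_simps
      by (intro op_eqI) ((intro bounded add_mem zero_mem; assumption)+, simp add: ip_simps)
  next
    fix S T assume a: "S \<in> carrier (op_alg H M)" "T \<in> carrier (op_alg H M)"
    then show "S \<oplus>\<^bsub>op_alg H M\<^esub> T = T \<oplus>\<^bsub>op_alg H M\<^esub> S"
      unfolding op_alg_simps
      by (intro op_eqI) ((intro bounded add_mem zero_mem; assumption)+, simp add: ip_simps)
  next
    fix S assume a: "S \<in> carrier (op_alg H M)"
    then show "\<zero>\<^bsub>op_alg H M\<^esub> \<oplus>\<^bsub>op_alg H M\<^esub> S = S"
      unfolding op_alg_simps
      by (intro op_eqI) ((intro bounded add_mem zero_mem; assumption)+, simp add: ip_simps)
    have "(\<lambda>x\<in>carrier H. (-1) \<odot>\<^bsub>H\<^esub> S x) \<oplus>\<^bsub>op_alg H M\<^esub> S = \<zero>\<^bsub>op_alg H M\<^esub>"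
      using a unfolding op_alg_simps
      by (intro op_eqI) ((intro bounded add_mem smult_mem zero_mem; assumption)+, simp add: ip_simps)
    then show "\<exists>T\<in>carrier (op_alg H M). T \<oplus>\<^bsub>op_alg H M\<^esub> S = \<zero>\<^bsub>op_alg H M\<^esub>"
      using a smult_mem[of S "-1"] by (metis op_alg_simps(1))
  qed simp_all
  show "monoid (op_alg H M)"
  proof (rule monoidI)
    fix S T U assume a: "S \<in> carrier (op_alg H M)" "T \<in> carrier (op_alg H M)" "U \<in> carrier (op_alg H M)"
    then show "S \<otimes>\<^bsub>op_alg H M\<^esub> T \<otimes>\<^bsub>op_alg H M\<^esub> U = S \<otimes>\<^bsub>op_alg H M\<^esub> (T \<otimes>\<^bsub>op_alg H M\<^esub> U)"
      by (intro op_eqI') (simp_all add: compose_eq)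
  next
    fix S assume a: "S \<in> carrier (op_alg H M)"
    then show "\<one>\<^bsub>op_alg H M\<^esub> \<otimes>\<^bsub>op_alg H M\<^esub> S = S"
      unfolding op_alg_simps
      by (intro op_eqI') ((intro bounded compose_mem one_mem; assumption)+, simp add: compose_eq)
    from a show "S \<otimes>\<^bsub>op_alg H M\<^esub> \<one>\<^bsub>op_alg H M\<^esub> = S"
      unfolding op_alg_simps
      by (intro op_eqI') ((intro bounded compose_mem one_mem; assumption)+, simp add: compose_eq)
  qed simp_all
next
  fix S T U assume a: "S \<in> carrier (op_alg H M)" "T \<in> carrier (op_alg H M)" "U \<in> carrier (op_alg H M)"
  then show "(S \<oplus>\<^bsub>op_alg H M\<^esub> T) \<otimes>\<^bsub>op_alg H M\<^esub> U = S \<otimes>\<^bsub>op_alg H M\<^esub> U \<oplus>\<^bsub>op_alg H M\<^esub> T \<otimes>\<^bsub>op_alg H M\<^esub> U"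
    unfolding op_alg_simps
    by (intro op_eqI') ((intro bounded add_mem compose_mem; assumption)+, simp add: compose_eq)
  from a show "U \<otimes>\<^bsub>op_alg H M\<^esub> (S \<oplus>\<^bsub>op_alg H M\<^esub> T) = U \<otimes>\<^bsub>op_alg H M\<^esub> S \<oplus>\<^bsub>op_alg H M\<^esub> U \<otimes>\<^bsub>op_alg H M\<^esub> T"
    unfolding op_alg_simps
    by (intro op_eqI') ((intro bounded add_mem compose_mem; assumption)+, simp add: compose_eq op_add)
qed

definition projection :: "('h \<Rightarrow> 'h) \<Rightarrow> bool" where
  "projection p \<longleftrightarrow> p \<in> M \<and> (\<forall>x\<in>carrier H. p (p x) = p x) \<and>
     (\<forall>x\<in>carrier H. \<forall>y\<in>carrier H. ip H (p x) y = ip H x (p y))"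

lemma projection_mem [simp, intro]: "projection p \<Longrightarrow> p \<in> M"
  by (simp add: projection_def)

lemma projection_idem: "projection p \<Longrightarrow> x \<in> carrier H \<Longrightarrow> p (p x) = p x"
  by (simp add: projection_def)

lemma projection_selfadj: "projection p \<Longrightarrow> x \<in> carrier H \<Longrightarrow> y \<in> carrier H \<Longrightarrow> ip H (p x) y = ip H x (p y)"
  by (simp add: projection_def)

text \<open>The common kernel of a family in \<open>M\<close> reduces every operator that commutes with \<open>M\<close>, so
  the bicommutant property puts the orthogonal projection onto it into \<open>M\<close>.\<close>

lemma kernel_projection:
  assumes S: "S \<subseteq> M"
  shows "\<exists>q. projection q \<and> (\<forall>x\<in>carrier H. q x = x \<longleftrightarrow> (\<forall>s\<in>S. s x = \<zero>\<^bsub>H\<^esub>))"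
proof -
  define N where "N = {x \<in> carrier H. \<forall>s\<in>S. s x = \<zero>\<^bsub>H\<^esub>}"
  have Sb: "\<And>s. s \<in> S \<Longrightarrow> s \<in> bounded_ops H" using S by blast
  have NI: "\<And>x. x \<in> carrier H \<Longrightarrow> (\<And>s. s \<in> S \<Longrightarrow> s x = \<zero>\<^bsub>H\<^esub>) \<Longrightarrow> x \<in> N"
    and NV: "\<And>x. x \<in> N \<Longrightarrow> x \<in> carrier H" and ND: "\<And>s x. s \<in> S \<Longrightarrow> x \<in> N \<Longrightarrow> s x = \<zero>\<^bsub>H\<^esub>"
    unfolding N_def by blast+
  have N: "closed_subspace N"
    unfolding closed_subspace_def
  proof (intro conjI allI impI ballI)
    show "N \<subseteq> carrier H" using NV by blast
    show "\<zero>\<^bsub>H\<^esub> \<in> N" using Sb by (intro NI) simp_all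
    show "x \<oplus>\<^bsub>H\<^esub> y \<in> N" if "x \<in> N" "y \<in> N" for x y
      using that Sb NV by (intro NI) (simp_all add: op_add ND)
    show "c \<odot>\<^bsub>H\<^esub> x \<in> N" if "x \<in> N" for c x
      using that Sb NV by (intro NI) (simp_all add: op_smult ND)
    fix u x assume u: "range u \<subseteq> N" and x: "x \<in> carrier H" and l: "vlim u x"
    have uV: "\<And>i. u i \<in> carrier H" and u0: "\<And>i s. s \<in> S \<Longrightarrow> s (u i) = \<zero>\<^bsub>H\<^esub>"
      using u NV ND by (simp_all add: image_subset_iff)
    have "s x = \<zero>\<^bsub>H\<^esub>" if s: "s \<in> S" for s
    proof -
      obtain c where c: "\<And>x. x \<in> carrier H \<Longrightarrow> hnorm H (s x) \<le> c * hnorm H x" using op_bound[OF Sb[OF s]] by blast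
      have e1: "hnorm H (s x) \<le> c * hnorm H (u i \<ominus>\<^bsub>H\<^esub> x)" for i
      proof -
        have "hnorm H (s x) = hnorm H (s (u i \<ominus>\<^bsub>H\<^esub> x))"
          using Sb[OF s] uV[of i] x u0[OF s, of i] by (simp add: op_diff hnorm_minus_commute[of "\<zero>\<^bsub>H\<^esub>"])
        then show ?thesis using c[of "u i \<ominus>\<^bsub>H\<^esub> x"] uV x by simp
      qed
      have e2: "(\<lambda>i. c * hnorm H (u i \<ominus>\<^bsub>H\<^esub> x)) \<longlonglongrightarrow> 0"
        using l by (simp add: vlim_def tendsto_mult_right_zero)
      have "hnorm H (s x) \<le> 0" by (rule LIMSEQ_le_const[OF e2]) (use e1 in blast)
      then have "hnorm H (s x) = 0" using Sb[OF s] x by (intro antisym hnorm_nonneg) simp_all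
      then show ?thesis using Sb[OF s] x by simp
    qed
    then show "x \<in> N" using x by (intro NI)
  qed
  obtain q where qb: "q \<in> bounded_ops H" and qN: "\<And>x. x \<in> carrier H \<Longrightarrow> q x \<in> N"
    and qid: "\<And>x. x \<in> N \<Longrightarrow> q x = x"
    and qo: "\<And>x z. x \<in> carrier H \<Longrightarrow> z \<in> N \<Longrightarrow> ip H (x \<ominus>\<^bsub>H\<^esub> q x) z = 0"
    using orth_proj_exists[OF N] by blast
  have q_zero: "q w = \<zero>\<^bsub>H\<^esub>" if w: "w \<in> carrier H" and o: "\<And>z. z \<in> N \<Longrightarrow> ip H w z = 0" for w
  proof -
    have "ip H (q w) (q w) = 0" using qo[OF w qN[OF w]] o[OF qN[OF w]] w qb by (simp add: ip_diff)
    then show ?thesis using ip_pos[of "q w"] w qb by (cases "q w = \<zero>\<^bsub>H\<^esub>") simp_all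
  qed
  have qM: "q \<in> M"
  proof (rule memI[OF qb])
    fix t x assume t: "t \<in> commutant H M" and x: "x \<in> carrier H"
    have tb: "t \<in> bounded_ops H" using t commutant_bounded by blast
    have t': "adjoint H t \<in> commutant H M" using t by (intro commutant_adjoint) blast+
    have inv: "r z \<in> N" if "r \<in> commutant H M" "z \<in> N" for r z
    proof -
      have rb: "r \<in> bounded_ops H" using that commutant_bounded by blast
      have "s (r z) = \<zero>\<^bsub>H\<^esub>" if s: "s \<in> S" for s
        using commutantD[OF \<open>r \<in> commutant H M\<close>, of s z] subsetD[OF S s] NV[OF \<open>z \<in> N\<close>] ND[OF s \<open>z \<in> N\<close>] rb by simp
      then show ?thesis using rb that NV by (intro NI) simp_all
    qed
    have d: "x \<ominus>\<^bsub>H\<^esub> q x \<in> carrier H" using x qb by simp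
    have "q (t (x \<ominus>\<^bsub>H\<^esub> q x)) = \<zero>\<^bsub>H\<^esub>"
    proof (rule q_zero)
      fix z assume z: "z \<in> N"
      have "ip H (t (x \<ominus>\<^bsub>H\<^esub> q x)) z = ip H (x \<ominus>\<^bsub>H\<^esub> q x) (adjoint H t z)"
        using ip_adjoint[OF tb d NV[OF z]] by simp
      then show "ip H (t (x \<ominus>\<^bsub>H\<^esub> q x)) z = 0" using qo[OF x inv[OF t' z]] by simp
    qed (use tb d in simp)
    moreover have "q (t (x \<ominus>\<^bsub>H\<^esub> q x)) = q (t x) \<ominus>\<^bsub>H\<^esub> q (t (q x))"
      using x qb tb by (simp add: op_diff)
    moreover have "q (t (q x)) = t (q x)" using qid inv[OF t qN[OF x]] by simp
    ultimately show "t (q x) = q (t x)" using x qb tb by (simp add: diff_zero_iff)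
  qed
  have sa: "ip H (q x) y = ip H x (q y)" if x: "x \<in> carrier H" and y: "y \<in> carrier H" for x y
  proof -
    have "ip H x (q y) = ip H (q x) (q y)" using qo[OF x qN[OF y]] x y qb by (simp add: ip_diff)
    moreover have "ip H y (q x) = ip H (q y) (q x)" using qo[OF y qN[OF x]] x y qb by (simp add: ip_diff)
    ultimately show ?thesis using ip_cnj[of y "q x"] ip_cnj[of "q y" "q x"] x y qb by simp
  qed
  have "q x = x \<longleftrightarrow> (\<forall>s\<in>S. s x = \<zero>\<^bsub>H\<^esub>)" if x: "x \<in> carrier H" for x
  proof
    assume "q x = x"
    then have "x \<in> N" using qN[OF x] by simp
    then show "\<forall>s\<in>S. s x = \<zero>\<^bsub>H\<^esub>" using ND by blast
  next
    assume "\<forall>s\<in>S. s x = \<zero>\<^bsub>H\<^esub>"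
    then have "x \<in> N" using x by (intro NI) blast+
    then show "q x = x" by (rule qid)
  qed
  moreover have "projection q"
    unfolding projection_def using qM sa qid qN by blast
  ultimately show ?thesis by blast
qed

text \<open>Commuting with a fixed operator survives pointwise limits, so the bicommutant property
  closes the algebra under limits of norm Cauchy sequences.\<close>

lemma norm_limit:
  assumes T: "\<And>i. T i \<in> M" and f: "f \<longlonglongrightarrow> (0::real)"
    and le: "\<And>i j x. i \<le> j \<Longrightarrow> x \<in> carrier H \<Longrightarrow> hnorm H (T j x \<ominus>\<^bsub>H\<^esub> T i x) \<le> f i * hnorm H x"
  shows "\<exists>L\<in>M. \<forall>i. \<forall>x\<in>carrier H. hnorm H (L x \<ominus>\<^bsub>H\<^esub> T i x) \<le> f i * hnorm H x"
proof -
  have TV: "\<And>i x. x \<in> carrier H \<Longrightarrow> T i x \<in> carrier H" using T by blast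
  have "\<exists>y\<in>carrier H. vlim (\<lambda>i. T i x) y" if x: "x \<in> carrier H" for x
  proof (rule Cauchy_vlim[where f="\<lambda>i. (f i * hnorm H x)\<^sup>2"])
    have nn: "hnorm H (T j x \<ominus>\<^bsub>H\<^esub> T i x) ^ 2 \<le> (f i * hnorm H x)\<^sup>2" if "i \<le> j" for i j
      using le[OF that x] TV[OF x] by (intro power_mono) simp_all
    show "(hnorm H (T i x \<ominus>\<^bsub>H\<^esub> T j x))\<^sup>2 \<le> (f i * hnorm H x)\<^sup>2 + (f j * hnorm H x)\<^sup>2" for i j
    proof (cases "i \<le> j")
      case True then show ?thesis
        using nn[OF True] hnorm_minus_commute[of "T i x" "T j x"] TV[OF x] by (simp add: add_increasing2)
    next
      case False then show ?thesis using nn[of j i] by (simp add: add_increasing)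
    qed
    show "(\<lambda>i. (f i * hnorm H x)\<^sup>2) \<longlonglongrightarrow> 0"
      using tendsto_power[OF tendsto_mult_left_zero[OF f, of "hnorm H x"], of 2] by simp
  qed (use TV[OF x] in blast)
  then obtain L0 where L0: "\<And>x. x \<in> carrier H \<Longrightarrow> L0 x \<in> carrier H"
    and L0l: "\<And>x. x \<in> carrier H \<Longrightarrow> vlim (\<lambda>i. T i x) (L0 x)" by metis
  define L where "L = (\<lambda>x\<in>carrier H. L0 x)"
  have Lv: "L x = L0 x" if "x \<in> carrier H" for x using that by (simp add: L_def)
  have ipl: "(\<lambda>i. ip H (T i x) z) \<longlonglongrightarrow> ip H (L x) z" if "x \<in> carrier H" "z \<in> carrier H" for x z
    using vlim_ip[of "\<lambda>i. T i x" "L0 x" z] TV L0 L0l that by (simp add: Lv image_subset_iff)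
  have est: "hnorm H (L x \<ominus>\<^bsub>H\<^esub> T i x) \<le> f i * hnorm H x" if x: "x \<in> carrier H" for i x
  proof -
    have "vlim (\<lambda>j. T j x \<ominus>\<^bsub>H\<^esub> T i x) (L x \<ominus>\<^bsub>H\<^esub> T i x)"
    proof -
      have "hnorm H ((T j x \<ominus>\<^bsub>H\<^esub> T i x) \<ominus>\<^bsub>H\<^esub> (L0 x \<ominus>\<^bsub>H\<^esub> T i x)) = hnorm H (T j x \<ominus>\<^bsub>H\<^esub> L0 x)" for j
      proof -
        have "(T j x \<ominus>\<^bsub>H\<^esub> T i x) \<ominus>\<^bsub>H\<^esub> (L0 x \<ominus>\<^bsub>H\<^esub> T i x) = T j x \<ominus>\<^bsub>H\<^esub> L0 x"
          using TV[OF x] L0[OF x] by (intro vec_eqI) (simp_all add: ip_simps)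
        then show ?thesis by simp
      qed
      then show ?thesis using L0l[OF x] x by (simp add: vlim_def Lv)
    qed
    then have "(\<lambda>j. hnorm H (T j x \<ominus>\<^bsub>H\<^esub> T i x)) \<longlonglongrightarrow> hnorm H (L x \<ominus>\<^bsub>H\<^esub> T i x)"
      using vlim_hnorm[of "\<lambda>j. T j x \<ominus>\<^bsub>H\<^esub> T i x"] TV[OF x] L0[OF x] x by (simp add: Lv image_subset_iff)
    then show ?thesis by (rule LIMSEQ_le_const2) (use le[OF _ x] in blast)
  qed
  have Tb: "\<And>i. T i \<in> bounded_ops H" using T by blast
  obtain c where c: "\<And>x. x \<in> carrier H \<Longrightarrow> hnorm H (T 0 x) \<le> c * hnorm H x" using op_bound[OF Tb[of 0]] by blast
  have Lb: "L \<in> bounded_ops H"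
  proof (rule bounded_opsI[where c="f 0 + c"])
    fix x assume x: "x \<in> carrier H"
    have "hnorm H (L x) \<le> hnorm H (L x \<ominus>\<^bsub>H\<^esub> T 0 x) + hnorm H (T 0 x)"
      using hnorm_triangle_diff[of "L x" "T 0 x"] TV[OF x] L0[OF x] x by (simp add: Lv)
    then show "hnorm H (L x) \<le> (f 0 + c) * hnorm H x"
      using est[OF x, of 0] c[OF x] by (simp add: algebra_simps)
  next
    fix x y assume x: "x \<in> carrier H" and y: "y \<in> carrier H"
    show "L (x \<oplus>\<^bsub>H\<^esub> y) = L x \<oplus>\<^bsub>H\<^esub> L y"
    proof (rule vec_eqI)
      fix z assume z: "z \<in> carrier H"
      have "(\<lambda>i. ip H (T i x) z + ip H (T i y) z) \<longlonglongrightarrow> ip H (L x) z + ip H (L y) z"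
        using ipl x y z by (intro tendsto_add)
      moreover have "ip H (T i (x \<oplus>\<^bsub>H\<^esub> y)) z = ip H (T i x) z + ip H (T i y) z" for i
        using Tb x y z by (simp add: op_add ip_simps)
      ultimately have "(\<lambda>i. ip H (T i (x \<oplus>\<^bsub>H\<^esub> y)) z) \<longlonglongrightarrow> ip H (L x) z + ip H (L y) z" by simp
      then have "ip H (L (x \<oplus>\<^bsub>H\<^esub> y)) z = ip H (L x) z + ip H (L y) z"
        using ipl[of "x \<oplus>\<^bsub>H\<^esub> y" z] x y z by (intro LIMSEQ_unique) simp_all
      then show "ip H (L (x \<oplus>\<^bsub>H\<^esub> y)) z = ip H (L x \<oplus>\<^bsub>H\<^esub> L y) z"
        using x y z L0 by (simp add: Lv ip_simps)
    qed (use x y L0 in \<open>simp_all add: Lv\<close>)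
  next
    fix a x assume x: "x \<in> carrier H"
    show "L (a \<odot>\<^bsub>H\<^esub> x) = a \<odot>\<^bsub>H\<^esub> L x"
    proof (rule vec_eqI)
      fix z assume z: "z \<in> carrier H"
      have "(\<lambda>i. a * ip H (T i x) z) \<longlonglongrightarrow> a * ip H (L x) z"
        using ipl x z by (intro tendsto_mult_left)
      moreover have "ip H (T i (a \<odot>\<^bsub>H\<^esub> x)) z = a * ip H (T i x) z" for i
        using Tb x z by (simp add: op_smult ip_simps)
      ultimately have "(\<lambda>i. ip H (T i (a \<odot>\<^bsub>H\<^esub> x)) z) \<longlonglongrightarrow> a * ip H (L x) z" by simp
      then have "ip H (L (a \<odot>\<^bsub>H\<^esub> x)) z = a * ip H (L x) z"
        using ipl[of "a \<odot>\<^bsub>H\<^esub> x" z] x z by (intro LIMSEQ_unique) simp_all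
      then show "ip H (L (a \<odot>\<^bsub>H\<^esub> x)) z = ip H (a \<odot>\<^bsub>H\<^esub> L x) z"
        using x z L0 by (simp add: Lv ip_simps)
    qed (use x L0 in \<open>simp_all add: Lv\<close>)
  qed (use L0 in \<open>simp_all add: L_def\<close>)
  have "L \<in> M"
  proof (rule memI[OF Lb])
    fix s x assume s: "s \<in> commutant H M" and x: "x \<in> carrier H"
    have sb: "s \<in> bounded_ops H" using s commutant_bounded by blast
    show "s (L x) = L (s x)"
    proof (rule vec_eqI)
      fix z assume z: "z \<in> carrier H"
      have "(\<lambda>i. ip H (T i x) (adjoint H s z)) \<longlonglongrightarrow> ip H (L x) (adjoint H s z)"
        using ipl[OF x] sb z by simp
      moreover have "ip H (T i x) (adjoint H s z) = ip H (T i (s x)) z" for i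
        using commutantD[OF s T x] sb TV[OF x] z by (simp add: ip_adjoint)
      ultimately have "(\<lambda>i. ip H (T i (s x)) z) \<longlonglongrightarrow> ip H (s (L x)) z"
        using sb L0[OF x] x z by (simp add: ip_adjoint Lv)
      then show "ip H (s (L x)) z = ip H (L (s x)) z"
        using ipl[of "s x" z] sb x z by (intro LIMSEQ_unique) simp_all
    qed (use sb x L0 in \<open>simp_all add: Lv\<close>)
  qed
  then show ?thesis using est by blast
qed

end

section \<open>Order and spectral dichotomies in abelian von Neumann algebras\<close>

context vn_algebra
begin

lemma diff_mem [simp, intro]:
  assumes S: "S \<in> M" and T: "T \<in> M"
  shows "(\<lambda>x\<in>carrier H. S x \<ominus>\<^bsub>H\<^esub> T x) \<in> M"
proof -
  have "(\<lambda>x\<in>carrier H. S x \<ominus>\<^bsub>H\<^esub> T x) = (\<lambda>x\<in>carrier H. S x \<oplus>\<^bsub>H\<^esub> (\<lambda>x\<in>carrier H. (-1) \<odot>\<^bsub>H\<^esub> T x) x)"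
    using S T by (intro restrict_ext) (simp add: diff_eq_add)
  also have "\<dots> \<in> M" by (rule add_mem[OF S smult_mem[OF T]])
  finally show ?thesis .
qed

lemma mem_closed [simp, intro]: "T \<in> M \<Longrightarrow> x \<in> carrier H \<Longrightarrow> T x \<in> carrier H"
  by (rule op_closed[OF bounded])

definition ran :: "('h \<Rightarrow> 'h) \<Rightarrow> 'h set" where
  "ran p = {x \<in> carrier H. p x = x}"

lemma ran_carrier: "x \<in> ran p \<Longrightarrow> x \<in> carrier H"
  by (simp add: ran_def)

lemma ran_zero: "p \<in> M \<Longrightarrow> \<zero>\<^bsub>H\<^esub> \<in> ran p"
  by (simp add: ran_def)

lemma ran_smult: "p \<in> M \<Longrightarrow> x \<in> ran p \<Longrightarrow> c \<odot>\<^bsub>H\<^esub> x \<in> ran p"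
  by (simp add: ran_def op_smult[OF bounded])

lemma ran_add: "p \<in> M \<Longrightarrow> x \<in> ran p \<Longrightarrow> y \<in> ran p \<Longrightarrow> x \<oplus>\<^bsub>H\<^esub> y \<in> ran p"
  by (simp add: ran_def op_add[OF bounded])

lemma ran_diff: "p \<in> M \<Longrightarrow> x \<in> ran p \<Longrightarrow> y \<in> ran p \<Longrightarrow> x \<ominus>\<^bsub>H\<^esub> y \<in> ran p"
  by (simp add: ran_def op_diff[OF bounded])

lemma projection_ran: "projection p \<Longrightarrow> x \<in> carrier H \<Longrightarrow> p x \<in> ran p"
  by (simp add: ran_def projection_idem)

lemma projection_complement:
  assumes p: "projection p"
  shows "projection (\<lambda>x\<in>carrier H. x \<ominus>\<^bsub>H\<^esub> p x)"
proof -
  have pM: "p \<in> M" using p by simp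
  have "(\<lambda>x\<in>carrier H. (\<lambda>x\<in>carrier H. x) x \<ominus>\<^bsub>H\<^esub> p x) \<in> M"
    by (rule diff_mem[OF one_mem pM])
  moreover have "(\<lambda>x\<in>carrier H. (\<lambda>x\<in>carrier H. x) x \<ominus>\<^bsub>H\<^esub> p x) = (\<lambda>x\<in>carrier H. x \<ominus>\<^bsub>H\<^esub> p x)"
    by (intro restrict_ext) simp
  ultimately have "(\<lambda>x\<in>carrier H. x \<ominus>\<^bsub>H\<^esub> p x) \<in> M" by simp
  then show ?thesis
    unfolding projection_def
    using pM by (simp add: op_diff[OF bounded] projection_idem[OF p] ip_simps projection_selfadj[OF p])
qed

lemma bounded_sq_form:
  assumes a: "a \<in> M" shows "\<exists>B>0. \<forall>x\<in>carrier H. \<bar>Re (ip H (a x) x)\<bar> \<le> B * (hnorm H x)\<^sup>2"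
proof -
  obtain B where B: "B > 0" "\<And>x. x \<in> carrier H \<Longrightarrow> hnorm H (a x) \<le> B * hnorm H x"
    using op_bound[OF bounded[OF a]] by blast
  have "\<bar>Re (ip H (a x) x)\<bar> \<le> B * (hnorm H x)\<^sup>2" if x: "x \<in> carrier H" for x
  proof -
    have "\<bar>Re (ip H (a x) x)\<bar> \<le> cmod (ip H (a x) x)" by (rule abs_Re_le_cmod)
    also have "\<dots> \<le> hnorm H (a x) * hnorm H x" using a x by (intro cauchy_schwarz) simp_all
    also have "\<dots> \<le> (B * hnorm H x) * hnorm H x" using B(2)[OF x] x by (intro mult_right_mono) simp_all
    finally show ?thesis by (simp add: power2_eq_square mult.assoc)
  qed
  then show ?thesis using B(1) by blast
qed

end

locale abelian_vn_algebra = vn_algebra H M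
  for H :: "'h hilbert" and M :: "('h \<Rightarrow> 'h) set" +
  assumes comm: "S \<in> M \<Longrightarrow> T \<in> M \<Longrightarrow> x \<in> carrier H \<Longrightarrow> S (T x) = T (S x)"
begin

text \<open>With \<open>C = 1 - S S\<close>, the square root of \<open>S S\<close> is \<open>1 -
  Y\<close>, where \<open>Y\<close> is the limit of the iteration \<open>Y := (C + Y Y) / 2\<close>
  started at \<open>0\<close>. The same iteration with \<open>C\<close> replaced by \<open>1\<close>
  produces a bounded increasing sequence of reals that majorizes the norms of the iterates and of
  their differences, and this gives convergence in norm.\<close>

lemma abs_exists_contraction:
  assumes S: "S \<in> M" and sa: "\<And>x y. x \<in> carrier H \<Longrightarrow> y \<in> carrier H \<Longrightarrow> ip H (S x) y = ip H x (S y)"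
    and le: "\<And>x. x \<in> carrier H \<Longrightarrow> hnorm H (S x) \<le> hnorm H x"
  shows "\<exists>R\<in>M. (\<forall>x\<in>carrier H. R (R x) = S (S x)) \<and>
    (\<forall>x\<in>carrier H. \<forall>y\<in>carrier H. ip H (R x) y = ip H x (R y)) \<and>
    (\<forall>x\<in>carrier H. 0 \<le> Re (ip H (R x) x))"
proof -
  define C where "C = (\<lambda>x\<in>carrier H. (\<lambda>x\<in>carrier H. x) x \<ominus>\<^bsub>H\<^esub> compose (carrier H) S S x)"
  have CM: "C \<in> M" unfolding C_def by (rule diff_mem[OF one_mem compose_mem[OF S S]])
  have Cv: "C x = x \<ominus>\<^bsub>H\<^esub> S (S x)" if "x \<in> carrier H" for x using that by (simp add: C_def compose_eq)
  have C1: "hnorm H (C x) \<le> hnorm H x" if x: "x \<in> carrier H" for x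
  proof (rule power2_le_imp_le)
    have Sx: "S x \<in> carrier H" "S (S x) \<in> carrier H" using S x by simp_all
    have "Re (ip H x (S (S x))) = (hnorm H (S x))\<^sup>2"
      using sa[OF x Sx(1)] Sx by (simp add: hnorm_sq)
    then have "(hnorm H (C x))\<^sup>2 = (hnorm H x)\<^sup>2 - 2 * (hnorm H (S x))\<^sup>2 + (hnorm H (S (S x)))\<^sup>2"
      using x Sx by (simp add: Cv hnorm_diff_sq)
    moreover have "(hnorm H (S (S x)))\<^sup>2 \<le> (hnorm H (S x))\<^sup>2"
      using le[OF Sx(1)] Sx by (intro power_mono) simp_all
    ultimately show "(hnorm H (C x))\<^sup>2 \<le> (hnorm H x)\<^sup>2"
      using zero_le_power2[of "hnorm H (S x)"] by linarith
  qed (use x in simp)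
  define G where "G = (\<lambda>Y. \<lambda>x\<in>carrier H. (1/2) \<odot>\<^bsub>H\<^esub> (\<lambda>x\<in>carrier H. C x \<oplus>\<^bsub>H\<^esub> compose (carrier H) Y Y x) x)"
  have GM: "G Y \<in> M" if "Y \<in> M" for Y
    unfolding G_def by (rule smult_mem[OF add_mem[OF CM compose_mem[OF that that]]])
  have Gv: "G Y x = (1/2) \<odot>\<^bsub>H\<^esub> (C x \<oplus>\<^bsub>H\<^esub> Y (Y x))" if "x \<in> carrier H" for Y x
    using that by (simp add: G_def compose_eq)
  define Y where "Y = rec_nat (\<lambda>x\<in>carrier H. \<zero>\<^bsub>H\<^esub>) (\<lambda>_. G)"
  have Y0: "Y 0 = (\<lambda>x\<in>carrier H. \<zero>\<^bsub>H\<^esub>)" and YS: "\<And>n. Y (Suc n) = G (Y n)" by (simp_all add: Y_def)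
  have YM: "Y n \<in> M" for n
  proof (induction n)
    case 0 show ?case unfolding Y0 by (rule zero_mem)
  qed (simp only: YS GM)
  define y :: "nat \<Rightarrow> real" where "y = rec_nat 0 (\<lambda>_ t. (1 + t\<^sup>2) / 2)"
  have y0: "y 0 = 0" and yS: "\<And>n. y (Suc n) = (1 + (y n)\<^sup>2) / 2" by (simp_all add: y_def)
  have y1: "0 \<le> y n \<and> y n \<le> 1" for n
  proof (induction n)
    case (Suc n)
    then have "(y n)\<^sup>2 \<le> 1" by (simp add: power_le_one)
    then show ?case by (simp add: yS)
  qed (simp add: y0)
  have ymono: "y n \<le> y (Suc n)" for n
  proof -
    have "0 \<le> (1 - y n)\<^sup>2" by simp
    then show ?thesis by (simp add: yS power2_eq_square algebra_simps)
  qed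
  have incy: "incseq y" using ymono by (rule incseq_SucI)
  obtain l where l: "y \<longlonglongrightarrow> l" "\<And>n. y n \<le> l"
    using incseq_convergent[OF incy, of 1] y1 by blast
  have Yy: "hnorm H (Y n x) \<le> y n * hnorm H x" if "x \<in> carrier H" for n x
    using that
  proof (induction n arbitrary: x)
    case 0 then show ?case by (simp add: Y0 y0)
  next
    case (Suc n)
    have x: "x \<in> carrier H" "Y n x \<in> carrier H" "Y n (Y n x) \<in> carrier H" "C x \<in> carrier H"
      using Suc.prems YM[of n] CM by simp_all
    have "hnorm H (Y (Suc n) x) \<le> (1/2) * (hnorm H (C x) + hnorm H (Y n (Y n x)))"
      using hnorm_triangle[OF x(4) x(3)] x by (simp add: YS Gv hnorm_smult)
    moreover have "hnorm H (Y n (Y n x)) \<le> y n * (y n * hnorm H x)"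
      using Suc.IH[OF x(2)] mult_left_mono[OF Suc.IH[OF x(1)], of "y n"] y1[of n] by linarith
    ultimately have "hnorm H (Y (Suc n) x) \<le> (1/2) * (hnorm H x + y n * (y n * hnorm H x))"
      using C1[OF x(1)] by simp
    also have "\<dots> = y (Suc n) * hnorm H x" by (simp add: yS power2_eq_square algebra_simps)
    finally show ?case .
  qed
  have Yd: "hnorm H (Y (Suc n) x \<ominus>\<^bsub>H\<^esub> Y n x) \<le> (y (Suc n) - y n) * hnorm H x" if "x \<in> carrier H" for n x
    using that
  proof (induction n arbitrary: x)
    case 0
    then show ?case using Yy[of x 1] YM[of 1] by (simp add: Y0 y0)
  next
    case (Suc n)
    let ?A = "Y (Suc n)" and ?B = "Y n"
    have M2: "?A \<in> M" "?B \<in> M" by (rule YM)+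
    have b2: "?A \<in> bounded_ops H" "?B \<in> bounded_ops H" using M2 by (blast intro: bounded)+
    have x: "x \<in> carrier H" by fact
    define d where "d = ?A x \<ominus>\<^bsub>H\<^esub> ?B x"
    have d: "d \<in> carrier H" using M2 x by (simp add: d_def)
    have cm: "?B (?A x) = ?A (?B x)" by (rule comm[OF M2(2,1) x])
    have "Y (Suc (Suc n)) x \<ominus>\<^bsub>H\<^esub> ?A x = (1/2) \<odot>\<^bsub>H\<^esub> (?A d \<oplus>\<^bsub>H\<^esub> ?B d)"
    proof (rule vec_eqI)
      fix z assume z: "z \<in> carrier H"
      have "Y (Suc (Suc n)) x = (1/2) \<odot>\<^bsub>H\<^esub> (C x \<oplus>\<^bsub>H\<^esub> ?A (?A x))"
        "?A x = (1/2) \<odot>\<^bsub>H\<^esub> (C x \<oplus>\<^bsub>H\<^esub> ?B (?B x))"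
        using Gv[OF x] by (simp_all add: YS)
      then have h1: "ip H (Y (Suc (Suc n)) x \<ominus>\<^bsub>H\<^esub> ?A x) z = (1/2) * (ip H (?A (?A x)) z - ip H (?B (?B x)) z)"
        using x z M2 CM by (simp add: ip_simps algebra_simps)
      have h2: "ip H ((1/2) \<odot>\<^bsub>H\<^esub> (?A d \<oplus>\<^bsub>H\<^esub> ?B d)) z = (1/2) * (ip H (?A (?A x)) z - ip H (?B (?B x)) z)"
        using x z M2 d cm by (simp add: d_def op_diff[OF b2(1)] op_diff[OF b2(2)] ip_simps)
      show "ip H (Y (Suc (Suc n)) x \<ominus>\<^bsub>H\<^esub> ?A x) z = ip H ((1/2) \<odot>\<^bsub>H\<^esub> (?A d \<oplus>\<^bsub>H\<^esub> ?B d)) z"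
        by (simp only: h1 h2)
    qed (use x d M2 YM[of "Suc (Suc n)"] in simp_all)
    then have "hnorm H (Y (Suc (Suc n)) x \<ominus>\<^bsub>H\<^esub> ?A x) = (1/2) * hnorm H (?A d \<oplus>\<^bsub>H\<^esub> ?B d)"
      using d M2 by (simp add: hnorm_smult)
    also have "\<dots> \<le> (1/2) * (y (Suc n) * hnorm H d + y n * hnorm H d)"
      using hnorm_triangle[of "?A d" "?B d"] Yy[OF d, of "Suc n"] Yy[OF d, of n] d M2 by simp
    also have "\<dots> = (1/2) * (y (Suc n) + y n) * hnorm H d" by (simp add: algebra_simps)
    also have "\<dots> \<le> (1/2) * (y (Suc n) + y n) * ((y (Suc n) - y n) * hnorm H x)"
      using Suc.IH[OF x] y1[of n] y1[of "Suc n"] by (intro mult_left_mono) (simp_all add: d_def)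
    also have "\<dots> = (y (Suc (Suc n)) - y (Suc n)) * hnorm H x"
      unfolding yS[of "Suc n"] by (subst (4) yS) (simp add: power2_eq_square algebra_simps)
    finally show ?case .
  qed
  have Yij: "hnorm H (Y j x \<ominus>\<^bsub>H\<^esub> Y i x) \<le> (l - y i) * hnorm H x" if ij: "i \<le> j" and x: "x \<in> carrier H" for i j x
  proof -
    have "hnorm H (Y j x \<ominus>\<^bsub>H\<^esub> Y i x) \<le> (y j - y i) * hnorm H x" using ij
    proof (induction j rule: dec_induct)
      case base then show ?case using YM[of i] x by simp
    next
      case (step j)
      have "hnorm H (Y (Suc j) x \<ominus>\<^bsub>H\<^esub> Y i x) \<le> hnorm H (Y (Suc j) x \<ominus>\<^bsub>H\<^esub> Y j x) + hnorm H (Y j x \<ominus>\<^bsub>H\<^esub> Y i x)"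
        by (rule hnorm_triangle_via) (use YM x in simp_all)
      then show ?case using step.IH Yd[OF x, of j] by (simp add: algebra_simps)
    qed
    also have "\<dots> \<le> (l - y i) * hnorm H x" using l(2)[of j] x by (intro mult_right_mono) simp_all
    finally show ?thesis .
  qed
  have f0: "(\<lambda>i. l - y i) \<longlonglongrightarrow> 0" using tendsto_diff[OF tendsto_const l(1), of l] by simp
  obtain L where LM: "L \<in> M" and L: "\<And>i x. x \<in> carrier H \<Longrightarrow> hnorm H (L x \<ominus>\<^bsub>H\<^esub> Y i x) \<le> (l - y i) * hnorm H x"
    using norm_limit[of Y, OF YM f0 Yij] by blast
  have lim: "vlim (\<lambda>i. Y i x) (L x)" if x: "x \<in> carrier H" for x
    unfolding vlim_def
  proof (rule null_sequence_comparison)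
    show "norm (hnorm H (Y i x \<ominus>\<^bsub>H\<^esub> L x)) \<le> (l - y i) * hnorm H x" for i
      using L[OF x, of i] hnorm_minus_commute[of "L x" "Y i x"] YM[of i] LM x by simp
    show "(\<lambda>i. (l - y i) * hnorm H x) \<longlonglongrightarrow> 0" using f0 by (rule tendsto_mult_left_zero)
  qed
  have ipl: "(\<lambda>i. ip H (Y i x) z) \<longlonglongrightarrow> ip H (L x) z" if "x \<in> carrier H" "z \<in> carrier H" for x z
    using vlim_ip[of "\<lambda>i. Y i x" "L x" z, OF _ _ _ lim] YM LM that by (simp add: image_subset_iff)
  have Ysa: "ip H (Y n x) z = ip H x (Y n z)" if "x \<in> carrier H" "z \<in> carrier H" for n x z
    using that
  proof (induction n arbitrary: x z)
    case 0 then show ?case by (simp add: Y0)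
  next
    case (Suc n)
    then show ?case using YM[of n] CM S sa by (simp add: YS Gv ip_simps Cv)
  qed
  have Lsa: "ip H (L x) z = ip H x (L z)" if x: "x \<in> carrier H" and z: "z \<in> carrier H" for x z
  proof -
    have "(\<lambda>i. ip H (Y i z) x) \<longlonglongrightarrow> ip H (L z) x" using ipl[OF z x] .
    then have "(\<lambda>i. cnj (ip H (Y i z) x)) \<longlonglongrightarrow> cnj (ip H (L z) x)" by (rule tendsto_cnj)
    moreover have "cnj (ip H (Y i z) x) = ip H (Y i x) z" for i
      using Ysa[OF x z, of i] ip_cnj[of "Y i z" x] YM[of i] x z by simp
    ultimately have "(\<lambda>i. ip H (Y i x) z) \<longlonglongrightarrow> cnj (ip H (L z) x)" by simp
    then have "ip H (L x) z = cnj (ip H (L z) x)" using ipl[OF x z] by (rule LIMSEQ_unique[rotated])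
    then show ?thesis using ip_cnj[of "L z" x] LM x z by simp
  qed
  have L1: "hnorm H (L x) \<le> hnorm H x" if x: "x \<in> carrier H" for x
  proof (rule LIMSEQ_le_const2)
    show "(\<lambda>i. hnorm H (Y i x)) \<longlonglongrightarrow> hnorm H (L x)"
      using vlim_hnorm[OF _ _ lim[OF x]] YM LM x by (simp add: image_subset_iff)
    have "hnorm H (Y i x) \<le> hnorm H x" for i
      using Yy[OF x, of i] mult_right_mono[of "y i" 1 "hnorm H x"] y1[of i] x by simp
    then show "\<exists>N. \<forall>n\<ge>N. hnorm H (Y n x) \<le> hnorm H x" by blast
  qed
  have fix_eq: "2 * ip H (L x) z = ip H (C x) z + ip H (L (L x)) z" if x: "x \<in> carrier H" and z: "z \<in> carrier H" for x z
  proof -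
    have "(\<lambda>i. ip H (Y i (Y i x)) z - ip H (L (L x)) z) \<longlonglongrightarrow> 0"
    proof (rule null_sequence_comparison)
      fix i
      have c: "Y i x \<in> carrier H" "L x \<in> carrier H" "L (L x) \<in> carrier H" "Y i (Y i x) \<in> carrier H" "Y i (L x) \<in> carrier H"
        using YM[of i] LM x by simp_all
      have "ip H (Y i (Y i x)) z - ip H (L (L x)) z = ip H (Y i x \<ominus>\<^bsub>H\<^esub> L x) (Y i z) + ip H (Y i (L x) \<ominus>\<^bsub>H\<^esub> L (L x)) z"
        using c z YM[of i] by (simp add: ip_diff Ysa)
      then have "cmod (ip H (Y i (Y i x)) z - ip H (L (L x)) z)
          \<le> cmod (ip H (Y i x \<ominus>\<^bsub>H\<^esub> L x) (Y i z)) + cmod (ip H (Y i (L x) \<ominus>\<^bsub>H\<^esub> L (L x)) z)"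
        by (simp add: norm_triangle_ineq)
      moreover have "cmod (ip H (Y i x \<ominus>\<^bsub>H\<^esub> L x) (Y i z)) \<le> (l - y i) * hnorm H x * hnorm H z"
      proof -
        have "cmod (ip H (Y i x \<ominus>\<^bsub>H\<^esub> L x) (Y i z)) \<le> hnorm H (Y i x \<ominus>\<^bsub>H\<^esub> L x) * hnorm H (Y i z)"
          using c z YM[of i] by (intro cauchy_schwarz) simp_all
        also have "\<dots> \<le> ((l - y i) * hnorm H x) * hnorm H z"
        proof (rule mult_mono)
          show "hnorm H (Y i x \<ominus>\<^bsub>H\<^esub> L x) \<le> (l - y i) * hnorm H x"
            using L[OF x, of i] hnorm_minus_commute[OF c(1,2)] by simp
          show "hnorm H (Y i z) \<le> hnorm H z"
            using Yy[OF z, of i] mult_right_mono[of "y i" 1 "hnorm H z"] y1[of i] z by simp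
        qed (use l(2)[of i] x z YM[of i] in simp_all)
        finally show ?thesis .
      qed
      moreover have "cmod (ip H (Y i (L x) \<ominus>\<^bsub>H\<^esub> L (L x)) z) \<le> (l - y i) * hnorm H x * hnorm H z"
      proof -
        have "cmod (ip H (Y i (L x) \<ominus>\<^bsub>H\<^esub> L (L x)) z) \<le> hnorm H (Y i (L x) \<ominus>\<^bsub>H\<^esub> L (L x)) * hnorm H z"
          using c z by (intro cauchy_schwarz) simp_all
        also have "\<dots> \<le> ((l - y i) * hnorm H x) * hnorm H z"
        proof (rule mult_right_mono)
          have "hnorm H (Y i (L x) \<ominus>\<^bsub>H\<^esub> L (L x)) \<le> (l - y i) * hnorm H (L x)"
            using L[OF c(2), of i] hnorm_minus_commute[OF c(5,3)] by simp
          also have "\<dots> \<le> (l - y i) * hnorm H x" using L1[OF x] l(2)[of i] by (intro mult_left_mono) simp_all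
          finally show "hnorm H (Y i (L x) \<ominus>\<^bsub>H\<^esub> L (L x)) \<le> (l - y i) * hnorm H x" .
        qed (use z in simp)
        finally show ?thesis .
      qed
      ultimately show "norm (ip H (Y i (Y i x)) z - ip H (L (L x)) z) \<le> (l - y i) * (2 * hnorm H x * hnorm H z)"
        by (simp add: algebra_simps)
      show "(\<lambda>i. (l - y i) * (2 * hnorm H x * hnorm H z)) \<longlonglongrightarrow> 0"
        using f0 by (rule tendsto_mult_left_zero)
    qed
    then have "(\<lambda>i. ip H (Y i (Y i x)) z) \<longlonglongrightarrow> ip H (L (L x)) z" by (simp add: LIM_zero_iff)
    then have l1: "(\<lambda>i. ip H (C x) z + ip H (Y i (Y i x)) z) \<longlonglongrightarrow> ip H (C x) z + ip H (L (L x)) z"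
      by (intro tendsto_add tendsto_const)
    have l2: "(\<lambda>i. 2 * ip H (Y (Suc i) x) z) \<longlonglongrightarrow> 2 * ip H (L x) z"
      using LIMSEQ_Suc[OF ipl[OF x z]] by (rule tendsto_mult_left)
    have e: "2 * ip H (Y (Suc i) x) z = ip H (C x) z + ip H (Y i (Y i x)) z" for i
      using x z YM[of i] CM by (simp add: YS Gv ip_simps)
    show ?thesis using LIMSEQ_unique[OF l2 l1[folded e]] .
  qed
  define R where "R = (\<lambda>x\<in>carrier H. (\<lambda>x\<in>carrier H. x) x \<ominus>\<^bsub>H\<^esub> L x)"
  have RM: "R \<in> M" unfolding R_def by (rule diff_mem[OF one_mem LM])
  have Rv: "R x = x \<ominus>\<^bsub>H\<^esub> L x" if "x \<in> carrier H" for x using that by (simp add: R_def)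
  have "R (R x) = S (S x)" if x: "x \<in> carrier H" for x
  proof (rule vec_eqI)
    fix z assume z: "z \<in> carrier H"
    have "ip H (R (R x)) z = ip H x z - 2 * ip H (L x) z + ip H (L (L x)) z"
      using x z LM by (simp add: Rv op_diff[OF bounded[OF LM]] ip_simps)
    also have "\<dots> = ip H x z - ip H (C x) z" using fix_eq[OF x z] by simp
    also have "\<dots> = ip H (S (S x)) z" using x z S by (simp add: Cv ip_simps)
    finally show "ip H (R (R x)) z = ip H (S (S x)) z" .
  qed (use x RM S in simp_all)
  moreover have "ip H (R x) z = ip H x (R z)" if "x \<in> carrier H" "z \<in> carrier H" for x z
    using that LM by (simp add: Rv ip_simps Lsa)
  moreover have "0 \<le> Re (ip H (R x) x)" if x: "x \<in> carrier H" for x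
  proof -
    have Lx: "L x \<in> carrier H" using LM x by simp
    have "Re (ip H (L x) x) \<le> cmod (ip H (L x) x)" by (rule complex_Re_le_cmod)
    also have "\<dots> \<le> hnorm H (L x) * hnorm H x" using Lx x by (rule cauchy_schwarz)
    also have "\<dots> \<le> hnorm H x * hnorm H x" using L1[OF x] x by (intro mult_right_mono) simp_all
    also have "\<dots> = Re (ip H x x)" using hnorm_sq[OF x] by (simp add: power2_eq_square)
    finally show ?thesis using Lx x by (simp add: Rv ip_simps)
  qed
  ultimately show ?thesis using RM by blast
qed

text \<open>Rescaling reduces the absolute value of a self-adjoint operator to that of a contraction.\<close>

lemma abs_exists:
  assumes S: "S \<in> M" and sa: "\<And>x y. x \<in> carrier H \<Longrightarrow> y \<in> carrier H \<Longrightarrow> ip H (S x) y = ip H x (S y)"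
  shows "\<exists>R\<in>M. (\<forall>x\<in>carrier H. R (R x) = S (S x)) \<and>
    (\<forall>x\<in>carrier H. \<forall>y\<in>carrier H. ip H (R x) y = ip H x (R y)) \<and>
    (\<forall>x\<in>carrier H. 0 \<le> Re (ip H (R x) x))"
proof -
  obtain B where B: "B > 0" "\<And>x. x \<in> carrier H \<Longrightarrow> hnorm H (S x) \<le> B * hnorm H x"
    using op_bound[OF bounded[OF S]] by blast
  define b where "b = complex_of_real B"
  have b: "b \<noteq> 0" "cnj b = b" "cmod b = B" "cnj (1/b) = 1/b" using B(1) by (simp_all add: b_def)
  define S1 where "S1 = (\<lambda>x\<in>carrier H. (1/b) \<odot>\<^bsub>H\<^esub> S x)"
  have S1: "S1 \<in> M" unfolding S1_def by (rule smult_mem[OF S])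
  have S1v: "S1 x = (1/b) \<odot>\<^bsub>H\<^esub> S x" if "x \<in> carrier H" for x using that by (simp add: S1_def)
  have n1: "hnorm H (S1 x) \<le> hnorm H x" if x: "x \<in> carrier H" for x
    using B(2)[OF x] B(1) b S x by (simp add: S1v hnorm_smult norm_divide field_simps)
  have s1: "ip H (S1 x) y = ip H x (S1 y)" if "x \<in> carrier H" "y \<in> carrier H" for x y
    using that S b by (simp add: S1v ip_simps sa)
  obtain R1 where R1: "R1 \<in> M" "\<And>x. x \<in> carrier H \<Longrightarrow> R1 (R1 x) = S1 (S1 x)"
    "\<And>x y. x \<in> carrier H \<Longrightarrow> y \<in> carrier H \<Longrightarrow> ip H (R1 x) y = ip H x (R1 y)"
    "\<And>x. x \<in> carrier H \<Longrightarrow> 0 \<le> Re (ip H (R1 x) x)"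
    using abs_exists_contraction[OF S1 s1 n1] by blast
  define R where "R = (\<lambda>x\<in>carrier H. b \<odot>\<^bsub>H\<^esub> R1 x)"
  have RM: "R \<in> M" unfolding R_def by (rule smult_mem[OF R1(1)])
  have Rv: "R x = b \<odot>\<^bsub>H\<^esub> R1 x" if "x \<in> carrier H" for x using that by (simp add: R_def)
  have "R (R x) = S (S x)" if x: "x \<in> carrier H" for x
  proof -
    have "R (R x) = (b * b) \<odot>\<^bsub>H\<^esub> R1 (R1 x)"
      using x R1(1) by (simp add: Rv op_smult[OF bounded[OF R1(1)]] smult_smult)
    also have "\<dots> = (b * b) \<odot>\<^bsub>H\<^esub> ((1/b * (1/b)) \<odot>\<^bsub>H\<^esub> S (S x))"
      using x S R1(2) by (simp add: S1v op_smult[OF bounded[OF S]] smult_smult)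
    also have "\<dots> = S (S x)" using x S b by (simp add: smult_smult)
    finally show ?thesis .
  qed
  moreover have "ip H (R x) y = ip H x (R y)" if "x \<in> carrier H" "y \<in> carrier H" for x y
    using that R1 b by (simp add: Rv ip_simps)
  moreover have "0 \<le> Re (ip H (R x) x)" if x: "x \<in> carrier H" for x
    using x R1(1) R1(4)[OF x] B(1) by (simp add: Rv ip_simps b_def)
  ultimately show ?thesis using RM by blast
qed

definition nonzero :: "('h \<Rightarrow> 'h) \<Rightarrow> bool" where
  "nonzero p \<longleftrightarrow> (\<exists>x\<in>ran p. x \<noteq> \<zero>\<^bsub>H\<^esub>)"

text \<open>With \<open>S = h - t\<close> and \<open>R\<close> its absolute value, \<open>(R - S) (R
  + S) = 0\<close>. On the kernel of \<open>R + S\<close> one has \<open>S = - R\<close>, so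
  \<open>h\<close> is at most \<open>t\<close> there; on its orthogonal complement, the closure of
  the range, \<open>S = R\<close>, so \<open>h\<close> is at least \<open>t\<close>. Cutting with
  \<open>e\<close> keeps the projection below \<open>e\<close>. This takes the place of the spectral
  theorem.\<close>

lemma spectral_dichotomy:
  assumes h: "h \<in> M" and sa: "\<And>x y. x \<in> carrier H \<Longrightarrow> y \<in> carrier H \<Longrightarrow> ip H (h x) y = ip H x (h y)"
    and e: "projection e"
  shows "(\<forall>x\<in>ran e. Re (ip H (h x) x) \<le> t * (hnorm H x)\<^sup>2) \<or>
    (\<exists>r. projection r \<and> nonzero r \<and> ran r \<subseteq> ran e \<and> (\<forall>x\<in>ran r. t * (hnorm H x)\<^sup>2 \<le> Re (ip H (h x) x)))"
proof -
  define S where "S = (\<lambda>x\<in>carrier H. h x \<ominus>\<^bsub>H\<^esub> (\<lambda>x\<in>carrier H. complex_of_real t \<odot>\<^bsub>H\<^esub> (\<lambda>x\<in>carrier H. x) x) x)"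
  have SM: "S \<in> M" unfolding S_def by (rule diff_mem[OF h smult_mem[OF one_mem]])
  have Sv: "S x = h x \<ominus>\<^bsub>H\<^esub> complex_of_real t \<odot>\<^bsub>H\<^esub> x" if "x \<in> carrier H" for x using that by (simp add: S_def)
  have Ssa: "ip H (S x) y = ip H x (S y)" if "x \<in> carrier H" "y \<in> carrier H" for x y
    using that h by (simp add: Sv ip_simps sa)
  have Sre: "Re (ip H (S x) x) = Re (ip H (h x) x) - t * (hnorm H x)\<^sup>2" if "x \<in> carrier H" for x
    using that h by (simp add: Sv ip_simps hnorm_sq)
  obtain R where RM: "R \<in> M" and RR: "\<And>x. x \<in> carrier H \<Longrightarrow> R (R x) = S (S x)"
    and Rsa: "\<And>x y. x \<in> carrier H \<Longrightarrow> y \<in> carrier H \<Longrightarrow> ip H (R x) y = ip H x (R y)"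
    and Rpos: "\<And>x. x \<in> carrier H \<Longrightarrow> 0 \<le> Re (ip H (R x) x)"
    using abs_exists[OF SM Ssa] by blast
  have eM: "e \<in> M" using e by simp
  define T where "T = compose (carrier H) (\<lambda>x\<in>carrier H. R x \<oplus>\<^bsub>H\<^esub> S x) e"
  have TM: "T \<in> M" unfolding T_def by (rule compose_mem[OF add_mem[OF RM SM] eM])
  have Tv: "T x = R (e x) \<oplus>\<^bsub>H\<^esub> S (e x)" if "x \<in> carrier H" for x using that eM by (simp add: T_def compose_eq)
  obtain q where q: "projection q" and qk: "\<And>x. x \<in> carrier H \<Longrightarrow> q x = x \<longleftrightarrow> T x = \<zero>\<^bsub>H\<^esub>"
    using kernel_projection[of "{T}"] TM by auto
  have qM: "q \<in> M" using q by simp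
  define r where "r = (\<lambda>x\<in>carrier H. x \<ominus>\<^bsub>H\<^esub> q x)"
  have r: "projection r" unfolding r_def by (rule projection_complement[OF q])
  have rr: "x \<in> ran r \<longleftrightarrow> x \<in> carrier H \<and> q x = \<zero>\<^bsub>H\<^esub>" for x
  proof -
    have "x \<ominus>\<^bsub>H\<^esub> q x = x \<longleftrightarrow> q x = \<zero>\<^bsub>H\<^esub>" if x: "x \<in> carrier H"
    proof
      assume a: "x \<ominus>\<^bsub>H\<^esub> q x = x"
      have "q x = x \<ominus>\<^bsub>H\<^esub> (x \<ominus>\<^bsub>H\<^esub> q x)" using x qM by (intro vec_eqI) (simp_all add: ip_simps)
      then show "q x = \<zero>\<^bsub>H\<^esub>" using a x by simp
    qed (use x in simp)
    then show ?thesis by (auto simp: ran_def r_def)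
  qed
  have orth: "ip H w x = 0" if "x \<in> ran r" "w \<in> carrier H" "T w = \<zero>\<^bsub>H\<^esub>" for x w
  proof -
    have "q w = w" using qk[OF that(2)] that(3) by blast
    then have "ip H w x = ip H (q w) x" by simp
    also have "\<dots> = ip H w (q x)" using that rr projection_selfadj[OF q] by simp
    finally show ?thesis using that rr by simp
  qed
  show ?thesis
  proof (cases "nonzero r")
    case True
    have re: "x \<in> ran e" if x: "x \<in> ran r" for x
    proof -
      define w where "w = x \<ominus>\<^bsub>H\<^esub> e x"
      have xV: "x \<in> carrier H" using x rr by simp
      have w: "w \<in> carrier H" using xV eM by (simp add: w_def)
      have ew: "e w = \<zero>\<^bsub>H\<^esub>" using xV eM by (simp add: w_def op_diff[OF bounded[OF eM]] projection_idem[OF e])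
      have "T w = \<zero>\<^bsub>H\<^esub>" using w ew RM SM by (simp add: Tv)
      then have "ip H w x = 0" using orth x w by simp
      moreover have "ip H w (e x) = 0" using projection_selfadj[OF e w xV] ew xV by simp
      ultimately have "ip H w w = 0" using w xV eM by (subst (2) w_def) (simp add: ip_simps)
      then have "w = \<zero>\<^bsub>H\<^esub>" using ip_pos[OF w] by (cases "w = \<zero>\<^bsub>H\<^esub>") simp_all
      then have "x = e x" using xV eM by (simp add: w_def diff_zero_iff)
      then show ?thesis using xV by (simp add: ran_def)
    qed
    have "t * (hnorm H x)\<^sup>2 \<le> Re (ip H (h x) x)" if x: "x \<in> ran r" for x
    proof -
      have xV: "x \<in> carrier H" using x rr by simp
      have ex: "e x = x" using re[OF x] by (simp add: ran_def)
      define u where "u = R x \<ominus>\<^bsub>H\<^esub> S x"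
      have u: "u \<in> carrier H" using xV RM SM by (simp add: u_def)
      have eu: "e u = u" using xV RM SM eM ex comm[OF eM RM xV] comm[OF eM SM xV]
        by (simp add: u_def op_diff[OF bounded[OF eM]])
      define v where "v = R u \<ominus>\<^bsub>H\<^esub> S u"
      have v: "v \<in> carrier H" using u RM SM by (simp add: v_def)
      have ev: "e v = v" using u RM SM eM eu comm[OF eM RM u] comm[OF eM SM u]
        by (simp add: v_def op_diff[OF bounded[OF eM]])
      have "T v = R v \<oplus>\<^bsub>H\<^esub> S v" using v ev by (simp add: Tv)
      also have "\<dots> = \<zero>\<^bsub>H\<^esub>"
        using u RM SM comm[OF RM SM u] RR[OF u]
        by (intro vec_eqI) (simp_all add: v_def op_diff[OF bounded[OF RM]] op_diff[OF bounded[OF SM]] ip_simps)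
      finally have "ip H v x = 0" using orth[OF x v] by simp
      moreover have "ip H v x = ip H u u"
        using u xV RM SM by (simp add: v_def ip_simps Rsa Ssa) (simp add: u_def ip_simps)
      ultimately have "u = \<zero>\<^bsub>H\<^esub>" using ip_pos[OF u] by (cases "u = \<zero>\<^bsub>H\<^esub>") simp_all
      then have "R x = S x" using xV RM SM by (simp add: u_def diff_zero_iff)
      then show ?thesis using Rpos[OF xV] Sre[OF xV] by simp
    qed
    then show ?thesis using True r re by blast
  next
    case False
    have "Re (ip H (h x) x) \<le> t * (hnorm H x)\<^sup>2" if x: "x \<in> ran e" for x
    proof -
      have xV: "x \<in> carrier H" and ex: "e x = x" using x by (simp_all add: ran_def)
      have "x \<ominus>\<^bsub>H\<^esub> q x \<in> ran r" using projection_ran[OF r xV] xV by (simp add: r_def)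
      then have "x \<ominus>\<^bsub>H\<^esub> q x = \<zero>\<^bsub>H\<^esub>" using False unfolding nonzero_def by blast
      then have "q x = x" using xV qM by (simp add: diff_zero_iff)
      then have "R x \<oplus>\<^bsub>H\<^esub> S x = \<zero>\<^bsub>H\<^esub>" using qk[OF xV] Tv[OF xV] ex by simp
      then have "ip H (R x) x + ip H (S x) x = 0"
        using ip_add[of "R x" "S x" x] xV RM SM by simp
      then have "Re (ip H (R x) x) + Re (ip H (S x) x) = 0" by (metis plus_complex.sel(1) zero_complex.sel(1))
      then show ?thesis using Rpos[OF xV] Sre[OF xV] by linarith
    qed
    then show ?thesis by blast
  qed
qed

text \<open>The spectral dichotomy for \<open>a* a\<close> at the level \<open>t\<close> squared.\<close>

lemma norm_dichotomy:
  assumes a: "a \<in> M" and e: "projection e" and t: "0 \<le> t"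
  shows "(\<forall>x\<in>ran e. hnorm H (a x) \<le> t * hnorm H x) \<or>
    (\<exists>r. projection r \<and> nonzero r \<and> ran r \<subseteq> ran e \<and> (\<forall>x\<in>ran r. t * hnorm H x \<le> hnorm H (a x)))"
proof -
  define h where "h = compose (carrier H) (adjoint H a) a"
  have hM: "h \<in> M" unfolding h_def by (rule compose_mem[OF adjoint_mem[OF a] a])
  have hv: "ip H (h x) y = ip H (a x) (a y)" if "x \<in> carrier H" "y \<in> carrier H" for x y
    using that a by (simp add: h_def compose_eq ip_adjoint'[OF bounded[OF a]])
  have hv': "ip H x (h y) = ip H (a x) (a y)" if "x \<in> carrier H" "y \<in> carrier H" for x y
    using that a by (simp add: h_def compose_eq ip_adjoint[OF bounded[OF a]])
  have hn: "Re (ip H (h x) x) = (hnorm H (a x))\<^sup>2" if "x \<in> carrier H" for x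
    using that a by (simp add: hv hnorm_sq)
  have le1: "hnorm H (a x) \<le> t * hnorm H x" if "x \<in> carrier H" "Re (ip H (h x) x) \<le> t\<^sup>2 * (hnorm H x)\<^sup>2" for x
    using that t a by - (rule power2_le_imp_le, simp_all add: hn power_mult_distrib)
  have le2: "t * hnorm H x \<le> hnorm H (a x)" if "x \<in> carrier H" "t\<^sup>2 * (hnorm H x)\<^sup>2 \<le> Re (ip H (h x) x)" for x
    using that t a by - (rule power2_le_imp_le, simp_all add: hn power_mult_distrib)
  have "ip H (h x) y = ip H x (h y)" if "x \<in> carrier H" "y \<in> carrier H" for x y
    using hv[OF that] hv'[OF that] by simp
  from spectral_dichotomy[OF hM this e, of "t\<^sup>2"] show ?thesis
  proof
    assume *: "\<forall>x\<in>ran e. Re (ip H (h x) x) \<le> t\<^sup>2 * (hnorm H x)\<^sup>2"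
    have "\<forall>x\<in>ran e. hnorm H (a x) \<le> t * hnorm H x"
    proof
      fix x assume x: "x \<in> ran e"
      show "hnorm H (a x) \<le> t * hnorm H x" by (rule le1[OF ran_carrier[OF x] bspec[OF * x]])
    qed
    then show ?thesis by (rule disjI1)
  next
    assume "\<exists>r. projection r \<and> nonzero r \<and> ran r \<subseteq> ran e \<and> (\<forall>x\<in>ran r. t\<^sup>2 * (hnorm H x)\<^sup>2 \<le> Re (ip H (h x) x))"
    then obtain r where r: "projection r" "nonzero r" "ran r \<subseteq> ran e"
      and *: "\<forall>x\<in>ran r. t\<^sup>2 * (hnorm H x)\<^sup>2 \<le> Re (ip H (h x) x)" by (elim exE conjE)
    have "\<forall>x\<in>ran r. t * hnorm H x \<le> hnorm H (a x)"
    proof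
      fix x assume x: "x \<in> ran r"
      show "t * hnorm H x \<le> hnorm H (a x)" by (rule le2[OF ran_carrier[OF x] bspec[OF * x]])
    qed
    with r show ?thesis by (intro disjI2 exI[of _ r] conjI)
  qed
qed

end

section \<open>Asymptotic joint eigenvectors\<close>

context abelian_vn_algebra
begin

lemma ran_invariant: "p \<in> M \<Longrightarrow> a \<in> M \<Longrightarrow> x \<in> ran p \<Longrightarrow> a x \<in> ran p"
  using comm[of p a x] by (simp add: ran_def)

text \<open>Polarization with the vectors \<open>eps x + S x\<close> and \<open>eps x - S x\<close>,
  at which the numerical bound is applied.\<close>

lemma numerical_radius_bound:
  assumes S: "S \<in> M" and sa: "\<And>x y. x \<in> carrier H \<Longrightarrow> y \<in> carrier H \<Longrightarrow> ip H (S x) y = ip H x (S y)"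
    and r: "r \<in> M" and eps: "eps > 0"
    and num: "\<And>x. x \<in> ran r \<Longrightarrow> \<bar>Re (ip H (S x) x)\<bar> \<le> eps * (hnorm H x)\<^sup>2"
    and x: "x \<in> ran r"
  shows "hnorm H (S x) \<le> eps * hnorm H x"
proof -
  define e where "e = complex_of_real eps"
  have xV: "x \<in> carrier H" and Sx: "S x \<in> carrier H" and SSx: "S (S x) \<in> carrier H"
    using x S ran_carrier by simp_all
  have Sr: "S x \<in> ran r" by (rule ran_invariant[OF r S x])
  define y where "y = e \<odot>\<^bsub>H\<^esub> x \<oplus>\<^bsub>H\<^esub> S x"
  define z where "z = e \<odot>\<^bsub>H\<^esub> x \<ominus>\<^bsub>H\<^esub> S x"
  have yr: "y \<in> ran r" unfolding y_def by (rule ran_add[OF r ran_smult[OF r x] Sr])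
  have zr: "z \<in> ran r" unfolding z_def by (rule ran_diff[OF r ran_smult[OF r x] Sr])
  define n m s t where "n = Re (ip H x x)" and "m = Re (ip H (S x) (S x))" and "s = Re (ip H (S x) x)"
    and "t = Re (ip H (S (S x)) (S x))"
  have s': "Re (ip H x (S x)) = s" using sa[OF xV xV] by (simp add: s_def)
  have m': "Re (ip H (S (S x)) x) = m" using sa[OF Sx xV] by (simp add: m_def)
  have Sy: "S y = e \<odot>\<^bsub>H\<^esub> S x \<oplus>\<^bsub>H\<^esub> S (S x)"
    using xV Sx by (simp add: y_def op_add[OF bounded[OF S]] op_smult[OF bounded[OF S]])
  have Sz: "S z = e \<odot>\<^bsub>H\<^esub> S x \<ominus>\<^bsub>H\<^esub> S (S x)"
    using xV Sx by (simp add: z_def op_diff[OF bounded[OF S]] op_smult[OF bounded[OF S]])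
  have yy: "(hnorm H y)\<^sup>2 = eps * eps * n + 2 * eps * s + m"
    using xV Sx ran_carrier[OF yr] by (simp add: hnorm_sq) (simp add: y_def e_def ip_simps n_def s_def[symmetric] s' m_def algebra_simps)
  have zz: "(hnorm H z)\<^sup>2 = eps * eps * n - 2 * eps * s + m"
    using xV Sx ran_carrier[OF zr] by (simp add: hnorm_sq) (simp add: z_def e_def ip_simps n_def s_def[symmetric] s' m_def algebra_simps)
  have Syy: "Re (ip H (S y) y) = eps * eps * s + 2 * eps * m + t"
    unfolding Sy unfolding y_def using xV Sx SSx
    by (simp add: e_def ip_simps s_def[symmetric] m' m_def[symmetric] t_def[symmetric] algebra_simps)
  have Szz: "Re (ip H (S z) z) = eps * eps * s - 2 * eps * m + t"
    unfolding Sz unfolding z_def using xV Sx SSx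
    by (simp add: e_def ip_simps s_def[symmetric] m' m_def[symmetric] t_def[symmetric] algebra_simps)
  have "0 \<le> (eps * (hnorm H y)\<^sup>2 - Re (ip H (S y) y)) + (eps * (hnorm H z)\<^sup>2 + Re (ip H (S z) z))"
    using num[OF yr] num[OF zr] by linarith
  also have "\<dots> = 2 * eps * (eps\<^sup>2 * n - m)"
    unfolding yy zz Syy Szz by (simp add: power2_eq_square algebra_simps)
  finally have "m \<le> eps\<^sup>2 * n" using eps by (simp add: zero_le_mult_iff)
  then have "(hnorm H (S x))\<^sup>2 \<le> (eps * hnorm H x)\<^sup>2"
    using xV Sx by (simp add: power_mult_distrib hnorm_sq n_def m_def)
  then show ?thesis by (rule power2_le_imp_le) (use eps xV in simp)
qed

text \<open>Each application of the spectral dichotomy halves an interval that contains the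
  numerical values. Once the interval is short, the numerical bound controls the norm.\<close>

lemma localize_selfadjoint:
  assumes a: "a \<in> M" and sa: "\<And>x y. x \<in> carrier H \<Longrightarrow> y \<in> carrier H \<Longrightarrow> ip H (a x) y = ip H x (a y)"
    and r: "projection r" "nonzero r" and d: "d > 0"
  shows "\<exists>r' c. projection r' \<and> nonzero r' \<and> ran r' \<subseteq> ran r \<and>
    (\<forall>x\<in>ran r'. hnorm H (a x \<ominus>\<^bsub>H\<^esub> complex_of_real c \<odot>\<^bsub>H\<^esub> x) \<le> d * hnorm H x)"
proof -
  obtain B where B: "B > 0" "\<And>x. x \<in> carrier H \<Longrightarrow> \<bar>Re (ip H (a x) x)\<bar> \<le> B * (hnorm H x)\<^sup>2"
    using bounded_sq_form[OF a] by blast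
  have bis: "\<exists>r' L. projection r' \<and> nonzero r' \<and> ran r' \<subseteq> ran r \<and>
     (\<forall>x\<in>ran r'. L * (hnorm H x)\<^sup>2 \<le> Re (ip H (a x) x) \<and>
        Re (ip H (a x) x) \<le> (L + 2 * B / 2 ^ n) * (hnorm H x)\<^sup>2)" for n :: nat
  proof (induction n)
    case 0
    have "(-B) * (hnorm H x)\<^sup>2 \<le> Re (ip H (a x) x) \<and> Re (ip H (a x) x) \<le> (-B + 2 * B / 2 ^ 0) * (hnorm H x)\<^sup>2"
      if x: "x \<in> ran r" for x using B(2)[OF ran_carrier[OF x]] by (simp add: abs_le_iff)
    then show ?case using r by blast
  next
    case (Suc n)
    then obtain p L where p: "projection p" "nonzero p" "ran p \<subseteq> ran r"
      and pL: "\<And>x. x \<in> ran p \<Longrightarrow> L * (hnorm H x)\<^sup>2 \<le> Re (ip H (a x) x)"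
      and pU: "\<And>x. x \<in> ran p \<Longrightarrow> Re (ip H (a x) x) \<le> (L + 2 * B / 2 ^ n) * (hnorm H x)\<^sup>2"
      by blast
    have eq: "(L + 2 * B / 2 ^ Suc n) + 2 * B / 2 ^ Suc n = L + 2 * B / 2 ^ n" by (simp add: field_simps)
    from spectral_dichotomy[OF a sa p(1), of "L + 2 * B / 2 ^ Suc n"] show ?case
    proof
      assume "\<forall>x\<in>ran p. Re (ip H (a x) x) \<le> (L + 2 * B / 2 ^ Suc n) * (hnorm H x)\<^sup>2"
      then show ?thesis using p pL by (intro exI[of _ p] exI[of _ L]) blast
    next
      assume "\<exists>q. projection q \<and> nonzero q \<and> ran q \<subseteq> ran p \<and>
         (\<forall>x\<in>ran q. (L + 2 * B / 2 ^ Suc n) * (hnorm H x)\<^sup>2 \<le> Re (ip H (a x) x))"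
      then obtain q where q: "projection q" "nonzero q" "ran q \<subseteq> ran p"
        and qL: "\<And>x. x \<in> ran q \<Longrightarrow> (L + 2 * B / 2 ^ Suc n) * (hnorm H x)\<^sup>2 \<le> Re (ip H (a x) x)" by blast
      have qU: "Re (ip H (a x) x) \<le> ((L + 2 * B / 2 ^ Suc n) + 2 * B / 2 ^ Suc n) * (hnorm H x)\<^sup>2" if "x \<in> ran q" for x
        unfolding eq using pU that q(3) by blast
      have "ran q \<subseteq> ran r" using q(3) p(3) by (rule order_trans)
      then show ?thesis using q qL qU by (intro exI[of _ q] exI[of _ "L + 2 * B / 2 ^ Suc n"]) blast
    qed
  qed
  have "(\<lambda>n. B / 2 ^ n) \<longlonglongrightarrow> 0"
    using LIMSEQ_divide_realpow_zero[of 2 B] by simp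
  then obtain n where n: "B / 2 ^ n < d"
    using LIMSEQ_D[of "\<lambda>n. B / 2 ^ n" 0 d] d B(1) by force
  obtain p L where p: "projection p" "nonzero p" "ran p \<subseteq> ran r"
    and pL: "\<And>x. x \<in> ran p \<Longrightarrow> L * (hnorm H x)\<^sup>2 \<le> Re (ip H (a x) x)"
    and pU: "\<And>x. x \<in> ran p \<Longrightarrow> Re (ip H (a x) x) \<le> (L + 2 * B / 2 ^ n) * (hnorm H x)\<^sup>2"
    using bis[of n] by blast
  define eps where "eps = B / 2 ^ n"
  have eps: "eps > 0" "eps < d" using B(1) n by (simp_all add: eps_def)
  define c where "c = L + eps"
  define S where "S = (\<lambda>x\<in>carrier H. a x \<ominus>\<^bsub>H\<^esub> (\<lambda>x\<in>carrier H. complex_of_real c \<odot>\<^bsub>H\<^esub> (\<lambda>x\<in>carrier H. x) x) x)"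
  have SM: "S \<in> M" unfolding S_def by (rule diff_mem[OF a smult_mem[OF one_mem]])
  have Sv: "S x = a x \<ominus>\<^bsub>H\<^esub> complex_of_real c \<odot>\<^bsub>H\<^esub> x" if "x \<in> carrier H" for x using that by (simp add: S_def)
  have Ssa: "ip H (S x) y = ip H x (S y)" if "x \<in> carrier H" "y \<in> carrier H" for x y
    using that a by (simp add: Sv ip_simps sa)
  have Sre: "Re (ip H (S x) x) = Re (ip H (a x) x) - c * (hnorm H x)\<^sup>2" if "x \<in> carrier H" for x
    using that a by (simp add: Sv ip_simps hnorm_sq)
  have num: "\<bar>Re (ip H (S x) x)\<bar> \<le> eps * (hnorm H x)\<^sup>2" if x: "x \<in> ran p" for x
  proof -
    have "c * (hnorm H x)\<^sup>2 = L * (hnorm H x)\<^sup>2 + eps * (hnorm H x)\<^sup>2" by (simp add: c_def algebra_simps)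
    moreover have "(L + 2 * B / 2 ^ n) * (hnorm H x)\<^sup>2 = L * (hnorm H x)\<^sup>2 + 2 * (eps * (hnorm H x)\<^sup>2)"
      by (simp add: eps_def algebra_simps)
    ultimately show ?thesis using pL[OF x] pU[OF x] Sre[OF ran_carrier[OF x]] by linarith
  qed
  have "hnorm H (a x \<ominus>\<^bsub>H\<^esub> complex_of_real c \<odot>\<^bsub>H\<^esub> x) \<le> d * hnorm H x" if x: "x \<in> ran p" for x
  proof -
    have "hnorm H (S x) \<le> eps * hnorm H x"
      by (rule numerical_radius_bound[OF SM Ssa projection_mem[OF p(1)] eps(1) num x])
    also have "\<dots> \<le> d * hnorm H x" using eps ran_carrier[OF x] by (intro mult_right_mono) simp_all
    finally show ?thesis using Sv[OF ran_carrier[OF x]] by simp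
  qed
  then show ?thesis using p by blast
qed

text \<open>Real and imaginary parts are localized in turn; the second step only shrinks the
  projection found in the first.\<close>

lemma localize:
  assumes a: "a \<in> M" and r: "projection r" "nonzero r" and d: "d > 0"
  shows "\<exists>r' c. projection r' \<and> nonzero r' \<and> ran r' \<subseteq> ran r \<and>
    (\<forall>x\<in>ran r'. hnorm H (a x \<ominus>\<^bsub>H\<^esub> c \<odot>\<^bsub>H\<^esub> x) \<le> d * hnorm H x)"
proof -
  have a': "adjoint H a \<in> M" by (rule adjoint_mem[OF a])
  define b where "b = (\<lambda>x\<in>carrier H. (1/2) \<odot>\<^bsub>H\<^esub> (\<lambda>x\<in>carrier H. a x \<oplus>\<^bsub>H\<^esub> adjoint H a x) x)"
  define g where "g = (\<lambda>x\<in>carrier H. (-\<i>/2) \<odot>\<^bsub>H\<^esub> (\<lambda>x\<in>carrier H. a x \<ominus>\<^bsub>H\<^esub> adjoint H a x) x)"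
  have bM: "b \<in> M" unfolding b_def by (rule smult_mem[OF add_mem[OF a a']])
  have gM: "g \<in> M" unfolding g_def by (rule smult_mem[OF diff_mem[OF a a']])
  have bv: "b x = (1/2) \<odot>\<^bsub>H\<^esub> (a x \<oplus>\<^bsub>H\<^esub> adjoint H a x)" if "x \<in> carrier H" for x using that by (simp add: b_def)
  have gv: "g x = (-\<i>/2) \<odot>\<^bsub>H\<^esub> (a x \<ominus>\<^bsub>H\<^esub> adjoint H a x)" if "x \<in> carrier H" for x using that by (simp add: g_def)
  note adj = ip_adjoint[OF bounded[OF a]] ip_adjoint'[OF bounded[OF a]]
  have bsa: "ip H (b x) y = ip H x (b y)" if "x \<in> carrier H" "y \<in> carrier H" for x y
    using that a a' by (simp add: bv ip_simps adj)
  have gsa: "ip H (g x) y = ip H x (g y)" if "x \<in> carrier H" "y \<in> carrier H" for x y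
    using that a a' by (simp add: gv ip_simps adj algebra_simps)
  have split: "a x = b x \<oplus>\<^bsub>H\<^esub> \<i> \<odot>\<^bsub>H\<^esub> g x" if x: "x \<in> carrier H" for x
    using x a a' bM gM by (intro vec_eqI) (simp_all add: bv gv ip_simps adj algebra_simps)
  obtain p \<beta> where p: "projection p" "nonzero p" "ran p \<subseteq> ran r"
    and pb: "\<And>x. x \<in> ran p \<Longrightarrow> hnorm H (b x \<ominus>\<^bsub>H\<^esub> complex_of_real \<beta> \<odot>\<^bsub>H\<^esub> x) \<le> (d/2) * hnorm H x"
    using localize_selfadjoint[OF bM bsa r half_gt_zero[OF d]] by blast
  obtain q \<gamma> where q: "projection q" "nonzero q" "ran q \<subseteq> ran p"
    and qb: "\<And>x. x \<in> ran q \<Longrightarrow> hnorm H (g x \<ominus>\<^bsub>H\<^esub> complex_of_real \<gamma> \<odot>\<^bsub>H\<^esub> x) \<le> (d/2) * hnorm H x"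
    using localize_selfadjoint[OF gM gsa p(1,2) half_gt_zero[OF d]] by blast
  define c where "c = complex_of_real \<beta> + \<i> * complex_of_real \<gamma>"
  have "hnorm H (a x \<ominus>\<^bsub>H\<^esub> c \<odot>\<^bsub>H\<^esub> x) \<le> d * hnorm H x" if x: "x \<in> ran q" for x
  proof -
    have xV: "x \<in> carrier H" by (rule ran_carrier[OF x])
    let ?u = "b x \<ominus>\<^bsub>H\<^esub> complex_of_real \<beta> \<odot>\<^bsub>H\<^esub> x" and ?v = "g x \<ominus>\<^bsub>H\<^esub> complex_of_real \<gamma> \<odot>\<^bsub>H\<^esub> x"
    have uv: "?u \<in> carrier H" "?v \<in> carrier H" using xV bM gM by simp_all
    have "a x \<ominus>\<^bsub>H\<^esub> c \<odot>\<^bsub>H\<^esub> x = ?u \<oplus>\<^bsub>H\<^esub> \<i> \<odot>\<^bsub>H\<^esub> ?v"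
      unfolding split[OF xV] using xV bM gM by (intro vec_eqI) (simp_all add: c_def ip_simps algebra_simps)
    then have "hnorm H (a x \<ominus>\<^bsub>H\<^esub> c \<odot>\<^bsub>H\<^esub> x) \<le> hnorm H ?u + hnorm H ?v"
      using hnorm_triangle[OF uv(1) vsmult[OF uv(2), of \<i>]] uv by (simp add: hnorm_smult)
    moreover have "x \<in> ran p" using x q(3) by blast
    ultimately show ?thesis using pb[of x] qb[OF x] by (simp add: algebra_simps)
  qed
  moreover have "ran q \<subseteq> ran r" using q(3) p(3) by (rule order_trans)
  ultimately show ?thesis using q(1,2) by blast
qed

lemma localize_finite:
  assumes F: "finite F" "F \<subseteq> M" and r: "projection r" "nonzero r" and d: "d > 0"
  shows "\<exists>r' c. projection r' \<and> nonzero r' \<and> ran r' \<subseteq> ran r \<and>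
    (\<forall>a\<in>F. \<forall>x\<in>ran r'. hnorm H (a x \<ominus>\<^bsub>H\<^esub> c a \<odot>\<^bsub>H\<^esub> x) \<le> d * hnorm H x)"
  using F
proof (induction F rule: finite_induct)
  case empty then show ?case using r by blast
next
  case (insert b F)
  then obtain p c where p: "projection p" "nonzero p" "ran p \<subseteq> ran r"
    and pc: "\<And>a x. a \<in> F \<Longrightarrow> x \<in> ran p \<Longrightarrow> hnorm H (a x \<ominus>\<^bsub>H\<^esub> c a \<odot>\<^bsub>H\<^esub> x) \<le> d * hnorm H x" by blast
  obtain q \<gamma> where q: "projection q" "nonzero q" "ran q \<subseteq> ran p"
    and qb: "\<And>x. x \<in> ran q \<Longrightarrow> hnorm H (b x \<ominus>\<^bsub>H\<^esub> \<gamma> \<odot>\<^bsub>H\<^esub> x) \<le> d * hnorm H x"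
    using localize[of b p d] insert.prems p d by blast
  have "hnorm H (a x \<ominus>\<^bsub>H\<^esub> (c(b := \<gamma>)) a \<odot>\<^bsub>H\<^esub> x) \<le> d * hnorm H x" if "a \<in> insert b F" "x \<in> ran q" for a x
    using that qb pc[of a x] q(3) insert.hyps(2) by (cases "a = b") (simp_all add: subset_iff)
  moreover have "ran q \<subseteq> ran r" using q(3) p(3) by (rule order_trans)
  ultimately show ?case using q(1,2) by blast
qed

text \<open>The substitute for a character of \<open>M\<close>: unit vectors that are asymptotically joint
  eigenvectors. The eigenvalues depend multiplicatively and additively on the operator.\<close>

definition asymp_eigen :: "(nat \<Rightarrow> 'h) \<Rightarrow> ('h \<Rightarrow> 'h) \<Rightarrow> complex \<Rightarrow> bool" where
  "asymp_eigen u a c \<longleftrightarrow> (\<lambda>k. hnorm H (a (u k) \<ominus>\<^bsub>H\<^esub> c \<odot>\<^bsub>H\<^esub> u k)) \<longlonglongrightarrow> 0"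

text \<open>Localizing with precision \<open>(1/2)^n\<close> under ever smaller projections, the
  approximate eigenvalues form Cauchy sequences; unit vectors are picked from the successive
  ranges.\<close>

lemma asymp_eigen_exists:
  assumes F: "finite F" "F \<subseteq> M" and r: "projection r" "nonzero r"
  shows "\<exists>u c. (\<forall>k. u k \<in> ran r \<and> hnorm H (u k) = 1) \<and> (\<forall>a\<in>F. asymp_eigen u a (c a))"
proof -
  define P where "P = (\<lambda>n (p, c). projection p \<and> nonzero p \<and> ran p \<subseteq> ran r \<and>
    (\<forall>a\<in>F. \<forall>x\<in>ran p. hnorm H (a x \<ominus>\<^bsub>H\<^esub> c a \<odot>\<^bsub>H\<^esub> x) \<le> (1/2)^n * hnorm H x))"
  have "\<exists>f. \<forall>n. P n (f n) \<and> ran (fst (f (Suc n))) \<subseteq> ran (fst (f n))"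
  proof (rule dependent_nat_choice)
    show "\<exists>x. P 0 x" using localize_finite[OF F r, of 1] by (simp add: P_def)
    fix x n assume "P n x"
    then obtain p c where x: "x = (p, c)" and p: "projection p" "nonzero p" "ran p \<subseteq> ran r"
      by (cases x) (simp add: P_def)
    obtain p' c' where p': "projection p'" "nonzero p'" "ran p' \<subseteq> ran p"
      "\<forall>a\<in>F. \<forall>x\<in>ran p'. hnorm H (a x \<ominus>\<^bsub>H\<^esub> c' a \<odot>\<^bsub>H\<^esub> x) \<le> (1/2)^(Suc n) * hnorm H x"
      using localize_finite[OF F p(1,2), of "(1/2)^(Suc n)"] zero_less_power[of "1/2::real" "Suc n"] by fastforce
    have "P (Suc n) (p', c')" unfolding P_def using p' p by blast
    then show "\<exists>y. P (Suc n) y \<and> ran (fst y) \<subseteq> ran (fst x)" using p'(3) x by (intro exI[of _ "(p', c')"]) simp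
  qed
  then obtain f where f: "\<And>n. P n (f n)" and dec: "\<And>n. ran (fst (f (Suc n))) \<subseteq> ran (fst (f n))" by blast
  define p where "p = (\<lambda>n. fst (f n))"
  define c where "c = (\<lambda>n. snd (f n))"
  have fpc: "P n (p n, c n)" for n using f[of n] by (simp add: p_def c_def)
  have p: "projection (p n)" "nonzero (p n)" "ran (p n) \<subseteq> ran r" for n using fpc[of n] by (simp_all add: P_def)
  have pc: "hnorm H (a x \<ominus>\<^bsub>H\<^esub> c n a \<odot>\<^bsub>H\<^esub> x) \<le> (1/2)^n * hnorm H x" if "a \<in> F" "x \<in> ran (p n)" for a x n
    using fpc[of n] that by (simp add: P_def)
  have mono: "ran (p j) \<subseteq> ran (p i)" if "i \<le> j" for i j
    using that by (rule lift_Suc_antimono_le[rotated]) (use dec in \<open>simp add: p_def\<close>)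
  have "\<exists>x. x \<in> ran (p n) \<and> hnorm H x = 1" for n
  proof -
    obtain x where x: "x \<in> ran (p n)" "x \<noteq> \<zero>\<^bsub>H\<^esub>" using p(2)[of n] unfolding nonzero_def by blast
    have "hnorm H ((1 / complex_of_real (hnorm H x)) \<odot>\<^bsub>H\<^esub> x) = 1"
      using x hnorm_pos[OF ran_carrier[OF x(1)]] ran_carrier[OF x(1)] by (simp add: hnorm_smult norm_divide)
    then show ?thesis using ran_smult[OF projection_mem[OF p(1)] x(1)] by blast
  qed
  then obtain u where u: "\<And>n. u n \<in> ran (p n)" "\<And>n. hnorm H (u n) = 1" by metis
  have uV: "u n \<in> carrier H" for n by (rule ran_carrier[OF u(1)])
  have cd: "cmod (c j a - c i a) \<le> 2 * (1/2)^i" if a: "a \<in> F" and ij: "i \<le> j" for i j a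
  proof -
    have aM: "a \<in> M" using a F by blast
    have uj: "u j \<in> ran (p i)" using u(1)[of j] mono[OF ij] by blast
    have A: "a (u j) \<in> carrier H" using aM uV by simp
    have "cmod (c j a - c i a) = hnorm H ((c j a - c i a) \<odot>\<^bsub>H\<^esub> u j)" using uV u(2) by (simp add: hnorm_smult)
    also have "(c j a - c i a) \<odot>\<^bsub>H\<^esub> u j = c j a \<odot>\<^bsub>H\<^esub> u j \<ominus>\<^bsub>H\<^esub> c i a \<odot>\<^bsub>H\<^esub> u j"
      using uV by (intro vec_eqI) (simp_all add: ip_simps algebra_simps)
    also have "hnorm H \<dots> \<le> hnorm H (c j a \<odot>\<^bsub>H\<^esub> u j \<ominus>\<^bsub>H\<^esub> a (u j)) + hnorm H (a (u j) \<ominus>\<^bsub>H\<^esub> c i a \<odot>\<^bsub>H\<^esub> u j)"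
      using uV A by (intro hnorm_triangle_via) simp_all
    also have "hnorm H (c j a \<odot>\<^bsub>H\<^esub> u j \<ominus>\<^bsub>H\<^esub> a (u j)) = hnorm H (a (u j) \<ominus>\<^bsub>H\<^esub> c j a \<odot>\<^bsub>H\<^esub> u j)"
      using uV A by (intro hnorm_minus_commute) simp_all
    finally have "cmod (c j a - c i a) \<le> (1/2)^j + (1/2)^i"
      using pc[OF a u(1)[of j]] pc[OF a uj] u(2)[of j] by simp
    moreover have "(1/2)^j \<le> ((1/2)^i :: real)" using ij by (intro power_decreasing) simp_all
    ultimately show ?thesis by linarith
  qed
  have half: "(\<lambda>i. K * (1/2)^i) \<longlonglongrightarrow> (0::real)" for K
    using tendsto_mult_right_zero[OF LIMSEQ_realpow_zero[of "1/2"], of K] by simp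
  have "\<exists>l. (\<lambda>i. c i a) \<longlonglongrightarrow> l" if a: "a \<in> F" for a
  proof -
    have "Cauchy (\<lambda>i. c i a)"
    proof (rule CauchyI)
      fix e :: real assume e: "0 < e"
      obtain N where N: "norm (4 * (1/2)^N - (0::real)) < e" using LIMSEQ_D[OF half[of 4] e] by blast
      show "\<exists>N. \<forall>m\<ge>N. \<forall>n\<ge>N. norm (c m a - c n a) < e"
      proof (intro exI allI impI)
        fix m n assume "N \<le> m" "N \<le> n"
        have "norm (c m a - c n a) \<le> cmod (c m a - c N a) + cmod (c n a - c N a)"
          using norm_triangle_ineq4[of "c m a - c N a" "c n a - c N a"] by simp
        then show "norm (c m a - c n a) < e"
          using cd[OF a \<open>N \<le> m\<close>] cd[OF a \<open>N \<le> n\<close>] N by simp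
      qed
    qed
    then show ?thesis by (simp add: Cauchy_convergent_iff convergent_def)
  qed
  then obtain l where l: "\<And>a. a \<in> F \<Longrightarrow> (\<lambda>i. c i a) \<longlonglongrightarrow> l a" by metis
  have "asymp_eigen u a (l a)" if a: "a \<in> F" for a
    unfolding asymp_eigen_def
  proof (rule null_sequence_comparison)
    fix i
    have A: "a (u i) \<in> carrier H" using a F uV by blast
    have "cmod (l a - c i a) \<le> 2 * (1/2)^i"
    proof (rule LIMSEQ_le_const2)
      show "(\<lambda>j. cmod (c j a - c i a)) \<longlonglongrightarrow> cmod (l a - c i a)" using l[OF a] by (intro tendsto_intros)
      show "\<exists>N. \<forall>n\<ge>N. cmod (c n a - c i a) \<le> 2 * (1/2)^i" using cd[OF a] by blast
    qed
    then have "cmod (c i a - l a) \<le> 2 * (1/2)^i" by (simp add: norm_minus_commute)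
    moreover have "c i a \<odot>\<^bsub>H\<^esub> u i \<ominus>\<^bsub>H\<^esub> l a \<odot>\<^bsub>H\<^esub> u i = (c i a - l a) \<odot>\<^bsub>H\<^esub> u i"
      using uV by (intro vec_eqI) (simp_all add: ip_simps algebra_simps)
    ultimately have "hnorm H (c i a \<odot>\<^bsub>H\<^esub> u i \<ominus>\<^bsub>H\<^esub> l a \<odot>\<^bsub>H\<^esub> u i) \<le> 2 * (1/2)^i"
      using uV u(2) by (simp add: hnorm_smult)
    moreover have "hnorm H (a (u i) \<ominus>\<^bsub>H\<^esub> l a \<odot>\<^bsub>H\<^esub> u i) \<le>
       hnorm H (a (u i) \<ominus>\<^bsub>H\<^esub> c i a \<odot>\<^bsub>H\<^esub> u i) + hnorm H (c i a \<odot>\<^bsub>H\<^esub> u i \<ominus>\<^bsub>H\<^esub> l a \<odot>\<^bsub>H\<^esub> u i)"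
      using uV A by (intro hnorm_triangle_via) simp_all
    ultimately show "norm (hnorm H (a (u i) \<ominus>\<^bsub>H\<^esub> l a \<odot>\<^bsub>H\<^esub> u i)) \<le> 3 * (1/2)^i"
      using pc[OF a u(1)[of i]] u(2)[of i] uV A by simp
  qed (rule half)
  moreover have "u k \<in> ran r" for k using u(1)[of k] p(3)[of k] by blast
  ultimately show ?thesis using u(2) by blast
qed

lemma asymp_eigen_one: "(\<And>k. u k \<in> carrier H) \<Longrightarrow> asymp_eigen u (\<lambda>x\<in>carrier H. x) 1"
  by (simp add: asymp_eigen_def)

lemma asymp_eigen_zero: "(\<And>k. u k \<in> carrier H) \<Longrightarrow> asymp_eigen u (\<lambda>x\<in>carrier H. \<zero>\<^bsub>H\<^esub>) 0"
  by (simp add: asymp_eigen_def)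

lemma asymp_eigen_add:
  assumes u: "\<And>k. u k \<in> carrier H" and M2: "a \<in> M" "b \<in> M" and e: "asymp_eigen u a c" "asymp_eigen u b d"
  shows "asymp_eigen u (\<lambda>x\<in>carrier H. a x \<oplus>\<^bsub>H\<^esub> b x) (c + d)"
  unfolding asymp_eigen_def
proof (rule null_sequence_comparison)
  fix k
  let ?p = "a (u k) \<ominus>\<^bsub>H\<^esub> c \<odot>\<^bsub>H\<^esub> u k" and ?q = "b (u k) \<ominus>\<^bsub>H\<^esub> d \<odot>\<^bsub>H\<^esub> u k"
  have pq: "?p \<in> carrier H" "?q \<in> carrier H" using u M2 by simp_all
  have "(\<lambda>x\<in>carrier H. a x \<oplus>\<^bsub>H\<^esub> b x) (u k) \<ominus>\<^bsub>H\<^esub> (c + d) \<odot>\<^bsub>H\<^esub> u k = ?p \<oplus>\<^bsub>H\<^esub> ?q"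
    using u[of k] M2 by (intro vec_eqI) (simp_all add: ip_simps algebra_simps)
  then show "norm (hnorm H ((\<lambda>x\<in>carrier H. a x \<oplus>\<^bsub>H\<^esub> b x) (u k) \<ominus>\<^bsub>H\<^esub> (c + d) \<odot>\<^bsub>H\<^esub> u k))
     \<le> hnorm H ?p + hnorm H ?q"
    using hnorm_triangle[OF pq] pq by simp
  show "(\<lambda>k. hnorm H (a (u k) \<ominus>\<^bsub>H\<^esub> c \<odot>\<^bsub>H\<^esub> u k) + hnorm H (b (u k) \<ominus>\<^bsub>H\<^esub> d \<odot>\<^bsub>H\<^esub> u k)) \<longlonglongrightarrow> 0"
    using tendsto_add[OF e[unfolded asymp_eigen_def]] by simp
qed

text \<open>The difference for a product telescopes, since the first factor is bounded.\<close>

lemma asymp_eigen_mult: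
  assumes u: "\<And>k. u k \<in> carrier H" and M2: "a \<in> M" "b \<in> M" and e: "asymp_eigen u a c" "asymp_eigen u b d"
  shows "asymp_eigen u (compose (carrier H) a b) (c * d)"
proof -
  obtain B where B: "B > 0" "\<And>x. x \<in> carrier H \<Longrightarrow> hnorm H (a x) \<le> B * hnorm H x"
    using op_bound[OF bounded[OF M2(1)]] by blast
  show ?thesis
    unfolding asymp_eigen_def
  proof (rule null_sequence_comparison)
    fix k
    let ?p = "a (u k) \<ominus>\<^bsub>H\<^esub> c \<odot>\<^bsub>H\<^esub> u k" and ?q = "b (u k) \<ominus>\<^bsub>H\<^esub> d \<odot>\<^bsub>H\<^esub> u k"
    have pq: "?p \<in> carrier H" "?q \<in> carrier H" "a ?q \<in> carrier H" using u M2 by simp_all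
    have "compose (carrier H) a b (u k) \<ominus>\<^bsub>H\<^esub> (c * d) \<odot>\<^bsub>H\<^esub> u k = a ?q \<oplus>\<^bsub>H\<^esub> d \<odot>\<^bsub>H\<^esub> ?p"
      using u[of k] M2 by (intro vec_eqI)
        (simp_all add: compose_eq op_diff[OF bounded[OF M2(1)]] op_smult[OF bounded[OF M2(1)]] ip_simps algebra_simps)
    then have "hnorm H (compose (carrier H) a b (u k) \<ominus>\<^bsub>H\<^esub> (c * d) \<odot>\<^bsub>H\<^esub> u k) \<le> hnorm H (a ?q) + cmod d * hnorm H ?p"
      using hnorm_triangle[OF pq(3) vsmult[OF pq(1), of d]] pq by (simp add: hnorm_smult)
    moreover have "compose (carrier H) a b (u k) \<ominus>\<^bsub>H\<^esub> (c * d) \<odot>\<^bsub>H\<^esub> u k \<in> carrier H"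
      using u M2 by (simp add: compose_eq)
    ultimately show "norm (hnorm H (compose (carrier H) a b (u k) \<ominus>\<^bsub>H\<^esub> (c * d) \<odot>\<^bsub>H\<^esub> u k))
       \<le> B * hnorm H ?q + cmod d * hnorm H ?p"
      using B(2)[OF pq(2)] by simp
    show "(\<lambda>k. B * hnorm H (b (u k) \<ominus>\<^bsub>H\<^esub> d \<odot>\<^bsub>H\<^esub> u k) + cmod d * hnorm H (a (u k) \<ominus>\<^bsub>H\<^esub> c \<odot>\<^bsub>H\<^esub> u k)) \<longlonglongrightarrow> 0"
      using tendsto_add[OF tendsto_mult_right_zero[OF e(2)[unfolded asymp_eigen_def], of B]
          tendsto_mult_right_zero[OF e(1)[unfolded asymp_eigen_def], of "cmod d"]] by simp
  qed
qed

lemma asymp_eigen_unique: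
  assumes u: "\<And>k. u k \<in> carrier H" "\<And>k. hnorm H (u k) = 1" and a: "a \<in> M"
    and e: "asymp_eigen u a c" "asymp_eigen u a d"
  shows "c = d"
proof -
  have le: "cmod (c - d) \<le> hnorm H (a (u k) \<ominus>\<^bsub>H\<^esub> c \<odot>\<^bsub>H\<^esub> u k) + hnorm H (a (u k) \<ominus>\<^bsub>H\<^esub> d \<odot>\<^bsub>H\<^esub> u k)" for k
  proof -
    have A: "a (u k) \<in> carrier H" using u a by simp
    have "cmod (c - d) = hnorm H (c \<odot>\<^bsub>H\<^esub> u k \<ominus>\<^bsub>H\<^esub> d \<odot>\<^bsub>H\<^esub> u k)"
    proof -
      have "c \<odot>\<^bsub>H\<^esub> u k \<ominus>\<^bsub>H\<^esub> d \<odot>\<^bsub>H\<^esub> u k = (c - d) \<odot>\<^bsub>H\<^esub> u k"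
        using u by (intro vec_eqI) (simp_all add: ip_simps algebra_simps)
      then show ?thesis using u by (simp add: hnorm_smult)
    qed
    also have "\<dots> \<le> hnorm H (c \<odot>\<^bsub>H\<^esub> u k \<ominus>\<^bsub>H\<^esub> a (u k)) + hnorm H (a (u k) \<ominus>\<^bsub>H\<^esub> d \<odot>\<^bsub>H\<^esub> u k)"
      using u A by (intro hnorm_triangle_via) simp_all
    finally show ?thesis using hnorm_minus_commute[OF A vsmult[OF u(1), of c k]] by simp
  qed
  have "(\<lambda>k. hnorm H (a (u k) \<ominus>\<^bsub>H\<^esub> c \<odot>\<^bsub>H\<^esub> u k) + hnorm H (a (u k) \<ominus>\<^bsub>H\<^esub> d \<odot>\<^bsub>H\<^esub> u k)) \<longlonglongrightarrow> 0"
    using tendsto_add[OF e[unfolded asymp_eigen_def]] by simp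
  then have "cmod (c - d) \<le> 0" by (rule LIMSEQ_le_const) (use le in blast)
  then show ?thesis by simp
qed

lemma asymp_eigen_bound:
  assumes u: "\<And>k. u k \<in> carrier H" "\<And>k. hnorm H (u k) = 1" and a: "a \<in> M"
    and e: "asymp_eigen u a c" and B: "\<And>x. x \<in> carrier H \<Longrightarrow> hnorm H (a x) \<le> B * hnorm H x"
  shows "cmod c \<le> B"
proof -
  have le: "cmod c \<le> hnorm H (a (u k) \<ominus>\<^bsub>H\<^esub> c \<odot>\<^bsub>H\<^esub> u k) + B" for k
  proof -
    have A: "a (u k) \<in> carrier H" "c \<odot>\<^bsub>H\<^esub> u k \<in> carrier H" using u a by simp_all
    have "cmod c = hnorm H (c \<odot>\<^bsub>H\<^esub> u k)" using u by (simp add: hnorm_smult)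
    also have "\<dots> \<le> hnorm H (c \<odot>\<^bsub>H\<^esub> u k \<ominus>\<^bsub>H\<^esub> a (u k)) + hnorm H (a (u k))"
      using A(2,1) by (rule hnorm_triangle_diff)
    finally show ?thesis using hnorm_minus_commute[OF A] B[OF u(1), of k] u(2) by simp
  qed
  have "(\<lambda>k. hnorm H (a (u k) \<ominus>\<^bsub>H\<^esub> c \<odot>\<^bsub>H\<^esub> u k) + B) \<longlonglongrightarrow> 0 + B"
    using e unfolding asymp_eigen_def by (intro tendsto_add tendsto_const)
  then have "cmod c \<le> 0 + B" by (rule LIMSEQ_le_const) (use le in blast)
  then show ?thesis by simp
qed

end

section \<open>Linear systems with constraints over an abelian von Neumann algebra\<close>

context hilbert_space
begin

lemma vsum_closed [simp, intro]: "(\<And>i. i \<in> A \<Longrightarrow> f i \<in> carrier H) \<Longrightarrow> finsum H f A \<in> carrier H"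
  by (rule M.finsum_closed) blast

lemma ip_vsum: "finite A \<Longrightarrow> (\<And>i. i \<in> A \<Longrightarrow> f i \<in> carrier H) \<Longrightarrow> y \<in> carrier H \<Longrightarrow>
    ip H (finsum H f A) y = (\<Sum>i\<in>A. ip H (f i) y)"
proof (induction A rule: finite_induct)
  case (insert a A)
  have "finsum H f (insert a A) = f a \<oplus>\<^bsub>H\<^esub> finsum H f A"
    using insert.prems(1) insert.hyps by (intro M.finsum_insert) blast+
  then show ?case using insert by (simp add: ip_add)
qed simp

lemma hnorm_vsum: "finite A \<Longrightarrow> (\<And>i. i \<in> A \<Longrightarrow> f i \<in> carrier H) \<Longrightarrow>
    hnorm H (finsum H f A) \<le> (\<Sum>i\<in>A. hnorm H (f i))"
proof (induction A rule: finite_induct)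
  case (insert a A)
  have "finsum H f (insert a A) = f a \<oplus>\<^bsub>H\<^esub> finsum H f A"
    using insert.prems(1) insert.hyps by (intro M.finsum_insert) blast+
  moreover have "hnorm H (f a \<oplus>\<^bsub>H\<^esub> finsum H f A) \<le> hnorm H (f a) + hnorm H (finsum H f A)"
    using insert.prems by (intro hnorm_triangle) simp_all
  moreover have "hnorm H (finsum H f A) \<le> (\<Sum>i\<in>A. hnorm H (f i))" using insert by simp
  ultimately show ?case using insert.hyps by simp
qed simp

lemma vsum_cong: "(\<And>i. i \<in> A \<Longrightarrow> f i \<in> carrier H) \<Longrightarrow> (\<And>i. i \<in> A \<Longrightarrow> f i = g i) \<Longrightarrow> finsum H f A = finsum H g A"
  by (rule M.finsum_cong') (simp_all add: Pi_iff)

end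

context vn_algebra
begin

lemma vsum_mem:
  assumes "finite A" "\<And>i. i \<in> A \<Longrightarrow> f i \<in> M"
  shows "(\<lambda>x\<in>carrier H. finsum H (\<lambda>i. f i x) A) \<in> M"
  using assms
proof (induction A rule: finite_induct)
  case empty
  have "(\<lambda>x\<in>carrier H. finsum H (\<lambda>i. f i x) {}) = (\<lambda>x\<in>carrier H. \<zero>\<^bsub>H\<^esub>)"
    by (intro restrict_ext) simp
  then show ?case by (simp only: zero_mem)
next
  case (insert a A)
  have "(\<lambda>x\<in>carrier H. finsum H (\<lambda>i. f i x) (insert a A)) =
    (\<lambda>x\<in>carrier H. f a x \<oplus>\<^bsub>H\<^esub> (\<lambda>x\<in>carrier H. finsum H (\<lambda>i. f i x) A) x)"
  proof (intro restrict_ext)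
    fix x assume x: "x \<in> carrier H"
    have "finsum H (\<lambda>i. f i x) (insert a A) = f a x \<oplus>\<^bsub>H\<^esub> finsum H (\<lambda>i. f i x) A"
      using insert x by (intro M.finsum_insert) blast+
    then show "finsum H (\<lambda>i. f i x) (insert a A) = f a x \<oplus>\<^bsub>H\<^esub> (\<lambda>x\<in>carrier H. finsum H (\<lambda>i. f i x) A) x"
      using x by simp
  qed
  also have "\<dots> \<in> M" using insert by (intro add_mem) blast+
  finally show ?case .
qed

lemma scalar_mem: "(\<lambda>x\<in>carrier H. c \<odot>\<^bsub>H\<^esub> x) \<in> M"
proof -
  have "(\<lambda>x\<in>carrier H. c \<odot>\<^bsub>H\<^esub> (\<lambda>x\<in>carrier H. x) x) \<in> M" by (rule smult_mem[OF one_mem])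
  moreover have "(\<lambda>x\<in>carrier H. c \<odot>\<^bsub>H\<^esub> (\<lambda>x\<in>carrier H. x) x) = (\<lambda>x\<in>carrier H. c \<odot>\<^bsub>H\<^esub> x)"
    by (intro restrict_ext) simp
  ultimately show ?thesis by simp
qed

end

context abelian_vn_algebra
begin

text \<open>Commuting projections form a lattice, with the product as meet.\<close>

lemma projection_compose:
  assumes p: "projection p" and q: "projection q"
  shows "projection (compose (carrier H) p q)" "ran (compose (carrier H) p q) = ran p \<inter> ran q"
proof -
  have pM: "p \<in> M" and qM: "q \<in> M" using p q by simp_all
  have c: "q (p x) = p (q x)" if "x \<in> carrier H" for x by (rule comm[OF qM pM that])
  show "projection (compose (carrier H) p q)"
    unfolding projection_def
  proof (intro conjI ballI)
    show "compose (carrier H) p q \<in> M" by (rule compose_mem[OF pM qM])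
    fix x assume x: "x \<in> carrier H"
    show "compose (carrier H) p q (compose (carrier H) p q x) = compose (carrier H) p q x"
      using x pM qM by (simp add: compose_eq c projection_idem[OF p] projection_idem[OF q])
    fix y assume y: "y \<in> carrier H"
    show "ip H (compose (carrier H) p q x) y = ip H x (compose (carrier H) p q y)"
      using x y pM qM c[OF y] by (simp add: compose_eq projection_selfadj[OF p] projection_selfadj[OF q])
  qed
  show "ran (compose (carrier H) p q) = ran p \<inter> ran q"
  proof
    show "ran (compose (carrier H) p q) \<subseteq> ran p \<inter> ran q"
    proof
      fix x assume "x \<in> ran (compose (carrier H) p q)"
      then have x: "x \<in> carrier H" "p (q x) = x" unfolding ran_def using compose_eq[of x "carrier H" p q] by simp_all
      have "p x = x" using projection_idem[OF p, of "q x"] x qM by simp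
      moreover have "q x = x" using projection_idem[OF q, of "p x"] x pM c[OF x(1)] by simp
      ultimately show "x \<in> ran p \<inter> ran q" using x by (simp add: ran_def)
    qed
    show "ran p \<inter> ran q \<subseteq> ran (compose (carrier H) p q)" 
    proof
      fix x assume "x \<in> ran p \<inter> ran q"
      then have "x \<in> carrier H" "p x = x" "q x = x" by (simp_all add: ran_def)
      then show "x \<in> ran (compose (carrier H) p q)" by (simp add: ran_def compose_eq)
    qed
  qed
qed

text \<open>The images of two orthogonal pieces under an operator of the abelian algebra stay
  orthogonal, so the squared norms add up and the constant does not deteriorate. This is why
  refinement below costs nothing in the norm.\<close>

lemma glue_bound:
  assumes a: "a \<in> M" and p: "projection e1" "projection e2"
    and e: "\<And>x. x \<in> carrier H \<Longrightarrow> e x = e1 x \<oplus>\<^bsub>H\<^esub> e2 x" and o: "\<And>x. x \<in> carrier H \<Longrightarrow> e1 (e2 x) = \<zero>\<^bsub>H\<^esub>"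
    and D: "D \<ge> 0" and le: "\<And>x. x \<in> ran e1 \<Longrightarrow> hnorm H (a x) \<le> D * hnorm H x"
      "\<And>x. x \<in> ran e2 \<Longrightarrow> hnorm H (a x) \<le> D * hnorm H x"
    and x: "x \<in> ran e"
  shows "hnorm H (a x) \<le> D * hnorm H x"
proof (rule power2_le_imp_le)
  have xV: "x \<in> carrier H" and ex: "e x = x" using x by (simp_all add: ran_def)
  have M2: "e1 \<in> M" "e2 \<in> M" using p by simp_all
  define x1 x2 where "x1 = e1 x" and "x2 = e2 x"
  have V: "x1 \<in> carrier H" "x2 \<in> carrier H" "a x1 \<in> carrier H" "a x2 \<in> carrier H"
    using xV M2 a by (simp_all add: x1_def x2_def)
  have xx: "x = x1 \<oplus>\<^bsub>H\<^esub> x2" using e[OF xV] ex by (simp add: x1_def x2_def)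
  have r1: "x1 \<in> ran e1" "x2 \<in> ran e2" unfolding x1_def x2_def using p xV by (simp_all add: projection_ran)
  have orth: "ip H u v = 0" if "u \<in> ran e1" "v \<in> ran e2" for u v
  proof -
    have uv: "u \<in> carrier H" "v \<in> carrier H" "e1 u = u" "e2 v = v" using that by (simp_all add: ran_def)
    have "ip H u v = ip H u (e1 (e2 v))" using projection_selfadj[OF p(1) uv(1,2)] uv by simp
    then show ?thesis using o[OF uv(2)] uv by simp
  qed
  have "(hnorm H (a x))\<^sup>2 = (hnorm H (a x1))\<^sup>2 + (hnorm H (a x2))\<^sup>2"
    unfolding xx using V orth[OF ran_invariant[OF M2(1) a r1(1)] ran_invariant[OF M2(2) a r1(2)]]
    by (simp add: op_add[OF bounded[OF a]] hnorm_add_sq)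
  also have "\<dots> \<le> (D * hnorm H x1)\<^sup>2 + (D * hnorm H x2)\<^sup>2"
    using le(1)[OF r1(1)] le(2)[OF r1(2)] V by (intro add_mono power_mono) simp_all
  also have "\<dots> = (D * hnorm H x)\<^sup>2"
    unfolding xx using V orth[OF r1] by (simp add: hnorm_add_sq power_mult_distrib algebra_simps)
  finally show "(hnorm H (a x))\<^sup>2 \<le> (D * hnorm H x)\<^sup>2" .
  show "0 \<le> D * hnorm H x" using D xV by simp
qed

end

lemma bounded_set_finite_cover:
  fixes K :: "('i \<Rightarrow> complex) set"
  assumes I: "finite I" and bd: "\<And>z i. z \<in> K \<Longrightarrow> i \<in> I \<Longrightarrow> cmod (z i) \<le> c" and d: "d > 0"
  shows "\<exists>C. finite C \<and> K \<subseteq> \<Union>C \<and> (\<forall>Q\<in>C. \<forall>w\<in>Q. \<forall>z\<in>Q. \<forall>i\<in>I. cmod (w i - z i) \<le> d)"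
proof -
  define g where "g = (\<lambda>z::'i \<Rightarrow> complex. \<lambda>i\<in>I. (\<lfloor>Re (z i) / (d/2)\<rfloor>, \<lfloor>Im (z i) / (d/2)\<rfloor>))"
  define N where "N = \<lceil>c / (d/2)\<rceil> + 1"
  have fl: "\<lfloor>t / (d/2)\<rfloor> \<in> {-N..N}" if t: "\<bar>t\<bar> \<le> c" for t :: real
  proof -
    have "\<bar>t / (d/2)\<bar> \<le> c / (d/2)" using t d by (simp add: divide_right_mono)
    then have "- of_int (N - 1) \<le> t / (d/2)" "t / (d/2) \<le> of_int (N - 1)"
      using le_of_int_ceiling[of "c / (d/2)"] unfolding N_def by linarith+
    then show ?thesis by (simp add: floor_le_iff le_floor_iff)
  qed
  have "g ` K \<subseteq> PiE I (\<lambda>_. {-N..N} \<times> {-N..N})"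
  proof
    fix y assume "y \<in> g ` K"
    then obtain z where z: "z \<in> K" "y = g z" by blast
    have "\<bar>Re (z i)\<bar> \<le> c" "\<bar>Im (z i)\<bar> \<le> c" if "i \<in> I" for i
      using bd[OF z(1) that] abs_Re_le_cmod[of "z i"] abs_Im_le_cmod[of "z i"] by linarith+
    then show "y \<in> PiE I (\<lambda>_. {-N..N} \<times> {-N..N})" unfolding z(2) g_def using fl by (simp add: PiE_iff)
  qed
  then have fin: "finite (g ` K)" using I by (rule finite_subset[OF _ finite_PiE]) simp_all
  have close: "\<bar>s - t\<bar> \<le> d/2" if "\<lfloor>s / (d/2)\<rfloor> = \<lfloor>t / (d/2)\<rfloor>" for s t :: real
  proof -
    have "\<bar>s / (d/2) - t / (d/2)\<bar> < 1" using that by linarith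
    moreover have "s - t = (s / (d/2) - t / (d/2)) * (d/2)" using d by (simp add: field_simps)
    then have "\<bar>s - t\<bar> = \<bar>s / (d/2) - t / (d/2)\<bar> * (d/2)" using d by (metis abs_mult abs_of_pos half_gt_zero)
    ultimately show ?thesis using d mult_right_mono[of "\<bar>s / (d/2) - t / (d/2)\<bar>" 1 "d/2"] by simp
  qed
  define C where "C = (\<lambda>y. {z \<in> K. g z = y}) ` (g ` K)"
  have "cmod (w i - z i) \<le> d" if "g w = g z" "i \<in> I" for w z i
  proof -
    have "g w i = g z i" using that by simp
    then have "\<bar>Re (w i) - Re (z i)\<bar> \<le> d/2" "\<bar>Im (w i) - Im (z i)\<bar> \<le> d/2"
      using that(2) close by (simp_all add: g_def)
    then show ?thesis using cmod_le[of "w i - z i"] by simp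
  qed
  then have "\<forall>Q\<in>C. \<forall>w\<in>Q. \<forall>z\<in>Q. \<forall>i\<in>I. cmod (w i - z i) \<le> d" unfolding C_def by simp
  moreover have "K \<subseteq> \<Union>C" unfolding C_def by blast
  moreover have "finite C" unfolding C_def using fin by (rule finite_imageI)
  ultimately show ?thesis by blast
qed

text \<open>Unknowns \<open>Z i\<close>, equations \<open>\<Sum>t\<in>T. \<alpha> j t Z(\<kappa> j
  t) = 0\<close> for \<open>j \<in> J\<close>, and a bounded set \<open>K\<close> of complex tuples
  in which the unknowns are to take their values at every point of the spectrum. Any constraint can
  be put into \<open>K\<close>; quadratic ones are recovered for the solution.\<close>

locale linear_system = abelian_vn_algebra H M
  for H :: "'h hilbert" and M :: "('h \<Rightarrow> 'h) set" +
  fixes I :: "'i set" and J :: "'j set" and T :: "'t set"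
    and \<alpha> :: "'j \<Rightarrow> 't \<Rightarrow> ('h \<Rightarrow> 'h)" and \<kappa> :: "'j \<Rightarrow> 't \<Rightarrow> 'i" and K :: "('i \<Rightarrow> complex) set" and c :: real
  assumes fin: "finite I" "finite J" "finite T"
    and \<alpha>M: "j \<in> J \<Longrightarrow> t \<in> T \<Longrightarrow> \<alpha> j t \<in> M" and \<kappa>I: "j \<in> J \<Longrightarrow> t \<in> T \<Longrightarrow> \<kappa> j t \<in> I"
    and K_bound: "z \<in> K \<Longrightarrow> i \<in> I \<Longrightarrow> cmod (z i) \<le> c"
begin

text \<open>The residual of the \<open>j\<close>-th equation \<open>\<Sum>t\<in>T. \<alpha> j t
  Z(\<kappa> j t) = 0\<close>, as an operator.\<close>

definition res :: "'j \<Rightarrow> ('i \<Rightarrow> 'h \<Rightarrow> 'h) \<Rightarrow> 'h \<Rightarrow> 'h" where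
  "res j Z = (\<lambda>x\<in>carrier H. finsum H (\<lambda>t. \<alpha> j t (Z (\<kappa> j t) x)) T)"

definition scal :: "('i \<Rightarrow> complex) \<Rightarrow> 'i \<Rightarrow> 'h \<Rightarrow> 'h" where
  "scal z i = (\<lambda>x\<in>carrier H. z i \<odot>\<^bsub>H\<^esub> x)"

lemma scal_mem [simp, intro]: "scal z i \<in> M"
  unfolding scal_def by (rule scalar_mem)

lemma res_mem [intro]:
  assumes j: "j \<in> J" and Z: "\<And>i. i \<in> I \<Longrightarrow> Z i \<in> M"
  shows "res j Z \<in> M"
proof -
  have "(\<lambda>x\<in>carrier H. finsum H (\<lambda>t. compose (carrier H) (\<alpha> j t) (Z (\<kappa> j t)) x) T) \<in> M"
    using Z j \<alpha>M \<kappa>I fin by (intro vsum_mem compose_mem) blast+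
  moreover have "(\<lambda>x\<in>carrier H. finsum H (\<lambda>t. compose (carrier H) (\<alpha> j t) (Z (\<kappa> j t)) x) T) = res j Z"
    unfolding res_def by (intro restrict_ext) (simp add: compose_eq)
  ultimately show ?thesis by simp
qed

lemma res_cong:
  assumes j: "j \<in> J" and x: "x \<in> carrier H" and Z: "\<And>i. i \<in> I \<Longrightarrow> Z i x \<in> carrier H" "\<And>i. i \<in> I \<Longrightarrow> Z i x = Z' i x"
  shows "res j Z x = res j Z' x"
  unfolding res_def using x
  by (simp, intro vsum_cong) (use assms \<kappa>I \<alpha>M in \<open>simp_all add: mem_closed\<close>)

text \<open>Residuals depend on the unknowns through finitely many bounded coefficients, with a
  Lipschitz constant independent of the vector.\<close>

lemma res_lipschitz:
  "\<exists>C>0. \<forall>j\<in>J. \<forall>x\<in>carrier H. \<forall>Z Z' d. 0 \<le> d \<longrightarrow> (\<forall>i\<in>I. Z i x \<in> carrier H \<and> Z' i x \<in> carrier H \<and>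
      hnorm H (Z i x \<ominus>\<^bsub>H\<^esub> Z' i x) \<le> d) \<longrightarrow> hnorm H (res j Z x \<ominus>\<^bsub>H\<^esub> res j Z' x) \<le> C * d"
proof -
  have "\<exists>B. \<forall>j\<in>J. \<forall>t\<in>T. B j t > 0 \<and> (\<forall>x\<in>carrier H. hnorm H (\<alpha> j t x) \<le> B j t * hnorm H x)"
    using op_bound[OF bounded[OF \<alpha>M]] by metis
  then obtain B where B: "\<And>j t. j \<in> J \<Longrightarrow> t \<in> T \<Longrightarrow> B j t > 0"
    "\<And>j t x. j \<in> J \<Longrightarrow> t \<in> T \<Longrightarrow> x \<in> carrier H \<Longrightarrow> hnorm H (\<alpha> j t x) \<le> B j t * hnorm H x" by blast
  define C where "C = 1 + (\<Sum>j\<in>J. \<Sum>t\<in>T. B j t)"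
  have Bnn: "j \<in> J \<Longrightarrow> t \<in> T \<Longrightarrow> B j t \<ge> 0" for j t using B(1) by (simp add: less_imp_le)
  have C: "C > 0" unfolding C_def using Bnn by (intro add_pos_nonneg sum_nonneg) simp_all
  have "hnorm H (res j Z x \<ominus>\<^bsub>H\<^esub> res j Z' x) \<le> C * d"
    if j: "j \<in> J" and x: "x \<in> carrier H" and d: "0 \<le> d"
      and ZZ: "\<forall>i\<in>I. Z i x \<in> carrier H \<and> Z' i x \<in> carrier H \<and> hnorm H (Z i x \<ominus>\<^bsub>H\<^esub> Z' i x) \<le> d" for j x Z Z' d
  proof -
    have Z: "Z (\<kappa> j t) x \<in> carrier H" "Z' (\<kappa> j t) x \<in> carrier H"
      "hnorm H (Z (\<kappa> j t) x \<ominus>\<^bsub>H\<^esub> Z' (\<kappa> j t) x) \<le> d" if "t \<in> T" for t using ZZ \<kappa>I[OF j that] by blast+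
    have ob: "\<alpha> j t \<in> bounded_ops H" if "t \<in> T" for t using \<alpha>M[OF j that] by (rule bounded)
    let ?f = "\<lambda>t. \<alpha> j t (Z (\<kappa> j t) x \<ominus>\<^bsub>H\<^esub> Z' (\<kappa> j t) x)"
    have fV: "?f t \<in> carrier H" if "t \<in> T" for t using ob Z that by simp
    have "res j Z x \<ominus>\<^bsub>H\<^esub> res j Z' x = finsum H ?f T"
      using x Z ob fin(3) fV
      by (intro vec_eqI) (simp_all add: res_def ip_diff ip_vsum op_diff sum_subtractf)
    then have "hnorm H (res j Z x \<ominus>\<^bsub>H\<^esub> res j Z' x) \<le> (\<Sum>t\<in>T. hnorm H (?f t))"
      using hnorm_vsum[OF fin(3), of ?f] fV by simp
    also have "\<dots> \<le> (\<Sum>t\<in>T. B j t * d)"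
    proof (rule sum_mono)
      fix t assume t: "t \<in> T"
      have "hnorm H (?f t) \<le> B j t * hnorm H (Z (\<kappa> j t) x \<ominus>\<^bsub>H\<^esub> Z' (\<kappa> j t) x)"
        using B(2)[OF j t] Z[OF t] by simp
      also have "\<dots> \<le> B j t * d" using Z(3)[OF t] Bnn[OF j t] by (rule mult_left_mono)
      finally show "hnorm H (?f t) \<le> B j t * d" .
    qed
    also have "\<dots> = (\<Sum>t\<in>T. B j t) * d" by (simp add: sum_distrib_right)
    also have "\<dots> \<le> C * d"
    proof (rule mult_right_mono[OF _ d])
      have "(\<Sum>t\<in>T. B j t) \<le> (\<Sum>j\<in>J. \<Sum>t\<in>T. B j t)"
        by (rule member_le_sum[OF j]) (use Bnn fin in \<open>simp_all add: sum_nonneg\<close>)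
      then show "(\<Sum>t\<in>T. B j t) \<le> C" by (simp add: C_def)
    qed
    finally show ?thesis .
  qed
  then show ?thesis using C by blast
qed

text \<open>On the range of a bad projection, all constant tuples of \<open>Q\<close> miss the
  system by a common positive amount.\<close>

definition bad :: "('h \<Rightarrow> 'h) \<Rightarrow> ('i \<Rightarrow> complex) set \<Rightarrow> bool" where
  "bad r Q \<longleftrightarrow> projection r \<and> nonzero r \<and>
     (\<exists>e>0. \<forall>z\<in>Q. \<forall>x\<in>ran r. e * hnorm H x \<le> (\<Sum>j\<in>J. hnorm H (res j (scal z) x)))"

text \<open>In terms of the spectrum: at every point below \<open>e\<close> the system has an
  approximate solution in \<open>Q\<close>.\<close>

definition good :: "('h \<Rightarrow> 'h) \<Rightarrow> ('i \<Rightarrow> complex) set \<Rightarrow> bool" where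
  "good e Q \<longleftrightarrow> projection e \<and> (\<forall>r. bad r Q \<longrightarrow> \<not> ran r \<subseteq> ran e)"

text \<open>Let \<open>e2\<close> project onto the part of \<open>ran e\<close> covered by the
  projections that are bad for \<open>Q1\<close>, and let \<open>e1\<close> be the rest. By
  construction nothing below \<open>e1\<close> is bad for \<open>Q1\<close>. A projection below
  \<open>e2\<close> that is bad for \<open>Q2\<close> would meet some projection that is bad for
  \<open>Q1\<close>, and their product would be bad for the union.\<close>

lemma good_split:
  assumes g: "good e (Q1 \<union> Q2)"
  shows "\<exists>e1 e2. good e1 Q1 \<and> good e2 Q2 \<and> (\<forall>x\<in>carrier H. e x = e1 x \<oplus>\<^bsub>H\<^esub> e2 x) \<and>
    (\<forall>x\<in>carrier H. e1 (e2 x) = \<zero>\<^bsub>H\<^esub>)"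
proof -
  have e: "projection e" and ng: "\<And>r. bad r (Q1 \<union> Q2) \<Longrightarrow> \<not> ran r \<subseteq> ran e"
    using g by (simp_all add: good_def)
  define S where "S = {s. bad s Q1 \<and> ran s \<subseteq> ran e}"
  have SM: "S \<subseteq> M" unfolding S_def bad_def using projection_mem by blast
  obtain q where q: "projection q" and qk: "\<forall>x\<in>carrier H. q x = x \<longleftrightarrow> (\<forall>s\<in>S. s x = \<zero>\<^bsub>H\<^esub>)"
    using kernel_projection[OF SM] by blast
  define q' where "q' = (\<lambda>x\<in>carrier H. x \<ominus>\<^bsub>H\<^esub> q x)"
  have q': "projection q'" unfolding q'_def by (rule projection_complement[OF q])
  have M3: "e \<in> M" "q \<in> M" "q' \<in> M" using e q q' by simp_all
  define e1 where "e1 = compose (carrier H) e q"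
  define e2 where "e2 = compose (carrier H) e q'"
  have e1: "projection e1" "ran e1 = ran e \<inter> ran q" unfolding e1_def by (rule projection_compose[OF e q])+
  have e2: "projection e2" "ran e2 = ran e \<inter> ran q'" unfolding e2_def by (rule projection_compose[OF e q'])+
  have "good e1 Q1"
    unfolding good_def
  proof (intro conjI allI impI notI)
    fix r assume r: "bad r Q1" "ran r \<subseteq> ran e1"
    then have rS: "r \<in> S" using e1(2) by (simp add: S_def)
    obtain x where x: "x \<in> ran r" "x \<noteq> \<zero>\<^bsub>H\<^esub>" using r(1) unfolding bad_def nonzero_def by blast
    have "x \<in> ran q" using x r(2) e1(2) by blast
    then have "x \<in> carrier H" "q x = x" by (simp_all add: ran_def)
    then have "r x = \<zero>\<^bsub>H\<^esub>" using qk rS by blast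
    then show False using x by (simp add: ran_def)
  qed (rule e1(1))
  moreover have "good e2 Q2"
    unfolding good_def
  proof (intro conjI allI impI notI)
    fix r assume r: "bad r Q2" "ran r \<subseteq> ran e2"
    obtain x where x: "x \<in> ran r" "x \<noteq> \<zero>\<^bsub>H\<^esub>" using r(1) unfolding bad_def nonzero_def by blast
    have xV: "x \<in> carrier H" and rx: "r x = x" using x(1) by (simp_all add: ran_def)
    have "x \<in> ran q'" using x r(2) e2(2) by blast
    then have eq: "x \<ominus>\<^bsub>H\<^esub> q x = x" using xV by (simp add: ran_def q'_def)
    have "q x \<noteq> x"
    proof
      assume "q x = x"
      then have "x \<ominus>\<^bsub>H\<^esub> x = x" using eq by simp
      then show False using x(2) xV by simp
    qed
    then obtain s where s: "s \<in> S" "s x \<noteq> \<zero>\<^bsub>H\<^esub>" using qk xV by blast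
    have rp: "projection r" and sp: "projection s" using r(1) s(1) by (simp_all add: S_def bad_def)
    define u where "u = compose (carrier H) s r"
    have u: "projection u" "ran u = ran s \<inter> ran r" unfolding u_def by (rule projection_compose[OF sp rp])+
    have "u x = s x" using xV rx by (simp add: u_def compose_eq)
    moreover have "u x \<in> ran u" using projection_ran[OF u(1) xV] .
    ultimately have "nonzero u" unfolding nonzero_def using s(2) by metis
    moreover obtain a b where ab: "a > 0" "b > 0"
      "\<forall>z\<in>Q1. \<forall>x\<in>ran s. a * hnorm H x \<le> (\<Sum>j\<in>J. hnorm H (res j (scal z) x))"
      "\<forall>z\<in>Q2. \<forall>x\<in>ran r. b * hnorm H x \<le> (\<Sum>j\<in>J. hnorm H (res j (scal z) x))"
      using r(1) s(1) unfolding S_def bad_def by blast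
    have "min a b * hnorm H x \<le> (\<Sum>j\<in>J. hnorm H (res j (scal z) x))"
      if z: "z \<in> Q1 \<union> Q2" and x: "x \<in> ran u" for z x
    proof -
      have xs: "x \<in> ran s" "x \<in> ran r" using x u(2) by simp_all
      have "min a b * hnorm H x \<le> a * hnorm H x" "min a b * hnorm H x \<le> b * hnorm H x"
        using ran_carrier[OF xs(1)] by (intro mult_right_mono; simp)+
      moreover have "a * hnorm H x \<le> (\<Sum>j\<in>J. hnorm H (res j (scal z) x))" if "z \<in> Q1" using ab(3) that xs(1) by blast
      moreover have "b * hnorm H x \<le> (\<Sum>j\<in>J. hnorm H (res j (scal z) x))" if "z \<in> Q2" using ab(4) that xs(2) by blast
      ultimately show ?thesis using z by (elim UnE) (rule order_trans, assumption, blast)+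
    qed
    ultimately have "bad u (Q1 \<union> Q2)" unfolding bad_def using u(1) ab(1,2) by (intro conjI exI[of _ "min a b"]) simp_all
    moreover have "ran u \<subseteq> ran e" using u(2) r(2) e2(2) by blast
    ultimately show False using ng by blast
  qed (rule e2(1))
  moreover have "e x = e1 x \<oplus>\<^bsub>H\<^esub> e2 x" if x: "x \<in> carrier H" for x
    using x M3 by (intro vec_eqI) (simp_all add: e1_def e2_def q'_def compose_eq op_diff[OF bounded[OF M3(1)]] ip_simps)
  moreover have "e1 (e2 x) = \<zero>\<^bsub>H\<^esub>" if x: "x \<in> carrier H" for x
  proof -
    have "q (e (x \<ominus>\<^bsub>H\<^esub> q x)) = e (q (x \<ominus>\<^bsub>H\<^esub> q x))" using x M3 by (intro comm) simp_all
    also have "\<dots> = \<zero>\<^bsub>H\<^esub>" using x M3 by (simp add: op_diff[OF bounded[OF M3(2)]] projection_idem[OF q])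
    finally show ?thesis using x M3 by (simp add: e1_def e2_def q'_def compose_eq)
  qed
  ultimately show ?thesis by blast
qed

text \<open>An operator tuple adapted to \<open>e\<close> with mesh \<open>d\<close> is locally
  constant: \<open>e\<close> is cut into finitely many orthogonal pieces, each good for a subset of
  \<open>K\<close> of size at most \<open>d\<close>, and on each piece the tuple is a constant from
  that subset. The inductive form makes gluing a rule instead of an index computation.\<close>

inductive adapted :: "real \<Rightarrow> ('h \<Rightarrow> 'h) \<Rightarrow> ('i \<Rightarrow> 'h \<Rightarrow> 'h) \<Rightarrow> bool" for d :: real where
  null: "projection e \<Longrightarrow> ran e = {\<zero>\<^bsub>H\<^esub>} \<Longrightarrow> (\<And>i. i \<in> I \<Longrightarrow> Z i \<in> M) \<Longrightarrow> adapted d e Z"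
| piece: "good e Q \<Longrightarrow> Q \<subseteq> K \<Longrightarrow> z \<in> Q \<Longrightarrow> (\<And>w i. w \<in> Q \<Longrightarrow> i \<in> I \<Longrightarrow> cmod (w i - z i) \<le> d) \<Longrightarrow>
    (\<And>i. i \<in> I \<Longrightarrow> Z i \<in> M) \<Longrightarrow> (\<And>i x. i \<in> I \<Longrightarrow> x \<in> ran e \<Longrightarrow> Z i x = z i \<odot>\<^bsub>H\<^esub> x) \<Longrightarrow> adapted d e Z"
| glue: "adapted d e1 Z1 \<Longrightarrow> adapted d e2 Z2 \<Longrightarrow> projection e \<Longrightarrow> (\<And>x. x \<in> carrier H \<Longrightarrow> e x = e1 x \<oplus>\<^bsub>H\<^esub> e2 x) \<Longrightarrow>
    (\<And>x. x \<in> carrier H \<Longrightarrow> e1 (e2 x) = \<zero>\<^bsub>H\<^esub>) \<Longrightarrow> (\<And>i. i \<in> I \<Longrightarrow> Z i \<in> M) \<Longrightarrow>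
    (\<And>i x. i \<in> I \<Longrightarrow> x \<in> ran e1 \<Longrightarrow> Z i x = Z1 i x) \<Longrightarrow>
    (\<And>i x. i \<in> I \<Longrightarrow> x \<in> ran e2 \<Longrightarrow> Z i x = Z2 i x) \<Longrightarrow> adapted d e Z"

lemma adapted_facts:
  assumes "adapted d e Z" shows "projection e" "i \<in> I \<Longrightarrow> Z i \<in> M"
  using assms by (induction rule: adapted.induct) (simp_all add: good_def)

text \<open>On a piece that is good for a small set \<open>Q\<close>, a constant tuple from
  \<open>Q\<close> must nearly solve the system: otherwise the norm dichotomy would yield a
  projection where this tuple, and hence by the Lipschitz bound every tuple of \<open>Q\<close>,
  misses the system by a fixed amount, that is, a bad projection. Gluing keeps the estimate by
  orthogonality.\<close>

lemma adapted_residual: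
  assumes C: "C > 0" and lip: "\<And>j x Z Z' d. j \<in> J \<Longrightarrow> x \<in> carrier H \<Longrightarrow> 0 \<le> d \<Longrightarrow> \<forall>i\<in>I. Z i x \<in> carrier H \<and> Z' i x \<in> carrier H \<and>
      hnorm H (Z i x \<ominus>\<^bsub>H\<^esub> Z' i x) \<le> d \<Longrightarrow> hnorm H (res j Z x \<ominus>\<^bsub>H\<^esub> res j Z' x) \<le> C * d"
    and d: "d > 0" and j: "j \<in> J" and ad: "adapted d e Z" and x: "x \<in> ran e"
  shows "hnorm H (res j Z x) \<le> (C + 1) * d * hnorm H x"
  using ad x
proof (induction arbitrary: x rule: adapted.induct)
  case (null e Z)
  then show ?case using res_mem[OF j null.hyps(3)] by simp
next
  case (piece e Q z Z)
  have e: "projection e" using piece.hyps(1) by (simp add: good_def)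
  have L: "res j (scal z) \<in> M" by (rule res_mem[OF j]) (rule scal_mem)
  have "\<not> (\<exists>r. projection r \<and> nonzero r \<and> ran r \<subseteq> ran e \<and>
      (\<forall>x\<in>ran r. (C + 1) * d * hnorm H x \<le> hnorm H (res j (scal z) x)))"
  proof
    assume "\<exists>r. projection r \<and> nonzero r \<and> ran r \<subseteq> ran e \<and>
      (\<forall>x\<in>ran r. (C + 1) * d * hnorm H x \<le> hnorm H (res j (scal z) x))"
    then obtain r where r: "projection r" "nonzero r" "ran r \<subseteq> ran e"
      and low: "\<And>x. x \<in> ran r \<Longrightarrow> (C + 1) * d * hnorm H x \<le> hnorm H (res j (scal z) x)" by blast
    have "d * hnorm H x \<le> (\<Sum>j\<in>J. hnorm H (res j (scal w) x))" if w: "w \<in> Q" and x: "x \<in> ran r" for w x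
    proof -
      have xV: "x \<in> carrier H" by (rule ran_carrier[OF x])
      have Lw: "res i (scal w) x \<in> carrier H" if "i \<in> J" for i using res_mem[OF that, of "scal w"] xV by blast
      have "hnorm H (scal z i x \<ominus>\<^bsub>H\<^esub> scal w i x) \<le> d * hnorm H x" if i: "i \<in> I" for i
      proof -
        have "scal z i x \<ominus>\<^bsub>H\<^esub> scal w i x = (z i - w i) \<odot>\<^bsub>H\<^esub> x"
          using xV by (intro vec_eqI) (simp_all add: scal_def ip_simps algebra_simps)
        then have "hnorm H (scal z i x \<ominus>\<^bsub>H\<^esub> scal w i x) = cmod (w i - z i) * hnorm H x"
          using xV by (simp add: hnorm_smult norm_minus_commute)
        also have "\<dots> \<le> d * hnorm H x" using piece.hyps(4)[OF w i] xV by (intro mult_right_mono) simp_all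
        finally show ?thesis .
      qed
      then have "hnorm H (res j (scal z) x \<ominus>\<^bsub>H\<^esub> res j (scal w) x) \<le> C * (d * hnorm H x)"
        using xV d by (intro lip[OF j xV]) (simp_all add: mem_closed)
      moreover have "hnorm H (res j (scal z) x) \<le> hnorm H (res j (scal z) x \<ominus>\<^bsub>H\<^esub> res j (scal w) x) + hnorm H (res j (scal w) x)"
        using L xV Lw[OF j] by (intro hnorm_triangle_diff) simp_all
      ultimately have "d * hnorm H x \<le> hnorm H (res j (scal w) x)"
        using low[OF x] by (simp add: algebra_simps)
      also have "\<dots> \<le> (\<Sum>j\<in>J. hnorm H (res j (scal w) x))"
        by (rule member_le_sum[OF j]) (use Lw fin in simp_all)
      finally show ?thesis .
    qed
    then have "bad r Q" unfolding bad_def using r d by blast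
    then show False using piece.hyps(1) r(3) unfolding good_def by blast
  qed
  moreover have "0 \<le> (C + 1) * d" using C d by simp
  ultimately have up: "\<forall>x\<in>ran e. hnorm H (res j (scal z) x) \<le> (C + 1) * d * hnorm H x"
    using norm_dichotomy[OF L e] by blast
  have "res j Z x = res j (scal z) x"
    using piece.prems piece.hyps(5,6) ran_carrier[OF piece.prems]
    by (intro res_cong[OF j]) (simp_all add: scal_def)
  then show ?case using up piece.prems by simp
next
  case (glue e1 Z1 e2 Z2 e Z)
  have e12: "projection e1" "projection e2" "\<And>i. i \<in> I \<Longrightarrow> Z1 i \<in> M" "\<And>i. i \<in> I \<Longrightarrow> Z2 i \<in> M"
    using adapted_facts glue.hyps(1,2) by blast+
  have eq1: "res j Z x = res j Z1 x" if "x \<in> ran e1" for x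
    by (rule res_cong[OF j ran_carrier[OF that]])
      (use that glue.hyps(6,7) ran_carrier[OF that] mem_closed in blast)+
  have eq2: "res j Z x = res j Z2 x" if "x \<in> ran e2" for x
    by (rule res_cong[OF j ran_carrier[OF that]])
      (use that glue.hyps(6,8) ran_carrier[OF that] mem_closed in blast)+
  show ?case
  proof (rule glue_bound[OF res_mem[OF j] e12(1,2) glue.hyps(4,5)])
    show "0 \<le> (C + 1) * d" using C d by simp
    show "hnorm H (res j Z x) \<le> (C + 1) * d * hnorm H x" if "x \<in> ran e1" for x
      using glue.IH(1)[OF that] eq1[OF that] by simp
    show "hnorm H (res j Z x) \<le> (C + 1) * d * hnorm H x" if "x \<in> ran e2" for x
      using glue.IH(2)[OF that] eq2[OF that] by simp
  qed (use glue.hyps(6) glue.prems in blast)+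
qed

text \<open>On each piece the unknowns act as constants taken from \<open>K\<close>, so a quadratic
  identity valid on \<open>K\<close> holds exactly, and not only up to a small error.\<close>

lemma adapted_quadratic:
  assumes S: "finite S" "\<And>s. s \<in> S \<Longrightarrow> f s \<in> I" "\<And>s. s \<in> S \<Longrightarrow> g s \<in> I"
    and Kq: "\<And>z. z \<in> K \<Longrightarrow> (\<Sum>s\<in>S. z (f s) * z (g s)) = b"
    and ad: "adapted d e Z" and x: "x \<in> ran e"
  shows "finsum H (\<lambda>s. Z (f s) (Z (g s) x)) S = b \<odot>\<^bsub>H\<^esub> x"
  using ad x
proof (induction arbitrary: x rule: adapted.induct)
  case (null e Z)
  have "x = \<zero>\<^bsub>H\<^esub>" using null by simp
  moreover have "finsum H (\<lambda>s. Z (f s) (Z (g s) \<zero>\<^bsub>H\<^esub>)) S = finsum H (\<lambda>s. \<zero>\<^bsub>H\<^esub>) S"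
    using S null.hyps(3) by (intro vsum_cong) (simp_all add: mem_closed op_zero[OF bounded])
  ultimately show ?case using null.hyps(3) by simp
next
  case (piece e Q z Z)
  have xV: "x \<in> carrier H" by (rule ran_carrier[OF piece.prems])
  have eM: "e \<in> M" using piece.hyps(1) by (simp add: good_def)
  have t: "Z (f s) (Z (g s) x) = (z (f s) * z (g s)) \<odot>\<^bsub>H\<^esub> x" if "s \<in> S" for s
    using piece.hyps(6)[OF S(3)[OF that] piece.prems] piece.hyps(6)[OF S(2)[OF that] ran_smult[OF eM piece.prems]]
      xV by (simp add: smult_smult)
  have "finsum H (\<lambda>s. Z (f s) (Z (g s) x)) S = finsum H (\<lambda>s. (z (f s) * z (g s)) \<odot>\<^bsub>H\<^esub> x) S"
    using t xV by (intro vsum_cong) simp_all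
  also have "\<dots> = (\<Sum>s\<in>S. z (f s) * z (g s)) \<odot>\<^bsub>H\<^esub> x"
    using xV S(1) by (intro vec_eqI) (simp_all add: ip_vsum ip_smult sum_distrib_right)
  also have "(\<Sum>s\<in>S. z (f s) * z (g s)) = b" using Kq piece.hyps(2,3) by blast
  finally show ?case .
next
  case (glue e1 Z1 e2 Z2 e Z)
  have xV: "x \<in> carrier H" and ex: "e x = x" using glue.prems by (simp_all add: ran_def)
  have e12: "projection e1" "projection e2" "\<And>i. i \<in> I \<Longrightarrow> Z1 i \<in> M" "\<And>i. i \<in> I \<Longrightarrow> Z2 i \<in> M"
    using adapted_facts glue.hyps(1,2) by blast+
  define x1 x2 where "x1 = e1 x" and "x2 = e2 x"
  have r: "x1 \<in> ran e1" "x2 \<in> ran e2" unfolding x1_def x2_def using e12 xV by (simp_all add: projection_ran)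
  note V = ran_carrier[OF r(1)] ran_carrier[OF r(2)]
  have xx: "x = x1 \<oplus>\<^bsub>H\<^esub> x2" using glue.hyps(4)[OF xV] ex by (simp add: x1_def x2_def)
  have ZM: "Z (f s) \<in> M" "Z (g s) \<in> M" if "s \<in> S" for s using glue.hyps(6) S that by blast+
  have t1: "Z (f s) (Z (g s) x1) = Z1 (f s) (Z1 (g s) x1)" if s: "s \<in> S" for s
  proof -
    have "Z1 (g s) x1 \<in> ran e1" by (rule ran_invariant) (use e12 S s r in simp_all)
    then show ?thesis using glue.hyps(7) S s r by simp
  qed
  have t2: "Z (f s) (Z (g s) x2) = Z2 (f s) (Z2 (g s) x2)" if s: "s \<in> S" for s
  proof -
    have "Z2 (g s) x2 \<in> ran e2" by (rule ran_invariant) (use e12 S s r in simp_all)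
    then show ?thesis using glue.hyps(8) S s r by simp
  qed
  have V1: "Z1 (f s) (Z1 (g s) x1) \<in> carrier H" "Z2 (f s) (Z2 (g s) x2) \<in> carrier H" if "s \<in> S" for s
    using e12 S that V by simp_all
  have "finsum H (\<lambda>s. Z (f s) (Z (g s) x)) S =
     finsum H (\<lambda>s. Z1 (f s) (Z1 (g s) x1)) S \<oplus>\<^bsub>H\<^esub> finsum H (\<lambda>s. Z2 (f s) (Z2 (g s) x2)) S"
  proof (rule vec_eqI)
    fix y assume y: "y \<in> carrier H"
    have "ip H (Z (f s) (Z (g s) x)) y = ip H (Z1 (f s) (Z1 (g s) x1)) y + ip H (Z2 (f s) (Z2 (g s) x2)) y"
      if s: "s \<in> S" for s
      unfolding xx t1[OF s, symmetric] t2[OF s, symmetric] using ZM[OF s] V y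
      by (simp add: op_add[OF bounded] ip_add)
    then show "ip H (finsum H (\<lambda>s. Z (f s) (Z (g s) x)) S) y =
       ip H (finsum H (\<lambda>s. Z1 (f s) (Z1 (g s) x1)) S \<oplus>\<^bsub>H\<^esub> finsum H (\<lambda>s. Z2 (f s) (Z2 (g s) x2)) S) y"
      using ZM xV V1 y S(1) by (simp add: ip_vsum ip_add sum.distrib)
  qed (use ZM xV V1 in simp_all)
  also have "\<dots> = b \<odot>\<^bsub>H\<^esub> x1 \<oplus>\<^bsub>H\<^esub> b \<odot>\<^bsub>H\<^esub> x2" using glue.IH(1)[OF r(1)] glue.IH(2)[OF r(2)] by simp
  also have "\<dots> = b \<odot>\<^bsub>H\<^esub> x" unfolding xx using V by (intro vec_eqI) (simp_all add: ip_simps algebra_simps)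
  finally show ?case .
qed

end

section \<open>Refinement and solution of linear systems\<close>

context linear_system
begin

lemma K_cover:
  assumes "d > 0"
  shows "\<exists>C. finite C \<and> K \<subseteq> \<Union>C \<and> (\<forall>Q\<in>C. \<forall>w\<in>Q. \<forall>z\<in>Q. \<forall>i\<in>I. cmod (w i - z i) \<le> d)"
  by (rule bounded_set_finite_cover[OF fin(1) _ assms]) (rule K_bound)

text \<open>Unknowns given on two orthogonal pieces are joined by cutting with the two projections
  and adding.\<close>

lemma adapted_glue_exists:
  assumes e: "projection e" and ee: "\<And>x. x \<in> carrier H \<Longrightarrow> e x = e1 x \<oplus>\<^bsub>H\<^esub> e2 x"
    and o: "\<And>x. x \<in> carrier H \<Longrightarrow> e1 (e2 x) = \<zero>\<^bsub>H\<^esub>" and d: "d' \<ge> 0"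
    and ad: "adapted d e1 Z1" "adapted d e2 Z2" and Y: "\<And>i. i \<in> I \<Longrightarrow> Y i \<in> M"
    and le: "\<And>i x. i \<in> I \<Longrightarrow> x \<in> ran e1 \<Longrightarrow> hnorm H (Z1 i x \<ominus>\<^bsub>H\<^esub> Y i x) \<le> d' * hnorm H x"
      "\<And>i x. i \<in> I \<Longrightarrow> x \<in> ran e2 \<Longrightarrow> hnorm H (Z2 i x \<ominus>\<^bsub>H\<^esub> Y i x) \<le> d' * hnorm H x"
  shows "\<exists>Z. adapted d e Z \<and> (\<forall>i\<in>I. \<forall>x\<in>ran e. hnorm H (Z i x \<ominus>\<^bsub>H\<^esub> Y i x) \<le> d' * hnorm H x)"
proof -
  have p: "projection e1" "projection e2" and Z12: "\<And>i. i \<in> I \<Longrightarrow> Z1 i \<in> M" "\<And>i. i \<in> I \<Longrightarrow> Z2 i \<in> M"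
    using adapted_facts ad by blast+
  have M2: "e1 \<in> M" "e2 \<in> M" using p by simp_all
  have o': "e2 (e1 x) = \<zero>\<^bsub>H\<^esub>" if "x \<in> carrier H" for x
    using comm[OF M2(2,1) that] o[OF that] by simp
  define Z where "Z = (\<lambda>i. \<lambda>x\<in>carrier H. compose (carrier H) (Z1 i) e1 x \<oplus>\<^bsub>H\<^esub> compose (carrier H) (Z2 i) e2 x)"
  have ZM: "Z i \<in> M" if "i \<in> I" for i
    unfolding Z_def by (rule add_mem[OF compose_mem[OF Z12(1)[OF that] M2(1)] compose_mem[OF Z12(2)[OF that] M2(2)]])
  have Zv: "Z i x = Z1 i (e1 x) \<oplus>\<^bsub>H\<^esub> Z2 i (e2 x)" if "x \<in> carrier H" for i x
    using that by (simp add: Z_def compose_eq)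
  have Z1e: "Z i x = Z1 i x" if i: "i \<in> I" and x: "x \<in> ran e1" for i x
  proof -
    have xV: "x \<in> carrier H" and ex: "e1 x = x" using x by (simp_all add: ran_def)
    have "e2 x = \<zero>\<^bsub>H\<^esub>" using o'[OF xV] ex by simp
    then show ?thesis using xV ex Z12(1)[OF i] bounded[OF Z12(2)[OF i]] by (simp add: Zv)
  qed
  have Z2e: "Z i x = Z2 i x" if i: "i \<in> I" and x: "x \<in> ran e2" for i x
  proof -
    have xV: "x \<in> carrier H" and ex: "e2 x = x" using x by (simp_all add: ran_def)
    have "e1 x = \<zero>\<^bsub>H\<^esub>" using o[OF xV] ex by simp
    then show ?thesis using xV ex Z12(2)[OF i] bounded[OF Z12(1)[OF i]] by (simp add: Zv)
  qed
  have "adapted d e Z" by (rule adapted.glue[OF ad e ee o ZM Z1e Z2e])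
  moreover have "hnorm H (Z i x \<ominus>\<^bsub>H\<^esub> Y i x) \<le> d' * hnorm H x" if i: "i \<in> I" and x: "x \<in> ran e" for i x
  proof -
    define D where "D = (\<lambda>x\<in>carrier H. Z i x \<ominus>\<^bsub>H\<^esub> Y i x)"
    have DM: "D \<in> M" unfolding D_def by (rule diff_mem[OF ZM[OF i] Y[OF i]])
    have Dv: "D x = Z i x \<ominus>\<^bsub>H\<^esub> Y i x" if "x \<in> carrier H" for x using that by (simp add: D_def)
    have "hnorm H (D x) \<le> d' * hnorm H x"
    proof (rule glue_bound[OF DM p ee o d _ _ x])
      fix y assume y: "y \<in> ran e1"
      show "hnorm H (D y) \<le> d' * hnorm H y" using le(1)[OF i y] Z1e[OF i y] Dv[OF ran_carrier[OF y]] by simp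
    next
      fix y assume y: "y \<in> ran e2"
      show "hnorm H (D y) \<le> d' * hnorm H y" using le(2)[OF i y] Z2e[OF i y] Dv[OF ran_carrier[OF y]] by simp
    qed
    then show ?thesis using Dv[OF ran_carrier[OF x]] by simp
  qed
  ultimately show ?thesis by blast
qed

lemma adapted_null_exists:
  assumes e: "projection e" and r: "ran e = {\<zero>\<^bsub>H\<^esub>}" and Y: "\<And>i. i \<in> I \<Longrightarrow> Y i \<in> M"
  shows "\<exists>Z. adapted d e Z \<and> (\<forall>i\<in>I. \<forall>x\<in>ran e. hnorm H (Z i x \<ominus>\<^bsub>H\<^esub> Y i x) \<le> d' * hnorm H x)"
proof -
  have "adapted d e Y" using e r Y by (rule adapted.null)
  moreover have "hnorm H (Y i x \<ominus>\<^bsub>H\<^esub> Y i x) \<le> d' * hnorm H x" if "i \<in> I" "x \<in> ran e" for i x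
    using Y[OF that(1)] that(2) r by (simp add: op_zero[OF bounded])
  ultimately show ?thesis by blast
qed

text \<open>Every nonzero projection is vacuously bad for the empty set.\<close>

lemma good_empty:
  assumes "good e {}" shows "projection e" "ran e = {\<zero>\<^bsub>H\<^esub>}"
proof -
  show e: "projection e" using assms by (simp add: good_def)
  have "\<not> nonzero e"
  proof
    assume "nonzero e"
    then have "bad e {}" unfolding bad_def using e by (intro conjI exI[of _ 1]) simp_all
    then show False using assms unfolding good_def by blast
  qed
  then show "ran e = {\<zero>\<^bsub>H\<^esub>}" unfolding nonzero_def using ran_zero[OF projection_mem[OF e]] by blast
qed

text \<open>Induction on the cover: one member of the cover is split off at a time, together with
  the part of the projection that is good for it.\<close>

lemma adapted_refine_piece:
  assumes C: "finite C" and small: "\<And>B w z i. B \<in> C \<Longrightarrow> w \<in> B \<Longrightarrow> z \<in> B \<Longrightarrow> i \<in> I \<Longrightarrow> cmod (w i - z i) \<le> d"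
    and d: "d' \<ge> 0" and "good e Q" "Q \<subseteq> K" "Q \<subseteq> \<Union>C"
    and "\<And>w i. w \<in> Q \<Longrightarrow> i \<in> I \<Longrightarrow> cmod (w i - z i) \<le> d'"
  shows "\<exists>Z. adapted d e Z \<and> (\<forall>i\<in>I. \<forall>x\<in>ran e. hnorm H (Z i x \<ominus>\<^bsub>H\<^esub> scal z i x) \<le> d' * hnorm H x)"
  using C small assms(4-)
proof (induction C arbitrary: e Q rule: finite_induct)
  case empty
  then have "good e {}" by simp
  from good_empty[OF this] show ?case by (rule adapted_null_exists) simp
next
  case (insert B C)
  have "(Q \<inter> B) \<union> (Q - B) = Q" by blast
  then have "good e ((Q \<inter> B) \<union> (Q - B))" using insert.prems(2) by simp
  from good_split[OF this] obtain e1 e2 where g: "good e1 (Q \<inter> B)" "good e2 (Q - B)"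
    and ee: "\<And>x. x \<in> carrier H \<Longrightarrow> e x = e1 x \<oplus>\<^bsub>H\<^esub> e2 x" and o: "\<And>x. x \<in> carrier H \<Longrightarrow> e1 (e2 x) = \<zero>\<^bsub>H\<^esub>"
    by blast
  have e: "projection e" using insert.prems(2) by (simp add: good_def)
  have "\<exists>Z. adapted d e2 Z \<and> (\<forall>i\<in>I. \<forall>x\<in>ran e2. hnorm H (Z i x \<ominus>\<^bsub>H\<^esub> scal z i x) \<le> d' * hnorm H x)"
  proof (rule insert.IH[OF _ g(2)])
    show "cmod (w i - z i) \<le> d" if "B' \<in> C" "w \<in> B'" "z \<in> B'" "i \<in> I" for B' w z i
      using insert.prems(1)[of B' w z i] that by simp
    show "Q - B \<subseteq> K" "Q - B \<subseteq> \<Union>C" using insert.prems(3,4) by blast+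
    show "cmod (w i - z i) \<le> d'" if "w \<in> Q - B" "i \<in> I" for w i using insert.prems(5) that by blast
  qed
  then obtain Z2 where Z2: "adapted d e2 Z2"
    "\<And>i x. i \<in> I \<Longrightarrow> x \<in> ran e2 \<Longrightarrow> hnorm H (Z2 i x \<ominus>\<^bsub>H\<^esub> scal z i x) \<le> d' * hnorm H x" by blast
  have "\<exists>Z. adapted d e1 Z \<and> (\<forall>i\<in>I. \<forall>x\<in>ran e1. hnorm H (Z i x \<ominus>\<^bsub>H\<^esub> scal z i x) \<le> d' * hnorm H x)"
  proof (cases "Q \<inter> B = {}")
    case True
    then have "good e1 {}" using g(1) by simp
    from good_empty[OF this] show ?thesis by (rule adapted_null_exists) simp
  next
    case False
    then obtain w where w: "w \<in> Q" "w \<in> B" by blast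
    have "adapted d e1 (scal w)"
    proof (rule adapted.piece[OF g(1)])
      show "Q \<inter> B \<subseteq> K" using insert.prems(3) by blast
      show "w \<in> Q \<inter> B" using w by simp
      show "cmod (v i - w i) \<le> d" if "v \<in> Q \<inter> B" "i \<in> I" for v i
        using insert.prems(1)[of B v w i] that w by simp
      show "scal w i x = w i \<odot>\<^bsub>H\<^esub> x" if "x \<in> ran e1" for i x using ran_carrier[OF that] by (simp add: scal_def)
    qed simp
    moreover have "hnorm H (scal w i x \<ominus>\<^bsub>H\<^esub> scal z i x) \<le> d' * hnorm H x" if i: "i \<in> I" and x: "x \<in> ran e1" for i x
    proof -
      have xV: "x \<in> carrier H" by (rule ran_carrier[OF x])
      have "scal w i x \<ominus>\<^bsub>H\<^esub> scal z i x = (w i - z i) \<odot>\<^bsub>H\<^esub> x"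
        using xV by (intro vec_eqI) (simp_all add: scal_def ip_simps algebra_simps)
      then have "hnorm H (scal w i x \<ominus>\<^bsub>H\<^esub> scal z i x) = cmod (w i - z i) * hnorm H x" using xV by (simp add: hnorm_smult)
      also have "\<dots> \<le> d' * hnorm H x" using insert.prems(5)[OF w(1) i] xV by (intro mult_right_mono) simp_all
      finally show ?thesis .
    qed
    ultimately show ?thesis by blast
  qed
  then obtain Z1 where Z1: "adapted d e1 Z1"
    "\<And>i x. i \<in> I \<Longrightarrow> x \<in> ran e1 \<Longrightarrow> hnorm H (Z1 i x \<ominus>\<^bsub>H\<^esub> scal z i x) \<le> d' * hnorm H x" by blast
  show ?case by (rule adapted_glue_exists[OF e ee o d Z1(1) Z2(1) scal_mem Z1(2) Z2(2)])
qed

text \<open>Refinement moves the constants only within the old pieces, so the new unknowns differ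
  from the old ones by at most the old mesh. Halving the mesh therefore makes the successive
  solutions norm Cauchy.\<close>

lemma adapted_refine:
  assumes ad: "adapted d e Z" and d: "d \<ge> 0" and d': "d' > 0"
  shows "\<exists>Z'. adapted d' e Z' \<and> (\<forall>i\<in>I. \<forall>x\<in>ran e. hnorm H (Z' i x \<ominus>\<^bsub>H\<^esub> Z i x) \<le> d * hnorm H x)"
  using ad
proof (induction rule: adapted.induct)
  case (null e Z)
  then show ?case by (rule adapted_null_exists)
next
  case (piece e Q z Z)
  have zK: "z \<in> K" using piece.hyps(2,3) by blast
  obtain C where C: "finite C" "K \<subseteq> \<Union>C" "\<forall>B\<in>C. \<forall>w\<in>B. \<forall>z\<in>B. \<forall>i\<in>I. cmod (w i - z i) \<le> d'"
    using K_cover[OF d'] by blast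
  have "\<exists>Z'. adapted d' e Z' \<and> (\<forall>i\<in>I. \<forall>x\<in>ran e. hnorm H (Z' i x \<ominus>\<^bsub>H\<^esub> scal z i x) \<le> d * hnorm H x)"
  proof (rule adapted_refine_piece[OF C(1) _ d piece.hyps(1,2)])
    show "Q \<subseteq> \<Union>C" using piece.hyps(2) C(2) by blast
    show "cmod (w i - z i) \<le> d'" if "B \<in> C" "w \<in> B" "z \<in> B" "i \<in> I" for B w z i using C(3) that by blast
  qed (rule piece.hyps(4))
  then obtain Z' where Z': "adapted d' e Z'"
    and le: "\<forall>i\<in>I. \<forall>x\<in>ran e. hnorm H (Z' i x \<ominus>\<^bsub>H\<^esub> scal z i x) \<le> d * hnorm H x" by blast
  have "scal z i x = Z i x" if "i \<in> I" "x \<in> ran e" for i x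
    using piece.hyps(6)[OF that] ran_carrier[OF that(2)] by (simp add: scal_def)
  then show ?case using Z' le by (intro exI[of _ Z']) simp
next
  case (glue e1 Z1 e2 Z2 e Z)
  obtain Z1' where Z1': "adapted d' e1 Z1'"
    "\<And>i x. i \<in> I \<Longrightarrow> x \<in> ran e1 \<Longrightarrow> hnorm H (Z1' i x \<ominus>\<^bsub>H\<^esub> Z1 i x) \<le> d * hnorm H x" using glue.IH(1) by blast
  obtain Z2' where Z2': "adapted d' e2 Z2'"
    "\<And>i x. i \<in> I \<Longrightarrow> x \<in> ran e2 \<Longrightarrow> hnorm H (Z2' i x \<ominus>\<^bsub>H\<^esub> Z2 i x) \<le> d * hnorm H x" using glue.IH(2) by blast
  show ?case
  proof (rule adapted_glue_exists[OF glue.hyps(3,4,5) d Z1'(1) Z2'(1) glue.hyps(6)])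
    show "hnorm H (Z1' i x \<ominus>\<^bsub>H\<^esub> Z i x) \<le> d * hnorm H x" if "i \<in> I" "x \<in> ran e1" for i x
      using Z1'(2)[OF that] glue.hyps(7)[OF that] by simp
    show "hnorm H (Z2' i x \<ominus>\<^bsub>H\<^esub> Z i x) \<le> d * hnorm H x" if "i \<in> I" "x \<in> ran e2" for i x
      using Z2'(2)[OF that] glue.hyps(8)[OF that] by simp
  qed
qed

text \<open>On the range of a bad projection, unit vectors can be chosen that are asymptotic joint
  eigenvectors of the coefficients. A tuple of \<open>K\<close> that solves the system for their eigenvalues makes
  the residuals along these vectors tend to zero.\<close>

lemma not_bad_K:
  assumes F: "finite F" "F \<subseteq> M" "\<And>j t. j \<in> J \<Longrightarrow> t \<in> T \<Longrightarrow> \<alpha> j t \<in> F"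
    and pw: "\<And>u ev. (\<And>k. u k \<in> carrier H) \<Longrightarrow> (\<And>k. hnorm H (u k) = 1) \<Longrightarrow> (\<And>a. a \<in> F \<Longrightarrow> asymp_eigen u a (ev a)) \<Longrightarrow>
      \<exists>z\<in>K. \<forall>j\<in>J. (\<Sum>t\<in>T. ev (\<alpha> j t) * z (\<kappa> j t)) = 0"
  shows "\<not> bad r K"
proof
  assume "bad r K"
  then obtain e where r: "projection r" "nonzero r" and e: "e > 0"
    and low: "\<And>z x. z \<in> K \<Longrightarrow> x \<in> ran r \<Longrightarrow> e * hnorm H x \<le> (\<Sum>j\<in>J. hnorm H (res j (scal z) x))"
    unfolding bad_def by blast
  obtain u ev where u: "\<forall>k. u k \<in> ran r \<and> hnorm H (u k) = 1" and ev: "\<forall>a\<in>F. asymp_eigen u a (ev a)"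
    using asymp_eigen_exists[OF F(1,2) r] by blast
  have uV: "u k \<in> carrier H" and u1: "hnorm H (u k) = 1" and ur: "u k \<in> ran r" for k using u ran_carrier by blast+
  obtain z where z: "z \<in> K" "\<forall>j\<in>J. (\<Sum>t\<in>T. ev (\<alpha> j t) * z (\<kappa> j t)) = 0"
    using pw[of u ev, OF uV u1] ev by blast
  have lim: "(\<lambda>k. hnorm H (res j (scal z) (u k))) \<longlonglongrightarrow> 0" if j: "j \<in> J" for j
  proof (rule null_sequence_comparison)
    fix k
    let ?d = "\<lambda>t. \<alpha> j t (u k) \<ominus>\<^bsub>H\<^esub> ev (\<alpha> j t) \<odot>\<^bsub>H\<^esub> u k"
    have aM: "\<alpha> j t \<in> M" if "t \<in> T" for t using \<alpha>M[OF j that] .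
    have dV: "?d t \<in> carrier H" if "t \<in> T" for t using aM[OF that] uV by simp
    have "res j (scal z) (u k) = finsum H (\<lambda>t. z (\<kappa> j t) \<odot>\<^bsub>H\<^esub> ?d t) T"
    proof (rule vec_eqI)
      show "res j (scal z) (u k) \<in> carrier H" by (rule mem_closed[OF res_mem[OF j scal_mem] uV])
      show "finsum H (\<lambda>t. z (\<kappa> j t) \<odot>\<^bsub>H\<^esub> ?d t) T \<in> carrier H" using dV by (intro vsum_closed vsmult)
      fix y assume y: "y \<in> carrier H"
      have "ip H (res j (scal z) (u k)) y = (\<Sum>t\<in>T. z (\<kappa> j t) * ip H (\<alpha> j t (u k)) y)"
        using uV aM y fin(3) by (simp add: res_def scal_def ip_vsum op_smult[OF bounded] ip_smult)
      also have "\<dots> = (\<Sum>t\<in>T. z (\<kappa> j t) * ip H (\<alpha> j t (u k)) y) - (\<Sum>t\<in>T. ev (\<alpha> j t) * z (\<kappa> j t)) * ip H (u k) y"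
        using z(2) j by simp
      also have "\<dots> = (\<Sum>t\<in>T. z (\<kappa> j t) * (ip H (\<alpha> j t (u k)) y - ev (\<alpha> j t) * ip H (u k) y))"
      proof -
        have "(\<Sum>t\<in>T. ev (\<alpha> j t) * z (\<kappa> j t)) * ip H (u k) y = (\<Sum>t\<in>T. z (\<kappa> j t) * (ev (\<alpha> j t) * ip H (u k) y))"
          unfolding sum_distrib_right by (intro sum.cong) (simp_all add: mult_ac)
        then show ?thesis by (simp add: right_diff_distrib sum_subtractf)
      qed
      also have "\<dots> = ip H (finsum H (\<lambda>t. z (\<kappa> j t) \<odot>\<^bsub>H\<^esub> ?d t) T) y"
        using uV aM y fin(3) by (simp add: ip_vsum ip_smult ip_diff)
      finally show "ip H (res j (scal z) (u k)) y = ip H (finsum H (\<lambda>t. z (\<kappa> j t) \<odot>\<^bsub>H\<^esub> ?d t) T) y" .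
    qed
    then have "hnorm H (res j (scal z) (u k)) \<le> (\<Sum>t\<in>T. cmod (z (\<kappa> j t)) * hnorm H (?d t))"
      using hnorm_vsum[OF fin(3), of "\<lambda>t. z (\<kappa> j t) \<odot>\<^bsub>H\<^esub> ?d t"] dV by (simp add: hnorm_smult)
    moreover have "0 \<le> hnorm H (res j (scal z) (u k))"
      by (rule hnorm_nonneg[OF mem_closed[OF res_mem[OF j scal_mem] uV]])
    ultimately show "norm (hnorm H (res j (scal z) (u k))) \<le> (\<Sum>t\<in>T. cmod (z (\<kappa> j t)) * hnorm H (?d t))"
      by simp
  next
    have "(\<lambda>k. hnorm H (\<alpha> j t (u k) \<ominus>\<^bsub>H\<^esub> ev (\<alpha> j t) \<odot>\<^bsub>H\<^esub> u k)) \<longlonglongrightarrow> 0" if "t \<in> T" for t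
      using ev F(3)[OF j that] unfolding asymp_eigen_def by blast
    then have "(\<lambda>k. \<Sum>t\<in>T. cmod (z (\<kappa> j t)) * hnorm H (\<alpha> j t (u k) \<ominus>\<^bsub>H\<^esub> ev (\<alpha> j t) \<odot>\<^bsub>H\<^esub> u k)) \<longlonglongrightarrow> (\<Sum>t\<in>T. 0)"
      by (intro tendsto_sum tendsto_mult_right_zero)
    then show "(\<lambda>k. \<Sum>t\<in>T. cmod (z (\<kappa> j t)) * hnorm H (\<alpha> j t (u k) \<ominus>\<^bsub>H\<^esub> ev (\<alpha> j t) \<odot>\<^bsub>H\<^esub> u k)) \<longlonglongrightarrow> 0"
      by simp
  qed
  then have sl: "(\<lambda>k. \<Sum>j\<in>J. hnorm H (res j (scal z) (u k))) \<longlonglongrightarrow> (\<Sum>j\<in>J. 0)"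
    by (rule tendsto_sum)
  have el: "e \<le> (\<Sum>j\<in>J. hnorm H (res j (scal z) (u k)))" for k
    using low[OF z(1) ur, of k] u1 by simp
  have "e \<le> (\<Sum>j\<in>J. 0)" by (rule LIMSEQ_le_const[OF sl]) (use el in blast)
  then show False using e by simp
qed

text \<open>The limit of a sequence of refinements with mesh \<open>(1/2)^n\<close>. The linear
  residuals tend to zero with the mesh, and the quadratic identities hold for every member of the
  sequence.\<close>

theorem linear_system_solution:
  assumes F: "finite F" "F \<subseteq> M" "\<And>j t. j \<in> J \<Longrightarrow> t \<in> T \<Longrightarrow> \<alpha> j t \<in> F"
    and pw: "\<And>u ev. (\<And>k. u k \<in> carrier H) \<Longrightarrow> (\<And>k. hnorm H (u k) = 1) \<Longrightarrow> (\<And>a. a \<in> F \<Longrightarrow> asymp_eigen u a (ev a)) \<Longrightarrow>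
      \<exists>z\<in>K. \<forall>j\<in>J. (\<Sum>t\<in>T. ev (\<alpha> j t) * z (\<kappa> j t)) = 0"
  shows "\<exists>Z. (\<forall>i\<in>I. Z i \<in> M) \<and> (\<forall>j\<in>J. \<forall>x\<in>carrier H. finsum H (\<lambda>t. \<alpha> j t (Z (\<kappa> j t) x)) T = \<zero>\<^bsub>H\<^esub>) \<and>
    (\<forall>S f g b. finite S \<longrightarrow> f ` S \<subseteq> I \<longrightarrow> g ` S \<subseteq> I \<longrightarrow> (\<forall>z\<in>K. (\<Sum>s\<in>S. z (f s) * z (g s)) = b) \<longrightarrow>
      (\<forall>x\<in>carrier H. finsum H (\<lambda>s::nat. Z (f s) (Z (g s) x)) S = b \<odot>\<^bsub>H\<^esub> x))"
proof -
  define one where "one = (\<lambda>x\<in>carrier H. x)"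
  have one: "projection one" unfolding projection_def one_def by (simp add: one_mem)
  have r1: "ran one = carrier H" by (simp add: ran_def one_def)
  have "\<not> bad r K" for r
  proof (rule not_bad_K[OF F(1,2)])
    show "\<alpha> j t \<in> F" if "j \<in> J" "t \<in> T" for j t using that by (rule F(3))
    fix u ev assume "\<And>k. u k \<in> carrier H" "\<And>k. hnorm H (u k) = 1" "\<And>a. a \<in> F \<Longrightarrow> asymp_eigen u a (ev a)"
    then show "\<exists>z\<in>K. \<forall>j\<in>J. (\<Sum>t\<in>T. ev (\<alpha> j t) * z (\<kappa> j t)) = 0" by (rule pw)
  qed
  then have good1: "good one K" unfolding good_def using one by blast
  have Z0: "\<exists>Z. adapted 1 one Z"
  proof -
    have e01: "(0::real) < 1" by simp
    obtain C where C: "finite C" "K \<subseteq> \<Union>C" "\<forall>B\<in>C. \<forall>w\<in>B. \<forall>z\<in>B. \<forall>i\<in>I. cmod (w i - z i) \<le> 1"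
      using K_cover[OF e01] by blast
    have "\<exists>Z. adapted 1 one Z \<and> (\<forall>i\<in>I. \<forall>x\<in>ran one. hnorm H (Z i x \<ominus>\<^bsub>H\<^esub> scal (\<lambda>_. 0) i x) \<le> \<bar>c\<bar> * hnorm H x)"
    proof (rule adapted_refine_piece[OF C(1) _ abs_ge_zero good1 order_refl C(2)])
      show "cmod (w i - z i) \<le> 1" if "B \<in> C" "w \<in> B" "z \<in> B" "i \<in> I" for B w z i using C(3) that by blast
      show "cmod (w i - 0) \<le> \<bar>c\<bar>" if "w \<in> K" "i \<in> I" for w i using K_bound[OF that] by simp
    qed
    then show ?thesis by blast
  qed
  have "\<exists>Z. \<forall>n. adapted ((1/2)^n) one (Z n) \<and>
      (\<forall>i\<in>I. \<forall>x\<in>ran one. hnorm H (Z (Suc n) i x \<ominus>\<^bsub>H\<^esub> Z n i x) \<le> (1/2)^n * hnorm H x)"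
  proof (rule dependent_nat_choice)
    show "\<exists>Z. adapted ((1/2)^0) one Z" using Z0 by simp
    fix Z n assume "adapted ((1/2)^n) one Z"
    then show "\<exists>Z'. adapted ((1/2)^Suc n) one Z' \<and> (\<forall>i\<in>I. \<forall>x\<in>ran one. hnorm H (Z' i x \<ominus>\<^bsub>H\<^esub> Z i x) \<le> (1/2)^n * hnorm H x)"
      by (rule adapted_refine) simp_all
  qed
  then obtain Z where "\<forall>n. adapted ((1/2)^n) one (Z n) \<and>
      (\<forall>i\<in>I. \<forall>x\<in>carrier H. hnorm H (Z (Suc n) i x \<ominus>\<^bsub>H\<^esub> Z n i x) \<le> (1/2)^n * hnorm H x)"
    unfolding r1 ..
  then have ad: "\<And>n. adapted ((1/2)^n) one (Z n)"
    and Zstep: "\<And>n i x. i \<in> I \<Longrightarrow> x \<in> carrier H \<Longrightarrow> hnorm H (Z (Suc n) i x \<ominus>\<^bsub>H\<^esub> Z n i x) \<le> (1/2)^n * hnorm H x"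
    by blast+
  have ZM: "Z n i \<in> M" if "i \<in> I" for n i using adapted_facts(2)[OF ad that] .
  define f where "f = (\<lambda>n. 2 * (1/2)^n :: real)"
  have f0: "f \<longlonglongrightarrow> 0"
    unfolding f_def using tendsto_mult_right_zero[OF LIMSEQ_realpow_zero[of "1/2"], of 2] by simp
  have fnn: "0 \<le> f n" for n by (simp add: f_def)
  have cau: "hnorm H (Z m i x \<ominus>\<^bsub>H\<^esub> Z n i x) \<le> f n * hnorm H x" if i: "i \<in> I" and nm: "n \<le> m" and x: "x \<in> carrier H" for i n m x
  proof -
    have "hnorm H (Z m i x \<ominus>\<^bsub>H\<^esub> Z n i x) \<le> (f n - f m) * hnorm H x" using nm
    proof (induction m rule: dec_induct)
      case base then show ?case using ZM[OF i, of n] x by simp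
    next
      case (step m)
      have "hnorm H (Z (Suc m) i x \<ominus>\<^bsub>H\<^esub> Z n i x) \<le> hnorm H (Z (Suc m) i x \<ominus>\<^bsub>H\<^esub> Z m i x) + hnorm H (Z m i x \<ominus>\<^bsub>H\<^esub> Z n i x)"
        by (rule hnorm_triangle_via) (use ZM[OF i] x in simp_all)
      moreover have "hnorm H (Z (Suc m) i x \<ominus>\<^bsub>H\<^esub> Z m i x) \<le> (f m - f (Suc m)) * hnorm H x"
        using Zstep[OF i x, of m]
        by (simp add: f_def)
      ultimately show ?case using step.IH by (simp add: algebra_simps)
    qed
    also have "\<dots> \<le> f n * hnorm H x" using fnn[of m] x by (intro mult_right_mono) simp_all
    finally show ?thesis .
  qed
  have "\<exists>L\<in>M. \<forall>n. \<forall>x\<in>carrier H. hnorm H (L x \<ominus>\<^bsub>H\<^esub> Z n i x) \<le> f n * hnorm H x" if i: "i \<in> I" for i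
    using norm_limit[of "\<lambda>n. Z n i", OF ZM[OF i] f0 cau[OF i]] by blast
  then have "\<forall>i\<in>I. \<exists>L. L \<in> M \<and> (\<forall>n. \<forall>x\<in>carrier H. hnorm H (L x \<ominus>\<^bsub>H\<^esub> Z n i x) \<le> f n * hnorm H x)" by blast
  from bchoice[OF this] obtain L where LL: "\<forall>i\<in>I. L i \<in> M \<and> (\<forall>n. \<forall>x\<in>carrier H. hnorm H (L i x \<ominus>\<^bsub>H\<^esub> Z n i x) \<le> f n * hnorm H x)" ..
  have LM: "\<And>i. i \<in> I \<Longrightarrow> L i \<in> M"
    and L: "\<And>i n x. i \<in> I \<Longrightarrow> x \<in> carrier H \<Longrightarrow> hnorm H (L i x \<ominus>\<^bsub>H\<^esub> Z n i x) \<le> f n * hnorm H x"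
    using LL by blast+
  obtain C where C: "C > 0" and lip0: "\<forall>j\<in>J. \<forall>x\<in>carrier H. \<forall>Z Z' d. 0 \<le> d \<longrightarrow> (\<forall>i\<in>I. Z i x \<in> carrier H \<and> Z' i x \<in> carrier H \<and>
      hnorm H (Z i x \<ominus>\<^bsub>H\<^esub> Z' i x) \<le> d) \<longrightarrow> hnorm H (res j Z x \<ominus>\<^bsub>H\<^esub> res j Z' x) \<le> C * d"
    using res_lipschitz by (elim exE conjE)
  have lip: "\<And>j x Z Z' d. j \<in> J \<Longrightarrow> x \<in> carrier H \<Longrightarrow> 0 \<le> d \<Longrightarrow> \<forall>i\<in>I. Z i x \<in> carrier H \<and> Z' i x \<in> carrier H \<and>
      hnorm H (Z i x \<ominus>\<^bsub>H\<^esub> Z' i x) \<le> d \<Longrightarrow> hnorm H (res j Z x \<ominus>\<^bsub>H\<^esub> res j Z' x) \<le> C * d"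
    by (rule lip0[THEN bspec, THEN bspec, THEN spec, THEN spec, THEN spec, THEN mp, THEN mp])
  have zeroI: "v = \<zero>\<^bsub>H\<^esub>" if v: "v \<in> carrier H" and le: "\<And>n. hnorm H v \<le> f n * B" for v B
  proof -
    have "(\<lambda>n. f n * B) \<longlonglongrightarrow> 0" using f0 by (rule tendsto_mult_left_zero)
    then have "hnorm H v \<le> 0" by (rule LIMSEQ_le_const) (use le in blast)
    then show ?thesis using hnorm_pos[OF v] by (cases "v = \<zero>\<^bsub>H\<^esub>") simp_all
  qed
  have "finsum H (\<lambda>t. \<alpha> j t (L (\<kappa> j t) x)) T = \<zero>\<^bsub>H\<^esub>" if j: "j \<in> J" and x: "x \<in> carrier H" for j x
  proof -
    have rc: "res j L x \<in> carrier H" "\<And>n. res j (Z n) x \<in> carrier H"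
      by (rule mem_closed[OF res_mem[OF j] x], erule LM) (rule mem_closed[OF res_mem[OF j] x], erule ZM)
    have "res j L x = \<zero>\<^bsub>H\<^esub>"
    proof (rule zeroI[of "res j L x" "(2 * C + 1) * hnorm H x"])
      fix n
      have "hnorm H (res j L x \<ominus>\<^bsub>H\<^esub> res j (Z n) x) \<le> C * (f n * hnorm H x)"
        using L LM ZM x fnn by (intro lip[OF j x]) simp_all
      moreover have "hnorm H (res j (Z n) x) \<le> (C + 1) * (1/2)^n * hnorm H x"
        by (rule adapted_residual[OF C lip _ j ad]) (use x r1 in simp_all)
      moreover have "hnorm H (res j L x) \<le> hnorm H (res j L x \<ominus>\<^bsub>H\<^esub> res j (Z n) x) + hnorm H (res j (Z n) x)"
        using rc by (intro hnorm_triangle_diff)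
      moreover have "(C + 1) * (1/2)^n * hnorm H x \<le> (C + 1) * f n * hnorm H x"
        using C x by (intro mult_right_mono mult_left_mono) (simp_all add: f_def)
      ultimately have "hnorm H (res j L x) \<le> C * (f n * hnorm H x) + (C + 1) * f n * hnorm H x" by linarith
      then show "hnorm H (res j L x) \<le> f n * ((2 * C + 1) * hnorm H x)" by (simp add: algebra_simps)
    qed (rule rc)
    then show ?thesis using x by (simp add: res_def)
  qed
  then have c1: "\<forall>j\<in>J. \<forall>x\<in>carrier H. finsum H (\<lambda>t. \<alpha> j t (L (\<kappa> j t) x)) T = \<zero>\<^bsub>H\<^esub>" by blast
  have c2: "finsum H (\<lambda>s. L (h s) (L (g s) x)) S = b \<odot>\<^bsub>H\<^esub> x"
    if S: "finite S" "h ` S \<subseteq> I" "g ` S \<subseteq> I" and q: "\<forall>z\<in>K. (\<Sum>s\<in>S. z (h s) * z (g s)) = b" and x: "x \<in> carrier H"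
    for S :: "nat set" and h g b x
  proof -
    have hI: "h s \<in> I" "g s \<in> I" if "s \<in> S" for s using S that by blast+
    have "\<forall>i\<in>I. \<exists>B. B > 0 \<and> (\<forall>x\<in>carrier H. hnorm H (L i x) \<le> B * hnorm H x)"
      using op_bound[OF bounded[OF LM]] by blast
    from bchoice[OF this] obtain B where BB: "\<forall>i\<in>I. B i > 0 \<and> (\<forall>x\<in>carrier H. hnorm H (L i x) \<le> B i * hnorm H x)" ..
    have B: "\<And>i. i \<in> I \<Longrightarrow> B i > 0" "\<And>i x. i \<in> I \<Longrightarrow> x \<in> carrier H \<Longrightarrow> hnorm H (L i x) \<le> B i * hnorm H x"
      using BB by blast+
    have Lc: "L (h s) (L (g s) x) \<in> carrier H" "Z n (h s) (Z n (g s) x) \<in> carrier H" "L (g s) x \<in> carrier H" "Z n (g s) x \<in> carrier H"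
      "L (h s) (Z n (g s) x) \<in> carrier H"
      if "s \<in> S" for s n using LM ZM hI[OF that] x by simp_all
    have fc: "finsum H (\<lambda>s. L (h s) (L (g s) x)) S \<in> carrier H" "b \<odot>\<^bsub>H\<^esub> x \<in> carrier H" using Lc x by simp_all
    have t: "hnorm H (L (h s) (L (g s) x) \<ominus>\<^bsub>H\<^esub> Z n (h s) (Z n (g s) x)) \<le> f n * ((B (h s) + B (g s) + 2) * hnorm H x)"
      if s: "s \<in> S" for s n
    proof -
      have z1: "hnorm H (Z n (g s) x) \<le> (B (g s) + 2) * hnorm H x"
      proof -
        have "hnorm H (Z n (g s) x) \<le> hnorm H (Z n (g s) x \<ominus>\<^bsub>H\<^esub> L (g s) x) + hnorm H (L (g s) x)"
          using Lc[OF s] by (intro hnorm_triangle_diff)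
        moreover have "hnorm H (Z n (g s) x \<ominus>\<^bsub>H\<^esub> L (g s) x) \<le> f n * hnorm H x"
          using L[OF hI(2)[OF s] x, of n] hnorm_minus_commute[OF Lc(4)[OF s, of n] Lc(3)[OF s]] by simp
        moreover have "f n * hnorm H x \<le> 2 * hnorm H x"
          using x by (intro mult_right_mono) (simp_all add: f_def power_le_one)
        ultimately show ?thesis using B(2)[OF hI(2)[OF s] x] by (simp add: algebra_simps)
      qed
      have "hnorm H (L (h s) (L (g s) x) \<ominus>\<^bsub>H\<^esub> L (h s) (Z n (g s) x)) = hnorm H (L (h s) (L (g s) x \<ominus>\<^bsub>H\<^esub> Z n (g s) x))"
        using Lc[OF s] LM[OF hI(1)[OF s]] by (simp add: op_diff[OF bounded])
      also have "\<dots> \<le> B (h s) * hnorm H (L (g s) x \<ominus>\<^bsub>H\<^esub> Z n (g s) x)" using B(2)[OF hI(1)[OF s]] Lc[OF s] by simp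
      also have "\<dots> \<le> B (h s) * (f n * hnorm H x)"
        using L[OF hI(2)[OF s] x] B(1)[OF hI(1)[OF s]] by (intro mult_left_mono) simp_all
      finally have a: "hnorm H (L (h s) (L (g s) x) \<ominus>\<^bsub>H\<^esub> L (h s) (Z n (g s) x)) \<le> B (h s) * (f n * hnorm H x)" .
      have "hnorm H (L (h s) (Z n (g s) x) \<ominus>\<^bsub>H\<^esub> Z n (h s) (Z n (g s) x)) \<le> f n * hnorm H (Z n (g s) x)"
        using L[OF hI(1)[OF s] Lc(4)[OF s]] .
      also have "\<dots> \<le> f n * ((B (g s) + 2) * hnorm H x)" using z1 fnn by (intro mult_left_mono)
      finally have b: "hnorm H (L (h s) (Z n (g s) x) \<ominus>\<^bsub>H\<^esub> Z n (h s) (Z n (g s) x)) \<le> f n * ((B (g s) + 2) * hnorm H x)" .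
      have "hnorm H (L (h s) (L (g s) x) \<ominus>\<^bsub>H\<^esub> Z n (h s) (Z n (g s) x)) \<le>
         hnorm H (L (h s) (L (g s) x) \<ominus>\<^bsub>H\<^esub> L (h s) (Z n (g s) x)) + hnorm H (L (h s) (Z n (g s) x) \<ominus>\<^bsub>H\<^esub> Z n (h s) (Z n (g s) x))"
        using Lc[OF s] by (intro hnorm_triangle_via)
      then show ?thesis using a b by (simp add: algebra_simps)
    qed
    have Zq: "finsum H (\<lambda>s. Z n (h s) (Z n (g s) x)) S = b \<odot>\<^bsub>H\<^esub> x" for n
      by (rule adapted_quadratic[OF S(1) hI _ ad]) (use q x r1 in simp_all)
    have "finsum H (\<lambda>s. L (h s) (L (g s) x)) S \<ominus>\<^bsub>H\<^esub> b \<odot>\<^bsub>H\<^esub> x = \<zero>\<^bsub>H\<^esub>"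
    proof (rule zeroI[of _ "\<Sum>s\<in>S. (B (h s) + B (g s) + 2) * hnorm H x"])
      fix n
      let ?d = "\<lambda>s. L (h s) (L (g s) x) \<ominus>\<^bsub>H\<^esub> Z n (h s) (Z n (g s) x)"
      have "finsum H (\<lambda>s. L (h s) (L (g s) x)) S \<ominus>\<^bsub>H\<^esub> b \<odot>\<^bsub>H\<^esub> x = finsum H ?d S"
        unfolding Zq[of n, symmetric] using Lc S(1)
        by (intro vec_eqI) (simp_all add: ip_vsum ip_diff sum_subtractf)
      then have "hnorm H (finsum H (\<lambda>s. L (h s) (L (g s) x)) S \<ominus>\<^bsub>H\<^esub> b \<odot>\<^bsub>H\<^esub> x) \<le> (\<Sum>s\<in>S. hnorm H (?d s))"
        using hnorm_vsum[OF S(1), of ?d] Lc by simp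
      also have "\<dots> \<le> (\<Sum>s\<in>S. f n * ((B (h s) + B (g s) + 2) * hnorm H x))" by (intro sum_mono t)
      finally show "hnorm H (finsum H (\<lambda>s. L (h s) (L (g s) x)) S \<ominus>\<^bsub>H\<^esub> b \<odot>\<^bsub>H\<^esub> x) \<le> f n * (\<Sum>s\<in>S. (B (h s) + B (g s) + 2) * hnorm H x)"
        by (simp add: sum_distrib_left)
    qed (use fc in simp)
    then show ?thesis using fc by (simp add: diff_zero_iff)
  qed
  show ?thesis
  proof (rule exI[of _ L], intro conjI)
    show "\<forall>i\<in>I. L i \<in> M" using LM by (rule ballI)
    show "\<forall>S h g b. finite S \<longrightarrow> h ` S \<subseteq> I \<longrightarrow> g ` S \<subseteq> I \<longrightarrow> (\<forall>z\<in>K. (\<Sum>s\<in>S. z (h s) * z (g s)) = b) \<longrightarrow>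
      (\<forall>x\<in>carrier H. finsum H (\<lambda>s::nat. L (h s) (L (g s) x)) S = b \<odot>\<^bsub>H\<^esub> x)"
      by (intro allI impI ballI) (rule c2)
  qed (rule c1)
qed

end

section \<open>Matrices over a ring and similarity of doubled elements\<close>

lemma mat_alg_carrier:
  "A \<in> carrier (mat_alg n R) \<longleftrightarrow> A \<in> carrier_mat n n \<and> (\<forall>i<n. \<forall>j<n. A $$ (i, j) \<in> carrier R)"
  by (simp add: mat_alg_def)

lemma mat_alg_carrierI: "(\<And>i j. i < n \<Longrightarrow> j < n \<Longrightarrow> f i j \<in> carrier R) \<Longrightarrow> mat n n (\<lambda>(i, j). f i j) \<in> carrier (mat_alg n R)"
  by (simp add: mat_alg_carrier)

lemma mat_alg_entry: "A \<in> carrier (mat_alg n R) \<Longrightarrow> i < n \<Longrightarrow> j < n \<Longrightarrow> A $$ (i, j) \<in> carrier R"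
  by (simp add: mat_alg_carrier)

lemma mat_alg_eqI:
  assumes "A \<in> carrier (mat_alg n R)" "B \<in> carrier (mat_alg n R)" "\<And>i j. i < n \<Longrightarrow> j < n \<Longrightarrow> A $$ (i, j) = B $$ (i, j)"
  shows "A = B"
proof -
  have c: "A \<in> carrier_mat n n" "B \<in> carrier_mat n n" using assms(1,2) by (simp_all only: mat_alg_carrier)
  show ?thesis
    by (rule eq_matI) (use c assms(3) in auto)
qed

lemma mat_alg_index [simp]:
  assumes "i < n" "j < n"
  shows "(A \<otimes>\<^bsub>mat_alg n R\<^esub> B) $$ (i, j) = (\<Oplus>\<^bsub>R\<^esub>k\<in>{..<n}. A $$ (i, k) \<otimes>\<^bsub>R\<^esub> B $$ (k, j))"
    "(A \<oplus>\<^bsub>mat_alg n R\<^esub> B) $$ (i, j) = A $$ (i, j) \<oplus>\<^bsub>R\<^esub> B $$ (i, j)"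
    "\<one>\<^bsub>mat_alg n R\<^esub> $$ (i, j) = (if i = j then \<one>\<^bsub>R\<^esub> else \<zero>\<^bsub>R\<^esub>)"
    "\<zero>\<^bsub>mat_alg n R\<^esub> $$ (i, j) = \<zero>\<^bsub>R\<^esub>"
    "(c \<odot>\<^bsub>mat_alg n R\<^esub> A) $$ (i, j) = c \<odot>\<^bsub>R\<^esub> A $$ (i, j)"
    "star (mat_alg n R) A $$ (i, j) = star R (A $$ (j, i))"
  using assms by (simp_all add: mat_alg_def)

lemma (in abelian_monoid) finsum_swap:
  assumes "finite A" "finite B" "\<And>i j. i \<in> A \<Longrightarrow> j \<in> B \<Longrightarrow> f i j \<in> carrier G"
  shows "(\<Oplus>i\<in>A. \<Oplus>j\<in>B. f i j) = (\<Oplus>j\<in>B. \<Oplus>i\<in>A. f i j)"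
  using assms(1,3)
proof (induction A rule: finite_induct)
  case empty then show ?case by simp
next
  case (insert a A)
  have inner: "(\<Oplus>i\<in>insert a A. f i j) = f a j \<oplus> (\<Oplus>i\<in>A. f i j)" if "j \<in> B" for j
    using insert that by (intro finsum_insert) (simp_all add: Pi_iff)
  have c: "(\<Oplus>j\<in>B. f i j) \<in> carrier G" if "i \<in> insert a A" for i
    using insert.prems that by (intro finsum_closed) (simp add: Pi_iff)
  have "(\<Oplus>i\<in>insert a A. \<Oplus>j\<in>B. f i j) = (\<Oplus>j\<in>B. f a j) \<oplus> (\<Oplus>i\<in>A. \<Oplus>j\<in>B. f i j)"
    using insert.hyps c by (intro finsum_insert) (simp_all add: Pi_iff)
  also have "\<dots> = (\<Oplus>j\<in>B. f a j) \<oplus> (\<Oplus>j\<in>B. \<Oplus>i\<in>A. f i j)"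
    using insert.IH insert.prems by simp
  also have "\<dots> = (\<Oplus>j\<in>B. f a j \<oplus> (\<Oplus>i\<in>A. f i j))"
    using insert.prems by (intro finsum_addf[symmetric]) (simp_all add: Pi_iff finsum_closed)
  also have "\<dots> = (\<Oplus>j\<in>B. \<Oplus>i\<in>insert a A. f i j)"
    using insert.prems by (intro finsum_cong') (simp_all add: inner Pi_iff finsum_closed)
  finally show ?case .
qed

lemma mat_mult_closed:
  fixes R :: "'a star_algebra"
  assumes "ring R" "A \<in> carrier (mat_alg n R)" "B \<in> carrier (mat_alg n R)"
  shows "A \<otimes>\<^bsub>mat_alg n R\<^esub> B \<in> carrier (mat_alg n R)"
proof -
  interpret ring R by fact
  have "(\<Oplus>\<^bsub>R\<^esub>k\<in>{..<n}. A $$ (i, k) \<otimes>\<^bsub>R\<^esub> B $$ (k, j)) \<in> carrier R" if "i < n" "j < n" for i j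
    using that assms by (intro finsum_closed) (simp add: Pi_iff mat_alg_entry)
  then show ?thesis by (simp add: mat_alg_def)
qed

text \<open>The one substantial point is associativity, which comes down to exchanging two finite
  sums.\<close>

lemma ring_mat_alg:
  fixes R :: "'a star_algebra"
  assumes "ring R"
  shows "ring (mat_alg n R)"
proof -
  interpret ring R by fact
  let ?S = "mat_alg n R"
  note e = mat_alg_entry[of _ n R]
  have add_closed: "A \<oplus>\<^bsub>?S\<^esub> B \<in> carrier ?S" if "A \<in> carrier ?S" "B \<in> carrier ?S" for A B
    using that by (simp add: mat_alg_def)
  have one_closed: "\<one>\<^bsub>?S\<^esub> \<in> carrier ?S" "\<zero>\<^bsub>?S\<^esub> \<in> carrier ?S" by (simp_all add: mat_alg_def)
  note mult_closed = mat_mult_closed[OF assms, of _ n]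
  have sc: "(\<Oplus>\<^bsub>R\<^esub>k\<in>{..<n}. A $$ (i, k) \<otimes>\<^bsub>R\<^esub> B $$ (k, j)) \<in> carrier R"
    if "A \<in> carrier ?S" "B \<in> carrier ?S" "i < n" "j < n" for A B i j
    using that by (intro finsum_closed) (simp add: Pi_iff e)
  show ?thesis
  proof (rule ringI)
    show "abelian_group ?S"
    proof (rule abelian_groupI)
      fix A B C assume a: "A \<in> carrier ?S" "B \<in> carrier ?S" "C \<in> carrier ?S"
      show "A \<oplus>\<^bsub>?S\<^esub> B \<oplus>\<^bsub>?S\<^esub> C = A \<oplus>\<^bsub>?S\<^esub> (B \<oplus>\<^bsub>?S\<^esub> C)"
      proof (rule mat_alg_eqI[of _ n R])
        fix i j assume ij: "i < n" "j < n"
        show "(A \<oplus>\<^bsub>?S\<^esub> B \<oplus>\<^bsub>?S\<^esub> C) $$ (i, j) = (A \<oplus>\<^bsub>?S\<^esub> (B \<oplus>\<^bsub>?S\<^esub> C)) $$ (i, j)"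
          unfolding mat_alg_index(2)[OF ij] by (rule a_assoc[OF e[OF a(1) ij] e[OF a(2) ij] e[OF a(3) ij]])
      qed (rule add_closed[OF add_closed[OF a(1,2)] a(3)] add_closed[OF a(1) add_closed[OF a(2,3)]])+
    next
      fix A B assume a: "A \<in> carrier ?S" "B \<in> carrier ?S"
      show "A \<oplus>\<^bsub>?S\<^esub> B \<in> carrier ?S" by (rule add_closed[OF a])
      show "A \<oplus>\<^bsub>?S\<^esub> B = B \<oplus>\<^bsub>?S\<^esub> A"
      proof (rule mat_alg_eqI[of _ n R])
        fix i j assume ij: "i < n" "j < n"
        show "(A \<oplus>\<^bsub>?S\<^esub> B) $$ (i, j) = (B \<oplus>\<^bsub>?S\<^esub> A) $$ (i, j)"
          unfolding mat_alg_index(2)[OF ij] by (rule a_comm[OF e[OF a(1) ij] e[OF a(2) ij]])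
      qed (rule add_closed[OF a] add_closed[OF a(2,1)])+
    next
      fix A assume a: "A \<in> carrier ?S"
      show "\<zero>\<^bsub>?S\<^esub> \<oplus>\<^bsub>?S\<^esub> A = A"
      proof (rule mat_alg_eqI[of _ n R])
        fix i j assume ij: "i < n" "j < n"
        show "(\<zero>\<^bsub>?S\<^esub> \<oplus>\<^bsub>?S\<^esub> A) $$ (i, j) = A $$ (i, j)"
          unfolding mat_alg_index(2,4)[OF ij] by (rule l_zero[OF e[OF a ij]])
      qed (rule add_closed[OF one_closed(2) a] a)+
      define B where "B = mat n n (\<lambda>(i, j). \<ominus>\<^bsub>R\<^esub> A $$ (i, j))"
      have B: "B \<in> carrier ?S" unfolding B_def using a by (intro mat_alg_carrierI) (simp add: e)
      have "B \<oplus>\<^bsub>?S\<^esub> A = \<zero>\<^bsub>?S\<^esub>"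
      proof (rule mat_alg_eqI[of _ n R])
        fix i j assume ij: "i < n" "j < n"
        show "(B \<oplus>\<^bsub>?S\<^esub> A) $$ (i, j) = \<zero>\<^bsub>?S\<^esub> $$ (i, j)"
          unfolding mat_alg_index(2,4)[OF ij] using ij l_neg[OF e[OF a ij]] by (simp add: B_def)
      qed (rule add_closed[OF B a] one_closed)+
      then show "\<exists>B\<in>carrier ?S. B \<oplus>\<^bsub>?S\<^esub> A = \<zero>\<^bsub>?S\<^esub>" using B by blast
    qed (rule one_closed)
    show "monoid ?S"
    proof (rule monoidI)
      fix A B C assume a: "A \<in> carrier ?S" "B \<in> carrier ?S" "C \<in> carrier ?S"
      show "A \<otimes>\<^bsub>?S\<^esub> B \<otimes>\<^bsub>?S\<^esub> C = A \<otimes>\<^bsub>?S\<^esub> (B \<otimes>\<^bsub>?S\<^esub> C)"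
      proof (rule mat_alg_eqI[of _ n R])
        fix i j assume ij: "i < n" "j < n"
        have "(A \<otimes>\<^bsub>?S\<^esub> B \<otimes>\<^bsub>?S\<^esub> C) $$ (i, j)
           = (\<Oplus>\<^bsub>R\<^esub>l\<in>{..<n}. (\<Oplus>\<^bsub>R\<^esub>k\<in>{..<n}. A $$ (i, k) \<otimes>\<^bsub>R\<^esub> B $$ (k, l)) \<otimes>\<^bsub>R\<^esub> C $$ (l, j))"
          using ij a by (simp, intro finsum_cong') (simp_all add: Pi_iff e sc)
        also have "\<dots> = (\<Oplus>\<^bsub>R\<^esub>l\<in>{..<n}. \<Oplus>\<^bsub>R\<^esub>k\<in>{..<n}. A $$ (i, k) \<otimes>\<^bsub>R\<^esub> B $$ (k, l) \<otimes>\<^bsub>R\<^esub> C $$ (l, j))"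
          using ij a by (intro finsum_cong' finsum_ldistr) (simp_all add: Pi_iff e finsum_closed)
        also have "\<dots> = (\<Oplus>\<^bsub>R\<^esub>k\<in>{..<n}. \<Oplus>\<^bsub>R\<^esub>l\<in>{..<n}. A $$ (i, k) \<otimes>\<^bsub>R\<^esub> B $$ (k, l) \<otimes>\<^bsub>R\<^esub> C $$ (l, j))"
          using ij a by (intro finsum_swap) (simp_all add: e)
        also have "\<dots> = (\<Oplus>\<^bsub>R\<^esub>k\<in>{..<n}. A $$ (i, k) \<otimes>\<^bsub>R\<^esub> (\<Oplus>\<^bsub>R\<^esub>l\<in>{..<n}. B $$ (k, l) \<otimes>\<^bsub>R\<^esub> C $$ (l, j)))"
        proof (intro finsum_cong' refl)
          fix k assume "k \<in> {..<n}"
          then have k: "k < n" by simp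
          have "A $$ (i, k) \<otimes>\<^bsub>R\<^esub> (\<Oplus>\<^bsub>R\<^esub>l\<in>{..<n}. B $$ (k, l) \<otimes>\<^bsub>R\<^esub> C $$ (l, j))
             = (\<Oplus>\<^bsub>R\<^esub>l\<in>{..<n}. A $$ (i, k) \<otimes>\<^bsub>R\<^esub> (B $$ (k, l) \<otimes>\<^bsub>R\<^esub> C $$ (l, j)))"
            using ij a k by (intro finsum_rdistr) (simp_all add: Pi_iff e)
          also have "\<dots> = (\<Oplus>\<^bsub>R\<^esub>l\<in>{..<n}. A $$ (i, k) \<otimes>\<^bsub>R\<^esub> B $$ (k, l) \<otimes>\<^bsub>R\<^esub> C $$ (l, j))"
            using ij a k by (intro finsum_cong') (simp_all add: Pi_iff e m_assoc)
          finally show "(\<Oplus>\<^bsub>R\<^esub>l\<in>{..<n}. A $$ (i, k) \<otimes>\<^bsub>R\<^esub> B $$ (k, l) \<otimes>\<^bsub>R\<^esub> C $$ (l, j))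
            = A $$ (i, k) \<otimes>\<^bsub>R\<^esub> (\<Oplus>\<^bsub>R\<^esub>l\<in>{..<n}. B $$ (k, l) \<otimes>\<^bsub>R\<^esub> C $$ (l, j))" by simp
        qed (use ij a in \<open>simp_all add: Pi_iff e sc\<close>)
        also have "\<dots> = (A \<otimes>\<^bsub>?S\<^esub> (B \<otimes>\<^bsub>?S\<^esub> C)) $$ (i, j)"
          using ij a by (simp, intro finsum_cong') (simp_all add: Pi_iff e sc)
        finally show "(A \<otimes>\<^bsub>?S\<^esub> B \<otimes>\<^bsub>?S\<^esub> C) $$ (i, j) = (A \<otimes>\<^bsub>?S\<^esub> (B \<otimes>\<^bsub>?S\<^esub> C)) $$ (i, j)" .
      qed (use a in \<open>simp_all add: mult_closed\<close>)
    next
      fix A B assume a: "A \<in> carrier ?S" "B \<in> carrier ?S"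
      show "A \<otimes>\<^bsub>?S\<^esub> B \<in> carrier ?S" by (rule mult_closed[OF a])
    next
      fix A assume a: "A \<in> carrier ?S"
      show "\<one>\<^bsub>?S\<^esub> \<otimes>\<^bsub>?S\<^esub> A = A"
      proof (rule mat_alg_eqI[of _ n R])
        fix i j assume ij: "i < n" "j < n"
        have "(\<one>\<^bsub>?S\<^esub> \<otimes>\<^bsub>?S\<^esub> A) $$ (i, j) = (\<Oplus>\<^bsub>R\<^esub>k\<in>{..<n}. if i = k then A $$ (k, j) else \<zero>\<^bsub>R\<^esub>)"
          using ij a by (simp, intro finsum_cong') (simp_all add: Pi_iff e)
        also have "\<dots> = A $$ (i, j)"
          using ij a by (intro finsum_singleton) (simp_all add: Pi_iff e)
        finally show "(\<one>\<^bsub>?S\<^esub> \<otimes>\<^bsub>?S\<^esub> A) $$ (i, j) = A $$ (i, j)" .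
      qed (use a one_closed in \<open>simp_all add: mult_closed\<close>)
      show "A \<otimes>\<^bsub>?S\<^esub> \<one>\<^bsub>?S\<^esub> = A"
      proof (rule mat_alg_eqI[of _ n R])
        fix i j assume ij: "i < n" "j < n"
        have "(A \<otimes>\<^bsub>?S\<^esub> \<one>\<^bsub>?S\<^esub>) $$ (i, j) = (\<Oplus>\<^bsub>R\<^esub>k\<in>{..<n}. if j = k then A $$ (i, k) else \<zero>\<^bsub>R\<^esub>)"
          using ij a by (simp, intro finsum_cong') (simp_all add: Pi_iff e)
        also have "\<dots> = A $$ (i, j)"
          using ij a by (intro finsum_singleton) (simp_all add: Pi_iff e)
        finally show "(A \<otimes>\<^bsub>?S\<^esub> \<one>\<^bsub>?S\<^esub>) $$ (i, j) = A $$ (i, j)" .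
      qed (use a one_closed in \<open>simp_all add: mult_closed\<close>)
    qed (rule one_closed)
  next
    fix A B C assume a: "A \<in> carrier ?S" "B \<in> carrier ?S" "C \<in> carrier ?S"
    show "(A \<oplus>\<^bsub>?S\<^esub> B) \<otimes>\<^bsub>?S\<^esub> C = A \<otimes>\<^bsub>?S\<^esub> C \<oplus>\<^bsub>?S\<^esub> B \<otimes>\<^bsub>?S\<^esub> C"
    proof (rule mat_alg_eqI[of _ n R])
      fix i j assume ij: "i < n" "j < n"
      have "((A \<oplus>\<^bsub>?S\<^esub> B) \<otimes>\<^bsub>?S\<^esub> C) $$ (i, j) = (\<Oplus>\<^bsub>R\<^esub>k\<in>{..<n}. A $$ (i, k) \<otimes>\<^bsub>R\<^esub> C $$ (k, j) \<oplus>\<^bsub>R\<^esub> B $$ (i, k) \<otimes>\<^bsub>R\<^esub> C $$ (k, j))"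
        using ij a by (simp, intro finsum_cong') (simp_all add: Pi_iff e l_distr)
      also have "\<dots> = (A \<otimes>\<^bsub>?S\<^esub> C \<oplus>\<^bsub>?S\<^esub> B \<otimes>\<^bsub>?S\<^esub> C) $$ (i, j)"
        using ij a by (simp, intro finsum_addf) (simp_all add: Pi_iff e)
      finally show "((A \<oplus>\<^bsub>?S\<^esub> B) \<otimes>\<^bsub>?S\<^esub> C) $$ (i, j) = (A \<otimes>\<^bsub>?S\<^esub> C \<oplus>\<^bsub>?S\<^esub> B \<otimes>\<^bsub>?S\<^esub> C) $$ (i, j)" .
    qed (use a in \<open>simp_all add: mult_closed add_closed\<close>)
    show "C \<otimes>\<^bsub>?S\<^esub> (A \<oplus>\<^bsub>?S\<^esub> B) = C \<otimes>\<^bsub>?S\<^esub> A \<oplus>\<^bsub>?S\<^esub> C \<otimes>\<^bsub>?S\<^esub> B"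
    proof (rule mat_alg_eqI[of _ n R])
      fix i j assume ij: "i < n" "j < n"
      have "(C \<otimes>\<^bsub>?S\<^esub> (A \<oplus>\<^bsub>?S\<^esub> B)) $$ (i, j) = (\<Oplus>\<^bsub>R\<^esub>k\<in>{..<n}. C $$ (i, k) \<otimes>\<^bsub>R\<^esub> A $$ (k, j) \<oplus>\<^bsub>R\<^esub> C $$ (i, k) \<otimes>\<^bsub>R\<^esub> B $$ (k, j))"
        using ij a by (simp, intro finsum_cong') (simp_all add: Pi_iff e r_distr)
      also have "\<dots> = (C \<otimes>\<^bsub>?S\<^esub> A \<oplus>\<^bsub>?S\<^esub> C \<otimes>\<^bsub>?S\<^esub> B) $$ (i, j)"
        using ij a by (simp, intro finsum_addf) (simp_all add: Pi_iff e)
      finally show "(C \<otimes>\<^bsub>?S\<^esub> (A \<oplus>\<^bsub>?S\<^esub> B)) $$ (i, j) = (C \<otimes>\<^bsub>?S\<^esub> A \<oplus>\<^bsub>?S\<^esub> C \<otimes>\<^bsub>?S\<^esub> B) $$ (i, j)" .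
    qed (use a in \<open>simp_all add: mult_closed add_closed\<close>)
  qed
qed

text \<open>Multiplying by the invertible element removes the inverse from the definition, which
  leaves equations that can be evaluated entrywise.\<close>

lemma similar_in_iff:
  fixes R :: "'a star_algebra"
  assumes "ring R" "A \<in> carrier R" "B \<in> carrier R"
  shows "similar_in R A B \<longleftrightarrow> (\<exists>X\<in>carrier R. \<exists>Y\<in>carrier R. X \<otimes>\<^bsub>R\<^esub> Y = \<one>\<^bsub>R\<^esub> \<and> Y \<otimes>\<^bsub>R\<^esub> X = \<one>\<^bsub>R\<^esub> \<and> A \<otimes>\<^bsub>R\<^esub> X = X \<otimes>\<^bsub>R\<^esub> B)"
proof -
  interpret ring R by fact
  show ?thesis
  proof
    assume "similar_in R A B"
    then obtain X where X: "X \<in> Units R" "A = X \<otimes>\<^bsub>R\<^esub> B \<otimes>\<^bsub>R\<^esub> inv\<^bsub>R\<^esub> X" unfolding similar_in_def by blast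
    have c: "X \<in> carrier R" "inv\<^bsub>R\<^esub> X \<in> carrier R" using Units_closed[OF X(1)] Units_inv_closed[OF X(1)] by simp_all
    have "A \<otimes>\<^bsub>R\<^esub> X = X \<otimes>\<^bsub>R\<^esub> B"
      unfolding X(2) using c assms(3) Units_l_inv[OF X(1)] by (simp add: m_assoc)
    then show "\<exists>X\<in>carrier R. \<exists>Y\<in>carrier R. X \<otimes>\<^bsub>R\<^esub> Y = \<one>\<^bsub>R\<^esub> \<and> Y \<otimes>\<^bsub>R\<^esub> X = \<one>\<^bsub>R\<^esub> \<and> A \<otimes>\<^bsub>R\<^esub> X = X \<otimes>\<^bsub>R\<^esub> B"
      using c Units_r_inv[OF X(1)] Units_l_inv[OF X(1)] by blast
  next
    assume "\<exists>X\<in>carrier R. \<exists>Y\<in>carrier R. X \<otimes>\<^bsub>R\<^esub> Y = \<one>\<^bsub>R\<^esub> \<and> Y \<otimes>\<^bsub>R\<^esub> X = \<one>\<^bsub>R\<^esub> \<and> A \<otimes>\<^bsub>R\<^esub> X = X \<otimes>\<^bsub>R\<^esub> B"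
    then obtain X Y where XY: "X \<in> carrier R" "Y \<in> carrier R" "X \<otimes>\<^bsub>R\<^esub> Y = \<one>\<^bsub>R\<^esub>" "Y \<otimes>\<^bsub>R\<^esub> X = \<one>\<^bsub>R\<^esub>" "A \<otimes>\<^bsub>R\<^esub> X = X \<otimes>\<^bsub>R\<^esub> B" by blast
    have U: "X \<in> Units R" unfolding Units_def using XY by blast
    have c: "inv\<^bsub>R\<^esub> X \<in> carrier R" using U by simp
    have "X \<otimes>\<^bsub>R\<^esub> B \<otimes>\<^bsub>R\<^esub> inv\<^bsub>R\<^esub> X = A \<otimes>\<^bsub>R\<^esub> (X \<otimes>\<^bsub>R\<^esub> inv\<^bsub>R\<^esub> X)"
      using XY c assms by (simp only: XY(5)[symmetric] m_assoc)
    then have "X \<otimes>\<^bsub>R\<^esub> B \<otimes>\<^bsub>R\<^esub> inv\<^bsub>R\<^esub> X = A" using Units_r_inv[OF U] assms(2) by simp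
    then show "similar_in R A B" unfolding similar_in_def using U by blast
  qed
qed

definition block_similar :: "'a star_algebra \<Rightarrow> 'a \<Rightarrow> 'a \<Rightarrow> (nat \<Rightarrow> nat \<Rightarrow> 'a) \<Rightarrow> (nat \<Rightarrow> nat \<Rightarrow> 'a) \<Rightarrow> bool" where
  "block_similar S A B W V \<longleftrightarrow> (\<forall>i<2. \<forall>j<2. W i j \<in> carrier S \<and> V i j \<in> carrier S \<and>
     A \<otimes>\<^bsub>S\<^esub> W i j = W i j \<otimes>\<^bsub>S\<^esub> B \<and>
     W i 0 \<otimes>\<^bsub>S\<^esub> V 0 j \<oplus>\<^bsub>S\<^esub> W i 1 \<otimes>\<^bsub>S\<^esub> V 1 j = (if i = j then \<one>\<^bsub>S\<^esub> else \<zero>\<^bsub>S\<^esub>) \<and>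
     V i 0 \<otimes>\<^bsub>S\<^esub> W 0 j \<oplus>\<^bsub>S\<^esub> V i 1 \<otimes>\<^bsub>S\<^esub> W 1 j = (if i = j then \<one>\<^bsub>S\<^esub> else \<zero>\<^bsub>S\<^esub>))"

text \<open>The entries of a \<open>2 \<times> 2\<close> witness and of its inverse satisfy finitely
  many equations over the ring itself; these are the equations that are transported along
  evaluations and isomorphisms.\<close>

lemma block_similar_iff:
  fixes S :: "'a star_algebra"
  assumes S: "ring S" and A: "A \<in> carrier S" and B: "B \<in> carrier S"
  shows "similar_in (mat_alg 2 S) (oplus_self S A) (oplus_self S B) \<longleftrightarrow> (\<exists>W V. block_similar S A B W V)"
proof -
  interpret ring S by fact
  let ?T = "mat_alg 2 S"
  have T: "ring ?T" by (rule ring_mat_alg[OF S])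
  have mult2: "(X \<otimes>\<^bsub>?T\<^esub> Y) $$ (i, j) = X $$ (i, 0) \<otimes>\<^bsub>S\<^esub> Y $$ (0, j) \<oplus>\<^bsub>S\<^esub> X $$ (i, 1) \<otimes>\<^bsub>S\<^esub> Y $$ (1, j)"
    if "X \<in> carrier ?T" "Y \<in> carrier ?T" "i < 2" "j < 2" for X Y i j
  proof -
    have c: "X $$ (i, k) \<in> carrier S" "Y $$ (k, j) \<in> carrier S" if "k < 2" for k
      using mat_alg_entry[OF \<open>X \<in> carrier ?T\<close> \<open>i < 2\<close> that] mat_alg_entry[OF \<open>Y \<in> carrier ?T\<close> that \<open>j < 2\<close>] by simp_all
    have "{..<2::nat} = insert 0 (insert 1 {})" by auto
    then show ?thesis using that c[of 0] c[of 1] by (simp add: finsum_insert Pi_iff)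
  qed
  have AA: "oplus_self S A \<in> carrier ?T" "oplus_self S B \<in> carrier ?T"
    using A B by (simp_all add: oplus_self_def mat_alg_carrier)
  have dl: "(oplus_self S A \<otimes>\<^bsub>?T\<^esub> X) $$ (i, j) = A \<otimes>\<^bsub>S\<^esub> X $$ (i, j)"
    "(X \<otimes>\<^bsub>?T\<^esub> oplus_self S B) $$ (i, j) = X $$ (i, j) \<otimes>\<^bsub>S\<^esub> B"
    if X: "X \<in> carrier ?T" and ij: "i < 2" "j < 2" for X i j
  proof -
    have c: "X $$ (k, j) \<in> carrier S" "X $$ (i, k) \<in> carrier S" if "k < 2" for k
      using mat_alg_entry[OF X that ij(2)] mat_alg_entry[OF X ij(1) that] by simp_all
    have i: "i = 0 \<or> i = 1" and j: "j = 0 \<or> j = 1" using ij by auto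
    show "(oplus_self S A \<otimes>\<^bsub>?T\<^esub> X) $$ (i, j) = A \<otimes>\<^bsub>S\<^esub> X $$ (i, j)"
      using i mult2[OF AA(1) X ij] c(1)[of 0] c(1)[of 1] A by (elim disjE) (simp_all add: oplus_self_def del: mat_alg_index)
    show "(X \<otimes>\<^bsub>?T\<^esub> oplus_self S B) $$ (i, j) = X $$ (i, j) \<otimes>\<^bsub>S\<^esub> B"
      using j mult2[OF X AA(2) ij] c(2)[of 0] c(2)[of 1] B by (elim disjE) (simp_all add: oplus_self_def del: mat_alg_index)
  qed
  show ?thesis
  proof
    assume "similar_in ?T (oplus_self S A) (oplus_self S B)"
    then obtain X Y where XY: "X \<in> carrier ?T" "Y \<in> carrier ?T" "X \<otimes>\<^bsub>?T\<^esub> Y = \<one>\<^bsub>?T\<^esub>" "Y \<otimes>\<^bsub>?T\<^esub> X = \<one>\<^bsub>?T\<^esub>"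
      "oplus_self S A \<otimes>\<^bsub>?T\<^esub> X = X \<otimes>\<^bsub>?T\<^esub> oplus_self S B"
      unfolding similar_in_iff[OF T AA] by blast
    have "block_similar S A B (\<lambda>i j. X $$ (i, j)) (\<lambda>i j. Y $$ (i, j))"
      unfolding block_similar_def
    proof (intro allI impI conjI)
      fix i j :: nat assume ij: "i < 2" "j < 2"
      show "X $$ (i, j) \<in> carrier S" "Y $$ (i, j) \<in> carrier S" using XY ij by (simp_all add: mat_alg_entry)
      show "A \<otimes>\<^bsub>S\<^esub> X $$ (i, j) = X $$ (i, j) \<otimes>\<^bsub>S\<^esub> B" using dl[OF XY(1) ij] XY(5) by simp
      show "X $$ (i, 0) \<otimes>\<^bsub>S\<^esub> Y $$ (0, j) \<oplus>\<^bsub>S\<^esub> X $$ (i, 1) \<otimes>\<^bsub>S\<^esub> Y $$ (1, j) = (if i = j then \<one>\<^bsub>S\<^esub> else \<zero>\<^bsub>S\<^esub>)"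
        unfolding mult2[OF XY(1,2) ij, symmetric] XY(3) using ij by (rule mat_alg_index(3))
      show "Y $$ (i, 0) \<otimes>\<^bsub>S\<^esub> X $$ (0, j) \<oplus>\<^bsub>S\<^esub> Y $$ (i, 1) \<otimes>\<^bsub>S\<^esub> X $$ (1, j) = (if i = j then \<one>\<^bsub>S\<^esub> else \<zero>\<^bsub>S\<^esub>)"
        unfolding mult2[OF XY(2,1) ij, symmetric] XY(4) using ij by (rule mat_alg_index(3))
    qed
    then show "\<exists>W V. block_similar S A B W V" by blast
  next
    assume "\<exists>W V. block_similar S A B W V"
    then obtain W V where WV: "block_similar S A B W V" by blast
    define X where "X = mat 2 2 (\<lambda>(i, j). W i j)"
    define Y where "Y = mat 2 2 (\<lambda>(i, j). V i j)"
    have XY: "X \<in> carrier ?T" "Y \<in> carrier ?T"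
      unfolding X_def Y_def by (rule mat_alg_carrierI, use WV in \<open>simp add: block_similar_def\<close>)+
    have one: "\<one>\<^bsub>?T\<^esub> \<in> carrier ?T" by (simp add: mat_alg_def)
    have "X \<otimes>\<^bsub>?T\<^esub> Y = \<one>\<^bsub>?T\<^esub>"
    proof (rule mat_alg_eqI[OF mat_mult_closed[OF S XY] one])
      fix i j :: nat assume ij: "i < 2" "j < 2"
      show "(X \<otimes>\<^bsub>?T\<^esub> Y) $$ (i, j) = \<one>\<^bsub>?T\<^esub> $$ (i, j)"
        unfolding mult2[OF XY ij] mat_alg_index(3)[OF ij] using WV ij by (simp add: block_similar_def X_def Y_def)
    qed
    moreover have "Y \<otimes>\<^bsub>?T\<^esub> X = \<one>\<^bsub>?T\<^esub>"
    proof (rule mat_alg_eqI[OF mat_mult_closed[OF S XY(2,1)] one])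
      fix i j :: nat assume ij: "i < 2" "j < 2"
      show "(Y \<otimes>\<^bsub>?T\<^esub> X) $$ (i, j) = \<one>\<^bsub>?T\<^esub> $$ (i, j)"
        unfolding mult2[OF XY(2,1) ij] mat_alg_index(3)[OF ij] using WV ij by (simp add: block_similar_def X_def Y_def)
    qed
    moreover have "oplus_self S A \<otimes>\<^bsub>?T\<^esub> X = X \<otimes>\<^bsub>?T\<^esub> oplus_self S B"
    proof (rule mat_alg_eqI[OF mat_mult_closed[OF S AA(1) XY(1)] mat_mult_closed[OF S XY(1) AA(2)]])
      fix i j :: nat assume ij: "i < 2" "j < 2"
      show "(oplus_self S A \<otimes>\<^bsub>?T\<^esub> X) $$ (i, j) = (X \<otimes>\<^bsub>?T\<^esub> oplus_self S B) $$ (i, j)"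
        unfolding dl[OF XY(1) ij] using WV ij by (simp add: block_similar_def X_def)
    qed
    ultimately show "similar_in ?T (oplus_self S A) (oplus_self S B)"
      unfolding similar_in_iff[OF T AA] using XY by blast
  qed
qed

text \<open>Both similarity and similarity of the doubles are expressed by ring equations, so they
  are carried over by an isomorphism.\<close>

lemma kaplansky2_iso:
  fixes R :: "'a star_algebra" and S :: "'b star_algebra"
  assumes R: "ring R" and S: "ring S" and h: "h \<in> ring_iso R S" and k: "kaplansky2 S"
  shows "kaplansky2 R"
  unfolding kaplansky2_def
proof (intro ballI impI)
  fix A B assume A: "A \<in> carrier R" and B: "B \<in> carrier R"
    and sim: "similar_in (mat_alg 2 R) (oplus_self R A) (oplus_self R B)"
  interpret R: ring R by fact
  interpret S: ring S by fact
  have hom: "h \<in> Ring.ring_hom R S" and bij: "bij_betw h (carrier R) (carrier S)" using h by (simp_all add: ring_iso_def)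
  have hc: "h x \<in> carrier S" if "x \<in> carrier R" for x using ring_hom_closed[OF hom that] .
  have hm: "h (x \<otimes>\<^bsub>R\<^esub> y) = h x \<otimes>\<^bsub>S\<^esub> h y" "h (x \<oplus>\<^bsub>R\<^esub> y) = h x \<oplus>\<^bsub>S\<^esub> h y" if "x \<in> carrier R" "y \<in> carrier R" for x y
    using ring_hom_mult[OF hom that] ring_hom_add[OF hom that] by simp_all
  have h1: "h \<one>\<^bsub>R\<^esub> = \<one>\<^bsub>S\<^esub>" by (rule ring_hom_one[OF hom])
  have h0: "h \<zero>\<^bsub>R\<^esub> = \<zero>\<^bsub>S\<^esub>" by (rule ring_hom_zero[OF hom R S])
  obtain W V where WV: "block_similar R A B W V" using sim block_similar_iff[OF R A B] by blast
  have "block_similar S (h A) (h B) (\<lambda>i j. h (W i j)) (\<lambda>i j. h (V i j))"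
    unfolding block_similar_def
  proof (intro allI impI conjI)
    fix i j :: nat assume ij: "i < 2" "j < 2"
    have c: "W i' j' \<in> carrier R" "V i' j' \<in> carrier R" if "i' < 2" "j' < 2" for i' j'
      using WV that unfolding block_similar_def by blast+
    note c2 = c[OF ij(1), of 0] c[OF ij(1), of 1] c[OF _ ij(2), of 0] c[OF _ ij(2), of 1]
    show "h (W i j) \<in> carrier S" "h (V i j) \<in> carrier S" using c[OF ij] hc by simp_all
    have "A \<otimes>\<^bsub>R\<^esub> W i j = W i j \<otimes>\<^bsub>R\<^esub> B"
      and w: "W i 0 \<otimes>\<^bsub>R\<^esub> V 0 j \<oplus>\<^bsub>R\<^esub> W i 1 \<otimes>\<^bsub>R\<^esub> V 1 j = (if i = j then \<one>\<^bsub>R\<^esub> else \<zero>\<^bsub>R\<^esub>)"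
      and v: "V i 0 \<otimes>\<^bsub>R\<^esub> W 0 j \<oplus>\<^bsub>R\<^esub> V i 1 \<otimes>\<^bsub>R\<^esub> W 1 j = (if i = j then \<one>\<^bsub>R\<^esub> else \<zero>\<^bsub>R\<^esub>)"
      using WV ij unfolding block_similar_def by blast+
    then have "h (A \<otimes>\<^bsub>R\<^esub> W i j) = h (W i j \<otimes>\<^bsub>R\<^esub> B)" by simp
    then show "h A \<otimes>\<^bsub>S\<^esub> h (W i j) = h (W i j) \<otimes>\<^bsub>S\<^esub> h B" using c[OF ij] A B by (simp add: hm)
    have "h (W i 0) \<otimes>\<^bsub>S\<^esub> h (V 0 j) \<oplus>\<^bsub>S\<^esub> h (W i 1) \<otimes>\<^bsub>S\<^esub> h (V 1 j) = h (W i 0 \<otimes>\<^bsub>R\<^esub> V 0 j \<oplus>\<^bsub>R\<^esub> W i 1 \<otimes>\<^bsub>R\<^esub> V 1 j)"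
      using c2 by (simp add: hm)
    then show "h (W i 0) \<otimes>\<^bsub>S\<^esub> h (V 0 j) \<oplus>\<^bsub>S\<^esub> h (W i 1) \<otimes>\<^bsub>S\<^esub> h (V 1 j) = (if i = j then \<one>\<^bsub>S\<^esub> else \<zero>\<^bsub>S\<^esub>)"
      unfolding w by (simp add: h0 h1)
    have "h (V i 0) \<otimes>\<^bsub>S\<^esub> h (W 0 j) \<oplus>\<^bsub>S\<^esub> h (V i 1) \<otimes>\<^bsub>S\<^esub> h (W 1 j) = h (V i 0 \<otimes>\<^bsub>R\<^esub> W 0 j \<oplus>\<^bsub>R\<^esub> V i 1 \<otimes>\<^bsub>R\<^esub> W 1 j)"
      using c2 by (simp add: hm)
    then show "h (V i 0) \<otimes>\<^bsub>S\<^esub> h (W 0 j) \<oplus>\<^bsub>S\<^esub> h (V i 1) \<otimes>\<^bsub>S\<^esub> h (W 1 j) = (if i = j then \<one>\<^bsub>S\<^esub> else \<zero>\<^bsub>S\<^esub>)"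
      unfolding v by (simp add: h0 h1)
  qed
  then have "similar_in (mat_alg 2 S) (oplus_self S (h A)) (oplus_self S (h B))"
    using block_similar_iff[OF S hc[OF A] hc[OF B]] by blast
  then have "similar_in S (h A) (h B)" using k hc A B unfolding kaplansky2_def by blast
  then obtain X Y where XY: "X \<in> carrier S" "Y \<in> carrier S" "X \<otimes>\<^bsub>S\<^esub> Y = \<one>\<^bsub>S\<^esub>" "Y \<otimes>\<^bsub>S\<^esub> X = \<one>\<^bsub>S\<^esub>" "h A \<otimes>\<^bsub>S\<^esub> X = X \<otimes>\<^bsub>S\<^esub> h B"
    unfolding similar_in_iff[OF S hc[OF A] hc[OF B]] by blast
  have "X \<in> h ` carrier R" "Y \<in> h ` carrier R" using XY(1,2) bij by (simp_all add: bij_betw_def)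
  then obtain X' Y' where X': "X' \<in> carrier R" "h X' = X" and Y': "Y' \<in> carrier R" "h Y' = Y" by (elim imageE) metis
  have inj: "x = y" if "h x = h y" "x \<in> carrier R" "y \<in> carrier R" for x y
    using bij that unfolding bij_betw_def by (meson inj_onD)
  have "X' \<otimes>\<^bsub>R\<^esub> Y' = \<one>\<^bsub>R\<^esub>" by (rule inj) (use X' Y' XY in \<open>simp_all add: hm h1\<close>)
  moreover have "Y' \<otimes>\<^bsub>R\<^esub> X' = \<one>\<^bsub>R\<^esub>" by (rule inj) (use X' Y' XY in \<open>simp_all add: hm h1\<close>)
  moreover have "A \<otimes>\<^bsub>R\<^esub> X' = X' \<otimes>\<^bsub>R\<^esub> B" by (rule inj) (use X' A B XY in \<open>simp_all add: hm\<close>)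
  ultimately show "similar_in R A B" unfolding similar_in_iff[OF R A B] using X' Y' by blast
qed

text \<open>Entrywise evaluation of matrices over a ring by a relation that is compatible with the
  ring operations; the relation may be partial.\<close>

locale evaluation = ring R for R :: "'a star_algebra" +
  fixes E :: "'a \<Rightarrow> complex \<Rightarrow> bool"
  assumes E_zero: "E \<zero>\<^bsub>R\<^esub> 0" and E_one: "E \<one>\<^bsub>R\<^esub> 1"
    and E_add: "a \<in> carrier R \<Longrightarrow> b \<in> carrier R \<Longrightarrow> E a c \<Longrightarrow> E b d \<Longrightarrow> E (a \<oplus>\<^bsub>R\<^esub> b) (c + d)"
    and E_mult: "a \<in> carrier R \<Longrightarrow> b \<in> carrier R \<Longrightarrow> E a c \<Longrightarrow> E b d \<Longrightarrow> E (a \<otimes>\<^bsub>R\<^esub> b) (c * d)"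
    and E_unique: "a \<in> carrier R \<Longrightarrow> E a c \<Longrightarrow> E a d \<Longrightarrow> c = d"
begin

definition mat_eval :: "nat \<Rightarrow> 'a mat \<Rightarrow> complex mat \<Rightarrow> bool" where
  "mat_eval n A a \<longleftrightarrow> A \<in> carrier (mat_alg n R) \<and> a \<in> carrier_mat n n \<and> (\<forall>i<n. \<forall>j<n. E (A $$ (i, j)) (a $$ (i, j)))"

lemma E_sum: "finite S \<Longrightarrow> (\<And>s. s \<in> S \<Longrightarrow> f s \<in> carrier R \<and> E (f s) (g s)) \<Longrightarrow> E (finsum R f S) (\<Sum>s\<in>S. g s)"
proof (induction S rule: finite_induct)
  case empty then show ?case by (simp add: E_zero)
next
  case (insert a S)
  have "finsum R f (insert a S) = f a \<oplus>\<^bsub>R\<^esub> finsum R f S"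
    using insert by (intro finsum_insert) (simp_all add: Pi_iff)
  moreover have "finsum R f S \<in> carrier R" using insert.prems by (intro finsum_closed) (simp add: Pi_iff)
  ultimately show ?case using insert by (simp add: E_add)
qed

lemma mat_eval_mult: "mat_eval n A a \<Longrightarrow> mat_eval n B b \<Longrightarrow> mat_eval n (A \<otimes>\<^bsub>mat_alg n R\<^esub> B) (a * b)"
  unfolding mat_eval_def
proof (intro conjI allI impI; (elim conjE)?)
  assume a: "A \<in> carrier (mat_alg n R)" "B \<in> carrier (mat_alg n R)"
  show "A \<otimes>\<^bsub>mat_alg n R\<^esub> B \<in> carrier (mat_alg n R)" by (rule mat_mult_closed[OF ring_axioms a])
next
  assume "a \<in> carrier_mat n n" "b \<in> carrier_mat n n"
  then show "a * b \<in> carrier_mat n n" by simp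
next
  fix i j assume ij: "i < n" "j < n" and a: "A \<in> carrier (mat_alg n R)" "B \<in> carrier (mat_alg n R)"
    and ab: "a \<in> carrier_mat n n" "b \<in> carrier_mat n n"
    and E: "\<forall>i<n. \<forall>j<n. E (A $$ (i, j)) (a $$ (i, j))" "\<forall>i<n. \<forall>j<n. E (B $$ (i, j)) (b $$ (i, j))"
  have "E (\<Oplus>\<^bsub>R\<^esub>k\<in>{..<n}. A $$ (i, k) \<otimes>\<^bsub>R\<^esub> B $$ (k, j)) (\<Sum>k\<in>{..<n}. a $$ (i, k) * b $$ (k, j))"
    using ij a E by (intro E_sum) (simp_all add: E_mult mat_alg_entry)
  moreover have "(a * b) $$ (i, j) = (\<Sum>k\<in>{..<n}. a $$ (i, k) * b $$ (k, j))"
    using ij ab by (simp add: scalar_prod_def atLeast0LessThan)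
  ultimately show "E ((A \<otimes>\<^bsub>mat_alg n R\<^esub> B) $$ (i, j)) ((a * b) $$ (i, j))" using ij by simp
qed

lemma mat_eval_add: "mat_eval n A a \<Longrightarrow> mat_eval n B b \<Longrightarrow> mat_eval n (A \<oplus>\<^bsub>mat_alg n R\<^esub> B) (a + b)"
proof -
  assume A: "mat_eval n A a" and B: "mat_eval n B b"
  interpret S: ring "mat_alg n R" by (rule ring_mat_alg[OF ring_axioms])
  have c: "A \<in> carrier (mat_alg n R)" "B \<in> carrier (mat_alg n R)" "a \<in> carrier_mat n n" "b \<in> carrier_mat n n"
    using A B unfolding mat_eval_def by blast+
  have "E ((A \<oplus>\<^bsub>mat_alg n R\<^esub> B) $$ (i, j)) ((a + b) $$ (i, j))" if ij: "i < n" "j < n" for i j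
  proof -
    have "E (A $$ (i, j)) (a $$ (i, j))" "E (B $$ (i, j)) (b $$ (i, j))" using A B ij unfolding mat_eval_def by blast+
    moreover have "(a + b) $$ (i, j) = a $$ (i, j) + b $$ (i, j)" using c ij by simp
    ultimately show ?thesis
      unfolding mat_alg_index(2)[OF ij] using E_add[OF mat_alg_entry[OF c(1) ij] mat_alg_entry[OF c(2) ij]] by simp
  qed
  moreover have "a + b \<in> carrier_mat n n" using c by simp
  ultimately show ?thesis unfolding mat_eval_def using S.a_closed[OF c(1,2)] by blast
qed

lemma mat_eval_one: "mat_eval n \<one>\<^bsub>mat_alg n R\<^esub> (1\<^sub>m n)"
  by (simp add: mat_eval_def mat_alg_carrier E_one E_zero) (simp add: mat_alg_def)

lemma mat_eval_zero: "mat_eval n \<zero>\<^bsub>mat_alg n R\<^esub> (0\<^sub>m n n)"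
  by (simp add: mat_eval_def mat_alg_carrier E_zero) (simp add: mat_alg_def)

lemma mat_eval_unique:
  assumes "mat_eval n A a" "mat_eval n A b" shows "a = b"
proof (rule eq_matI)
  have c: "a \<in> carrier_mat n n" "b \<in> carrier_mat n n" using assms by (simp_all add: mat_eval_def)
  then show "dim_row a = dim_row b" "dim_col a = dim_col b" by simp_all
  fix i j assume "i < dim_row b" "j < dim_col b"
  then have ij: "i < n" "j < n" using c by simp_all
  then have "A $$ (i, j) \<in> carrier R" "E (A $$ (i, j)) (a $$ (i, j))" "E (A $$ (i, j)) (b $$ (i, j))"
    using assms mat_alg_entry[of A n R i j] unfolding mat_eval_def by blast+
  then show "a $$ (i, j) = b $$ (i, j)" by (rule E_unique)
qed

end

section \<open>Operator norms and block matrices\<close>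

lemma l2norm_eq: "l2norm v = L2_set (\<lambda>i. cmod (v $ i)) {..<dim_vec v}"
proof -
  have "v \<bullet>c v = complex_of_real (\<Sum>i<dim_vec v. (cmod (v $ i))\<^sup>2)"
    unfolding scalar_prod_def of_real_sum
    by (simp add: atLeast0LessThan complex_norm_square del: of_real_power)
  then show ?thesis by (simp add: l2norm_def L2_set_def)
qed

lemma l2norm_zero [simp]: "l2norm (0\<^sub>v k) = 0"
  by (simp add: l2norm_eq L2_set_def)

text \<open>Cauchy-Schwarz in each row: the crude bound by the entries suffices, since only
  boundedness of the norms matters.\<close>

lemma l2norm_mult_vec_le:
  assumes A: "A \<in> carrier_mat r k" and le: "\<And>i j. i < r \<Longrightarrow> j < k \<Longrightarrow> cmod (A $$ (i, j)) \<le> c"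
    and v: "v \<in> carrier_vec k" "l2norm v \<le> 1"
  shows "l2norm (A *\<^sub>v v) \<le> real r * real k * c"
proof -
  have comp: "cmod (v $ j) \<le> 1" if "j < k" for j
    using member_le_L2_set[of "{..<dim_vec v}" j "\<lambda>i. cmod (v $ i)"] that v by (simp add: l2norm_eq)
  have "l2norm (A *\<^sub>v v) \<le> (\<Sum>i<r. cmod ((A *\<^sub>v v) $ i))"
  proof -
    have "dim_vec (A *\<^sub>v v) = r" using A by simp
    then show ?thesis unfolding l2norm_eq by (simp only:) (rule L2_set_le_sum, simp)
  qed
  also have "\<dots> \<le> (\<Sum>i<r. \<Sum>j<k. c)"
  proof (rule sum_mono)
    fix i assume "i \<in> {..<r}"
    then have i: "i < r" by simp
    have "(A *\<^sub>v v) $ i = (\<Sum>j<k. A $$ (i, j) * v $ j)"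
      using A v i by (simp add: scalar_prod_def atLeast0LessThan)
    also have "cmod \<dots> \<le> (\<Sum>j<k. cmod (A $$ (i, j) * v $ j))" by (rule norm_sum)
    also have "\<dots> \<le> (\<Sum>j<k. c)"
    proof (rule sum_mono)
      fix j assume "j \<in> {..<k}"
      then have j: "j < k" by simp
      have "cmod (A $$ (i, j)) * cmod (v $ j) \<le> cmod (A $$ (i, j)) * 1"
        using comp[OF j] by (intro mult_left_mono) simp_all
      then show "cmod (A $$ (i, j) * v $ j) \<le> c" using le[OF i j] by (simp add: norm_mult)
    qed
    finally show "cmod ((A *\<^sub>v v) $ i) \<le> (\<Sum>j<k. c)" .
  qed
  also have "\<dots> = real r * real k * c" by simp
  finally show ?thesis .
qed

lemma opnorm_le:
  assumes A: "A \<in> carrier_mat r k" and le: "\<And>i j. i < r \<Longrightarrow> j < k \<Longrightarrow> cmod (A $$ (i, j)) \<le> c"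
  shows "opnorm A \<le> real r * real k * c"
  unfolding opnorm_def
proof (rule cSup_least)
  have "l2norm (A *\<^sub>v 0\<^sub>v k) \<in> {l2norm (A *\<^sub>v v) |v. v \<in> carrier_vec (dim_col A) \<and> l2norm v \<le> 1}"
    using A by (intro CollectI exI[of _ "0\<^sub>v k"]) simp
  then show "{l2norm (A *\<^sub>v v) |v. v \<in> carrier_vec (dim_col A) \<and> l2norm v \<le> 1} \<noteq> {}" by blast
  fix x assume "x \<in> {l2norm (A *\<^sub>v v) |v. v \<in> carrier_vec (dim_col A) \<and> l2norm v \<le> 1}"
  then show "x \<le> real r * real k * c" using l2norm_mult_vec_le[OF A le] A by auto
qed

text \<open>An entry is a coordinate of the image of a standard unit vector.\<close>

lemma entry_le_opnorm:
  assumes A: "A \<in> carrier_mat r k" and i: "i < r" and j: "j < k"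
  shows "cmod (A $$ (i, j)) \<le> opnorm A"
proof -
  define c where "c = (\<Sum>i<r. \<Sum>j<k. cmod (A $$ (i, j)))"
  have le: "cmod (A $$ (i, j)) \<le> c" if "i < r" "j < k" for i j
  proof -
    have "cmod (A $$ (i, j)) \<le> (\<Sum>j<k. cmod (A $$ (i, j)))"
      using that by (intro member_le_sum) simp_all
    also have "\<dots> \<le> c" unfolding c_def
      using that by (intro member_le_sum[of i "{..<r}" "\<lambda>i. \<Sum>j<k. cmod (A $$ (i, j))"]) (simp_all add: sum_nonneg)
    finally show ?thesis .
  qed
  have uv: "l2norm (unit_vec k j :: complex vec) \<le> 1"
  proof -
    have "l2norm (unit_vec k j :: complex vec) \<le> (\<Sum>i<k. cmod (unit_vec k j $ i))"
      by (simp add: l2norm_eq L2_set_le_sum)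
    also have "\<dots> = (\<Sum>i<k. if i = j then 1 else 0)" by (intro sum.cong) (simp_all add: unit_vec_def)
    finally show ?thesis using j by simp
  qed
  have "cmod (A $$ (i, j)) \<le> l2norm (A *\<^sub>v unit_vec k j)"
  proof -
    have "(A *\<^sub>v unit_vec k j) $ i = A $$ (i, j)" using A i j by simp
    then show ?thesis
      using member_le_L2_set[of "{..<r}" i "\<lambda>l. cmod ((A *\<^sub>v unit_vec k j) $ l)"] A i by (simp add: l2norm_eq)
  qed
  also have "\<dots> \<le> opnorm A"
    unfolding opnorm_def
  proof (rule cSup_upper)
    show "l2norm (A *\<^sub>v unit_vec k j) \<in> {l2norm (A *\<^sub>v v) |v. v \<in> carrier_vec (dim_col A) \<and> l2norm v \<le> 1}"
      using uv A by (intro CollectI exI[of _ "unit_vec k j"]) simp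
    show "bdd_above {l2norm (A *\<^sub>v v) |v. v \<in> carrier_vec (dim_col A) \<and> l2norm v \<le> 1}"
      by (rule bdd_aboveI[of _ "real r * real k * c"]) (use l2norm_mult_vec_le[OF A le] A in auto)
  qed
  finally show ?thesis .
qed

definition join_blocks :: "(nat \<Rightarrow> nat \<Rightarrow> complex mat) \<Rightarrow> complex mat" where
  "join_blocks w = four_block_mat (w 0 0) (w 0 1) (w 1 0) (w 1 1)"

definition block :: "nat \<Rightarrow> complex mat \<Rightarrow> nat \<Rightarrow> nat \<Rightarrow> complex mat" where
  "block n X i j = mat n n (\<lambda>(p, q). X $$ (i * n + p, j * n + q))"

lemma less_2_cases': "(i::nat) < 2 \<Longrightarrow> i = 0 \<or> i = 1"
  by auto

lemma join_blocks_carrier: "(\<And>i j. i < 2 \<Longrightarrow> j < 2 \<Longrightarrow> w i j \<in> carrier_mat n n) \<Longrightarrow> join_blocks w \<in> carrier_mat (n + n) (n + n)"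
  unfolding join_blocks_def by (intro four_block_carrier_mat) simp_all

lemma block_join_blocks:
  assumes w: "\<And>i j. i < 2 \<Longrightarrow> j < 2 \<Longrightarrow> w i j \<in> carrier_mat n n" and ij: "i < 2" "j < 2"
  shows "block n (join_blocks w) i j = w i j"
proof (rule eq_matI)
  have d: "w 0 0 \<in> carrier_mat n n" "w 0 1 \<in> carrier_mat n n" "w 1 0 \<in> carrier_mat n n" "w 1 1 \<in> carrier_mat n n"
    using w by simp_all
  show "dim_row (block n (join_blocks w) i j) = dim_row (w i j)" "dim_col (block n (join_blocks w) i j) = dim_col (w i j)"
    using w[OF ij] by (simp_all add: block_def)
  fix p q assume "p < dim_row (w i j)" "q < dim_col (w i j)"
  then have pq: "p < n" "q < n" using w[OF ij] by simp_all
  show "block n (join_blocks w) i j $$ (p, q) = w i j $$ (p, q)"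
    using less_2_cases'[OF ij(1)] less_2_cases'[OF ij(2)] d pq
    by (elim disjE) (simp_all add: block_def join_blocks_def)
qed

lemma join_blocks_block:
  assumes X: "X \<in> carrier_mat (n + n) (n + n)"
  shows "join_blocks (block n X) = X"
proof (rule eq_matI)
  show "dim_row (join_blocks (block n X)) = dim_row X" "dim_col (join_blocks (block n X)) = dim_col X"
    using X by (simp_all add: join_blocks_def block_def)
  fix p q assume "p < dim_row X" "q < dim_col X"
  then have pq: "p < n + n" "q < n + n" using X by simp_all
  show "join_blocks (block n X) $$ (p, q) = X $$ (p, q)"
    using pq by (cases "p < n"; cases "q < n") (simp_all add: join_blocks_def block_def)
qed

lemma join_blocks_mult:
  assumes w: "\<And>i j. i < 2 \<Longrightarrow> j < 2 \<Longrightarrow> w i j \<in> carrier_mat n n" and v: "\<And>i j. i < 2 \<Longrightarrow> j < 2 \<Longrightarrow> v i j \<in> carrier_mat n n"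
  shows "join_blocks w * join_blocks v = join_blocks (\<lambda>i j. w i 0 * v 0 j + w i 1 * v 1 j)"
  unfolding join_blocks_def
  by (rule mult_four_block_mat[where ?nr1.0=n and ?n1.0=n and ?n2.0=n and ?nr2.0=n and ?nc1.0=n and ?nc2.0=n])
    (use w v in simp_all)

lemma double_mat_join: "a \<in> carrier_mat n n \<Longrightarrow> double_mat a = join_blocks (\<lambda>i j. if i = j then a else 0\<^sub>m n n)"
  by (simp add: double_mat_def join_blocks_def)

lemma join_blocks_one: "join_blocks (\<lambda>i j. if i = j then 1\<^sub>m n else 0\<^sub>m n n) = 1\<^sub>m (n + n)"
  by (simp add: join_blocks_def)

lemma join_blocks_cong:
  assumes "\<And>i j. i < 2 \<Longrightarrow> j < 2 \<Longrightarrow> w i j = v i j" shows "join_blocks w = join_blocks v"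
  using assms by (simp add: join_blocks_def)

text \<open>Block matrices identify a witness for the doubled matrices with its four blocks.\<close>

lemma double_mat_mult:
  assumes a: "a \<in> carrier_mat n n" and w: "\<And>i j. i < 2 \<Longrightarrow> j < 2 \<Longrightarrow> w i j \<in> carrier_mat n n"
  shows "double_mat a * join_blocks w = join_blocks (\<lambda>i j. a * w i j)"
    "join_blocks w * double_mat a = join_blocks (\<lambda>i j. w i j * a)"
proof -
  have d: "(if i = j then a else 0\<^sub>m n n) \<in> carrier_mat n n" for i j :: nat using a by simp
  have w': "w 0 0 \<in> carrier_mat n n" "w 0 1 \<in> carrier_mat n n" "w 1 0 \<in> carrier_mat n n" "w 1 1 \<in> carrier_mat n n"
    using w by simp_all
  show "double_mat a * join_blocks w = join_blocks (\<lambda>i j. a * w i j)"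
    unfolding double_mat_join[OF a]
  proof (rule trans[OF join_blocks_mult[where n=n] join_blocks_cong])
    fix i j :: nat assume ij: "i < 2" "j < 2"
    show "(if i = 0 then a else 0\<^sub>m n n) * w 0 j + (if i = 1 then a else 0\<^sub>m n n) * w 1 j = a * w i j"
      using less_2_cases'[OF ij(1)] a w[of 0 j] w[of 1 j] ij(2) by (elim disjE) simp_all
  qed (rule d, erule (1) w)
  show "join_blocks w * double_mat a = join_blocks (\<lambda>i j. w i j * a)"
    unfolding double_mat_join[OF a]
  proof (rule trans[OF join_blocks_mult[where n=n] join_blocks_cong])
    fix i j :: nat assume ij: "i < 2" "j < 2"
    show "w i 0 * (if 0 = j then a else 0\<^sub>m n n) + w i 1 * (if 1 = j then a else 0\<^sub>m n n) = w i j * a"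
      using less_2_cases'[OF ij(2)] a w[of i 0] w[of i 1] ij(1) by (elim disjE) simp_all
  qed (erule (1) w, rule d)
qed

definition cblock_similar :: "nat \<Rightarrow> complex mat \<Rightarrow> complex mat \<Rightarrow> (nat \<Rightarrow> nat \<Rightarrow> complex mat) \<Rightarrow> (nat \<Rightarrow> nat \<Rightarrow> complex mat) \<Rightarrow> bool" where
  "cblock_similar n a b w v \<longleftrightarrow> (\<forall>i<2. \<forall>j<2. w i j \<in> carrier_mat n n \<and> v i j \<in> carrier_mat n n \<and>
     a * w i j = w i j * b \<and>
     w i 0 * v 0 j + w i 1 * v 1 j = (if i = j then 1\<^sub>m n else 0\<^sub>m n n) \<and>
     v i 0 * w 0 j + v i 1 * w 1 j = (if i = j then 1\<^sub>m n else 0\<^sub>m n n))"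

lemma similar_mat_wit_iff:
  assumes a: "a \<in> carrier_mat n n" and b: "b \<in> carrier_mat n n"
  shows "similar_mat_wit a b x y \<longleftrightarrow> x \<in> carrier_mat n n \<and> y \<in> carrier_mat n n \<and> x * y = 1\<^sub>m n \<and> y * x = 1\<^sub>m n \<and> a * x = x * b"
proof
  assume s: "similar_mat_wit a b x y"
  have c: "x \<in> carrier_mat n n" "y \<in> carrier_mat n n" "x * y = 1\<^sub>m n" "y * x = 1\<^sub>m n" "a = x * b * y"
    using similar_mat_witD2[OF a s] by blast+
  have "a * x = x * b * (y * x)" unfolding c(5) using c(1,2) b by (simp add: assoc_mult_mat[of _ n n _ n _ n])
  then have "a * x = x * b" using c b by simp
  then show "x \<in> carrier_mat n n \<and> y \<in> carrier_mat n n \<and> x * y = 1\<^sub>m n \<and> y * x = 1\<^sub>m n \<and> a * x = x * b" using c by simp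
next
  assume s: "x \<in> carrier_mat n n \<and> y \<in> carrier_mat n n \<and> x * y = 1\<^sub>m n \<and> y * x = 1\<^sub>m n \<and> a * x = x * b"
  then have "x * b * y = a * (x * y)" using a by (metis assoc_mult_mat)
  then have "a = x * b * y" using s a by simp
  then show "similar_mat_wit a b x y" using s a b by (intro similar_mat_witI[of _ _ n]) simp_all
qed

lemma cblock_similar_join:
  assumes a: "a \<in> carrier_mat n n" and b: "b \<in> carrier_mat n n" and s: "cblock_similar n a b w v"
  shows "similar_mat_wit (double_mat a) (double_mat b) (join_blocks w) (join_blocks v)"
proof -
  have w: "w i j \<in> carrier_mat n n" and v: "v i j \<in> carrier_mat n n" if "i < 2" "j < 2" for i j
    using s that unfolding cblock_similar_def by blast+
  have da: "double_mat a \<in> carrier_mat (n + n) (n + n)" "double_mat b \<in> carrier_mat (n + n) (n + n)"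
    using a b by (simp_all add: double_mat_def)
  have "join_blocks w * join_blocks v = 1\<^sub>m (n + n)"
    unfolding join_blocks_one[symmetric]
    by (rule trans[OF join_blocks_mult[where n=n] join_blocks_cong]; (erule (1) w | erule (1) v)?)
      (use s in \<open>simp add: cblock_similar_def\<close>)
  moreover have "join_blocks v * join_blocks w = 1\<^sub>m (n + n)"
    unfolding join_blocks_one[symmetric]
    by (rule trans[OF join_blocks_mult[where n=n] join_blocks_cong]; (erule (1) w | erule (1) v)?)
      (use s in \<open>simp add: cblock_similar_def\<close>)
  moreover have "double_mat a * join_blocks w = join_blocks w * double_mat b"
    by (rule trans[OF double_mat_mult(1)[OF a] trans[OF join_blocks_cong double_mat_mult(2)[OF b, symmetric]]]; (erule (1) w)?)
      (use s in \<open>simp add: cblock_similar_def\<close>)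
  ultimately show ?thesis
    unfolding similar_mat_wit_iff[OF da] using join_blocks_carrier[of w n, OF w] join_blocks_carrier[of v n, OF v] by blast
qed

lemma cblock_similar_block:
  assumes a: "a \<in> carrier_mat n n" and b: "b \<in> carrier_mat n n"
    and s: "similar_mat_wit (double_mat a) (double_mat b) X Y"
  shows "cblock_similar n a b (block n X) (block n Y)"
proof -
  have da: "double_mat a \<in> carrier_mat (n + n) (n + n)" "double_mat b \<in> carrier_mat (n + n) (n + n)"
    using a b by (simp_all add: double_mat_def)
  have X: "X \<in> carrier_mat (n + n) (n + n)" and Y: "Y \<in> carrier_mat (n + n) (n + n)"
    and XY: "X * Y = 1\<^sub>m (n + n)" "Y * X = 1\<^sub>m (n + n)" "double_mat a * X = X * double_mat b"
    using s unfolding similar_mat_wit_iff[OF da] by blast+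
  have c: "block n Z i j \<in> carrier_mat n n" for Z i j by (simp add: block_def)
  have e: "join_blocks (\<lambda>i j. block n X i 0 * block n Y 0 j + block n X i 1 * block n Y 1 j) = join_blocks (\<lambda>i j. if i = j then 1\<^sub>m n else 0\<^sub>m n n)"
    "join_blocks (\<lambda>i j. block n Y i 0 * block n X 0 j + block n Y i 1 * block n X 1 j) = join_blocks (\<lambda>i j. if i = j then 1\<^sub>m n else 0\<^sub>m n n)"
    "join_blocks (\<lambda>i j. a * block n X i j) = join_blocks (\<lambda>i j. block n X i j * b)"
    using XY join_blocks_mult[of "block n X" n "block n Y", OF c c] join_blocks_mult[of "block n Y" n "block n X", OF c c]
      double_mat_mult(1)[OF a, of "block n X", OF c] double_mat_mult(2)[OF b, of "block n X", OF c]
    by (simp_all only: join_blocks_block[OF X] join_blocks_block[OF Y] join_blocks_one)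
  have inj: "w i j = v i j" if "join_blocks w = join_blocks v" "\<And>i j. i < 2 \<Longrightarrow> j < 2 \<Longrightarrow> w i j \<in> carrier_mat n n"
    "\<And>i j. i < 2 \<Longrightarrow> j < 2 \<Longrightarrow> v i j \<in> carrier_mat n n" "i < 2" "j < 2" for w v :: "nat \<Rightarrow> nat \<Rightarrow> complex mat" and i j
    using block_join_blocks[of w n i j] block_join_blocks[of v n i j] that by simp
  show ?thesis
    unfolding cblock_similar_def
  proof (intro allI impI conjI)
    fix i j :: nat assume ij: "i < 2" "j < 2"
    show "a * block n X i j = block n X i j * b"
      by (rule inj[OF e(3) _ _ ij]) (rule mult_carrier_mat[OF a c] mult_carrier_mat[OF c b])+
    show "block n X i 0 * block n Y 0 j + block n X i 1 * block n Y 1 j = (if i = j then 1\<^sub>m n else 0\<^sub>m n n)"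
      by (rule inj[OF e(1) _ _ ij]) (rule add_carrier_mat[OF mult_carrier_mat[OF c c]], simp)
    show "block n Y i 0 * block n X 0 j + block n Y i 1 * block n X 1 j = (if i = j then 1\<^sub>m n else 0\<^sub>m n n)"
      by (rule inj[OF e(2) _ _ ij]) (rule add_carrier_mat[OF mult_carrier_mat[OF c c]], simp)
  qed (rule c)+
qed

lemma block_entry_le:
  assumes X: "X \<in> carrier_mat (n + n) (n + n)" and ij: "i < 2" "j < 2" and pq: "p < n" "q < n"
  shows "cmod (block n X i j $$ (p, q)) \<le> opnorm X"
proof -
  have "i * n + p < n + n" "j * n + q < n + n" using less_2_cases'[OF ij(1)] less_2_cases'[OF ij(2)] pq by auto
  then have "cmod (X $$ (i * n + p, j * n + q)) \<le> opnorm X" by (rule entry_le_opnorm[OF X])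
  then show ?thesis using pq by (simp add: block_def)
qed

lemma join_blocks_opnorm_le:
  assumes w: "\<And>i j. i < 2 \<Longrightarrow> j < 2 \<Longrightarrow> w i j \<in> carrier_mat n n"
    and le: "\<And>i j p q. i < 2 \<Longrightarrow> j < 2 \<Longrightarrow> p < n \<Longrightarrow> q < n \<Longrightarrow> cmod (w i j $$ (p, q)) \<le> c"
  shows "opnorm (join_blocks w) \<le> real (n + n) * real (n + n) * c"
proof (rule opnorm_le[OF join_blocks_carrier[of w n, OF w]])
  fix p q assume pq: "p < n + n" "q < n + n"
  have d: "w 0 0 \<in> carrier_mat n n" "w 0 1 \<in> carrier_mat n n" "w 1 0 \<in> carrier_mat n n" "w 1 1 \<in> carrier_mat n n"
    using w by simp_all
  show "cmod (join_blocks w $$ (p, q)) \<le> c"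
    using pq d le by (cases "p < n"; cases "q < n") (simp_all add: join_blocks_def)
qed simp_all

section \<open>From bounded sequences to the similarity function\<close>

lemma Bseq_iff_le: "Bseq (f :: nat \<Rightarrow> complex) \<longleftrightarrow> (\<exists>c. \<forall>m. cmod (f m) \<le> c)"
  by (metis BseqE BseqI')

lemma linf_simps [simp]:
  "carrier linf = {f. Bseq f}" "mult linf = (\<lambda>f g k. f k * g k)" "one linf = (\<lambda>_. 1)" "zero linf = (\<lambda>_. 0)"
  "add linf = (\<lambda>f g k. f k + g k)" "module.smult linf = (\<lambda>c f k. c * f k)" "star linf = (\<lambda>f k. cnj (f k))"
  by (simp_all add: linf_def)

lemma Bseq_arith:
  fixes f g :: "nat \<Rightarrow> complex"
  assumes "Bseq f" "Bseq g"
  shows "Bseq (\<lambda>k. f k + g k)" "Bseq (\<lambda>k. f k * g k)" "Bseq (\<lambda>k. c * f k)" "Bseq (\<lambda>k. cnj (f k))"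
proof -
  obtain a where a: "\<And>m. cmod (f m) \<le> a" using assms(1) unfolding Bseq_iff_le by blast
  obtain b where b: "\<And>m. cmod (g m) \<le> b" using assms(2) unfolding Bseq_iff_le by blast
  have "cmod (f m + g m) \<le> a + b" for m using norm_triangle_ineq[of "f m" "g m"] a[of m] b[of m] by linarith
  then show "Bseq (\<lambda>k. f k + g k)" unfolding Bseq_iff_le by blast
  have "cmod (f m * g m) \<le> a * b" for m
    unfolding norm_mult using a[of m] b[of m] order_trans[OF norm_ge_zero a[of m]] by (intro mult_mono) simp_all
  then show "Bseq (\<lambda>k. f k * g k)" unfolding Bseq_iff_le by blast
  have "cmod (c * f m) \<le> cmod c * a" for m
    unfolding norm_mult using a[of m] by (intro mult_left_mono) simp_all
  then show "Bseq (\<lambda>k. c * f k)" unfolding Bseq_iff_le by blast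
  show "Bseq (\<lambda>k. cnj (f k))" using assms(1) unfolding Bseq_iff_le by simp
qed

lemma ring_linf: "ring linf"
proof (rule ringI)
  show "abelian_group linf"
  proof (rule abelian_groupI)
    fix f :: "nat \<Rightarrow> complex" assume f: "f \<in> carrier linf"
    show "\<exists>g\<in>carrier linf. g \<oplus>\<^bsub>linf\<^esub> f = \<zero>\<^bsub>linf\<^esub>"
      using Bseq_arith(3)[of f f "-1"] f by (intro bexI[of _ "\<lambda>k. -1 * f k"]) simp_all
  qed (simp_all add: Bseq_arith(1) algebra_simps)
  show "monoid linf" by (rule monoidI) (simp_all add: Bseq_arith(2) algebra_simps)
qed (simp_all add: algebra_simps)

interpretation linf_eval: evaluation linf "\<lambda>f c. f m = c" for m :: nat
  by (rule evaluation.intro[OF ring_linf]) (unfold_locales, simp_all)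

definition seq_mat :: "nat \<Rightarrow> (nat \<Rightarrow> complex mat) \<Rightarrow> (nat \<Rightarrow> complex) mat" where
  "seq_mat n a = mat n n (\<lambda>(p, q) m. a m $$ (p, q))"

lemma seq_mat_eval:
  assumes a: "\<And>m. a m \<in> carrier_mat n n" and le: "\<And>m p q. p < n \<Longrightarrow> q < n \<Longrightarrow> cmod (a m $$ (p, q)) \<le> c"
  shows "linf_eval.mat_eval m n (seq_mat n a) (a m)"
proof -
  have "Bseq (\<lambda>m. a m $$ (p, q))" if "p < n" "q < n" for p q
    unfolding Bseq_iff_le using le[OF that] by blast
  then show ?thesis using a by (simp add: linf_eval.mat_eval_def mat_alg_carrier seq_mat_def)
qed

lemma linf_mat_eqI:
  assumes X: "\<And>m. linf_eval.mat_eval m n X (x m)" and Y: "\<And>m. linf_eval.mat_eval m n Y (x m)"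
  shows "X = Y"
proof (rule mat_alg_eqI[of _ n linf])
  show "X \<in> carrier (mat_alg n linf)" "Y \<in> carrier (mat_alg n linf)"
    using X[of 0] Y[of 0] unfolding linf_eval.mat_eval_def by blast+
  fix i j assume "i < n" "j < n"
  then have "(X $$ (i, j)) m = (Y $$ (i, j)) m" for m
    using X[of m] Y[of m] unfolding linf_eval.mat_eval_def by simp
  then show "X $$ (i, j) = Y $$ (i, j)" by (rule ext)
qed

lemma smult_smult_mat: "(c :: complex) \<cdot>\<^sub>m (d \<cdot>\<^sub>m A) = (c * d) \<cdot>\<^sub>m A"
  by (rule eq_matI) simp_all

lemma smult_mult_smult:
  assumes "(A :: complex mat) \<in> carrier_mat n n" "B \<in> carrier_mat n n"
  shows "(s \<cdot>\<^sub>m A) * (r \<cdot>\<^sub>m B) = (s * r) \<cdot>\<^sub>m (A * B)"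
proof -
  have "(s \<cdot>\<^sub>m A) * (r \<cdot>\<^sub>m B) = s \<cdot>\<^sub>m (A * (r \<cdot>\<^sub>m B))"
    by (rule mult_smult_assoc_mat[OF assms(1) smult_carrier_mat[OF assms(2)]])
  also have "A * (r \<cdot>\<^sub>m B) = r \<cdot>\<^sub>m (A * B)" by (rule mult_smult_distrib[OF assms])
  finally show ?thesis by (simp add: smult_smult_mat)
qed

lemma one_smult_mat [simp]: "(1 :: complex) \<cdot>\<^sub>m A = A"
  by (rule eq_matI) simp_all

text \<open>Similarity is insensitive to scalar factors; this is what turns sequences of matrices
  without a common bound into bounded ones.\<close>

lemma cblock_similar_scale:
  assumes a: "a \<in> carrier_mat n n" and b: "b \<in> carrier_mat n n" and s: "cblock_similar n a b w v" and \<alpha>: "\<alpha> \<noteq> 0"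
  shows "cblock_similar n (\<mu> \<cdot>\<^sub>m a) (\<mu> \<cdot>\<^sub>m b) (\<lambda>i j. (1/\<alpha>) \<cdot>\<^sub>m w i j) (\<lambda>i j. \<alpha> \<cdot>\<^sub>m v i j)"
  unfolding cblock_similar_def
proof (intro allI impI conjI)
  fix i j :: nat assume ij: "i < 2" "j < 2"
  have c: "w i j \<in> carrier_mat n n" "v i j \<in> carrier_mat n n" if "i < 2" "j < 2" for i j
    using s that unfolding cblock_similar_def by blast+
  have e: "a * w i j = w i j * b" "w i 0 * v 0 j + w i 1 * v 1 j = (if i = j then 1\<^sub>m n else 0\<^sub>m n n)"
    "v i 0 * w 0 j + v i 1 * w 1 j = (if i = j then 1\<^sub>m n else 0\<^sub>m n n)"
    using s ij unfolding cblock_similar_def by blast+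
  have c2: "w i 0 \<in> carrier_mat n n" "w i 1 \<in> carrier_mat n n" "w 0 j \<in> carrier_mat n n" "w 1 j \<in> carrier_mat n n"
    "v i 0 \<in> carrier_mat n n" "v i 1 \<in> carrier_mat n n" "v 0 j \<in> carrier_mat n n" "v 1 j \<in> carrier_mat n n"
    using c ij by simp_all
  show "(1/\<alpha>) \<cdot>\<^sub>m w i j \<in> carrier_mat n n" "\<alpha> \<cdot>\<^sub>m v i j \<in> carrier_mat n n" using c[OF ij] by simp_all
  show "(\<mu> \<cdot>\<^sub>m a) * ((1/\<alpha>) \<cdot>\<^sub>m w i j) = (1/\<alpha>) \<cdot>\<^sub>m w i j * (\<mu> \<cdot>\<^sub>m b)"
    unfolding smult_mult_smult[OF a c(1)[OF ij]] smult_mult_smult[OF c(1)[OF ij] b] e by (simp add: mult.commute)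
  show "(1/\<alpha>) \<cdot>\<^sub>m w i 0 * (\<alpha> \<cdot>\<^sub>m v 0 j) + (1/\<alpha>) \<cdot>\<^sub>m w i 1 * (\<alpha> \<cdot>\<^sub>m v 1 j) = (if i = j then 1\<^sub>m n else 0\<^sub>m n n)"
    unfolding smult_mult_smult[OF c2(1) c2(7)] smult_mult_smult[OF c2(2) c2(8)] e(2)[symmetric] using \<alpha> by simp
  show "\<alpha> \<cdot>\<^sub>m v i 0 * ((1/\<alpha>) \<cdot>\<^sub>m w 0 j) + \<alpha> \<cdot>\<^sub>m v i 1 * ((1/\<alpha>) \<cdot>\<^sub>m w 1 j) = (if i = j then 1\<^sub>m n else 0\<^sub>m n n)"
    unfolding smult_mult_smult[OF c2(5) c2(3)] smult_mult_smult[OF c2(6) c2(4)] e(3)[symmetric] using \<alpha> by simp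
qed

lemma opnorm_pos_of_invertible:
  assumes n: "n \<ge> 1" and X: "X \<in> carrier_mat n n" and Y: "Y \<in> carrier_mat n n" and XY: "X * Y = 1\<^sub>m n"
  shows "opnorm X > 0"
proof (rule ccontr)
  assume np: "\<not> opnorm X > 0"
  have "X $$ (0, k) = 0" if "k < n" for k
  proof -
    have "cmod (X $$ (0, k)) \<le> opnorm X" using entry_le_opnorm[OF X, of 0 k] n that by simp
    then have "cmod (X $$ (0, k)) \<le> 0" using np by linarith
    then show ?thesis by simp
  qed
  then have "(X * Y) $$ (0, 0) = 0" using X Y n by (simp add: scalar_prod_def)
  then show False using XY n by simp
qed

lemma similarity_number_witness:
  assumes "similarity_number A B < ereal s"
  shows "\<exists>X Y. similar_mat_wit A B X Y \<and> opnorm X * opnorm Y < s"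
  using assms unfolding similarity_number_def INF_less_iff by auto

lemma similarity_number_le: "similar_mat_wit A B X Y \<Longrightarrow> similarity_number A B \<le> ereal (opnorm X * opnorm Y)"
  unfolding similarity_number_def by (rule INF_lower2[of "(X, Y)"]) simp_all

text \<open>By contraposition, one pair of matrices with condition number beyond \<open>m\<close> is
  collected for each \<open>m\<close>. A similarity between the two collected sequences has entries
  bounded uniformly in \<open>m\<close>, which contradicts the choice for large
  \<open>m\<close>.\<close>

theorem similarity_function_finite_if_kaplansky2_linf:
  assumes n: "n \<ge> 1" and k: "kaplansky2 (mat_alg n linf)"
  shows "similarity_function n t < \<infinity>"
proof (rule ccontr)
  assume inf: "\<not> similarity_function n t < \<infinity>"
  let ?S = "mat_alg n linf"
  have S: "ring ?S" by (rule ring_mat_alg[OF ring_linf])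
  have "\<exists>p. fst p \<in> carrier_mat n n \<and> snd p \<in> carrier_mat n n \<and>
      similarity_number (double_mat (fst p)) (double_mat (snd p)) \<le> ereal t \<and> ereal (real m) < similarity_number (fst p) (snd p)" for m :: nat
  proof -
    have "ereal (real m) < similarity_function n t" using inf by (cases "similarity_function n t") simp_all
    then show ?thesis unfolding similarity_function_def less_SUP_iff by auto
  qed
  then obtain p where p: "\<And>m. fst (p m) \<in> carrier_mat n n \<and> snd (p m) \<in> carrier_mat n n \<and>
      similarity_number (double_mat (fst (p m))) (double_mat (snd (p m))) \<le> ereal t \<and> ereal (real m) < similarity_number (fst (p m)) (snd (p m))"
    by metis
  define A where "A m = fst (p m)" for m
  define B where "B m = snd (p m)" for m
  have A: "A m \<in> carrier_mat n n" and B: "B m \<in> carrier_mat n n"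
    and AB: "similarity_number (double_mat (A m)) (double_mat (B m)) \<le> ereal t"
    and big: "ereal (real m) < similarity_number (A m) (B m)" for m
    using p[of m] by (simp_all add: A_def B_def)
  have "\<exists>q. similar_mat_wit (double_mat (A m)) (double_mat (B m)) (fst q) (snd q) \<and> opnorm (fst q) * opnorm (snd q) < t + 1" for m
  proof -
    have "similarity_number (double_mat (A m)) (double_mat (B m)) < ereal (t + 1)"
      by (rule le_less_trans[OF AB]) simp
    then show ?thesis using similarity_number_witness by fastforce
  qed
  then obtain q where q: "\<And>m. similar_mat_wit (double_mat (A m)) (double_mat (B m)) (fst (q m)) (snd (q m)) \<and> opnorm (fst (q m)) * opnorm (snd (q m)) < t + 1"
    by metis
  define X where "X m = fst (q m)" for m
  define Y where "Y m = snd (q m)" for m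
  have dA: "double_mat (A m) \<in> carrier_mat (n + n) (n + n)" "double_mat (B m) \<in> carrier_mat (n + n) (n + n)" for m
    using A B by (simp_all add: double_mat_def)
  have sXY: "similar_mat_wit (double_mat (A m)) (double_mat (B m)) (X m) (Y m)" and oXY: "opnorm (X m) * opnorm (Y m) < t + 1" for m
    using q[of m] by (simp_all add: X_def Y_def)
  have XC: "X m \<in> carrier_mat (n + n) (n + n)" "Y m \<in> carrier_mat (n + n) (n + n)" "X m * Y m = 1\<^sub>m (n + n)" for m
    using sXY[of m] unfolding similar_mat_wit_iff[OF dA] by blast+
  define \<alpha> where "\<alpha> m = opnorm (X m)" for m
  have \<alpha>: "\<alpha> m > 0" for m unfolding \<alpha>_def by (rule opnorm_pos_of_invertible[OF _ XC]) (use n in simp)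
  define \<mu> where "\<mu> m = 1 / (1 + opnorm (A m) + opnorm (B m))" for m
  have on: "0 \<le> opnorm (A m)" "0 \<le> opnorm (B m)" for m
    using order_trans[OF norm_ge_zero entry_le_opnorm[OF A, of 0 0]] order_trans[OF norm_ge_zero entry_le_opnorm[OF B, of 0 0]] n by simp_all
  have \<mu>: "\<mu> m > 0" for m using on[of m] by (simp add: \<mu>_def add_pos_nonneg)
  define a where "a m = complex_of_real (\<mu> m) \<cdot>\<^sub>m A m" for m
  define b where "b m = complex_of_real (\<mu> m) \<cdot>\<^sub>m B m" for m
  define w where "w m i j = (1 / complex_of_real (\<alpha> m)) \<cdot>\<^sub>m block n (X m) i j" for m i j
  define v where "v m i j = complex_of_real (\<alpha> m) \<cdot>\<^sub>m block n (Y m) i j" for m i j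
  have ab: "a m \<in> carrier_mat n n" "b m \<in> carrier_mat n n" for m using A B by (simp_all add: a_def b_def)
  have wv: "w m i j \<in> carrier_mat n n" "v m i j \<in> carrier_mat n n" for m i j by (simp_all add: w_def v_def block_def)
  have cs: "cblock_similar n (a m) (b m) (w m) (v m)" for m
    unfolding a_def b_def w_def v_def
    by (rule cblock_similar_scale[OF A B cblock_similar_block[OF A B sXY]]) (use \<alpha>[of m] in simp)
  have bound_ab: "cmod (a m $$ (i, j)) \<le> 1" "cmod (b m $$ (i, j)) \<le> 1" if "i < n" "j < n" for m i j
  proof -
    have "cmod (A m $$ (i, j)) \<le> 1 + opnorm (A m) + opnorm (B m)" "cmod (B m $$ (i, j)) \<le> 1 + opnorm (A m) + opnorm (B m)"
      using entry_le_opnorm[OF A that, of m] entry_le_opnorm[OF B that, of m] on[of m] by linarith+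
    moreover have "1 + opnorm (A m) + opnorm (B m) > 0" using on[of m] by simp
    ultimately show "cmod (a m $$ (i, j)) \<le> 1" "cmod (b m $$ (i, j)) \<le> 1"
      unfolding a_def b_def using A[of m] B[of m] that \<mu>[of m] by (simp_all add: norm_mult) (simp_all add: \<mu>_def)
  qed
  have bound_w: "cmod (w m i j $$ (r, s)) \<le> 1" if "i < 2" "j < 2" "r < n" "s < n" for m i j r s
    using block_entry_le[OF XC(1) that, of m] \<alpha>[of m] that by (simp add: w_def norm_mult norm_divide \<alpha>_def block_def)
  have bound_v: "cmod (v m i j $$ (r, s)) \<le> t + 1" if "i < 2" "j < 2" "r < n" "s < n" for m i j r s
  proof -
    have "cmod (v m i j $$ (r, s)) = \<alpha> m * cmod (block n (Y m) i j $$ (r, s))"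
      using \<alpha>[of m] that by (simp add: v_def norm_mult block_def)
    also have "\<dots> \<le> \<alpha> m * opnorm (Y m)" using block_entry_le[OF XC(2) that, of m] \<alpha>[of m] by (intro mult_left_mono) simp_all
    also have "\<dots> \<le> t + 1" using oXY[of m] by (simp add: \<alpha>_def)
    finally show ?thesis .
  qed
  define AA where "AA = seq_mat n a"
  define BB where "BB = seq_mat n b"
  define WW where "WW i j = seq_mat n (\<lambda>m. w m i j)" for i j
  define VV where "VV i j = seq_mat n (\<lambda>m. v m i j)" for i j
  have EA: "linf_eval.mat_eval m n AA (a m)" for m unfolding AA_def by (rule seq_mat_eval[OF ab(1) bound_ab(1)])
  have EB: "linf_eval.mat_eval m n BB (b m)" for m unfolding BB_def by (rule seq_mat_eval[OF ab(2) bound_ab(2)])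
  have EW: "linf_eval.mat_eval m n (WW i j) (w m i j)" if "i < 2" "j < 2" for m i j
    unfolding WW_def by (rule seq_mat_eval[of "\<lambda>m. w m i j", OF wv(1) bound_w[OF that]])
  have EV: "linf_eval.mat_eval m n (VV i j) (v m i j)" if "i < 2" "j < 2" for m i j
    unfolding VV_def by (rule seq_mat_eval[of "\<lambda>m. v m i j", OF wv(2) bound_v[OF that]])
  have car: "X \<in> carrier ?S" if "linf_eval.mat_eval m n X x" for X x m using that unfolding linf_eval.mat_eval_def by blast
  have Edelta: "linf_eval.mat_eval m n (if i = j then \<one>\<^bsub>?S\<^esub> else \<zero>\<^bsub>?S\<^esub>) (if i = j then 1\<^sub>m n else 0\<^sub>m n n)" for m and i j :: nat
    using linf_eval.mat_eval_one[of m n] linf_eval.mat_eval_zero[of m n] by simp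
  have "block_similar ?S AA BB WW VV"
    unfolding block_similar_def
  proof (intro allI impI conjI)
    fix i j :: nat assume ij: "i < 2" "j < 2"
    show "WW i j \<in> carrier ?S" "VV i j \<in> carrier ?S" using car[OF EW[OF ij]] car[OF EV[OF ij]] .
    have z: "(0::nat) < 2" "(1::nat) < 2" by simp_all
    have c: "a m * w m i j = w m i j * b m" "w m i 0 * v m 0 j + w m i 1 * v m 1 j = (if i = j then 1\<^sub>m n else 0\<^sub>m n n)"
      "v m i 0 * w m 0 j + v m i 1 * w m 1 j = (if i = j then 1\<^sub>m n else 0\<^sub>m n n)" for m
      using cs[of m] ij unfolding cblock_similar_def by blast+
    show "AA \<otimes>\<^bsub>?S\<^esub> WW i j = WW i j \<otimes>\<^bsub>?S\<^esub> BB"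
      by (rule linf_mat_eqI[OF linf_eval.mat_eval_mult[OF EA EW[OF ij]]])
        (use linf_eval.mat_eval_mult[OF EW[OF ij] EB] c(1) in simp)
    show "WW i 0 \<otimes>\<^bsub>?S\<^esub> VV 0 j \<oplus>\<^bsub>?S\<^esub> WW i 1 \<otimes>\<^bsub>?S\<^esub> VV 1 j = (if i = j then \<one>\<^bsub>?S\<^esub> else \<zero>\<^bsub>?S\<^esub>)"
      by (rule linf_mat_eqI[OF linf_eval.mat_eval_add[OF linf_eval.mat_eval_mult[OF EW[OF ij(1) z(1)] EV[OF z(1) ij(2)]]
              linf_eval.mat_eval_mult[OF EW[OF ij(1) z(2)] EV[OF z(2) ij(2)]]]]) (unfold c, rule Edelta)
    show "VV i 0 \<otimes>\<^bsub>?S\<^esub> WW 0 j \<oplus>\<^bsub>?S\<^esub> VV i 1 \<otimes>\<^bsub>?S\<^esub> WW 1 j = (if i = j then \<one>\<^bsub>?S\<^esub> else \<zero>\<^bsub>?S\<^esub>)"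
      by (rule linf_mat_eqI[OF linf_eval.mat_eval_add[OF linf_eval.mat_eval_mult[OF EV[OF ij(1) z(1)] EW[OF z(1) ij(2)]]
              linf_eval.mat_eval_mult[OF EV[OF ij(1) z(2)] EW[OF z(2) ij(2)]]]]) (unfold c, rule Edelta)
  qed
  then have "similar_in (mat_alg 2 ?S) (oplus_self ?S AA) (oplus_self ?S BB)"
    using block_similar_iff[OF S car[OF EA] car[OF EB]] by blast
  then have "similar_in ?S AA BB" using k car[OF EA] car[OF EB] unfolding kaplansky2_def by blast
  then obtain P Q where PQ: "P \<in> carrier ?S" "Q \<in> carrier ?S" "P \<otimes>\<^bsub>?S\<^esub> Q = \<one>\<^bsub>?S\<^esub>" "Q \<otimes>\<^bsub>?S\<^esub> P = \<one>\<^bsub>?S\<^esub>" "AA \<otimes>\<^bsub>?S\<^esub> P = P \<otimes>\<^bsub>?S\<^esub> BB"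
    unfolding similar_in_iff[OF S car[OF EA] car[OF EB]] by blast
  define ev where "ev Z m = mat n n (\<lambda>(p, q). (Z $$ (p, q)) m)" for Z :: "(nat \<Rightarrow> complex) mat" and m :: nat
  have Eev: "linf_eval.mat_eval m n Z (ev Z m)" if "Z \<in> carrier ?S" for Z m
    using that by (simp add: linf_eval.mat_eval_def ev_def)
  have bd: "\<exists>c\<ge>0. \<forall>m. opnorm (ev Z m) \<le> c" if Z: "Z \<in> carrier ?S" for Z
  proof -
    have "\<exists>c. \<forall>m. cmod ((Z $$ (p, q)) m) \<le> c" if "p < n" "q < n" for p q
      using mat_alg_entry[OF Z that] by (simp add: Bseq_iff_le)
    then have "\<forall>p q. \<exists>c. p < n \<longrightarrow> q < n \<longrightarrow> (\<forall>m. cmod ((Z $$ (p, q)) m) \<le> c)" by blast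
    then obtain c where c: "\<And>p q m. p < n \<Longrightarrow> q < n \<Longrightarrow> cmod ((Z $$ (p, q)) m) \<le> c p q" by metis
    define C where "C = (\<Sum>p<n. \<Sum>q<n. \<bar>c p q\<bar>)"
    have le: "cmod ((Z $$ (p, q)) m) \<le> C" if "p < n" "q < n" for p q m
    proof -
      have "cmod ((Z $$ (p, q)) m) \<le> \<bar>c p q\<bar>" using c[OF that, of m] by simp
      also have "\<dots> \<le> (\<Sum>q<n. \<bar>c p q\<bar>)" using that by (intro member_le_sum) simp_all
      also have "\<dots> \<le> C" unfolding C_def
        using that by (intro member_le_sum[of p "{..<n}" "\<lambda>p. \<Sum>q<n. \<bar>c p q\<bar>"]) (simp_all add: sum_nonneg)
      finally show ?thesis .
    qed
    have "opnorm (ev Z m) \<le> real n * real n * C" for m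
      by (rule opnorm_le) (simp_all add: ev_def le)
    moreover have "0 \<le> real n * real n * C" by (simp add: C_def sum_nonneg)
    ultimately show ?thesis by blast
  qed
  obtain c d where cd: "c \<ge> 0" "d \<ge> 0" "\<And>m. opnorm (ev P m) \<le> c" "\<And>m. opnorm (ev Q m) \<le> d"
    using bd[OF PQ(1)] bd[OF PQ(2)] by blast
  obtain m :: nat where m: "c * d < real m" using reals_Archimedean2 by blast
  have evc: "ev P m \<in> carrier_mat n n" "ev Q m \<in> carrier_mat n n" by (simp_all add: ev_def)
  have e1: "ev P m * ev Q m = 1\<^sub>m n"
    using linf_eval.mat_eval_unique[OF linf_eval.mat_eval_mult[OF Eev[OF PQ(1)] Eev[OF PQ(2)]]] linf_eval.mat_eval_one PQ(3) by simp
  have e2: "ev Q m * ev P m = 1\<^sub>m n"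
    using linf_eval.mat_eval_unique[OF linf_eval.mat_eval_mult[OF Eev[OF PQ(2)] Eev[OF PQ(1)]]] linf_eval.mat_eval_one PQ(4) by simp
  have e3: "a m * ev P m = ev P m * b m"
    using linf_eval.mat_eval_unique[OF linf_eval.mat_eval_mult[OF EA Eev[OF PQ(1)]]] linf_eval.mat_eval_mult[OF Eev[OF PQ(1)] EB] PQ(5) by simp
  have "A m * ev P m = ev P m * B m"
  proof -
    have "complex_of_real (\<mu> m) \<cdot>\<^sub>m (A m * ev P m) = complex_of_real (\<mu> m) \<cdot>\<^sub>m (ev P m * B m)"
      using e3 mult_smult_assoc_mat[OF A evc(1), of "complex_of_real (\<mu> m)" m] mult_smult_distrib[OF evc(1) B, of "complex_of_real (\<mu> m)" m]
      by (simp add: a_def b_def)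
    then have "(1 / complex_of_real (\<mu> m)) \<cdot>\<^sub>m (complex_of_real (\<mu> m) \<cdot>\<^sub>m (A m * ev P m)) = (1 / complex_of_real (\<mu> m)) \<cdot>\<^sub>m (complex_of_real (\<mu> m) \<cdot>\<^sub>m (ev P m * B m))"
      by simp
    then show ?thesis using \<mu>[of m] by (simp add: smult_smult_mat)
  qed
  then have "similar_mat_wit (A m) (B m) (ev P m) (ev Q m)"
    unfolding similar_mat_wit_iff[OF A B] using evc e1 e2 by blast
  then have "similarity_number (A m) (B m) \<le> ereal (opnorm (ev P m) * opnorm (ev Q m))" by (rule similarity_number_le)
  also have "\<dots> \<le> ereal (c * d)"
    using mult_mono[OF cd(3)[of m] cd(4)[of m] cd(1)] order_trans[OF norm_ge_zero entry_le_opnorm[OF evc(2), of 0 0]] n by simp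
  also have "\<dots> < ereal (real m)" using m by simp
  finally show False using big[of m] by simp
qed

section \<open>From the similarity function to abelian von Neumann algebras\<close>

context vn_algebra
begin

lemma op_alg_finsum:
  assumes "finite A" "\<And>i. i \<in> A \<Longrightarrow> f i \<in> M" "x \<in> carrier H"
  shows "finsum (op_alg H M) f A x = finsum H (\<lambda>i. f i x) A"
  using assms(1,2)
proof (induction A rule: finite_induct)
  case empty
  interpret R: ring "op_alg H M" by (rule ring_op_alg)
  show ?case using assms(3) by simp
next
  case (insert a A)
  interpret R: ring "op_alg H M" by (rule ring_op_alg)
  have "finsum (op_alg H M) f (insert a A) = f a \<oplus>\<^bsub>op_alg H M\<^esub> finsum (op_alg H M) f A"
    using insert by (intro R.finsum_insert) (simp_all add: Pi_iff)
  then have "finsum (op_alg H M) f (insert a A) x = f a x \<oplus>\<^bsub>H\<^esub> finsum (op_alg H M) f A x"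
    using assms(3) by simp
  also have "\<dots> = f a x \<oplus>\<^bsub>H\<^esub> finsum H (\<lambda>i. f i x) A" using insert by simp
  also have "\<dots> = finsum H (\<lambda>i. f i x) (insert a A)"
    using insert assms(3) by (intro M.finsum_insert[symmetric]) (simp_all add: Pi_iff)
  finally show ?case .
qed

lemma finite_bound:
  assumes "finite F" "F \<subseteq> M"
  shows "\<exists>B>0. \<forall>a\<in>F. \<forall>x\<in>carrier H. hnorm H (a x) \<le> B * hnorm H x"
  using assms
proof (induction F rule: finite_induct)
  case empty then show ?case by (intro exI[of _ 1]) simp
next
  case (insert b F)
  then obtain B where B: "B > 0" "\<forall>a\<in>F. \<forall>x\<in>carrier H. hnorm H (a x) \<le> B * hnorm H x" by blast
  obtain c where c: "c > 0" "\<forall>x\<in>carrier H. hnorm H (b x) \<le> c * hnorm H x"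
    using op_bound[OF bounded, of b] insert.prems by blast
  have "hnorm H (a x) \<le> max B c * hnorm H x" if "a \<in> insert b F" and x: "x \<in> carrier H" for a x
  proof -
    have m: "B * hnorm H x \<le> max B c * hnorm H x" "c * hnorm H x \<le> max B c * hnorm H x"
      using x by (intro mult_right_mono; simp)+
    show ?thesis
    proof (cases "a = b")
      case True
      then have "hnorm H (a x) \<le> c * hnorm H x" using c(2) x by blast
      then show ?thesis using m(2) by (rule order_trans)
    next
      case False
      then have "hnorm H (a x) \<le> B * hnorm H x" using B(2) that(1) x by simp
      then show ?thesis using m(1) by (rule order_trans)
    qed
  qed
  moreover have "max B c > 0" using B by simp
  ultimately show ?case by blast
qed

end

context abelian_vn_algebra
begin

lemma asymp_eigen_scalar: "(\<And>k. u k \<in> carrier H) \<Longrightarrow> asymp_eigen u (\<lambda>x\<in>carrier H. c \<odot>\<^bsub>H\<^esub> x) c"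
  by (simp add: asymp_eigen_def)

text \<open>Asymptotic eigenvalues along a fixed sequence of unit vectors behave like a partially
  defined character.\<close>

lemma evaluation_asymp_eigen:
  assumes u: "\<And>k. u k \<in> carrier H" "\<And>k. hnorm H (u k) = 1"
  shows "evaluation (op_alg H M) (asymp_eigen u)"
proof (rule evaluation.intro[OF ring_op_alg], unfold_locales)
  show "asymp_eigen u \<zero>\<^bsub>op_alg H M\<^esub> 0" using asymp_eigen_zero[OF u(1)] by simp
  show "asymp_eigen u \<one>\<^bsub>op_alg H M\<^esub> 1" using asymp_eigen_one[OF u(1)] by simp
  show "asymp_eigen u (a \<oplus>\<^bsub>op_alg H M\<^esub> b) (c + d)"
    if "a \<in> carrier (op_alg H M)" "b \<in> carrier (op_alg H M)" "asymp_eigen u a c" "asymp_eigen u b d" for a b c d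
    using asymp_eigen_add[OF u(1)] that by simp
  show "asymp_eigen u (a \<otimes>\<^bsub>op_alg H M\<^esub> b) (c * d)"
    if "a \<in> carrier (op_alg H M)" "b \<in> carrier (op_alg H M)" "asymp_eigen u a c" "asymp_eigen u b d" for a b c d
    using asymp_eigen_mult[OF u(1)] that by simp
  show "c = d" if "a \<in> carrier (op_alg H M)" "asymp_eigen u a c" "asymp_eigen u a d" for a c d
    using asymp_eigen_unique[OF u] that by simp
qed

text \<open>The infimum in the similarity number is approached up to \<open>1\<close>, and the
  witness is scaled to norm one, so that the bound on the product of the norms becomes a bound on
  the inverse alone.\<close>

lemma bounded_witness:
  assumes n: "n \<ge> 1" and ab: "a \<in> carrier_mat n n" "b \<in> carrier_mat n n"
    and s: "similarity_function n t \<le> ereal s" and dbl: "similarity_number (double_mat a) (double_mat b) \<le> ereal t"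
  obtains x y where "x \<in> carrier_mat n n" "y \<in> carrier_mat n n" "x * y = 1\<^sub>m n" "y * x = 1\<^sub>m n" "a * x = x * b"
    "\<And>p q. p < n \<Longrightarrow> q < n \<Longrightarrow> cmod (x $$ (p, q)) \<le> max 1 (s + 1) \<and> cmod (y $$ (p, q)) \<le> max 1 (s + 1)"
proof -
  have "similarity_number a b \<le> similarity_function n t"
    unfolding similarity_function_def by (rule SUP_upper2[of "(a, b)"]) (use ab dbl in simp_all)
  also have "\<dots> \<le> ereal s" by (rule s)
  also have "\<dots> < ereal (s + 1)" by simp
  finally obtain X Y where XY: "similar_mat_wit a b X Y" "opnorm X * opnorm Y < s + 1"
    using similarity_number_witness by blast
  have c: "X \<in> carrier_mat n n" "Y \<in> carrier_mat n n" "X * Y = 1\<^sub>m n" "Y * X = 1\<^sub>m n" "a * X = X * b"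
    using XY(1) unfolding similar_mat_wit_iff[OF ab] by blast+
  define r where "r = opnorm X"
  have r: "r > 0" unfolding r_def by (rule opnorm_pos_of_invertible[OF n c(1,2,3)])
  define x where "x = (1 / complex_of_real r) \<cdot>\<^sub>m X"
  define y where "y = complex_of_real r \<cdot>\<^sub>m Y"
  have xy: "x * y = 1\<^sub>m n" "y * x = 1\<^sub>m n" "a * x = x * b"
    using smult_mult_smult[OF c(1,2)] smult_mult_smult[OF c(2,1)] mult_smult_distrib[OF ab(1) c(1)] mult_smult_assoc_mat[OF c(1) ab(2)] c r
    by (simp_all add: x_def y_def)
  have le: "cmod (x $$ (p, q)) \<le> max 1 (s + 1) \<and> cmod (y $$ (p, q)) \<le> max 1 (s + 1)" if "p < n" "q < n" for p q
  proof
    have "cmod (x $$ (p, q)) = cmod (X $$ (p, q)) / r" using c that r by (simp add: x_def norm_mult norm_divide)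
    also have "\<dots> \<le> 1" using entry_le_opnorm[OF c(1) that] r by (simp add: r_def)
    finally show "cmod (x $$ (p, q)) \<le> max 1 (s + 1)" by simp
    have "cmod (y $$ (p, q)) = r * cmod (Y $$ (p, q))" using c that r by (simp add: y_def norm_mult)
    also have "\<dots> \<le> r * opnorm Y" using entry_le_opnorm[OF c(2) that] r by (intro mult_left_mono) simp_all
    finally show "cmod (y $$ (p, q)) \<le> max 1 (s + 1)" using XY(2) by (simp add: r_def)
  qed
  have xyc: "x \<in> carrier_mat n n" "y \<in> carrier_mat n n" using c by (simp_all add: x_def y_def)
  show ?thesis by (rule that[OF xyc xy le])
qed

text \<open>The unknowns are the entries of \<open>X\<close> (first index \<open>0\<close>) and of
  \<open>Y\<close> (first index \<open>1\<close>). The compact set \<open>K\<close> of the linear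
  system consists of the bounded tuples that satisfy \<open>X Y = 1 = Y X\<close>, and the linear
  equations are the entries of \<open>A X - X B = 0\<close>. Pointwise solvability is the finiteness
  of the similarity function at a bound for the given similarity of the doubles.\<close>

theorem kaplansky2_matrices_over_abelian:
  assumes n: "n \<ge> 1" and fin_sim: "\<forall>t\<ge>1. similarity_function n t < \<infinity>"
  shows "kaplansky2 (mat_alg n (op_alg H M))"
  unfolding kaplansky2_def
proof (intro ballI impI)
  let ?R = "op_alg H M" and ?S = "mat_alg n (op_alg H M)"
  have R: "ring ?R" by (rule ring_op_alg)
  have S: "ring ?S" by (rule ring_mat_alg[OF R])
  interpret R: ring ?R by (rule R)
  fix A B assume A: "A \<in> carrier ?S" and B: "B \<in> carrier ?S"
    and "similar_in (mat_alg 2 ?S) (oplus_self ?S A) (oplus_self ?S B)"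
  then obtain W V where WV: "block_similar ?S A B W V" using block_similar_iff[OF S A B] by blast
  have W: "W i j \<in> carrier ?S" and V: "V i j \<in> carrier ?S" if "i < 2" "j < 2" for i j
    using WV that unfolding block_similar_def by blast+
  have Ae: "A $$ (p, q) \<in> M" and Be: "B $$ (p, q) \<in> M" if "p < n" "q < n" for p q
    using mat_alg_entry[OF A that] mat_alg_entry[OF B that] by simp_all
  have We: "W i j $$ (p, q) \<in> M" and Ve: "V i j $$ (p, q) \<in> M" if "i < 2" "j < 2" "p < n" "q < n" for i j p q
    using mat_alg_entry[OF W[OF that(1,2)] that(3,4)] mat_alg_entry[OF V[OF that(1,2)] that(3,4)] by simp_all
  define neg where "neg b = compose (carrier H) (\<lambda>x\<in>carrier H. (-1) \<odot>\<^bsub>H\<^esub> x) b" for b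
  have negM: "neg b \<in> M" if "b \<in> M" for b unfolding neg_def by (rule compose_mem[OF scalar_mem that])
  have negv: "neg b x = (-1) \<odot>\<^bsub>H\<^esub> b x" if "b \<in> M" "x \<in> carrier H" for b x
    using that by (simp add: neg_def compose_eq)
  define nn where "nn = {..<n} \<times> {..<n}"
  define tt where "tt = {..<2::nat} \<times> {..<2::nat}"
  define F where "F = (\<lambda>pq. A $$ pq) ` nn \<union> (\<lambda>pq. B $$ pq) ` nn \<union> (\<lambda>pq. neg (B $$ pq)) ` nn
     \<union> (\<lambda>(ij, pq). W (fst ij) (snd ij) $$ pq) ` (tt \<times> nn) \<union> (\<lambda>(ij, pq). V (fst ij) (snd ij) $$ pq) ` (tt \<times> nn)"
  have Ffin: "finite F" unfolding F_def nn_def tt_def by simp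
  have FM: "F \<subseteq> M"
    unfolding F_def nn_def tt_def
  proof (intro Un_least image_subsetI; elim SigmaE; hypsubst)
    fix p q assume "p \<in> {..<n}" "q \<in> {..<n}"
    then show "A $$ (p, q) \<in> M" "B $$ (p, q) \<in> M" "neg (B $$ (p, q)) \<in> M" using Ae Be negM by simp_all
  next
    fix i j p q :: nat assume "i \<in> {..<2}" "j \<in> {..<2}" "p \<in> {..<n}" "q \<in> {..<n}"
    then show "(case ((i, j), p, q) of (ij, pq) \<Rightarrow> W (fst ij) (snd ij) $$ pq) \<in> M"
      "(case ((i, j), p, q) of (ij, pq) \<Rightarrow> V (fst ij) (snd ij) $$ pq) \<in> M" using We Ve by simp_all
  qed
  have FA: "A $$ (p, q) \<in> F" "B $$ (p, q) \<in> F" "neg (B $$ (p, q)) \<in> F" if "p < n" "q < n" for p q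
  proof -
    have m: "(p, q) \<in> nn" using that by (simp add: nn_def)
    show "A $$ (p, q) \<in> F" unfolding F_def by (rule UnI1[OF UnI1[OF UnI1[OF UnI1[OF imageI[OF m]]]]])
    show "B $$ (p, q) \<in> F" unfolding F_def by (rule UnI1[OF UnI1[OF UnI1[OF UnI2[OF imageI[OF m]]]]])
    show "neg (B $$ (p, q)) \<in> F" unfolding F_def by (rule UnI1[OF UnI1[OF UnI2[OF imageI[OF m]]]])
  qed
  have FW: "W i j $$ (p, q) \<in> F" "V i j $$ (p, q) \<in> F" if "i < 2" "j < 2" "p < n" "q < n" for i j p q
  proof -
    have m: "((i, j), (p, q)) \<in> tt \<times> nn" using that by (simp add: tt_def nn_def)
    have wv: "W i j $$ (p, q) \<in> (\<lambda>(ij, pq). W (fst ij) (snd ij) $$ pq) ` (tt \<times> nn)"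
      "V i j $$ (p, q) \<in> (\<lambda>(ij, pq). V (fst ij) (snd ij) $$ pq) ` (tt \<times> nn)"
      by (rule image_eqI[OF _ m], simp)+
    show "W i j $$ (p, q) \<in> F" unfolding F_def by (rule UnI1[OF UnI2[OF wv(1)]])
    show "V i j $$ (p, q) \<in> F" unfolding F_def by (rule UnI2[OF wv(2)])
  qed
  obtain Bd where Bd: "Bd > 0" "\<forall>a\<in>F. \<forall>x\<in>carrier H. hnorm H (a x) \<le> Bd * hnorm H x"
    by (rule exE[OF finite_bound[OF Ffin FM]], erule conjE, rule that)
  define L where "L = real (n + n) * real (n + n) * Bd"
  define t where "t = max 1 (L * L)"
  have "similarity_function n t < \<infinity>" using fin_sim by (simp add: t_def)
  then have "\<exists>s0. similarity_function n t < ereal (real s0)" by (metis less_PInf_Ex_of_nat infinity_ereal_def less_irrefl)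
  then obtain s0 :: nat where "similarity_function n t < ereal (real s0)" ..
  then have s: "similarity_function n t \<le> ereal (real s0)" by simp
  define cz where "cz = max 1 (real s0 + 1)"
  define I where "I = {..<2::nat} \<times> {..<n} \<times> {..<n}"
  define T where "T = {..<2::nat} \<times> {..<n}"
  define \<alpha> where "\<alpha> pq rk = (if fst rk = (0::nat) then A $$ (fst pq, snd rk) else neg (B $$ (snd rk, snd pq)))" for pq rk :: "nat \<times> nat"
  define \<kappa> where "\<kappa> pq rk = (if fst rk = (0::nat) then (0::nat, snd rk, snd pq) else (0, fst pq, snd rk))" for pq rk :: "nat \<times> nat"
  define K where "K = {z :: nat \<times> nat \<times> nat \<Rightarrow> complex. (\<forall>i\<in>I. cmod (z i) \<le> cz) \<and>
     (\<forall>p<n. \<forall>q<n. (\<Sum>k<n. z (0, p, k) * z (1, k, q)) = (if p = q then 1 else 0)) \<and>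
     (\<forall>p<n. \<forall>q<n. (\<Sum>k<n. z (1, p, k) * z (0, k, q)) = (if p = q then 1 else 0))}"
  have T2: "{..<2::nat} = {0, 1}" by auto
  have sumT: "(\<Sum>t\<in>T. f t) = (\<Sum>k<n. f (0, k)) + (\<Sum>k<n. f (1, k))" for f :: "nat \<times> nat \<Rightarrow> complex"
    using sum.cartesian_product[of "\<lambda>r k. f (r, k)" "{..<n}" "{0, 1}"] unfolding T_def T2 by simp
  have \<alpha>F: "\<alpha> j t \<in> F" if "j \<in> nn" "t \<in> T" for j t
  proof -
    have "fst j < n" "snd j < n" "snd t < n" using that unfolding nn_def T_def by (simp_all only: mem_Times_iff lessThan_iff)
    then show ?thesis unfolding \<alpha>_def using FA(1)[of "fst j" "snd t"] FA(3)[of "snd t" "snd j"] by simp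
  qed
  interpret sys: linear_system H M I nn T \<alpha> \<kappa> K cz
  proof unfold_locales
    show "finite I" "finite nn" "finite T" by (simp_all add: I_def nn_def T_def)
    show "\<alpha> j t \<in> M" if "j \<in> nn" "t \<in> T" for j t using \<alpha>F[OF that] FM by blast
    show "\<kappa> j t \<in> I" if "j \<in> nn" "t \<in> T" for j t
    proof -
      have "fst j < n" "snd j < n" "snd t < n" using that unfolding nn_def T_def by (simp_all only: mem_Times_iff lessThan_iff)
      then show ?thesis unfolding \<kappa>_def I_def by simp
    qed
    show "cmod (z i) \<le> cz" if "z \<in> K" "i \<in> I" for z i using that unfolding K_def by blast
  qed
  have pw: "\<exists>z\<in>K. \<forall>j\<in>nn. (\<Sum>t\<in>T. ev (\<alpha> j t) * z (\<kappa> j t)) = 0"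
    if u: "\<And>k. u k \<in> carrier H" "\<And>k. hnorm H (u k) = 1" and ev: "\<And>a. a \<in> F \<Longrightarrow> asymp_eigen u a (ev a)" for u ev
  proof -
    interpret E: evaluation ?R "asymp_eigen u" by (rule evaluation_asymp_eigen[OF u])
    define em where "em Z = mat n n (\<lambda>pq. ev (Z $$ pq))" for Z
    have emc: "em Z \<in> carrier_mat n n" for Z by (simp add: em_def)
    have EvA: "E.mat_eval n A (em A)" "E.mat_eval n B (em B)"
      unfolding E.mat_eval_def using A B emc FA ev by (simp_all add: em_def)
    have EvW: "E.mat_eval n (W i j) (em (W i j))" "E.mat_eval n (V i j) (em (V i j))" if "i < 2" "j < 2" for i j
      unfolding E.mat_eval_def using W[OF that] V[OF that] emc FW[OF that] ev by (simp_all add: em_def)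
    have Edelta: "E.mat_eval n (if i = j then \<one>\<^bsub>?S\<^esub> else \<zero>\<^bsub>?S\<^esub>) (if i = j then 1\<^sub>m n else 0\<^sub>m n n)" for i j :: nat
      using E.mat_eval_one[of n] E.mat_eval_zero[of n] by simp
    have cs: "cblock_similar n (em A) (em B) (\<lambda>i j. em (W i j)) (\<lambda>i j. em (V i j))"
      unfolding cblock_similar_def
    proof (intro allI impI conjI)
      fix i j :: nat assume ij: "i < 2" "j < 2"
      have z: "(0::nat) < 2" "(1::nat) < 2" by simp_all
      have c: "A \<otimes>\<^bsub>?S\<^esub> W i j = W i j \<otimes>\<^bsub>?S\<^esub> B"
        "W i 0 \<otimes>\<^bsub>?S\<^esub> V 0 j \<oplus>\<^bsub>?S\<^esub> W i 1 \<otimes>\<^bsub>?S\<^esub> V 1 j = (if i = j then \<one>\<^bsub>?S\<^esub> else \<zero>\<^bsub>?S\<^esub>)"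
        "V i 0 \<otimes>\<^bsub>?S\<^esub> W 0 j \<oplus>\<^bsub>?S\<^esub> V i 1 \<otimes>\<^bsub>?S\<^esub> W 1 j = (if i = j then \<one>\<^bsub>?S\<^esub> else \<zero>\<^bsub>?S\<^esub>)"
        using WV ij unfolding block_similar_def by blast+
      show "em A * em (W i j) = em (W i j) * em B"
        by (rule E.mat_eval_unique[OF E.mat_eval_mult[OF EvA(1) EvW(1)[OF ij]]])
          (unfold c, rule E.mat_eval_mult[OF EvW(1)[OF ij] EvA(2)])
      show "em (W i 0) * em (V 0 j) + em (W i 1) * em (V 1 j) = (if i = j then 1\<^sub>m n else 0\<^sub>m n n)"
        by (rule E.mat_eval_unique[OF E.mat_eval_add[OF E.mat_eval_mult[OF EvW(1)[OF ij(1) z(1)] EvW(2)[OF z(1) ij(2)]]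
            E.mat_eval_mult[OF EvW(1)[OF ij(1) z(2)] EvW(2)[OF z(2) ij(2)]]]]) (unfold c, rule Edelta)
      show "em (V i 0) * em (W 0 j) + em (V i 1) * em (W 1 j) = (if i = j then 1\<^sub>m n else 0\<^sub>m n n)"
        by (rule E.mat_eval_unique[OF E.mat_eval_add[OF E.mat_eval_mult[OF EvW(2)[OF ij(1) z(1)] EvW(1)[OF z(1) ij(2)]]
            E.mat_eval_mult[OF EvW(2)[OF ij(1) z(2)] EvW(1)[OF z(2) ij(2)]]]]) (unfold c, rule Edelta)
    qed (rule emc)+
    have evb: "cmod (ev a) \<le> Bd" if a: "a \<in> F" for a
      by (rule asymp_eigen_bound[OF u subsetD[OF FM a] ev[OF a]]) (use Bd(2) a in blast)
    have "similarity_number (double_mat (em A)) (double_mat (em B))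
       \<le> ereal (opnorm (join_blocks (\<lambda>i j. em (W i j))) * opnorm (join_blocks (\<lambda>i j. em (V i j))))"
      by (rule similarity_number_le[OF cblock_similar_join[OF emc emc cs]])
    also have "\<dots> \<le> ereal (L * L)"
    proof -
      have "opnorm (join_blocks (\<lambda>i j. em (W i j))) \<le> L" "opnorm (join_blocks (\<lambda>i j. em (V i j))) \<le> L"
        unfolding L_def by (rule join_blocks_opnorm_le[OF emc], use evb FW in \<open>simp add: em_def\<close>)+
      moreover have "0 \<le> opnorm (join_blocks (\<lambda>i j. em (V i j)))"
        using order_trans[OF norm_ge_zero entry_le_opnorm[OF join_blocks_carrier[OF emc], of 0 0]] n by simp
      moreover have "0 \<le> L" using Bd(1) by (simp add: L_def)
      ultimately show ?thesis by (simp add: mult_mono)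
    qed
    also have "\<dots> \<le> ereal t" by (simp add: t_def)
    finally have dbl: "similarity_number (double_mat (em A)) (double_mat (em B)) \<le> ereal t" .
    obtain x y where xy: "x \<in> carrier_mat n n" "y \<in> carrier_mat n n" "x * y = 1\<^sub>m n" "y * x = 1\<^sub>m n" "em A * x = x * em B"
      and le0: "\<And>p q. p < n \<Longrightarrow> q < n \<Longrightarrow> cmod (x $$ (p, q)) \<le> max 1 (real s0 + 1) \<and> cmod (y $$ (p, q)) \<le> max 1 (real s0 + 1)"
    proof (rule bounded_witness[OF n emc emc s dbl])
      fix x y
      assume "x \<in> carrier_mat n n" "y \<in> carrier_mat n n" "x * y = 1\<^sub>m n" "y * x = 1\<^sub>m n" "em A * x = x * em B"
        and "\<And>p q. p < n \<Longrightarrow> q < n \<Longrightarrow> cmod (x $$ (p, q)) \<le> max 1 (real s0 + 1) \<and> cmod (y $$ (p, q)) \<le> max 1 (real s0 + 1)"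
      then show thesis by (rule that[of x y])
    qed
    have le: "cmod (x $$ (p, q)) \<le> cz" "cmod (y $$ (p, q)) \<le> cz" if "p < n" "q < n" for p q
      using le0[OF that] unfolding cz_def by blast+
    define z where "z i = (if fst i = 0 then x $$ snd i else y $$ snd i)" for i :: "nat \<times> nat \<times> nat"
    have prod: "(g * h) $$ (p, q) = (\<Sum>k<n. g $$ (p, k) * h $$ (k, q))"
      if "g \<in> carrier_mat n n" "h \<in> carrier_mat n n" "p < n" "q < n" for g h :: "complex mat" and p q
      using that by (simp add: scalar_prod_def atLeast0LessThan)
    have "z \<in> K"
      unfolding K_def
    proof (intro CollectI conjI ballI allI impI)
      fix i assume "i \<in> I" then show "cmod (z i) \<le> cz" using le by (cases i) (simp add: I_def z_def)
    next
      fix p q assume pq: "p < n" "q < n"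
      show "(\<Sum>k<n. z (0, p, k) * z (1, k, q)) = (if p = q then 1 else 0)"
        using prod[OF xy(1,2) pq] xy(3) pq by (simp add: z_def)
      show "(\<Sum>k<n. z (1, p, k) * z (0, k, q)) = (if p = q then 1 else 0)"
        using prod[OF xy(2,1) pq] xy(4) pq by (simp add: z_def)
    qed
    moreover have "(\<Sum>t\<in>T. ev (\<alpha> j t) * z (\<kappa> j t)) = 0" if "j \<in> nn" for j
    proof -
      obtain p q where j: "j = (p, q)" "p < n" "q < n" using \<open>j \<in> nn\<close> unfolding nn_def by blast
      have ng: "ev (neg (B $$ (k, q))) = - ev (B $$ (k, q))" if k: "k < n" for k
      proof (rule asymp_eigen_unique[OF u negM[OF Be[OF k j(3)]] ev[OF FA(3)[OF k j(3)]]])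
        show "asymp_eigen u (neg (B $$ (k, q))) (- ev (B $$ (k, q)))"
          unfolding neg_def
          using asymp_eigen_mult[OF u(1) scalar_mem Be[OF k j(3)] asymp_eigen_scalar[OF u(1)] ev[OF FA(2)[OF k j(3)]], of "-1"] by simp
      qed
      have "(\<Sum>t\<in>T. ev (\<alpha> j t) * z (\<kappa> j t)) = (\<Sum>k<n. em A $$ (p, k) * x $$ (k, q)) - (\<Sum>k<n. x $$ (p, k) * em B $$ (k, q))"
        unfolding sumT using j by (simp add: \<alpha>_def \<kappa>_def z_def em_def ng sum_negf mult.commute)
      also have "\<dots> = 0"
        unfolding prod[OF emc xy(1) j(2,3), symmetric] prod[OF xy(1) emc j(2,3), symmetric] xy(5) by simp
      finally show ?thesis .
    qed
    ultimately show ?thesis by blast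
  qed
  have ex: "\<exists>Z. (\<forall>i\<in>I. Z i \<in> M) \<and> (\<forall>j\<in>nn. \<forall>x\<in>carrier H. finsum H (\<lambda>t. \<alpha> j t (Z (\<kappa> j t) x)) T = \<zero>\<^bsub>H\<^esub>) \<and>
    (\<forall>S f g b. finite S \<longrightarrow> f ` S \<subseteq> I \<longrightarrow> g ` S \<subseteq> I \<longrightarrow> (\<forall>z\<in>K. (\<Sum>s\<in>S. z (f s) * z (g s)) = b) \<longrightarrow>
      (\<forall>x\<in>carrier H. finsum H (\<lambda>s::nat. Z (f s) (Z (g s) x)) S = b \<odot>\<^bsub>H\<^esub> x))" (is "\<exists>Z. ?P Z")
  proof (rule sys.linear_system_solution[OF Ffin FM])
    show "\<alpha> j t \<in> F" if "j \<in> nn" "t \<in> T" for j t by (rule \<alpha>F[OF that])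
    fix u ev assume "\<And>k. u k \<in> carrier H" "\<And>k. hnorm H (u k) = 1" "\<And>a. a \<in> F \<Longrightarrow> asymp_eigen u a (ev a)"
    then show "\<exists>z\<in>K. \<forall>j\<in>nn. (\<Sum>t\<in>T. ev (\<alpha> j t) * z (\<kappa> j t)) = 0" by (rule pw[of u ev])
  qed
  from ex obtain Z where Z: "?P Z" ..
  have ZM: "\<forall>i\<in>I. Z i \<in> M" by (rule Z[THEN conjunct1])
  have Zlin: "\<forall>j\<in>nn. \<forall>x\<in>carrier H. finsum H (\<lambda>t. \<alpha> j t (Z (\<kappa> j t) x)) T = \<zero>\<^bsub>H\<^esub>"
    by (rule Z[THEN conjunct2, THEN conjunct1])
  have Zquad: "\<forall>S f g b. finite S \<longrightarrow> f ` S \<subseteq> I \<longrightarrow> g ` S \<subseteq> I \<longrightarrow> (\<forall>z\<in>K. (\<Sum>s\<in>S. z (f s) * z (g s)) = b) \<longrightarrow>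
      (\<forall>x\<in>carrier H. finsum H (\<lambda>s::nat. Z (f s) (Z (g s) x)) S = b \<odot>\<^bsub>H\<^esub> x)"
    by (rule Z[THEN conjunct2, THEN conjunct2])
  define X where "X = mat n n (\<lambda>(p, q). Z (0, p, q))"
  define Y where "Y = mat n n (\<lambda>(p, q). Z (1, p, q))"
  have Zm: "Z (r, p, q) \<in> M" if "r < 2" "p < n" "q < n" for r p q using ZM that by (simp add: I_def)
  have XY: "X \<in> carrier ?S" "Y \<in> carrier ?S"
    unfolding X_def Y_def by (rule mat_alg_carrierI, use Zm in simp)+
  have prodv: "((P \<otimes>\<^bsub>?S\<^esub> Q) $$ (p, q)) x = finsum H (\<lambda>k. (P $$ (p, k)) ((Q $$ (k, q)) x)) {..<n}"
    if PQ: "P \<in> carrier ?S" "Q \<in> carrier ?S" and pq: "p < n" "q < n" and x: "x \<in> carrier H" for P Q p q x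
  proof -
    have m: "P $$ (p, k) \<in> M" "Q $$ (k, q) \<in> M" if "k < n" for k
      using mat_alg_entry[OF PQ(1) pq(1) that] mat_alg_entry[OF PQ(2) that pq(2)] by simp_all
    have "((P \<otimes>\<^bsub>?S\<^esub> Q) $$ (p, q)) x = finsum H (\<lambda>k. (P $$ (p, k) \<otimes>\<^bsub>?R\<^esub> Q $$ (k, q)) x) {..<n}"
      unfolding mat_alg_index(1)[OF pq] by (rule op_alg_finsum) (use m x in simp_all)
    also have "\<dots> = finsum H (\<lambda>k. (P $$ (p, k)) ((Q $$ (k, q)) x)) {..<n}"
      using x by (simp add: compose_eq)
    finally show ?thesis .
  qed
  have eq: "P = Q" if PQ: "P \<in> carrier ?S" "Q \<in> carrier ?S"
    and e: "\<And>p q x. p < n \<Longrightarrow> q < n \<Longrightarrow> x \<in> carrier H \<Longrightarrow> (P $$ (p, q)) x = (Q $$ (p, q)) x" for P Q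
  proof (rule mat_alg_eqI[OF PQ])
    fix p q assume pq: "p < n" "q < n"
    show "P $$ (p, q) = Q $$ (p, q)"
      by (rule op_eqI') (use mat_alg_entry[OF PQ(1) pq] mat_alg_entry[OF PQ(2) pq] e[OF pq] in simp_all)
  qed
  have one: "\<one>\<^bsub>?S\<^esub> \<in> carrier ?S" by (simp add: mat_alg_def)
  have onev: "(\<one>\<^bsub>?S\<^esub> $$ (p, q)) x = (if p = q then 1 else 0) \<odot>\<^bsub>H\<^esub> x" if "p < n" "q < n" "x \<in> carrier H" for p q x
    unfolding mat_alg_index(3)[OF that(1,2)] using that by simp
  have "X \<otimes>\<^bsub>?S\<^esub> Y = \<one>\<^bsub>?S\<^esub>"
  proof (rule eq[OF mat_mult_closed[OF R XY] one])
    fix p q x assume pq: "p < n" "q < n" and x: "x \<in> carrier H"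
    have "((X \<otimes>\<^bsub>?S\<^esub> Y) $$ (p, q)) x = finsum H (\<lambda>k. Z (0, p, k) (Z (1, k, q) x)) {..<n}"
      unfolding prodv[OF XY pq x] using pq x Zm by (intro vsum_cong) (simp_all add: X_def Y_def)
    also have "\<dots> = (if p = q then 1 else 0) \<odot>\<^bsub>H\<^esub> x"
    proof -
      have "\<forall>z\<in>K. (\<Sum>k<n. z (0, p, k) * z (1, k, q)) = (if p = q then 1 else 0)" using pq unfolding K_def by blast
      moreover have "(\<lambda>k. (0, p, k)) ` {..<n} \<subseteq> I" "(\<lambda>k. (1, k, q)) ` {..<n} \<subseteq> I" using pq by (auto simp: I_def)
      ultimately show ?thesis
        using Zquad[THEN spec, THEN spec, THEN spec, THEN spec, of "{..<n}" "\<lambda>k. (0, p, k)" "\<lambda>k. (1, k, q)" "if p = q then 1 else 0"] x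
        by simp
    qed
    finally show "((X \<otimes>\<^bsub>?S\<^esub> Y) $$ (p, q)) x = (\<one>\<^bsub>?S\<^esub> $$ (p, q)) x" unfolding onev[OF pq x] .
  qed
  moreover have "Y \<otimes>\<^bsub>?S\<^esub> X = \<one>\<^bsub>?S\<^esub>"
  proof (rule eq[OF mat_mult_closed[OF R XY(2,1)] one])
    fix p q x assume pq: "p < n" "q < n" and x: "x \<in> carrier H"
    have "((Y \<otimes>\<^bsub>?S\<^esub> X) $$ (p, q)) x = finsum H (\<lambda>k. Z (1, p, k) (Z (0, k, q) x)) {..<n}"
      unfolding prodv[OF XY(2,1) pq x] using pq x Zm by (intro vsum_cong) (simp_all add: X_def Y_def)
    also have "\<dots> = (if p = q then 1 else 0) \<odot>\<^bsub>H\<^esub> x"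
    proof -
      have "\<forall>z\<in>K. (\<Sum>k<n. z (1, p, k) * z (0, k, q)) = (if p = q then 1 else 0)" using pq unfolding K_def by blast
      moreover have "(\<lambda>k. (1, p, k)) ` {..<n} \<subseteq> I" "(\<lambda>k. (0, k, q)) ` {..<n} \<subseteq> I" using pq by (auto simp: I_def)
      ultimately show ?thesis
        using Zquad[THEN spec, THEN spec, THEN spec, THEN spec, of "{..<n}" "\<lambda>k. (1, p, k)" "\<lambda>k. (0, k, q)" "if p = q then 1 else 0"] x
        by simp
    qed
    finally show "((Y \<otimes>\<^bsub>?S\<^esub> X) $$ (p, q)) x = (\<one>\<^bsub>?S\<^esub> $$ (p, q)) x" unfolding onev[OF pq x] .
  qed
  moreover have "A \<otimes>\<^bsub>?S\<^esub> X = X \<otimes>\<^bsub>?S\<^esub> B"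
  proof (rule eq[OF mat_mult_closed[OF R A XY(1)] mat_mult_closed[OF R XY(1) B]])
    fix p q x assume pq: "p < n" "q < n" and x: "x \<in> carrier H"
    have pqn: "(p, q) \<in> nn" using pq by (simp add: nn_def)
    have Tfin: "finite T" by (simp add: T_def)
    have l: "((A \<otimes>\<^bsub>?S\<^esub> X) $$ (p, q)) x = finsum H (\<lambda>k. (A $$ (p, k)) (Z (0, k, q) x)) {..<n}"
      unfolding prodv[OF A XY(1) pq x] using pq x Zm Ae by (intro vsum_cong) (simp_all add: X_def)
    have r: "((X \<otimes>\<^bsub>?S\<^esub> B) $$ (p, q)) x = finsum H (\<lambda>k. (B $$ (k, q)) (Z (0, p, k) x)) {..<n}"
      unfolding prodv[OF XY(1) B pq x] using pq x Zm Be comm[OF Zm Be x]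
      by (intro vsum_cong) (simp_all add: X_def)
    have tV: "\<alpha> (p, q) t (Z (\<kappa> (p, q) t) x) \<in> carrier H" if "t \<in> T" for t
      using sys.\<alpha>M[OF pqn that] sys.\<kappa>I[OF pqn that] ZM x by simp
    show "((A \<otimes>\<^bsub>?S\<^esub> X) $$ (p, q)) x = ((X \<otimes>\<^bsub>?S\<^esub> B) $$ (p, q)) x"
      unfolding l r
    proof (rule vec_eqI)
      fix y assume y: "y \<in> carrier H"
      have "(\<Sum>t\<in>T. ip H (\<alpha> (p, q) t (Z (\<kappa> (p, q) t) x)) y) = 0"
      proof -
        have "finsum H (\<lambda>t. \<alpha> (p, q) t (Z (\<kappa> (p, q) t) x)) T = \<zero>\<^bsub>H\<^esub>" using Zlin pqn x by blast
        then show ?thesis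
          using ip_vsum[of T "\<lambda>t. \<alpha> (p, q) t (Z (\<kappa> (p, q) t) x)" y] Tfin tV y by simp
      qed
      then have eq0: "(\<Sum>k<n. ip H ((A $$ (p, k)) (Z (0, k, q) x)) y) - (\<Sum>k<n. ip H ((B $$ (k, q)) (Z (0, p, k) x)) y) = 0"
        unfolding sumT using pq x y Zm Be by (simp add: \<alpha>_def \<kappa>_def negv ip_smult sum_negf)
      show "ip H (finsum H (\<lambda>k. (A $$ (p, k)) (Z (0, k, q) x)) {..<n}) y = ip H (finsum H (\<lambda>k. (B $$ (k, q)) (Z (0, p, k) x)) {..<n}) y"
      proof -
        have "(A $$ (p, k)) (Z (0, k, q) x) \<in> carrier H" "(B $$ (k, q)) (Z (0, p, k) x) \<in> carrier H" if "k \<in> {..<n}" for k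
          using that pq x Zm Ae Be by simp_all
        then have "ip H (finsum H (\<lambda>k. (A $$ (p, k)) (Z (0, k, q) x)) {..<n}) y = (\<Sum>k<n. ip H ((A $$ (p, k)) (Z (0, k, q) x)) y)"
          "ip H (finsum H (\<lambda>k. (B $$ (k, q)) (Z (0, p, k) x)) {..<n}) y = (\<Sum>k<n. ip H ((B $$ (k, q)) (Z (0, p, k) x)) y)"
          using y by (intro ip_vsum; simp)+
        then show ?thesis using eq0 by simp
      qed
    qed (use pq x Zm Ae Be in \<open>simp_all add: vsum_closed\<close>)
  qed
  ultimately show "similar_in ?S A B" unfolding similar_in_iff[OF S A B] using XY by blast
qed

end

section \<open>Square summable sequences as a Hilbert space in a given type\<close>

definition ell2 :: "(nat \<Rightarrow> complex) set" where
  "ell2 = {f. summable (\<lambda>k. (cmod (f k))\<^sup>2)}"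

lemma ell2_add: assumes "f \<in> ell2" "g \<in> ell2" shows "(\<lambda>k. f k + g k) \<in> ell2"
proof -
  have le: "norm ((cmod (f k + g k))\<^sup>2) \<le> 2 * (cmod (f k))\<^sup>2 + 2 * (cmod (g k))\<^sup>2" for k
  proof -
    have "(cmod (f k + g k))\<^sup>2 \<le> (cmod (f k) + cmod (g k))\<^sup>2" by (rule power_mono[OF norm_triangle_ineq norm_ge_zero])
    then show ?thesis
      using sum_squares_bound[of "cmod (f k)" "cmod (g k)"] unfolding power2_sum real_norm_def abs_power2 by linarith
  qed
  have "summable (\<lambda>k. 2 * (cmod (f k))\<^sup>2 + 2 * (cmod (g k))\<^sup>2)"
    using assms unfolding ell2_def mem_Collect_eq by (intro summable_add summable_mult)
  then show ?thesis
    unfolding ell2_def mem_Collect_eq by (rule summable_comparison_test'[where N = 0]) (rule le)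
qed

lemma ell2_smult: assumes "f \<in> ell2" shows "(\<lambda>k. c * f k) \<in> ell2"
  using summable_mult[of "\<lambda>k. (cmod (f k))\<^sup>2" "(cmod c)\<^sup>2"] assms
  unfolding ell2_def mem_Collect_eq norm_mult power_mult_distrib .

lemma ell2_zero: "(\<lambda>_. 0) \<in> ell2" by (simp add: ell2_def)

lemma ell2_prod_summable: assumes "f \<in> ell2" "g \<in> ell2" shows "summable (\<lambda>k. f k * cnj (g k))"
proof (rule summable_comparison_test'[where N = 0])
  show "summable (\<lambda>k. (cmod (f k))\<^sup>2 + (cmod (g k))\<^sup>2)"
    using assms unfolding ell2_def mem_Collect_eq by (rule summable_add)
  fix k :: nat
  have "0 \<le> cmod (f k) * cmod (g k)" by (rule mult_nonneg_nonneg[OF norm_ge_zero norm_ge_zero])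
  then show "norm (f k * cnj (g k)) \<le> (cmod (f k))\<^sup>2 + (cmod (g k))\<^sup>2"
    using sum_squares_bound[of "cmod (f k)" "cmod (g k)"] unfolding norm_mult complex_mod_cnj by linarith
qed

lemma ell2_bounded_partial_sums:
  assumes le: "\<And>m. (\<Sum>k<m. (cmod (f k))\<^sup>2) \<le> c"
  shows "f \<in> ell2" "(\<Sum>k. (cmod (f k))\<^sup>2) \<le> c"
proof -
  have s: "summable (\<lambda>k. (cmod (f k))\<^sup>2)" by (rule summableI_nonneg_bounded[OF zero_le_power2 le])
  then show "f \<in> ell2" unfolding ell2_def mem_Collect_eq .
  show "(\<Sum>k. (cmod (f k))\<^sup>2) \<le> c" by (rule suminf_le_const[OF s le])
qed

locale ell2_model =
  fixes j :: "(nat \<Rightarrow> complex) \<Rightarrow> 'h"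
  assumes inj: "inj j"
begin

definition co :: "'h \<Rightarrow> nat \<Rightarrow> complex" where "co = inv_into UNIV j"

text \<open>The structure is transported along the injection \<open>j\<close>, because the points of
  the space have to lie in the given type.\<close>

definition space :: "'h hilbert" where
  "space = \<lparr>carrier = j ` ell2, mult = undefined, one = undefined, zero = j (\<lambda>_. 0),
     add = (\<lambda>x y. j (\<lambda>k. co x k + co y k)), smult = (\<lambda>c x. j (\<lambda>k. c * co x k)),
     ip = (\<lambda>x y. \<Sum>k. co x k * cnj (co y k))\<rparr>"

lemma co_j [simp]: "co (j f) = f" using inj by (simp add: co_def)

lemma carrier_iff: "x \<in> carrier space \<longleftrightarrow> co x \<in> ell2 \<and> j (co x) = x"
proof
  show "co x \<in> ell2 \<and> j (co x) = x" if "x \<in> carrier space" using that by (auto simp: space_def)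
  show "x \<in> carrier space" if "co x \<in> ell2 \<and> j (co x) = x"
    using that imageI[of "co x" ell2 j] by (simp add: space_def)
qed

lemma j_mem [simp]: "j f \<in> carrier space \<longleftrightarrow> f \<in> ell2"
  by (simp add: carrier_iff)

lemma co_mem: "x \<in> carrier space \<Longrightarrow> co x \<in> ell2" by (simp add: carrier_iff)

lemma co_eqI:
  assumes x: "x \<in> carrier space" and y: "y \<in> carrier space" and e: "\<And>k. co x k = co y k"
  shows "x = y"
proof -
  have "co x = co y" by (rule ext) (rule e)
  then have "j (co x) = j (co y)" by (rule arg_cong)
  then show ?thesis using x y by (simp add: carrier_iff)
qed

lemma space_simps:
  "\<zero>\<^bsub>space\<^esub> = j (\<lambda>_. 0)" "x \<oplus>\<^bsub>space\<^esub> y = j (\<lambda>k. co x k + co y k)"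
  "c \<odot>\<^bsub>space\<^esub> x = j (\<lambda>k. c * co x k)" "ip space x y = (\<Sum>k. co x k * cnj (co y k))"
  by (simp_all add: space_def)

lemma co_simps [simp]:
  "co \<zero>\<^bsub>space\<^esub> k = 0" "co (x \<oplus>\<^bsub>space\<^esub> y) k = co x k + co y k" "co (c \<odot>\<^bsub>space\<^esub> x) k = c * co x k"
  by (simp_all add: space_simps)

lemma space_closed [simp]:
  "\<zero>\<^bsub>space\<^esub> \<in> carrier space"
  "x \<in> carrier space \<Longrightarrow> y \<in> carrier space \<Longrightarrow> x \<oplus>\<^bsub>space\<^esub> y \<in> carrier space"
  "x \<in> carrier space \<Longrightarrow> c \<odot>\<^bsub>space\<^esub> x \<in> carrier space"
  by (simp_all add: space_simps ell2_zero ell2_add ell2_smult co_mem)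

lemma abelian_group_space: "abelian_group space"
proof (rule abelian_groupI)
  fix x assume x: "x \<in> carrier space"
  show "\<exists>y\<in>carrier space. y \<oplus>\<^bsub>space\<^esub> x = \<zero>\<^bsub>space\<^esub>"
    by (rule bexI[of _ "(-1) \<odot>\<^bsub>space\<^esub> x"], rule co_eqI) (use x in simp_all)
next
  fix x y assume xy: "x \<in> carrier space" "y \<in> carrier space"
  show "x \<oplus>\<^bsub>space\<^esub> y \<in> carrier space" using xy by simp
  show "x \<oplus>\<^bsub>space\<^esub> y = y \<oplus>\<^bsub>space\<^esub> x" by (rule co_eqI) (use xy in \<open>simp_all add: add.commute\<close>)
next
  fix x y z assume xyz: "x \<in> carrier space" "y \<in> carrier space" "z \<in> carrier space"
  show "x \<oplus>\<^bsub>space\<^esub> y \<oplus>\<^bsub>space\<^esub> z = x \<oplus>\<^bsub>space\<^esub> (y \<oplus>\<^bsub>space\<^esub> z)"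
    by (rule co_eqI) (use xyz in \<open>simp_all add: add.assoc\<close>)
next
  fix x assume x: "x \<in> carrier space"
  show "\<zero>\<^bsub>space\<^esub> \<oplus>\<^bsub>space\<^esub> x = x" by (rule co_eqI) (use x in simp_all)
qed simp

lemma vectorspace_space: "vectorspace (class_ring :: complex ring) space"
proof -
  have f: "field (class_ring :: complex ring)" by (rule class_field)
  have c: "cring (class_ring :: complex ring)" by (rule domain.axioms(1)[OF field.axioms(1)[OF f]])
  have "module (class_ring :: complex ring) space"
  proof (rule moduleI[OF c abelian_group_space])
    fix a :: complex and x assume x: "x \<in> carrier space"
    show "a \<odot>\<^bsub>space\<^esub> x \<in> carrier space" using x by simp
  next
    fix a b :: complex and x assume x: "x \<in> carrier space"
    show "(a \<oplus>\<^bsub>class_ring\<^esub> b) \<odot>\<^bsub>space\<^esub> x = a \<odot>\<^bsub>space\<^esub> x \<oplus>\<^bsub>space\<^esub> b \<odot>\<^bsub>space\<^esub> x"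
      unfolding class_ring_simps by (rule co_eqI) (use x in \<open>simp_all add: distrib_right\<close>)
    show "(a \<otimes>\<^bsub>class_ring\<^esub> b) \<odot>\<^bsub>space\<^esub> x = a \<odot>\<^bsub>space\<^esub> (b \<odot>\<^bsub>space\<^esub> x)"
      unfolding class_ring_simps by (rule co_eqI) (use x in simp_all)
  next
    fix x assume x: "x \<in> carrier space"
    show "\<one>\<^bsub>class_ring\<^esub> \<odot>\<^bsub>space\<^esub> x = x"
      unfolding class_ring_simps by (rule co_eqI) (use x in simp_all)
  next
    fix a :: complex and x y assume x: "x \<in> carrier space" and y: "y \<in> carrier space"
    show "a \<odot>\<^bsub>space\<^esub> (x \<oplus>\<^bsub>space\<^esub> y) = a \<odot>\<^bsub>space\<^esub> x \<oplus>\<^bsub>space\<^esub> a \<odot>\<^bsub>space\<^esub> y"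
      by (rule co_eqI) (use x y in \<open>simp_all add: distrib_left\<close>)
  qed
  then show ?thesis using f by (rule vectorspace.intro)
qed

lemma co_diff:
  assumes "x \<in> carrier space" "y \<in> carrier space"
  shows "co (x \<ominus>\<^bsub>space\<^esub> y) k = co x k - co y k"
proof -
  note ab = abelian_group_space
  have n: "\<ominus>\<^bsub>space\<^esub> y \<in> carrier space" by (rule abelian_group.a_inv_closed[OF ab assms(2)])
  have "co (\<ominus>\<^bsub>space\<^esub> y \<oplus>\<^bsub>space\<^esub> y) k = 0" unfolding abelian_group.l_neg[OF ab assms(2)] by simp
  then show ?thesis unfolding a_minus_def co_simps by (simp add: add_eq_0_iff)
qed

lemma ip_self_sum:
  assumes "x \<in> carrier space"
  shows "ip space x x = complex_of_real (\<Sum>k. (cmod (co x k))\<^sup>2)"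
proof -
  have "summable (\<lambda>k. (cmod (co x k))\<^sup>2)" using co_mem[OF assms] by (simp add: ell2_def)
  from suminf_of_real[OF this, where 'a = complex] show ?thesis
    by (simp only: space_simps complex_norm_square)
qed

lemma hnorm_sum: "x \<in> carrier space \<Longrightarrow> hnorm space x = sqrt (\<Sum>k. (cmod (co x k))\<^sup>2)"
  by (simp add: hnorm_def ip_self_sum)

lemma partial_sum_le_hnorm:
  assumes "x \<in> carrier space" "finite I"
  shows "(\<Sum>k\<in>I. (cmod (co x k))\<^sup>2) \<le> (hnorm space x)\<^sup>2"
proof -
  have s: "summable (\<lambda>k. (cmod (co x k))\<^sup>2)" using co_mem[OF assms(1)] by (simp add: ell2_def)
  show ?thesis
    using sum_le_suminf[OF s assms(2)] suminf_nonneg[OF s] hnorm_sum[OF assms(1)] by simp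
qed

lemma co_le_hnorm: assumes "x \<in> carrier space" shows "cmod (co x k) \<le> hnorm space x"
proof -
  have "0 \<le> hnorm space x"
    using suminf_nonneg[of "\<lambda>k. (cmod (co x k))\<^sup>2"] co_mem[OF assms] by (simp add: hnorm_sum[OF assms] ell2_def)
  then show ?thesis
    using partial_sum_le_hnorm[OF assms, of "{k}"] by (simp add: power2_le_iff_abs_le)
qed

lemma hnorm_le_partial_sums:
  assumes "\<And>m. (\<Sum>k<m. (cmod (f k))\<^sup>2) \<le> c\<^sup>2" "0 \<le> c"
  shows "j f \<in> carrier space" "hnorm space (j f) \<le> c"
proof -
  show m: "j f \<in> carrier space" using ell2_bounded_partial_sums(1)[OF assms(1)] by simp
  show "hnorm space (j f) \<le> c"
    using ell2_bounded_partial_sums(2)[OF assms(1)] assms(2) by (simp add: hnorm_sum[OF m] real_le_lsqrt)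
qed

text \<open>Coordinates converge, and the bounds on partial sums of the differences pass to the limit.\<close>

lemma complete_space:
  assumes s: "range s \<subseteq> carrier space"
    and cauchy: "\<forall>e>0. \<exists>N. \<forall>i\<ge>N. \<forall>l\<ge>N. hnorm space (s i \<ominus>\<^bsub>space\<^esub> s l) < e"
  shows "\<exists>x\<in>carrier space. (\<lambda>i. hnorm space (s (i::nat) \<ominus>\<^bsub>space\<^esub> x)) \<longlonglongrightarrow> 0"
proof -
  have sc: "s i \<in> carrier space" for i using s by blast
  have dc: "x \<ominus>\<^bsub>space\<^esub> y \<in> carrier space" if "x \<in> carrier space" "y \<in> carrier space" for x y
    by (rule abelian_group.minus_closed[OF abelian_group_space that])
  have "\<exists>l. (\<lambda>i. co (s i) k) \<longlonglongrightarrow> l" for k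
  proof -
    have "Cauchy (\<lambda>i. co (s i) k)"
      unfolding Cauchy_def
    proof (intro allI impI)
      fix e :: real assume "e > 0"
      then obtain N where N: "\<forall>i\<ge>N. \<forall>l\<ge>N. hnorm space (s i \<ominus>\<^bsub>space\<^esub> s l) < e" using cauchy by blast
      have "dist (co (s i) k) (co (s l) k) < e" if "i \<ge> N" "l \<ge> N" for i l
        using co_le_hnorm[OF dc[OF sc sc], of i l k] N[rule_format, OF that] by (simp add: co_diff sc dist_norm)
      then show "\<exists>M. \<forall>i\<ge>M. \<forall>l\<ge>M. dist (co (s i) k) (co (s l) k) < e" by blast
    qed
    then show ?thesis using Cauchy_convergent convergent_def by blast
  qed
  then obtain f where f: "\<And>k. (\<lambda>i. co (s i) k) \<longlonglongrightarrow> f k" by metis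
  have close: "\<exists>N. \<forall>i\<ge>N. (\<lambda>k. co (s i) k - f k) \<in> ell2 \<and> hnorm space (j (\<lambda>k. co (s i) k - f k)) \<le> e" if e: "e > 0" for e
  proof -
    obtain N where N: "\<forall>i\<ge>N. \<forall>l\<ge>N. hnorm space (s i \<ominus>\<^bsub>space\<^esub> s l) < e" using cauchy e by blast
    have "(\<Sum>k<m. (cmod (co (s i) k - f k))\<^sup>2) \<le> e\<^sup>2" if i: "i \<ge> N" for i m
    proof (rule LIMSEQ_le_const2)
      show "(\<lambda>l. \<Sum>k<m. (cmod (co (s i) k - co (s l) k))\<^sup>2) \<longlonglongrightarrow> (\<Sum>k<m. (cmod (co (s i) k - f k))\<^sup>2)"
        by (intro tendsto_intros f)
      have "(\<Sum>k<m. (cmod (co (s i) k - co (s l) k))\<^sup>2) \<le> e\<^sup>2" if l: "l \<ge> N" for l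
      proof -
        have "(\<Sum>k<m. (cmod (co (s i) k - co (s l) k))\<^sup>2) \<le> (hnorm space (s i \<ominus>\<^bsub>space\<^esub> s l))\<^sup>2"
          using partial_sum_le_hnorm[OF dc[OF sc sc], of "{..<m}" i l] by (simp add: co_diff sc)
        also have "\<dots> \<le> e\<^sup>2"
          using N i l order_trans[OF norm_ge_zero co_le_hnorm[OF dc[OF sc sc]]]
          by (intro power_mono) (simp_all add: less_imp_le)
        finally show ?thesis .
      qed
      then show "\<exists>N. \<forall>l\<ge>N. (\<Sum>k<m. (cmod (co (s i) k - co (s l) k))\<^sup>2) \<le> e\<^sup>2" by blast
    qed
    then have "(\<lambda>k. co (s i) k - f k) \<in> ell2 \<and> hnorm space (j (\<lambda>k. co (s i) k - f k)) \<le> e" if "i \<ge> N" for i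
      using hnorm_le_partial_sums[of "\<lambda>k. co (s i) k - f k" e] that e by simp
    then show ?thesis by blast
  qed
  have fm: "f \<in> ell2"
  proof -
    have "\<exists>N. \<forall>i\<ge>N. (\<lambda>k. co (s i) k - f k) \<in> ell2 \<and> hnorm space (j (\<lambda>k. co (s i) k - f k)) \<le> 1"
      by (rule close) simp
    then obtain i where "\<forall>l\<ge>i. (\<lambda>k. co (s l) k - f k) \<in> ell2 \<and> hnorm space (j (\<lambda>k. co (s l) k - f k)) \<le> 1" ..
    note h = this
    have d: "(\<lambda>k. co (s i) k - f k) \<in> ell2" by (rule conjunct1[OF mp[OF spec[OF h, of i] order_refl]])
    show ?thesis using ell2_add[OF co_mem[OF sc[of i]] ell2_smult[OF d, of "-1"]] by simp
  qed
  then have fm': "j f \<in> carrier space" by simp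
  have eq: "s i \<ominus>\<^bsub>space\<^esub> j f = j (\<lambda>k. co (s i) k - f k)" for i
  proof (rule co_eqI)
    show "s i \<ominus>\<^bsub>space\<^esub> j f \<in> carrier space" by (rule dc[OF sc fm'])
    show "j (\<lambda>k. co (s i) k - f k) \<in> carrier space"
      using ell2_add[OF co_mem[OF sc[of i]] ell2_smult[OF fm, of "-1"]] by simp
    show "co (s i \<ominus>\<^bsub>space\<^esub> j f) k = co (j (\<lambda>k. co (s i) k - f k)) k" for k
      unfolding co_diff[OF sc fm'] co_j ..
  qed
  have "(\<lambda>i. hnorm space (s i \<ominus>\<^bsub>space\<^esub> j f)) \<longlonglongrightarrow> 0"
  proof (rule LIMSEQ_I)
    fix e :: real assume "e > 0"
    then have "0 < e / 2" by simp
    from close[OF this] obtain N where N: "\<forall>i\<ge>N. (\<lambda>k. co (s i) k - f k) \<in> ell2 \<and> hnorm space (j (\<lambda>k. co (s i) k - f k)) \<le> e / 2" ..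
    have "norm (hnorm space (s i \<ominus>\<^bsub>space\<^esub> j f) - 0) < e" if "i \<ge> N" for i
    proof -
      have m: "j (\<lambda>k. co (s i) k - f k) \<in> carrier space" and le: "hnorm space (j (\<lambda>k. co (s i) k - f k)) \<le> e / 2"
        using N that by simp_all
      have "0 \<le> hnorm space (j (\<lambda>k. co (s i) k - f k))" by (rule order_trans[OF norm_ge_zero co_le_hnorm[OF m, of 0]])
      then show ?thesis using le \<open>e > 0\<close> unfolding eq by simp
    qed
    then show "\<exists>no. \<forall>i\<ge>no. norm (hnorm space (s i \<ominus>\<^bsub>space\<^esub> j f) - 0) < e" by blast
  qed
  then show ?thesis using fm' by (rule bexI)
qed

lemma ip_self_pos:
  assumes x: "x \<in> carrier space" and nz: "x \<noteq> \<zero>\<^bsub>space\<^esub>"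
  shows "0 < Re (ip space x x)"
proof (rule ccontr)
  assume "\<not> 0 < Re (ip space x x)"
  then have h: "hnorm space x \<le> 0" unfolding hnorm_def real_sqrt_le_0_iff by (rule leI)
  have z: "co x k = 0" for k
  proof -
    have "cmod (co x k) \<le> 0" by (rule order_trans[OF co_le_hnorm[OF x] h])
    then show ?thesis by (rule norm_le_zero_iff[THEN iffD1])
  qed
  have "x = \<zero>\<^bsub>space\<^esub>"
  proof (rule co_eqI[OF x space_closed(1)])
    show "co x k = co \<zero>\<^bsub>space\<^esub> k" for k unfolding z co_simps(1) ..
  qed
  with nz show False by (rule notE)
qed

lemma hilbert_space_space: "hilbert_space space"
proof -
  note ps = ell2_prod_summable[OF co_mem co_mem]
  have a: "ip space (x \<oplus>\<^bsub>space\<^esub> y) z = ip space x z + ip space y z"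
    if "x \<in> carrier space" "y \<in> carrier space" "z \<in> carrier space" for x y z
    using suminf_add[OF ps[OF that(1,3)] ps[OF that(2,3)]] by (simp add: space_simps distrib_right)
  have b: "ip space (c \<odot>\<^bsub>space\<^esub> x) y = c * ip space x y"
    if "x \<in> carrier space" "y \<in> carrier space" for c x y
    using suminf_mult[OF ps[OF that], of c] by (simp add: space_simps mult.assoc)
  have c: "ip space y x = cnj (ip space x y)" if "x \<in> carrier space" "y \<in> carrier space" for x y
    using bounded_linear.suminf[OF bounded_linear_cnj ps[OF that]] by (simp add: space_simps mult.commute)
  have "hilbert_space_axioms space"
    by (rule hilbert_space_axioms.intro) (assumption | rule a b c ip_self_pos complete_space)+
  with vectorspace_space show ?thesis by (rule hilbert_space.intro)
qed


end

section \<open>Block diagonal operators\<close>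

locale ell2_blocks = ell2_model j + hilbert_space "ell2_model.space j" for j :: "(nat \<Rightarrow> complex) \<Rightarrow> 'h" +
  fixes n :: nat
  assumes n: "n > 0"
begin

definition e :: "nat \<Rightarrow> 'h" where "e k = j (\<lambda>m. if m = k then 1 else 0)"

text \<open>The orthogonal projection onto the coordinates \<open>q * n, \<dots>, q * n + n -
  1\<close>.\<close>

definition blk :: "nat \<Rightarrow> 'h \<Rightarrow> 'h" where
  "blk q = (\<lambda>x\<in>carrier space. j (\<lambda>k. if k div n = q then co x k else 0))"

definition M :: "('h \<Rightarrow> 'h) set" where "M = commutant space (range blk)"

text \<open>The entry \<open>(i, l)\<close> is the sequence, over the blocks \<open>q\<close>, of
  the entries of the \<open>q\<close>-th diagonal block.\<close>

definition ent :: "('h \<Rightarrow> 'h) \<Rightarrow> (nat \<Rightarrow> complex) mat" where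
  "ent T = mat n n (\<lambda>(i, l) q. co (T (e (q * n + l))) (q * n + i))"

lemma e_mem [simp]: "e k \<in> carrier space"
proof -
  have "summable (\<lambda>m. (cmod (if m = k then 1 else 0))\<^sup>2)" by (rule summable_finite[of "{k}"]) simp_all
  then show ?thesis by (simp add: e_def ell2_def)
qed

lemma co_e [simp]: "co (e k) m = (if m = k then 1 else 0)" by (simp add: e_def)

lemma ip_e: "ip space x (e k) = co x k"
proof -
  have "(\<Sum>m. co x m * cnj (co (e k) m)) = (\<Sum>m\<in>{k}. co x m * cnj (co (e k) m))" by (rule suminf_finite) simp_all
  then show ?thesis by (simp add: space_simps)
qed

lemma hnorm_e: "hnorm space (e k) = 1" by (simp add: hnorm_def ip_e)

lemma block_div [simp]: "l < n \<Longrightarrow> (q * n + l) div n = q" "l < n \<Longrightarrow> (q * n + l) mod n = l"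
  by simp_all

lemma blk_coord: "x \<in> carrier space \<Longrightarrow> co (blk q x) k = (if k div n = q then co x k else 0)"
  by (simp add: blk_def)

lemma mask_mem:
  assumes x: "x \<in> carrier space"
  shows "j (\<lambda>k. if k div n = q then co x k else 0) \<in> carrier space"
    "hnorm space (j (\<lambda>k. if k div n = q then co x k else 0)) \<le> hnorm space x"
proof -
  have le: "(\<Sum>k<m. (cmod (if k div n = q then co x k else 0))\<^sup>2) \<le> (hnorm space x)\<^sup>2" for m
  proof -
    have "(\<Sum>k<m. (cmod (if k div n = q then co x k else 0))\<^sup>2) \<le> (\<Sum>k<m. (cmod (co x k))\<^sup>2)"
      by (rule sum_mono) simp
    also have "\<dots> \<le> (hnorm space x)\<^sup>2" by (rule partial_sum_le_hnorm[OF x]) simp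
    finally show ?thesis .
  qed
  show "j (\<lambda>k. if k div n = q then co x k else 0) \<in> carrier space"
    "hnorm space (j (\<lambda>k. if k div n = q then co x k else 0)) \<le> hnorm space x"
    by (rule hnorm_le_partial_sums[OF le hnorm_nonneg[OF x]])+
qed

lemma blk_mem: "x \<in> carrier space \<Longrightarrow> blk q x \<in> carrier space"
  using mask_mem(1) by (simp add: blk_def)

lemma blk_bounded: "blk q \<in> bounded_ops space"
proof (rule bounded_opsI)
  fix x assume x: "x \<in> carrier space"
  show "blk q x \<in> carrier space" by (rule blk_mem[OF x])
  show "hnorm space (blk q x) \<le> 1 * hnorm space x" using mask_mem(2)[OF x] x by (simp add: blk_def)
  show "blk q (c \<odot>\<^bsub>space\<^esub> x) = c \<odot>\<^bsub>space\<^esub> blk q x" for c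
    by (rule co_eqI) (use x in \<open>simp_all add: blk_mem blk_coord\<close>)
next
  fix x y assume xy: "x \<in> carrier space" "y \<in> carrier space"
  show "blk q (x \<oplus>\<^bsub>space\<^esub> y) = blk q x \<oplus>\<^bsub>space\<^esub> blk q y"
    by (rule co_eqI) (use xy in \<open>simp_all add: blk_mem blk_coord\<close>)
next
  fix x assume "x \<notin> carrier space" then show "blk q x = undefined" by (simp add: blk_def)
qed

lemma blk_adjoint: "adjoint space (blk q) = blk q"
proof (rule adjoint_eqI[OF blk_bounded blk_bounded])
  fix x y assume xy: "x \<in> carrier space" "y \<in> carrier space"
  have "co (blk q x) k * cnj (co y k) = co x k * cnj (co (blk q y) k)" for k
    by (simp add: blk_coord[OF xy(1)] blk_coord[OF xy(2)])
  then show "ip space (blk q x) y = ip space x (blk q y)" by (simp add: space_simps)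
qed

lemma range_blk: "range blk \<subseteq> bounded_ops space" using blk_bounded by blast

lemma vn_M: "von_neumann_algebra space M"
  unfolding M_def by (rule commutant_vn[OF range_blk]) (elim rangeE, simp add: blk_adjoint)

lemma M_bounded: "T \<in> M \<Longrightarrow> T \<in> bounded_ops space" unfolding M_def commutant_iff by (rule conjunct1)

lemma M_commute: "T \<in> M \<Longrightarrow> x \<in> carrier space \<Longrightarrow> blk q (T x) = T (blk q x)"
  unfolding M_def commutant_iff by simp

text \<open>The coordinate is an inner product with a basis vector; moving the operator to the other
  side by its adjoint makes it a series that converges without any appeal to continuity.\<close>

lemma coord_expansion:
  assumes T: "T \<in> bounded_ops space" and x: "x \<in> carrier space"
  shows "co (T x) k = (\<Sum>m. co x m * co (T (e m)) k)"
proof -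
  have c: "cnj (co (adjoint space T (e k)) m) = co (T (e m)) k" for m
  proof -
    have "cnj (co (adjoint space T (e k)) m) = cnj (ip space (e k) (T (e m)))"
      using ip_adjoint'[OF T e_mem e_mem, of k m] by (simp add: ip_e)
    also have "\<dots> = ip space (T (e m)) (e k)"
      by (rule ip_cnj[symmetric]) (simp_all add: op_closed[OF T])
    finally show ?thesis by (simp add: ip_e)
  qed
  have "co (T x) k = ip space x (adjoint space T (e k))"
    using ip_adjoint[OF T x e_mem, of k] by (simp add: ip_e)
  then show ?thesis by (simp only: space_simps(4) c)
qed

text \<open>A basis vector is fixed by the projection of its block, and the operator commutes with
  that projection.\<close>

lemma off_block:
  assumes T: "T \<in> M" and ne: "m div n \<noteq> k div n"
  shows "co (T (e m)) k = 0"
proof -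
  have "blk (m div n) (e m) = e m"
    by (rule co_eqI[OF blk_mem[OF e_mem] e_mem]) (simp add: blk_coord[OF e_mem])
  then have "T (e m) = blk (m div n) (T (e m))" using M_commute[OF T e_mem, of "m div n" m] by simp
  then have "co (T (e m)) k = co (blk (m div n) (T (e m))) k" by (rule arg_cong)
  also have "\<dots> = 0" using ne by (simp add: blk_coord[OF op_closed[OF M_bounded[OF T] e_mem]])
  finally show ?thesis .
qed

lemma block_decomp: "k = k div n * n + k mod n" by simp

text \<open>Only the basis vectors of the block of the coordinate contribute to the expansion.\<close>

lemma block_formula:
  assumes T: "T \<in> M" and x: "x \<in> carrier space" and i: "i < n"
  shows "co (T x) (q * n + i) = (\<Sum>l<n. (ent T $$ (i, l)) q * co x (q * n + l))"
proof -
  let ?N = "(\<lambda>l. q * n + l) ` {..<n}"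
  have "co (T x) (q * n + i) = (\<Sum>m. co x m * co (T (e m)) (q * n + i))"
    by (rule coord_expansion[OF M_bounded[OF T] x])
  also have "\<dots> = (\<Sum>m\<in>?N. co x m * co (T (e m)) (q * n + i))"
  proof (rule suminf_finite)
    fix m assume m: "m \<notin> ?N"
    have "m div n \<noteq> q"
    proof
      assume q: "m div n = q"
      have "m = q * n + m mod n" using block_decomp[of m] unfolding q .
      moreover have "m mod n \<in> {..<n}" using n by simp
      ultimately have "m \<in> ?N" by (rule image_eqI)
      then show False using m by contradiction
    qed
    then have "m div n \<noteq> (q * n + i) div n" unfolding block_div(1)[OF i] .
    then have "co (T (e m)) (q * n + i) = 0" by (rule off_block[OF T])
    then show "co x m * co (T (e m)) (q * n + i) = 0" by simp
  qed simp
  also have "\<dots> = (\<Sum>l<n. co x (q * n + l) * co (T (e (q * n + l))) (q * n + i))"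
    by (subst sum.reindex) (simp_all add: inj_on_def)
  also have "\<dots> = (\<Sum>l<n. (ent T $$ (i, l)) q * co x (q * n + l))"
    by (rule sum.cong) (simp_all add: ent_def i)
  finally show ?thesis .
qed

lemma M_eqI:
  assumes S: "S \<in> M" and T: "T \<in> M" and eq: "ent S = ent T"
  shows "S = T"
proof (rule op_eqI'[OF M_bounded[OF S] M_bounded[OF T]])
  fix x assume x: "x \<in> carrier space"
  show "S x = T x"
  proof (rule co_eqI[OF op_closed[OF M_bounded[OF S] x] op_closed[OF M_bounded[OF T] x]])
    fix k
    have i: "k mod n < n" using n by simp
    show "co (S x) k = co (T x) k"
      using block_formula[OF S x i, of "k div n"] block_formula[OF T x i, of "k div n"] unfolding eq block_decomp[symmetric] by simp
  qed
qed

lemma ent_entry: "i < n \<Longrightarrow> l < n \<Longrightarrow> (ent T $$ (i, l)) q = co (T (e (q * n + l))) (q * n + i)"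
  by (simp add: ent_def)

lemma ent_mem:
  assumes T: "T \<in> M"
  shows "ent T \<in> carrier (mat_alg n linf)"
  unfolding ent_def
proof (rule mat_alg_carrierI)
  fix i l
  obtain c where c: "\<forall>x\<in>carrier space. hnorm space (T x) \<le> c * hnorm space x" using op_bound[OF M_bounded[OF T]] by blast
  have "cmod (co (T (e (q * n + l))) (q * n + i)) \<le> c" for q
  proof -
    have "cmod (co (T (e (q * n + l))) (q * n + i)) \<le> hnorm space (T (e (q * n + l)))"
      by (rule co_le_hnorm[OF op_closed[OF M_bounded[OF T] e_mem]])
    also have "\<dots> \<le> c * hnorm space (e (q * n + l))" by (rule bspec[OF c e_mem])
    finally show ?thesis by (simp add: hnorm_e)
  qed
  then show "(\<lambda>q. co (T (e (q * n + l))) (q * n + i)) \<in> carrier linf"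
    unfolding linf_simps mem_Collect_eq Bseq_iff_le by blast
qed

definition block_op :: "(nat \<Rightarrow> complex) mat \<Rightarrow> 'h \<Rightarrow> 'h" where
  "block_op A = (\<lambda>x\<in>carrier space. j (\<lambda>k. \<Sum>l<n. (A $$ (k mod n, l)) (k div n) * co x (k div n * n + l)))"

lemma sum_block: "(\<Sum>l<n. h (q * n + l)) = sum h {q * n..<q * n + n}" for h :: "nat \<Rightarrow> real"
  by (rule sum.reindex_bij_witness[of _ "\<lambda>k. k - q * n" "\<lambda>l. q * n + l"]) auto

lemma entries_bounded:
  assumes A: "A \<in> carrier (mat_alg n linf)"
  shows "\<exists>C\<ge>0. \<forall>i<n. \<forall>l<n. \<forall>q. cmod ((A $$ (i, l)) q) \<le> C"
proof -
  have "\<exists>c\<ge>0. i < n \<longrightarrow> l < n \<longrightarrow> (\<forall>q. cmod ((A $$ (i, l)) q) \<le> c)" for i l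
  proof (cases "i < n \<and> l < n")
    case True
    then have "Bseq (A $$ (i, l))" using mat_alg_entry[OF A, of i l] by simp
    then obtain c where c: "\<forall>q. cmod ((A $$ (i, l)) q) \<le> c" unfolding Bseq_iff_le by blast
    have "0 \<le> c" using order_trans[OF norm_ge_zero c[rule_format, of 0]] .
    then show ?thesis using c by blast
  qed auto
  then have "\<forall>i l. \<exists>c. 0 \<le> c \<and> (i < n \<longrightarrow> l < n \<longrightarrow> (\<forall>q. cmod ((A $$ (i, l)) q) \<le> c))" by blast
  then obtain c where c: "\<And>i l. 0 \<le> c i l \<and> (i < n \<longrightarrow> l < n \<longrightarrow> (\<forall>q. cmod ((A $$ (i, l)) q) \<le> c i l))" by metis
  have "cmod ((A $$ (i, l)) q) \<le> (\<Sum>i<n. \<Sum>l<n. c i l)" if "i < n" "l < n" for i l q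
  proof -
    have "cmod ((A $$ (i, l)) q) \<le> c i l" using c that by blast
    also have "\<dots> \<le> (\<Sum>l<n. c i l)" by (rule member_le_sum) (use c that in simp_all)
    also have "\<dots> \<le> (\<Sum>i<n. \<Sum>l<n. c i l)"
      by (rule member_le_sum[of i "{..<n}" "\<lambda>i. \<Sum>l<n. c i l"]) (use c that in \<open>simp_all add: sum_nonneg\<close>)
    finally show ?thesis .
  qed
  moreover have "0 \<le> (\<Sum>i<n. \<Sum>l<n. c i l)" using c by (simp add: sum_nonneg)
  ultimately show ?thesis by blast
qed

lemma sum_square_le: "(\<Sum>l<m. a l)\<^sup>2 \<le> real m * (\<Sum>l<m. (a l)\<^sup>2)" for a :: "nat \<Rightarrow> real"
proof -
  have "(\<Sum>l<m. \<bar>a l\<bar>) \<le> sqrt (\<Sum>l<m. (a l)\<^sup>2) * sqrt (real m)"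
    using L2_set_mult_ineq[of a "\<lambda>_. 1" "{..<m}"] by (simp add: L2_set_def)
  with sum_abs[of a "{..<m}"] have "\<bar>\<Sum>l<m. a l\<bar> \<le> sqrt (\<Sum>l<m. (a l)\<^sup>2) * sqrt (real m)" by (rule order_trans)
  then have "\<bar>\<Sum>l<m. a l\<bar>\<^sup>2 \<le> (sqrt (\<Sum>l<m. (a l)\<^sup>2) * sqrt (real m))\<^sup>2" by (rule power_mono) simp
  also have "\<dots> = real m * (\<Sum>l<m. (a l)\<^sup>2)" by (simp add: power_mult_distrib sum_nonneg)
  finally show ?thesis by simp
qed

text \<open>By Cauchy-Schwarz in each block, the image is bounded block by block, and the squared
  norms of the blocks add up.\<close>

lemma block_op_bound:
  assumes C: "0 \<le> C" "\<forall>i<n. \<forall>l<n. \<forall>q. cmod ((A $$ (i, l)) q) \<le> C" and x: "x \<in> carrier space"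
  shows "block_op A x \<in> carrier space" "hnorm space (block_op A x) \<le> real n * C * hnorm space x"
proof -
  let ?f = "\<lambda>k. \<Sum>l<n. (A $$ (k mod n, l)) (k div n) * co x (k div n * n + l)"
  let ?h = "\<lambda>k. (cmod (co x k))\<^sup>2"
  have pt: "(cmod (?f k))\<^sup>2 \<le> C\<^sup>2 * (real n * (\<Sum>l<n. ?h (k div n * n + l)))" for k
  proof -
    have i: "k mod n < n" using n by simp
    have "cmod (?f k) \<le> (\<Sum>l<n. cmod ((A $$ (k mod n, l)) (k div n) * co x (k div n * n + l)))" by (rule norm_sum)
    also have "\<dots> \<le> (\<Sum>l<n. C * cmod (co x (k div n * n + l)))"
      unfolding norm_mult by (rule sum_mono, rule mult_right_mono) (use C(2) i in simp_all)
    also have "\<dots> = C * (\<Sum>l<n. cmod (co x (k div n * n + l)))" by (simp add: sum_distrib_left)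
    finally have "(cmod (?f k))\<^sup>2 \<le> (C * (\<Sum>l<n. cmod (co x (k div n * n + l))))\<^sup>2" by (rule power_mono) simp
    also have "\<dots> = C\<^sup>2 * (\<Sum>l<n. cmod (co x (k div n * n + l)))\<^sup>2" by (rule power_mult_distrib)
    also have "\<dots> \<le> C\<^sup>2 * (real n * (\<Sum>l<n. ?h (k div n * n + l)))"
      by (rule mult_left_mono[OF sum_square_le]) simp
    finally show ?thesis .
  qed
  have le: "(\<Sum>k<m. (cmod (?f k))\<^sup>2) \<le> (real n * C * hnorm space x)\<^sup>2" for m
  proof -
    have "(\<Sum>k<m. (cmod (?f k))\<^sup>2) \<le> (\<Sum>k<m * n. (cmod (?f k))\<^sup>2)"
      by (rule sum_mono2) (use n in auto)
    also have "\<dots> = (\<Sum>q<m. \<Sum>k=q * n..<q * n + n. (cmod (?f k))\<^sup>2)" by (rule sum.nat_group[symmetric])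
    also have "\<dots> = (\<Sum>q<m. \<Sum>i<n. (cmod (?f (q * n + i)))\<^sup>2)" by (simp only: sum_block[of "\<lambda>k. (cmod (?f k))\<^sup>2"])
    also have "\<dots> \<le> (\<Sum>q<m. \<Sum>i<n. C\<^sup>2 * (real n * (\<Sum>l<n. ?h (q * n + l))))"
    proof (rule sum_mono, rule sum_mono)
      fix q i assume "i \<in> {..<n}"
      then have "(q * n + i) div n = q" by simp
      from pt[of "q * n + i", unfolded this] show "(cmod (?f (q * n + i)))\<^sup>2 \<le> C\<^sup>2 * (real n * (\<Sum>l<n. ?h (q * n + l)))"
        unfolding \<open>(q * n + i) div n = q\<close> .
    qed
    also have "\<dots> = (real n * C)\<^sup>2 * (\<Sum>q<m. \<Sum>k=q * n..<q * n + n. ?h k)"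
      unfolding sum_block[of ?h, symmetric] by (simp add: sum_distrib_left power2_eq_square mult_ac)
    also have "\<dots> = (real n * C)\<^sup>2 * (\<Sum>k<m * n. ?h k)" by (simp only: sum.nat_group)
    also have "\<dots> \<le> (real n * C)\<^sup>2 * (hnorm space x)\<^sup>2"
      by (rule mult_left_mono[OF partial_sum_le_hnorm[OF x]]) simp_all
    finally show ?thesis by (simp only: power_mult_distrib)
  qed
  have nn: "0 \<le> real n * C * hnorm space x" using C(1) hnorm_nonneg[OF x] by simp
  show "block_op A x \<in> carrier space" "hnorm space (block_op A x) \<le> real n * C * hnorm space x"
    using hnorm_le_partial_sums[OF le nn] x by (simp_all add: block_op_def)
qed

lemma block_op_mem:
  assumes A: "A \<in> carrier (mat_alg n linf)"
  shows "block_op A \<in> M"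
proof -
  obtain C where C: "0 \<le> C" "\<forall>i<n. \<forall>l<n. \<forall>q. cmod ((A $$ (i, l)) q) \<le> C" using entries_bounded[OF A] by blast
  note cl = block_op_bound(1)[OF C]
  have coord: "co (block_op A x) k = (\<Sum>l<n. (A $$ (k mod n, l)) (k div n) * co x (k div n * n + l))" if "x \<in> carrier space" for x k
    using that by (simp add: block_op_def)
  have "block_op A \<in> bounded_ops space"
  proof (rule bounded_opsI)
    fix x assume x: "x \<in> carrier space"
    show "block_op A x \<in> carrier space" by (rule cl[OF x])
    show "hnorm space (block_op A x) \<le> real n * C * hnorm space x" by (rule block_op_bound(2)[OF C x])
    show "block_op A (c \<odot>\<^bsub>space\<^esub> x) = c \<odot>\<^bsub>space\<^esub> block_op A x" for c
      by (rule co_eqI) (use x cl in \<open>simp_all add: coord sum_distrib_left mult.left_commute\<close>)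
  next
    fix x y assume xy: "x \<in> carrier space" "y \<in> carrier space"
    show "block_op A (x \<oplus>\<^bsub>space\<^esub> y) = block_op A x \<oplus>\<^bsub>space\<^esub> block_op A y"
      by (rule co_eqI) (use xy cl in \<open>simp_all add: coord distrib_left sum.distrib\<close>)
  next
    fix x assume "x \<notin> carrier space" then show "block_op A x = undefined" by (simp add: block_op_def)
  qed
  moreover have "blk q (block_op A x) = block_op A (blk q x)" if x: "x \<in> carrier space" for q x
  proof (rule co_eqI[OF blk_mem[OF cl[OF x]] cl[OF blk_mem[OF x]]])
    fix k
    show "co (blk q (block_op A x)) k = co (block_op A (blk q x)) k"
    proof (cases "k div n = q")
      case True
      have "co (block_op A (blk q x)) k = (\<Sum>l<n. (A $$ (k mod n, l)) (k div n) * co x (k div n * n + l))"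
        unfolding coord[OF blk_mem[OF x]] by (rule sum.cong) (simp_all add: blk_coord[OF x] True)
      then show ?thesis by (simp add: blk_coord[OF cl[OF x]] coord[OF x] True)
    next
      case False
      have "co (block_op A (blk q x)) k = 0"
        unfolding coord[OF blk_mem[OF x]] by (rule sum.neutral) (simp add: blk_coord[OF x] False)
      then show ?thesis by (simp add: blk_coord[OF cl[OF x]] False)
    qed
  qed
  ultimately show ?thesis unfolding M_def commutant_iff by simp
qed

lemma ent_block_op:
  assumes A: "A \<in> carrier (mat_alg n linf)"
  shows "ent (block_op A) = A"
proof (rule mat_alg_eqI[OF ent_mem[OF block_op_mem[OF A]] A])
  fix i l assume il: "i < n" "l < n"
  show "ent (block_op A) $$ (i, l) = A $$ (i, l)"
  proof (rule ext)
    fix q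
    have "(ent (block_op A) $$ (i, l)) q = (\<Sum>m<n. (A $$ (i, m)) q * co (e (q * n + l)) (q * n + m))"
      using il by (simp only: ent_entry block_op_def restrict_apply e_mem if_True co_j block_div)
    also have "\<dots> = (\<Sum>m<n. if m = l then (A $$ (i, m)) q else 0)" by (rule sum.cong) simp_all
    also have "\<dots> = (A $$ (i, l)) q" using il by simp
    finally show "(ent (block_op A) $$ (i, l)) q = (A $$ (i, l)) q" .
  qed
qed

lemma linf_finsum:
  assumes "finite S" "\<And>s. s \<in> S \<Longrightarrow> f s \<in> carrier linf"
  shows "finsum linf f S m = (\<Sum>s\<in>S. f s m)"
  by (rule linf_eval.E_sum) (use assms in simp_all)

lemma M_closed:
  assumes "S \<in> M" "T \<in> M"
  shows "compose (carrier space) S T \<in> M" "(\<lambda>x\<in>carrier space. S x \<oplus>\<^bsub>space\<^esub> T x) \<in> M"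
    "(\<lambda>x\<in>carrier space. c \<odot>\<^bsub>space\<^esub> T x) \<in> M" "adjoint space T \<in> M"
proof -
  interpret vn_algebra space M by (rule vn_algebra.intro[OF hilbert_space_axioms vn_algebra_axioms.intro[OF vn_M]])
  show "adjoint space T \<in> M" by (rule adjoint_mem[OF assms(2)])
  show "compose (carrier space) S T \<in> M"
    using commutant_compose[OF range_blk] assms unfolding M_def by simp
  show "(\<lambda>x\<in>carrier space. S x \<oplus>\<^bsub>space\<^esub> T x) \<in> M"
    using commutant_add[OF range_blk] assms unfolding M_def by simp
  show "(\<lambda>x\<in>carrier space. c \<odot>\<^bsub>space\<^esub> T x) \<in> M"
    using commutant_smult[OF range_blk] assms unfolding M_def by simp
qed

text \<open>Multiplicativity is the block formula applied to basis vectors. For the adjoint only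
  matrix entries with respect to basis vectors are compared, so no series has to be
  rearranged.\<close>

lemma ent_star_iso: "ent \<in> star_iso (op_alg space M) (mat_alg n linf)"
proof -
  have R: "ring (mat_alg n linf)" by (rule ring_mat_alg[OF ring_linf])
  interpret R: ring "mat_alg n linf" by (rule R)
  have one: "(\<lambda>x\<in>carrier space. x) \<in> M" unfolding M_def by (rule commutant_one[OF range_blk])
  have cl: "T x \<in> carrier space" if "T \<in> M" "x \<in> carrier space" for T x by (rule op_closed[OF M_bounded[OF that(1)] that(2)])
  have iso: "ent \<in> ring_iso (op_alg space M) (mat_alg n linf)"
  proof (rule ring_iso_memI)
    show "ent T \<in> carrier (mat_alg n linf)" if "T \<in> carrier (op_alg space M)" for T
      by (rule ent_mem) (use that in simp)
  next
    fix S T assume "S \<in> carrier (op_alg space M)" "T \<in> carrier (op_alg space M)"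
    then have S: "S \<in> M" and T: "T \<in> M" by simp_all
    show "ent (S \<otimes>\<^bsub>op_alg space M\<^esub> T) = ent S \<otimes>\<^bsub>mat_alg n linf\<^esub> ent T"
      unfolding op_alg_simps
    proof (rule mat_alg_eqI[OF ent_mem[OF M_closed(1)[OF S T]] R.m_closed[OF ent_mem[OF S] ent_mem[OF T]]], rule ext)
      fix i l q assume il: "i < n" "l < n"
      have m: "(ent S $$ (i, k)) \<otimes>\<^bsub>linf\<^esub> (ent T $$ (k, l)) \<in> carrier linf" if "k < n" for k
        using mat_alg_entry[OF ent_mem[OF S] il(1) that] mat_alg_entry[OF ent_mem[OF T] that il(2)]
        by (simp add: Bseq_arith(2))
      have "(ent (compose (carrier space) S T) $$ (i, l)) q = co (S (T (e (q * n + l)))) (q * n + i)"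
        unfolding ent_entry[OF il] by (simp add: compose_eq)
      also have "\<dots> = (\<Sum>k<n. (ent S $$ (i, k)) q * (ent T $$ (k, l)) q)"
        unfolding block_formula[OF S cl[OF T e_mem] il(1)]
        by (rule sum.cong[OF refl]) (simp add: ent_entry il)
      also have "\<dots> = ((ent S \<otimes>\<^bsub>mat_alg n linf\<^esub> ent T) $$ (i, l)) q"
        unfolding mat_alg_index(1)[OF il] by (subst linf_finsum) (use m in simp_all)
      finally show "(ent (compose (carrier space) S T) $$ (i, l)) q = ((ent S \<otimes>\<^bsub>mat_alg n linf\<^esub> ent T) $$ (i, l)) q" .
    qed
    show "ent (S \<oplus>\<^bsub>op_alg space M\<^esub> T) = ent S \<oplus>\<^bsub>mat_alg n linf\<^esub> ent T"
      unfolding op_alg_simps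
    proof (rule mat_alg_eqI[OF ent_mem[OF M_closed(2)[OF S T]] R.a_closed[OF ent_mem[OF S] ent_mem[OF T]]], rule ext)
      fix i l q assume il: "i < n" "l < n"
      show "(ent (\<lambda>x\<in>carrier space. S x \<oplus>\<^bsub>space\<^esub> T x) $$ (i, l)) q = ((ent S \<oplus>\<^bsub>mat_alg n linf\<^esub> ent T) $$ (i, l)) q"
        unfolding mat_alg_index(2)[OF il] by (simp add: ent_entry[OF il])
    qed
  next
    show "ent \<one>\<^bsub>op_alg space M\<^esub> = \<one>\<^bsub>mat_alg n linf\<^esub>"
      unfolding op_alg_simps
    proof (rule mat_alg_eqI[OF ent_mem[OF one] R.one_closed], rule ext)
      fix i l q assume il: "i < n" "l < n"
      show "(ent (\<lambda>x\<in>carrier space. x) $$ (i, l)) q = (\<one>\<^bsub>mat_alg n linf\<^esub> $$ (i, l)) q"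
        unfolding mat_alg_index(3)[OF il] by (simp add: ent_entry[OF il])
    qed
  next
    show "bij_betw ent (carrier (op_alg space M)) (carrier (mat_alg n linf))"
      unfolding op_alg_simps
    proof (rule bij_betw_byWitness[where f' = block_op])
      show "\<forall>T\<in>M. block_op (ent T) = T"
        by (intro ballI M_eqI block_op_mem ent_block_op ent_mem)
      show "\<forall>A\<in>carrier (mat_alg n linf). ent (block_op A) = A" by (intro ballI ent_block_op)
      show "ent ` M \<subseteq> carrier (mat_alg n linf)" by (intro image_subsetI ent_mem)
      show "block_op ` carrier (mat_alg n linf) \<subseteq> M" by (intro image_subsetI block_op_mem)
    qed
  qed
  have "ent (c \<odot>\<^bsub>op_alg space M\<^esub> T) = c \<odot>\<^bsub>mat_alg n linf\<^esub> ent T" if T: "T \<in> M" for c T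
  proof (rule eq_matI)
    fix i l assume "i < dim_row (c \<odot>\<^bsub>mat_alg n linf\<^esub> ent T)" "l < dim_col (c \<odot>\<^bsub>mat_alg n linf\<^esub> ent T)"
    then have il: "i < n" "l < n" by (simp_all add: mat_alg_def)
    show "ent (c \<odot>\<^bsub>op_alg space M\<^esub> T) $$ (i, l) = (c \<odot>\<^bsub>mat_alg n linf\<^esub> ent T) $$ (i, l)"
      unfolding mat_alg_index(5)[OF il] by (rule ext) (simp add: ent_entry[OF il])
  qed (simp_all add: ent_def mat_alg_def)
  moreover have "ent (star (op_alg space M) T) = star (mat_alg n linf) (ent T)" if T: "T \<in> M" for T
  proof (rule eq_matI)
    fix i l assume "i < dim_row (star (mat_alg n linf) (ent T))" "l < dim_col (star (mat_alg n linf) (ent T))"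
    then have il: "i < n" "l < n" by (simp_all add: mat_alg_def)
    show "ent (star (op_alg space M) T) $$ (i, l) = star (mat_alg n linf) (ent T) $$ (i, l)"
      unfolding mat_alg_index(6)[OF il] op_alg_simps linf_simps
    proof (rule ext)
      fix q
      have "co (adjoint space T (e (q * n + l))) (q * n + i) = ip space (e (q * n + l)) (T (e (q * n + i)))"
        using ip_adjoint'[OF M_bounded[OF T] e_mem e_mem] by (simp only: ip_e)
      also have "\<dots> = cnj (ip space (T (e (q * n + i))) (e (q * n + l)))" by (rule ip_cnj[OF cl[OF T e_mem] e_mem])
      finally show "(ent (adjoint space T) $$ (i, l)) q = cnj ((ent T $$ (l, i)) q)"
        unfolding ent_entry[OF il] ent_entry[OF il(2,1)] ip_e .
    qed
  qed (simp_all add: ent_def mat_alg_def)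
  ultimately show ?thesis using iso unfolding star_iso_def by simp
qed

end

section \<open>The equivalence\<close>

lemma star_iso_closed: "h \<in> star_iso R S \<Longrightarrow> x \<in> carrier R \<Longrightarrow> h x \<in> carrier S"
  using Ring.ring_hom_closed[of h R S x] unfolding star_iso_def ring_iso_def by blast

lemma star_iso_ring_iso: "h \<in> star_iso R S \<Longrightarrow> h \<in> ring_iso R S"
  by (simp add: star_iso_def)

lemma star_iso_star:
  assumes "h \<in> star_iso R S" "x \<in> carrier R"
  shows "h (c \<odot>\<^bsub>R\<^esub> x) = c \<odot>\<^bsub>S\<^esub> h x" "h (star R x) = star S (h x)"
  using assms by (simp_all add: star_iso_def)

lemma star_iso_trans:
  assumes h: "h \<in> star_iso R S" and g: "g \<in> star_iso S T"
  shows "g \<circ> h \<in> star_iso R T"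
proof -
  have "g \<circ> h \<in> ring_iso R T" by (rule ring_iso_set_trans[OF star_iso_ring_iso[OF h] star_iso_ring_iso[OF g]])
  then show ?thesis
    unfolding star_iso_def mem_Collect_eq comp_def
    by (simp add: star_iso_star[OF h] star_iso_star[OF g star_iso_closed[OF h]])
qed

lemma star_iso_sym:
  assumes R: "ring R" and h: "h \<in> star_iso R S"
    and cl: "\<And>c x. x \<in> carrier R \<Longrightarrow> c \<odot>\<^bsub>R\<^esub> x \<in> carrier R" "\<And>x. x \<in> carrier R \<Longrightarrow> star R x \<in> carrier R"
  shows "inv_into (carrier R) h \<in> star_iso S R"
proof -
  let ?g = "inv_into (carrier R) h"
  have iso: "?g \<in> ring_iso S R" by (rule ring_iso_set_sym[OF R star_iso_ring_iso[OF h]])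
  have bij: "bij_betw h (carrier R) (carrier S)" using star_iso_ring_iso[OF h] by (simp add: ring_iso_def)
  have inj: "inj_on h (carrier R)" and im: "h ` carrier R = carrier S" using bij by (simp_all add: bij_betw_def)
  have "?g (c \<odot>\<^bsub>S\<^esub> y) = c \<odot>\<^bsub>R\<^esub> ?g y \<and> ?g (star S y) = star R (?g y)" if y: "y \<in> carrier S" for y c
  proof -
    have y': "y \<in> h ` carrier R" using y im by simp
    have x: "?g y \<in> carrier R" by (rule inv_into_into[OF y'])
    have e: "h (?g y) = y" by (rule f_inv_into_f[OF y'])
    have "?g (h (c \<odot>\<^bsub>R\<^esub> ?g y)) = c \<odot>\<^bsub>R\<^esub> ?g y" by (rule inv_into_f_f[OF inj cl(1)[OF x]])
    moreover have "?g (h (star R (?g y))) = star R (?g y)" by (rule inv_into_f_f[OF inj cl(2)[OF x]])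
    ultimately show ?thesis unfolding star_iso_star[OF h x] e by blast
  qed
  then show ?thesis using iso unfolding star_iso_def by blast
qed

lemma hom_finsum:
  assumes R: "ring R" and S: "ring S" and h: "h \<in> Ring.ring_hom R S"
    and "finite I" "\<And>i. i \<in> I \<Longrightarrow> f i \<in> carrier R"
  shows "h (finsum R f I) = finsum S (\<lambda>i. h (f i)) I"
  using assms(4,5)
proof (induction I rule: finite_induct)
  interpret R: ring R by fact
  interpret S: ring S by fact
  case empty show ?case using ring_hom_zero[OF h R S] by simp
next
  interpret R: ring R by fact
  interpret S: ring S by fact
  case (insert a I)
  have m: "f a \<in> carrier R" "f \<in> I \<rightarrow> carrier R" using insert.prems by (simp_all add: Pi_iff)
  have m': "h (f a) \<in> carrier S" "(\<lambda>i. h (f i)) \<in> I \<rightarrow> carrier S"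
    using m ring_hom_closed[OF h] by (simp_all add: Pi_iff)
  have "h (finsum R f (insert a I)) = h (f a) \<oplus>\<^bsub>S\<^esub> h (finsum R f I)"
    unfolding R.finsum_insert[OF insert.hyps m(2,1)] by (rule ring_hom_add[OF h m(1) R.finsum_closed[OF m(2)]])
  also have "\<dots> = finsum S (\<lambda>i. h (f i)) (insert a I)"
    unfolding S.finsum_insert[OF insert.hyps m'(2,1)] using insert.IH insert.prems by simp
  finally show ?case .
qed

text \<open>Applying an isomorphism entrywise commutes with all operations, since each entry of a
  product is a finite sum of products.\<close>

lemma star_iso_mat_alg:
  assumes R: "ring R" and S: "ring S" and h: "h \<in> star_iso R S"
    and cl: "\<And>c x. x \<in> carrier R \<Longrightarrow> c \<odot>\<^bsub>R\<^esub> x \<in> carrier R" "\<And>x. x \<in> carrier R \<Longrightarrow> star R x \<in> carrier R"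
  shows "(\<lambda>A. mat n n (\<lambda>(i, j). h (A $$ (i, j)))) \<in> star_iso (mat_alg n R) (mat_alg n S)" (is "?h \<in> _")
proof -
  interpret R: ring R by fact
  interpret mR: ring "mat_alg n R" by (rule ring_mat_alg[OF R])
  interpret mS: ring "mat_alg n S" by (rule ring_mat_alg[OF S])
  have hom: "h \<in> Ring.ring_hom R S" and bij: "bij_betw h (carrier R) (carrier S)"
    using star_iso_ring_iso[OF h] by (simp_all add: ring_iso_def)
  have hc: "h x \<in> carrier S" if "x \<in> carrier R" for x by (rule star_iso_closed[OF h that])
  have ent: "?h A $$ (i, j) = h (A $$ (i, j))" if "i < n" "j < n" for A i j using that by simp
  have c: "?h A \<in> carrier (mat_alg n S)" if A: "A \<in> carrier (mat_alg n R)" for A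
    by (rule mat_alg_carrierI) (rule hc[OF mat_alg_entry[OF A]])
  have iso: "?h \<in> ring_iso (mat_alg n R) (mat_alg n S)"
  proof (rule ring_iso_memI)
    show "?h A \<in> carrier (mat_alg n S)" if A: "A \<in> carrier (mat_alg n R)" for A by (rule c[OF A])
  next
    fix A B assume A: "A \<in> carrier (mat_alg n R)" and B: "B \<in> carrier (mat_alg n R)"
    show "?h (A \<otimes>\<^bsub>mat_alg n R\<^esub> B) = ?h A \<otimes>\<^bsub>mat_alg n S\<^esub> ?h B"
    proof (rule mat_alg_eqI[OF c[OF mR.m_closed[OF A B]] mS.m_closed[OF c[OF A] c[OF B]]])
      fix i j assume ij: "i < n" "j < n"
      have "h (\<Oplus>\<^bsub>R\<^esub>k\<in>{..<n}. A $$ (i, k) \<otimes>\<^bsub>R\<^esub> B $$ (k, j)) = (\<Oplus>\<^bsub>S\<^esub>k\<in>{..<n}. h (A $$ (i, k) \<otimes>\<^bsub>R\<^esub> B $$ (k, j)))"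
        by (rule hom_finsum[OF R S hom]) (use mat_alg_entry[OF A ij(1)] mat_alg_entry[OF B _ ij(2)] in simp_all)
      also have "\<dots> = (\<Oplus>\<^bsub>S\<^esub>k\<in>{..<n}. ?h A $$ (i, k) \<otimes>\<^bsub>S\<^esub> ?h B $$ (k, j))"
      proof -
        interpret S: ring S by (rule S)
        show ?thesis
        proof (rule S.finsum_cong')
          show "(\<lambda>k. ?h A $$ (i, k) \<otimes>\<^bsub>S\<^esub> ?h B $$ (k, j)) \<in> {..<n} \<rightarrow> carrier S"
            using mat_alg_entry[OF c[OF A] ij(1)] mat_alg_entry[OF c[OF B] _ ij(2)] by (simp add: Pi_iff)
          fix k assume "k \<in> {..<n}"
          then have k: "k < n" by simp
          show "h (A $$ (i, k) \<otimes>\<^bsub>R\<^esub> B $$ (k, j)) = ?h A $$ (i, k) \<otimes>\<^bsub>S\<^esub> ?h B $$ (k, j)"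
            unfolding ent[OF ij(1) k] ent[OF k ij(2)]
            by (rule ring_hom_mult[OF hom mat_alg_entry[OF A ij(1) k] mat_alg_entry[OF B k ij(2)]])
        qed simp
      qed
      finally show "?h (A \<otimes>\<^bsub>mat_alg n R\<^esub> B) $$ (i, j) = (?h A \<otimes>\<^bsub>mat_alg n S\<^esub> ?h B) $$ (i, j)"
        unfolding ent[OF ij] mat_alg_index(1)[OF ij] .
    qed
    show "?h (A \<oplus>\<^bsub>mat_alg n R\<^esub> B) = ?h A \<oplus>\<^bsub>mat_alg n S\<^esub> ?h B"
    proof (rule mat_alg_eqI[OF c[OF mR.a_closed[OF A B]] mS.a_closed[OF c[OF A] c[OF B]]])
      fix i j assume ij: "i < n" "j < n"
      show "?h (A \<oplus>\<^bsub>mat_alg n R\<^esub> B) $$ (i, j) = (?h A \<oplus>\<^bsub>mat_alg n S\<^esub> ?h B) $$ (i, j)"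
        unfolding ent[OF ij] mat_alg_index(2)[OF ij] by (rule ring_hom_add[OF hom mat_alg_entry[OF A ij] mat_alg_entry[OF B ij]])
    qed
  next
    show "?h \<one>\<^bsub>mat_alg n R\<^esub> = \<one>\<^bsub>mat_alg n S\<^esub>"
    proof (rule mat_alg_eqI[OF c[OF mR.one_closed] mS.one_closed])
      fix i j assume ij: "i < n" "j < n"
      show "?h \<one>\<^bsub>mat_alg n R\<^esub> $$ (i, j) = \<one>\<^bsub>mat_alg n S\<^esub> $$ (i, j)"
        unfolding ent[OF ij] mat_alg_index(3)[OF ij] by (simp add: ring_hom_one[OF hom] ring_hom_zero[OF hom R S])
    qed
  next
    have inj: "inj_on h (carrier R)" and im: "h ` carrier R = carrier S" using bij by (simp_all add: bij_betw_def)
    show "bij_betw ?h (carrier (mat_alg n R)) (carrier (mat_alg n S))"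
      unfolding bij_betw_def
    proof
      show "inj_on ?h (carrier (mat_alg n R))"
      proof (rule inj_onI)
        fix A B assume A: "A \<in> carrier (mat_alg n R)" and B: "B \<in> carrier (mat_alg n R)" and eq: "?h A = ?h B"
        show "A = B"
        proof (rule mat_alg_eqI[OF A B])
          fix i j assume ij: "i < n" "j < n"
          have "h (A $$ (i, j)) = h (B $$ (i, j))" using arg_cong[OF eq, of "\<lambda>Z. Z $$ (i, j)"] unfolding ent[OF ij] .
          then show "A $$ (i, j) = B $$ (i, j)" by (rule inj_onD[OF inj _ mat_alg_entry[OF A ij] mat_alg_entry[OF B ij]])
        qed
      qed
      show "?h ` carrier (mat_alg n R) = carrier (mat_alg n S)"
      proof
        show "?h ` carrier (mat_alg n R) \<subseteq> carrier (mat_alg n S)" using c by (rule image_subsetI)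
        show "carrier (mat_alg n S) \<subseteq> ?h ` carrier (mat_alg n R)"
        proof
          fix B assume B: "B \<in> carrier (mat_alg n S)"
          let ?A = "mat n n (\<lambda>(i, j). inv_into (carrier R) h (B $$ (i, j)))"
          have Bi: "B $$ (i, j) \<in> h ` carrier R" if "i < n" "j < n" for i j using mat_alg_entry[OF B that] im by simp
          have A: "?A \<in> carrier (mat_alg n R)" by (rule mat_alg_carrierI) (rule inv_into_into[OF Bi])
          have "B = ?h ?A"
          proof (rule mat_alg_eqI[OF B c[OF A]])
            fix i j assume ij: "i < n" "j < n"
            show "B $$ (i, j) = ?h ?A $$ (i, j)" unfolding ent[OF ij] using ij f_inv_into_f[OF Bi[OF ij]] by simp
          qed
          then show "B \<in> ?h ` carrier (mat_alg n R)" using A by (rule image_eqI)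
        qed
      qed
    qed
  qed
  have "?h (c \<odot>\<^bsub>mat_alg n R\<^esub> A) = c \<odot>\<^bsub>mat_alg n S\<^esub> ?h A \<and> ?h (star (mat_alg n R) A) = star (mat_alg n S) (?h A)"
    if A: "A \<in> carrier (mat_alg n R)" for A c
  proof
    show "?h (c \<odot>\<^bsub>mat_alg n R\<^esub> A) = c \<odot>\<^bsub>mat_alg n S\<^esub> ?h A"
      by (rule eq_matI) (simp_all add: mat_alg_def star_iso_star(1)[OF h mat_alg_entry[OF A]])
    show "?h (star (mat_alg n R) A) = star (mat_alg n S) (?h A)"
      by (rule eq_matI) (simp_all add: mat_alg_def star_iso_star(2)[OF h mat_alg_entry[OF A]])
  qed
  then show ?thesis using iso unfolding star_iso_def by simp
qed

lemma corner_star_iso: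
  assumes R: "ring R"
  shows "(\<lambda>A. A $$ (0, 0)) \<in> star_iso (mat_alg 1 R) R"
proof -
  interpret R: ring R by fact
  have z: "(0::nat) < 1" by simp
  have one: "{..<1::nat} = {0}" by (simp add: lessThan_Suc)
  have "(\<lambda>A. A $$ (0, 0)) \<in> ring_iso (mat_alg 1 R) R"
  proof (rule ring_iso_memI)
    show "A $$ (0, 0) \<in> carrier R" if "A \<in> carrier (mat_alg 1 R)" for A by (rule mat_alg_entry[OF that z z])
  next
    fix A B assume A: "A \<in> carrier (mat_alg 1 R)" and B: "B \<in> carrier (mat_alg 1 R)"
    have m: "A $$ (0, 0) \<in> carrier R" "B $$ (0, 0) \<in> carrier R" by (rule mat_alg_entry[OF A z z], rule mat_alg_entry[OF B z z])
    show "(A \<otimes>\<^bsub>mat_alg 1 R\<^esub> B) $$ (0, 0) = A $$ (0, 0) \<otimes>\<^bsub>R\<^esub> B $$ (0, 0)"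
      unfolding mat_alg_index(1)[OF z z] one using m by simp
    show "(A \<oplus>\<^bsub>mat_alg 1 R\<^esub> B) $$ (0, 0) = A $$ (0, 0) \<oplus>\<^bsub>R\<^esub> B $$ (0, 0)" by (rule mat_alg_index(2)[OF z z])
  next
    show "\<one>\<^bsub>mat_alg 1 R\<^esub> $$ (0, 0) = \<one>\<^bsub>R\<^esub>" unfolding mat_alg_index(3)[OF z z] by simp
  next
    show "bij_betw (\<lambda>A. A $$ (0, 0)) (carrier (mat_alg 1 R)) (carrier R)"
    proof (rule bij_betw_byWitness[where f' = "\<lambda>a. mat 1 1 (\<lambda>(i, j). a)"])
      have c: "mat 1 1 (\<lambda>(i, j). a) \<in> carrier (mat_alg 1 R)" if "a \<in> carrier R" for a by (rule mat_alg_carrierI) (rule that)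
      show "\<forall>A\<in>carrier (mat_alg 1 R). mat 1 1 (\<lambda>(i, j). A $$ (0, 0)) = A"
      proof
        fix A assume A: "A \<in> carrier (mat_alg 1 R)"
        show "mat 1 1 (\<lambda>(i, j). A $$ (0, 0)) = A"
          by (rule mat_alg_eqI[OF c[OF mat_alg_entry[OF A z z]] A]) simp
      qed
      show "\<forall>a\<in>carrier R. mat 1 1 (\<lambda>(i, j). a) $$ (0, 0) = a" by simp
      show "(\<lambda>A. A $$ (0, 0)) ` carrier (mat_alg 1 R) \<subseteq> carrier R" by (rule image_subsetI) (rule mat_alg_entry[OF _ z z])
      show "(\<lambda>a. mat 1 1 (\<lambda>(i, j). a)) ` carrier R \<subseteq> carrier (mat_alg 1 R)" by (rule image_subsetI) (rule c)
    qed
  qed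
  then show ?thesis unfolding star_iso_def by simp
qed

text \<open>A sequence is determined by the rational lower cuts of the real and imaginary parts of
  its terms, which form a set of triples from a countable type.\<close>

lemma complex_sequences_lepoll_reals: "(UNIV :: (nat \<Rightarrow> complex) set) \<lesssim> (UNIV :: real set)"
proof -
  define cut where "cut f = to_nat ` {(m :: nat, b :: bool, r :: rat). of_rat r < (if b then Re (f m) else Im (f m))}" for f :: "nat \<Rightarrow> complex"
  have mem: "to_nat (m, b, r) \<in> cut f \<longleftrightarrow> of_rat r < (if b then Re (f m) else Im (f m))" for m b and r :: rat and f
  proof -
    have "to_nat (m, b, r) \<in> cut f \<longleftrightarrow> (m, b, r) \<in> {(m :: nat, b :: bool, r :: rat). of_rat r < (if b then Re (f m) else Im (f m))}"
      unfolding cut_def by (rule inj_image_mem_iff[OF inj_to_nat])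
    then show ?thesis by simp
  qed
  have le: "(if b then Re (f m) else Im (f m)) \<le> (if b then Re (g m) else Im (g m))" if eq: "cut f = cut g" for f g m b
  proof (rule ccontr)
    assume "\<not> (if b then Re (f m) else Im (f m)) \<le> (if b then Re (g m) else Im (g m))"
    then have "(if b then Re (g m) else Im (g m)) < (if b then Re (f m) else Im (f m))" by (rule not_le_imp_less)
    from of_rat_dense[OF this] obtain r where r: "(if b then Re (g m) else Im (g m)) < of_rat r" "of_rat r < (if b then Re (f m) else Im (f m))" by blast
    have "to_nat (m, b, r) \<in> cut g" using r(2) unfolding mem[symmetric] eq .
    then show False using r(1) unfolding mem by simp
  qed
  have "inj cut"
  proof (rule injI, rule ext)
    fix f g m assume eq: "cut f = cut g"
    show "f m = g m"
      using le[OF eq, of True m] le[OF eq[symmetric], of True m] le[OF eq, of False m] le[OF eq[symmetric], of False m]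
      by (simp add: complex_eq_iff)
  qed
  then have "(UNIV :: (nat \<Rightarrow> complex) set) \<lesssim> (UNIV :: nat set set)" unfolding lepoll_def by blast
  then show ?thesis by (rule lepoll_trans[OF _ eqpoll_imp_lepoll[OF nat_sets_eqpoll_reals]])
qed

text \<open>The block diagonal operators are isomorphic to the \<open>n \<times> n\<close> matrices
  of bounded sequences, and the diagonal operators (blocks of size one) to the bounded sequences
  themselves. Composition shows that the former is of type \<open>I\<^sub>n\<close> over the
  latter.\<close>

theorem kaplansky2_linf_if_type_I:
  assumes n: "n \<ge> 1" and card: "(UNIV :: real set) \<lesssim> (UNIV :: 'h set)" and k: "kaplansky2_type_I TYPE('h) n"
  shows "kaplansky2 (mat_alg n linf)"
proof -
  from lepoll_trans[OF complex_sequences_lepoll_reals card]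
  have "\<exists>j :: (nat \<Rightarrow> complex) \<Rightarrow> 'h. inj j" unfolding lepoll_def by blast
  then obtain j :: "(nat \<Rightarrow> complex) \<Rightarrow> 'h" where "inj j" ..
  then have mod: "ell2_model j" by (rule ell2_model.intro)
  define K where "K = ell2_model.space j"
  have blocks: "ell2_blocks j m" if "m > 0" for m
    by (rule ell2_blocks.intro[OF mod ell2_model.hilbert_space_space[OF mod] ell2_blocks_axioms.intro[OF that]])
  have b1: "ell2_blocks j 1" by (rule blocks) simp
  have bn: "ell2_blocks j n" by (rule blocks) (use n in simp)
  define D where "D = ell2_blocks.M j 1"
  define N where "N = ell2_blocks.M j n"
  have vnD: "von_neumann_algebra K D" unfolding K_def D_def by (rule ell2_blocks.vn_M[OF b1])
  have vnN: "von_neumann_algebra K N" unfolding K_def N_def by (rule ell2_blocks.vn_M[OF bn])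
  have H: "hilbert_space K" unfolding K_def by (rule ell2_model.hilbert_space_space[OF mod])
  have ringD: "ring (op_alg K D)" by (rule vn_algebra.ring_op_alg[OF vn_algebra.intro[OF H vn_algebra_axioms.intro[OF vnD]]])
  have ringN: "ring (op_alg K N)" by (rule vn_algebra.ring_op_alg[OF vn_algebra.intro[OF H vn_algebra_axioms.intro[OF vnN]]])
  have eN: "ell2_blocks.ent j n \<in> star_iso (op_alg K N) (mat_alg n linf)"
    unfolding K_def N_def by (rule ell2_blocks.ent_star_iso[OF bn])
  have eD: "ell2_blocks.ent j 1 \<in> star_iso (op_alg K D) (mat_alg 1 linf)"
    unfolding K_def D_def by (rule ell2_blocks.ent_star_iso[OF b1])
  from star_iso_trans[OF eD corner_star_iso[OF ring_linf]]
  obtain h where h: "h \<in> star_iso (op_alg K D) linf" by (rule that)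
  have clD: "compose (carrier K) S T \<in> D" "(\<lambda>x\<in>carrier K. c \<odot>\<^bsub>K\<^esub> T x) \<in> D" "adjoint K T \<in> D" if "S \<in> D" "T \<in> D" for S T c
    using that unfolding K_def D_def
    by (rule ell2_blocks.M_closed(1)[OF b1], rule ell2_blocks.M_closed(3)[OF b1], rule ell2_blocks.M_closed(4)[OF b1])
  have g: "inv_into (carrier (op_alg K D)) h \<in> star_iso linf (op_alg K D)"
    by (rule star_iso_sym[OF ringD h]) (simp_all add: clD)
  have "\<exists>G. G \<in> star_iso (mat_alg n linf) (mat_alg n (op_alg K D))"
    by (rule exI, rule star_iso_mat_alg[OF ring_linf ringD g]) (simp_all add: Bseq_arith(3,4))
  then obtain G where G: "G \<in> star_iso (mat_alg n linf) (mat_alg n (op_alg K D))" ..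
  have "compose (carrier K) S T = compose (carrier K) T S" if S: "S \<in> D" and T: "T \<in> D" for S T
  proof -
    have hom: "h \<in> Ring.ring_hom (op_alg K D) linf" and bij: "bij_betw h (carrier (op_alg K D)) (carrier linf)"
      using star_iso_ring_iso[OF h] by (simp_all add: ring_iso_def)
    have inj: "inj_on h D" using bij by (simp add: bij_betw_def)
    have "h (compose (carrier K) S T) = (\<lambda>m. h S m * h T m)" using ring_hom_mult[OF hom, of S T] S T by simp
    moreover have "h (compose (carrier K) T S) = (\<lambda>m. h T m * h S m)" using ring_hom_mult[OF hom, of T S] S T by simp
    ultimately have "h (compose (carrier K) S T) = h (compose (carrier K) T S)" by (simp add: mult.commute)
    then show ?thesis by (rule inj_onD[OF inj _ clD(1)[OF S T] clD(1)[OF T S]])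
  qed
  then have "abelian_von_neumann_algebra K D" unfolding abelian_von_neumann_algebra_def using vnD by blast
  moreover have "star_iso (op_alg K N) (mat_alg n (op_alg K D)) \<noteq> {}" using star_iso_trans[OF eN G] by blast
  ultimately have "type_I n K N" unfolding type_I_def using vnN by blast
  then have "kaplansky2 (op_alg K N)" using k unfolding kaplansky2_type_I_def by blast
  then show ?thesis
    by (rule kaplansky2_iso[OF ring_mat_alg[OF ring_linf] ringN ring_iso_set_sym[OF ringN star_iso_ring_iso[OF eN]]])
qed

theorem kaplansky2_type_I_if_similarity_function_finite:
  assumes n: "n \<ge> 1" and fin_sim: "\<forall>t\<ge>1. similarity_function n t < \<infinity>"
  shows "kaplansky2_type_I TYPE('h) n"
  unfolding kaplansky2_type_I_def
proof (intro allI impI)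
  fix H :: "'h hilbert" and M assume "type_I n H M"
  then have vn: "von_neumann_algebra H M"
    and ex: "\<exists>(K :: 'h hilbert) A. abelian_von_neumann_algebra K A \<and> star_iso (op_alg H M) (mat_alg n (op_alg K A)) \<noteq> {}"
    unfolding type_I_def by blast+
  from ex obtain K :: "'h hilbert" and A where ab: "abelian_von_neumann_algebra K A"
    and ne: "star_iso (op_alg H M) (mat_alg n (op_alg K A)) \<noteq> {}" by blast
  from ne obtain h where h: "h \<in> star_iso (op_alg H M) (mat_alg n (op_alg K A))" by blast
  have vnA: "von_neumann_algebra K A" and cm: "\<forall>S\<in>A. \<forall>T\<in>A. compose (carrier K) S T = compose (carrier K) T S"
    using ab unfolding abelian_von_neumann_algebra_def by simp_all
  have HH: "hilbert_space H" and HK: "hilbert_space K" using vn vnA unfolding von_neumann_algebra_def by simp_all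
  have M: "vn_algebra H M" by (rule vn_algebra.intro[OF HH vn_algebra_axioms.intro[OF vn]])
  have A: "vn_algebra K A" by (rule vn_algebra.intro[OF HK vn_algebra_axioms.intro[OF vnA]])
  have "S (T x) = T (S x)" if "S \<in> A" "T \<in> A" "x \<in> carrier K" for S T x
    using fun_cong[OF cm[rule_format, OF that(1,2)], of x] that(3) by (simp add: compose_eq)
  then have "T (S x) = S (T x)" if "S \<in> A" "T \<in> A" "x \<in> carrier K" for S T x using that by simp
  then have "abelian_vn_algebra K A"
    by (intro abelian_vn_algebra.intro[OF A] abelian_vn_algebra_axioms.intro)
  then have "kaplansky2 (mat_alg n (op_alg K A))"
    using n fin_sim by (rule abelian_vn_algebra.kaplansky2_matrices_over_abelian)
  then show "kaplansky2 (op_alg H M)"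
    by (rule kaplansky2_iso[OF vn_algebra.ring_op_alg[OF M] ring_mat_alg[OF vn_algebra.ring_op_alg[OF A]] star_iso_ring_iso[OF h]])
qed

theorem theorem4p3:
  fixes n :: nat
  assumes "n \<ge> 1"
    and "(UNIV :: real set) \<lesssim> (UNIV :: 'h set)"
  shows "((\<forall>t\<ge>1. similarity_function n t < \<infinity>) \<longleftrightarrow> kaplansky2 (mat_alg n linf)) \<and>
    (kaplansky2 (mat_alg n linf) \<longleftrightarrow> kaplansky2_type_I TYPE('h) n)"
proof -
  have "\<forall>t\<ge>1. similarity_function n t < \<infinity>" if "kaplansky2 (mat_alg n linf)"
    by (intro allI impI similarity_function_finite_if_kaplansky2_linf[OF assms(1) that])
  moreover have "kaplansky2_type_I TYPE('h) n" if "\<forall>t\<ge>1. similarity_function n t < \<infinity>"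
    by (rule kaplansky2_type_I_if_similarity_function_finite[OF assms(1) that])
  moreover have "kaplansky2 (mat_alg n linf)" if "kaplansky2_type_I TYPE('h) n"
    by (rule kaplansky2_linf_if_type_I[OF assms that])
  ultimately show ?thesis by blast
qed

end
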